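(* Let $m,n\ge1$ be integers. Let $T_K$ be a multilinear ($m$-linear) Calderón-Zygmund singular integral operator whose kernel function $K$ satisfies $$K(x,\vec y)=\int_{\mathbb{R}^{mn}}\sigma(x,\vec\xi)e^{2\pi i\vec y\cdot\vec\xi}\,d\vec\xi,$$ i.e. $T_K$ is associated with the kernel $K(x,\vec x-\vec y)$, where $\vec x=(x,\dots,x)\in\mathbb{R}^{mn}$, and where $\sigma\in S^r_{\rho,\delta}(n,m)$ with $\rho,\delta\in[0,1]$ and $r+\delta<nm(\rho-1)$. Let $\mathbb{X},\mathbb{X}_1,\dots,\mathbb{X}_m$ be rearrangement invariant Banach function spaces on $\mathbb{R}^n$ with $1<p_{\mathbb{X}}\le q_{\mathbb{X}}<\infty$ and $1<p_{\mathbb{X}_i}\le q_{\mathbb{X}_i}<\infty$ for $i=1,\dots,m$. Assume that the $m$-product operator $P_m$ maps $\overline{\mathbb{X}}_1\times\cdots\times\overline{\mathbb{X}}_m$ to $\overline{\mathbb{X}}$ (boundedly). Then for every $w\in A_{\min_ip_{\mathbb{X}_i}}$, $T_K$ is bounded from $\mathbb{X}_1(w)\times\cdots\times\mathbb{X}_m(w)$ to $\mathbb{X}(w)$.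
   Context: **Symbols and kernel.** $S^r_{\rho,\delta}(n,m)$ ($r\in\mathbb{R}$, $0\le\rho,\delta\le1$) is the set of smooth functions $\sigma$ on $\mathbb{R}^n\times\mathbb{R}^{mn}$ such that for all multi-indices $\alpha,\beta_1,\dots,\beta_m$ there is a constant $C_{\alpha,\beta}$ with $|\partial_x^\alpha\partial_{\xi_1}^{\beta_1}\cdots\partial_{\xi_m}^{\beta_m}\sigma(x,\vec\xi)|\le C_{\alpha,\beta}(1+|\xi_1|+\cdots+|\xi_m|)^{r-\rho\sum_j|\beta_j|+\delta|\alpha|}$. The integral defining $K$ is understood as an oscillatory integral (inverse Fourier transform in $\vec\xi$), and $T_K(\vec f)(x)=\int_{(\mathbb{R}^n)^m}K(x,\vec x-\vec y)f_1(y_1)\cdots f_m(y_m)\,d\vec y$ for $x\notin\bigcap_j\operatorname{supp}f_j$. Multilinear Calderón-Zygmund operator is meant in the usual (Grafakos-Torres) sense. **Rearrangement invariant Banach function spaces (RIBFS).** A rearrangement invariant Banach norm is a map $\varrho$ from nonnegative measurable functions on $\mathbb{R}^n$ to $[0,\infty]$ with: (i) $\varrho(f)=0\Leftrightarrow f=0$ a.e., $\varrho(f+g)\le\varrho(f)+\varrho(g)$, $\varrho(af)=a\varrho(f)$ for $a\ge0$; (ii) $0\le f\le g$ a.e. implies $\varrho(f)\le\varrho(g)$; (iii) $f_k\uparrow f$ a.e. implies $\varrho(f_k)\uparrow\varrho(f)$; (iv) if $|E|<\infty$ then $\varrho(\chi_E)<\infty$ and $\int_E f\,dx\le C_E\varrho(f)$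 with $C_E$ independent of $f$; (v) $\varrho(f)=\varrho(g)$ if $f,g$ are equimeasurable. The RIBFS is $\mathbb{X}=\{f \text{ measurable}:\|f\|_{\mathbb{X}}:=\varrho(|f|)<\infty\}$. By Luxemburg's representation theorem there is a RIBFS $\overline{\mathbb{X}}$ over $(\mathbb{R}^+,dt)$ such that $f\in\mathbb{X}$ iff $f^*\in\overline{\mathbb{X}}$, with $\|f\|_{\mathbb{X}}=\|f^*\|_{\overline{\mathbb{X}}}$, where $f^*$ is the decreasing rearrangement. For a weight $w$, $\mathbb{X}(w)=\{f:\|f\|_{\mathbb{X}(w)}:=\|f^*_w\|_{\overline{\mathbb{X}}}<\infty\}$, where $f^*_w(t)=\inf\{\lambda\ge0: w(\{|f|>\lambda\})\le t\}$. **Boyd indices.** Let $D_tf(s)=f(s/t)$ and $h_{\mathbb{X}}(t)=\|D_t\|_{\overline{\mathbb{X}}\to\overline{\mathbb{X}}}$, $0<t<\infty$. Then $p_{\mathbb{X}}=\lim_{t\to\infty}\frac{\log t}{\log h_{\mathbb{X}}(t)}$ and $q_{\mathbb{X}}=\lim_{t\to0^+}\frac{\log t}{\log h_{\mathbb{X}}(t)}$. **Product operator.** $P_m(f_1,\dots,f_m)=\prod_{j=1}^m f_j$ (pointwise product); "$P_m$ maps $\overline{\mathbb{X}}_1\times\cdots\times\overline{\mathbb{X}}_m$ to $\overline{\mathbb{X}}$" means $\|P_m(\vec f)\|_{\overline{\mathbb{X}}}\le C\prod_i\|f_i\|_{\overline{\mathbb{X}}_i}$. **Weights.** A weight is a nonnegative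 locally integrable function. For $1<p<\infty$, $w\in A_p$ means $[w]_{A_p}=\sup_Q\big(\frac1{|Q|}\int_Qw\big)\big(\frac1{|Q|}\int_Qw^{1-p'}\big)^{p-1}<\infty$, with $Q$ ranging over cubes. *)

theory Defs
  imports "HOL-Analysis.Analysis"
begin

section \<open>Smooth functions and symbols\<close>

definition dir_deriv ::
  "'a::real_normed_vector \<Rightarrow> ('a \<Rightarrow> 'b::real_normed_vector) \<Rightarrow> 'a \<Rightarrow> 'b"
  where "dir_deriv v f x = frechet_derivative f (at x) v"

text \<open>
  A multi-index is encoded by the list of the coordinate directions to differentiate in, so that
  its order is the length of the list. For smooth functions the order of the entries is irrelevant.
\<close>

definition iter_deriv ::
  "'a list \<Rightarrow> ('a::real_normed_vector \<Rightarrow> 'b::real_normed_vector) \<Rightarrow> 'a \<Rightarrow> 'b"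
  where "iter_deriv vs f = foldr dir_deriv vs f"

definition smooth :: "('a::euclidean_space \<Rightarrow> 'b::real_normed_vector) \<Rightarrow> bool"
  where "smooth f \<longleftrightarrow> (\<forall>vs. set vs \<subseteq> Basis \<longrightarrow> iter_deriv vs f differentiable_on UNIV)"

definition supp :: "('a::topological_space \<Rightarrow> 'b::zero) \<Rightarrow> 'a set"
  where "supp f = closure {x. f x \<noteq> 0}"

definition test_fun :: "('a::euclidean_space \<Rightarrow> complex) \<Rightarrow> bool"
  where "test_fun f \<longleftrightarrow> smooth f \<and> compact (supp f)"

text \<open>
  Points of \<open>(\<real>\<^sup>n)\<^sup>m\<close> have type \<^typ>\<open>real^'n^'m\<close>, the \<open>j\<close>-th block of \<open>\<xi>\<close> being \<open>\<xi> $ j\<close>.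
  The list \<open>\<alpha>\<close> holds the \<open>x\<close>-coordinates to differentiate in, and a pair \<open>(j, i)\<close> in
  \<open>\<beta>\<close> stands for the \<open>i\<close>-th coordinate of \<open>\<xi>\<^sub>j\<close>.
\<close>

definition symbol_class ::
  "real \<Rightarrow> real \<Rightarrow> real \<Rightarrow> (real^'n \<Rightarrow> real^'n^'m \<Rightarrow> complex) set"
  where "symbol_class r \<rho> \<delta> = {\<sigma>.
    smooth (\<lambda>(x, \<xi>). \<sigma> x \<xi>) \<and>
    (\<forall>(\<alpha> :: 'n list) (\<beta> :: ('m \<times> 'n) list). \<exists>C. \<forall>x \<xi>.
      norm (iter_deriv (map (\<lambda>i. (axis i 1, 0)) \<alpha> @ map (\<lambda>(j, i). (0, axis j (axis i 1))) \<beta>)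
              (\<lambda>(x, \<xi>). \<sigma> x \<xi>) (x, \<xi>))
        \<le> C * (1 + (\<Sum>j\<in>UNIV. norm (\<xi> $ j)))
               powr (r - \<rho> * real (length \<beta>) + \<delta> * real (length \<alpha>)))}"

text \<open>
  \<open>I\<close> is the value of the oscillatory integral \<open>\<integral> a(\<xi>) e\<^bsup>2\<pi>i y\<cdot>\<xi>\<^esup> d\<xi>\<close>, defined by means of
  smooth cut-offs \<open>\<theta>(\<epsilon>\<xi>)\<close> with \<open>\<theta>(0) = 1\<close>.
\<close>

definition has_osc_inverse_fourier ::
  "('a::euclidean_space \<Rightarrow> complex) \<Rightarrow> 'a \<Rightarrow> complex \<Rightarrow> bool"
  where "has_osc_inverse_fourier a y I \<longleftrightarrow>
    (\<forall>\<theta>. test_fun \<theta> \<and> \<theta> 0 = 1 \<longrightarrow>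
      ((\<lambda>\<epsilon>. LINT \<xi>|lebesgue.
          \<theta> (\<epsilon> *\<^sub>R \<xi>) * a \<xi> * exp (2 * of_real pi * \<i> * of_real (y \<bullet> \<xi>))) \<longlongrightarrow> I)
        (at_right 0))"


section \<open>Multilinear operators\<close>

text \<open>
  Operators act on tuples of functions on \<open>\<real>\<^sup>n\<close>; functions that agree a.e. are identified, so the
  linearity identities hold a.e.
\<close>

definition multilinear_on ::
  "('m \<Rightarrow> (real^'n \<Rightarrow> complex) set) \<Rightarrow>
    (('m \<Rightarrow> real^'n \<Rightarrow> complex) \<Rightarrow> real^'n \<Rightarrow> complex) \<Rightarrow> bool"
  where "multilinear_on E T \<longleftrightarrow>
    (\<forall>f j g a. (\<forall>i. f i \<in> E i) \<and> g \<in> E j \<longrightarrow>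
      (AE x in lebesgue.
        T (f(j := (\<lambda>y. a * f j y + g y))) x = a * T f x + T (f(j := g)) x))"

definition bounded_on ::
  "('m::finite \<Rightarrow> ('a \<Rightarrow> complex) set) \<Rightarrow> ('m \<Rightarrow> ('a \<Rightarrow> complex) \<Rightarrow> ennreal) \<Rightarrow>
    ('a \<Rightarrow> complex) set \<Rightarrow> (('a \<Rightarrow> complex) \<Rightarrow> ennreal) \<Rightarrow>
    (('m \<Rightarrow> 'a \<Rightarrow> complex) \<Rightarrow> 'a \<Rightarrow> complex) \<Rightarrow> bool"
  where "bounded_on E NE F NF T \<longleftrightarrow>
    (\<exists>C::real. \<forall>f. (\<forall>i. f i \<in> E i) \<longrightarrow>
      T f \<in> F \<and> NF (T f) \<le> ennreal C * (\<Prod>i\<in>UNIV. NE i (f i)))"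

definition product_op :: "('m::finite \<Rightarrow> 'a \<Rightarrow> complex) \<Rightarrow> 'a \<Rightarrow> complex"
  where "product_op f = (\<lambda>x. \<Prod>i\<in>UNIV. f i x)"

text \<open>Real powers on \<open>[0, \<infinity>]\<close>, with \<open>0\<^sup>a = \<infinity>\<close> and \<open>\<infinity>\<^sup>a = 0\<close> for \<open>a < 0\<close>.\<close>

definition epowr :: "ennreal \<Rightarrow> real \<Rightarrow> ennreal"
  where "epowr x a =
    (if a = 0 then 1
     else if x = 0 then (if a < 0 then \<infinity> else 0)
     else if x = \<infinity> then (if a < 0 then 0 else \<infinity>)
     else ennreal (enn2real x powr a))"

definition Lp_norm :: "real \<Rightarrow> (real^'n \<Rightarrow> complex) \<Rightarrow> ennreal"
  where "Lp_norm p f = epowr (\<integral>\<^sup>+x. ennreal (norm (f x) powr p) \<partial>lebesgue) (1 / p)"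

definition Lp_space :: "real \<Rightarrow> (real^'n \<Rightarrow> complex) set"
  where "Lp_space p = {f \<in> borel_measurable lebesgue. Lp_norm p f < \<infinity>}"


section \<open>Multilinear Calderon-Zygmund operators (Grafakos-Torres)\<close>

text \<open>
  A kernel on \<open>(\<real>\<^sup>n)\<^bsup>m+1\<^esup>\<close> takes a tuple \<open>u = (y\<^sub>0, y\<^sub>1, \<dots>, y\<^sub>m)\<close> indexed by \<^typ>\<open>'m option\<close>:
  \<open>u None\<close> is \<open>y\<^sub>0 = x\<close> and \<open>u (Some j)\<close> is \<open>y\<^sub>j\<close>.
\<close>

definition tuple_spread :: "('m::finite option \<Rightarrow> real^'n) \<Rightarrow> real"
  where "tuple_spread u = (\<Sum>k\<in>UNIV. \<Sum>l\<in>UNIV. norm (u k - u l))"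

definition cz_kernel :: "(('m::finite option \<Rightarrow> real^'n) \<Rightarrow> complex) \<Rightarrow> bool"
  where "cz_kernel k \<longleftrightarrow>
    (\<exists>A \<epsilon>. 0 < A \<and> 0 < \<epsilon> \<and>
      (\<forall>u. (\<exists>i j. u i \<noteq> u j) \<longrightarrow>
        norm (k u) \<le> A / tuple_spread u ^ (CARD('m) * CARD('n)) \<and>
        (\<forall>i z. norm (u i - z) \<le> (MAX j. norm (u i - u j)) / 2 \<longrightarrow>
          norm (k u - k (u(i := z)))
            \<le> A * norm (u i - z) powr \<epsilon>
                / tuple_spread u powr (real (CARD('m) * CARD('n)) + \<epsilon>))))"

definition cons_point :: "real^'n \<Rightarrow> real^'n^'m \<Rightarrow> 'm option \<Rightarrow> real^'n"
  where "cons_point x y = case_option x (\<lambda>j. y $ j)"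

definition has_kernel ::
  "(('m::finite \<Rightarrow> real^'n \<Rightarrow> complex) \<Rightarrow> real^'n \<Rightarrow> complex) \<Rightarrow>
    (('m option \<Rightarrow> real^'n) \<Rightarrow> complex) \<Rightarrow> bool"
  where "has_kernel T k \<longleftrightarrow>
    (\<forall>f. (\<forall>j. test_fun (f j)) \<longrightarrow>
      (AE x in lebesgue. x \<notin> (\<Inter>j. supp (f j)) \<longrightarrow>
        T f x = (LINT y|lebesgue. k (cons_point x y) * (\<Prod>j\<in>UNIV. f j (y $ j)))))"

text \<open>
  \<open>T\<close> denotes the bounded extension to \<open>L\<^bsup>q\<^sub>1\<^esup> \<times> \<dots> \<times> L\<^bsup>q\<^sub>m\<^esup>\<close> that is part of the notion of a
  Calderon-Zygmund operator; as all \<open>q\<^sub>j\<close> are finite it is determined by its values on tuples of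
  Schwartz functions.
\<close>

definition multilinear_cz_operator ::
  "('m::finite \<Rightarrow> real) \<Rightarrow>
    (('m \<Rightarrow> real^'n \<Rightarrow> complex) \<Rightarrow> real^'n \<Rightarrow> complex) \<Rightarrow>
    (('m option \<Rightarrow> real^'n) \<Rightarrow> complex) \<Rightarrow> bool"
  where "multilinear_cz_operator q T k \<longleftrightarrow>
    (let q0 = 1 / (\<Sum>j\<in>UNIV. 1 / q j) in
      (\<forall>j. 1 \<le> q j) \<and>
      multilinear_on (\<lambda>j. Lp_space (q j)) T \<and>
      bounded_on (\<lambda>j. Lp_space (q j)) (\<lambda>j. Lp_norm (q j)) (Lp_space q0) (Lp_norm q0) T \<and>
      cz_kernel k \<and> has_kernel T k)"


section \<open>Rearrangement invariant Banach function spaces\<close>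

definition equimeasurable :: "'a measure \<Rightarrow> ('a \<Rightarrow> ennreal) \<Rightarrow> ('a \<Rightarrow> ennreal) \<Rightarrow> bool"
  where "equimeasurable M f g \<longleftrightarrow>
    (\<forall>l. emeasure M {x \<in> space M. f x > l} = emeasure M {x \<in> space M. g x > l})"

definition ri_banach_norm :: "'a measure \<Rightarrow> (('a \<Rightarrow> ennreal) \<Rightarrow> ennreal) \<Rightarrow> bool"
  where "ri_banach_norm M N \<longleftrightarrow>
    (\<forall>f\<in>borel_measurable M. N f = 0 \<longleftrightarrow> (AE x in M. f x = 0)) \<and>
    (\<forall>f\<in>borel_measurable M. \<forall>g\<in>borel_measurable M. N (\<lambda>x. f x + g x) \<le> N f + N g) \<and>
    (\<forall>f\<in>borel_measurable M. \<forall>a\<ge>0. N (\<lambda>x. ennreal a * f x) = ennreal a * N f) \<and>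
    (\<forall>f\<in>borel_measurable M. \<forall>g\<in>borel_measurable M.
      (AE x in M. f x \<le> g x) \<longrightarrow> N f \<le> N g) \<and>
    (\<forall>F f. (\<forall>k. F k \<in> borel_measurable M) \<and> f \<in> borel_measurable M \<and>
        (AE x in M. incseq (\<lambda>k::nat. F k x) \<and> (\<lambda>k. F k x) \<longlonglongrightarrow> f x) \<longrightarrow>
      incseq (\<lambda>k. N (F k)) \<and> (\<lambda>k. N (F k)) \<longlonglongrightarrow> N f) \<and>
    (\<forall>E\<in>sets M. emeasure M E < \<infinity> \<longrightarrow>
      N (indicator E) < \<infinity> \<and>
      (\<exists>C::real. \<forall>f\<in>borel_measurable M. (\<integral>\<^sup>+x\<in>E. f x \<partial>M) \<le> ennreal C * N f)) \<and>
    (\<forall>f\<in>borel_measurable M. \<forall>g\<in>borel_measurable M. equimeasurable M f g \<longrightarrow> N f = N g)"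

definition ri_norm :: "(('a \<Rightarrow> ennreal) \<Rightarrow> ennreal) \<Rightarrow> ('a \<Rightarrow> complex) \<Rightarrow> ennreal"
  where "ri_norm N f = N (\<lambda>x. ennreal (norm (f x)))"

definition ri_space :: "'a measure \<Rightarrow> (('a \<Rightarrow> ennreal) \<Rightarrow> ennreal) \<Rightarrow> ('a \<Rightarrow> complex) set"
  where "ri_space M N = {f \<in> borel_measurable M. ri_norm N f < \<infinity>}"

definition decr_rearrangement :: "'a measure \<Rightarrow> ('a \<Rightarrow> ennreal) \<Rightarrow> real \<Rightarrow> ennreal"
  where "decr_rearrangement M f t =
    Inf {l. emeasure M {x \<in> space M. f x > l} \<le> ennreal t}"

abbreviation half_line :: "real measure"
  where "half_line \<equiv> lebesgue_on {0<..}"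

text \<open>
  \<open>Nb\<close> is the norm of the space over \<open>\<real>\<^sup>+\<close> that Luxemburg's theorem assigns to the space with norm
  \<open>N\<close>. The theorem provides such an \<open>Nb\<close>, and since every nonincreasing right-continuous
  function on \<open>\<real>\<^sup>+\<close> is the rearrangement of some function on \<open>\<real>\<^sup>n\<close>, it is unique.
\<close>

definition luxemburg_representation ::
  "((real^'n \<Rightarrow> ennreal) \<Rightarrow> ennreal) \<Rightarrow> ((real \<Rightarrow> ennreal) \<Rightarrow> ennreal) \<Rightarrow> bool"
  where "luxemburg_representation N Nb \<longleftrightarrow>
    ri_banach_norm half_line Nb \<and>
    (\<forall>f\<in>borel_measurable lebesgue. N f = Nb (decr_rearrangement lebesgue f))"

definition dilation_norm :: "((real \<Rightarrow> ennreal) \<Rightarrow> ennreal) \<Rightarrow> real \<Rightarrow> ennreal"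
  where "dilation_norm Nb t =
    (SUP f\<in>{f \<in> ri_space half_line Nb. ri_norm Nb f \<le> 1}. ri_norm Nb (\<lambda>s. f (s / t)))"

text \<open>
  The quotient \<open>log t / log h(t)\<close> is written as the reciprocal of \<open>log h(t) / log t\<close> in the
  extended reals, so that it is \<open>\<infinity>\<close> where \<open>h(t) = 1\<close> (as for \<open>L\<^sup>\<infinity>\<close>). The number \<open>h(t)\<close> is
  always finite and positive.
\<close>

definition boyd_quotient :: "((real \<Rightarrow> ennreal) \<Rightarrow> ennreal) \<Rightarrow> real \<Rightarrow> ereal"
  where "boyd_quotient Nb t = inverse (ereal (ln (enn2real (dilation_norm Nb t)) / ln t))"

definition boyd_p :: "((real \<Rightarrow> ennreal) \<Rightarrow> ennreal) \<Rightarrow> ereal"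
  where "boyd_p Nb = Lim at_top (boyd_quotient Nb)"

definition boyd_q :: "((real \<Rightarrow> ennreal) \<Rightarrow> ennreal) \<Rightarrow> ereal"
  where "boyd_q Nb = Lim (at_right 0) (boyd_quotient Nb)"


section \<open>Weights\<close>

definition weight :: "(real^'n \<Rightarrow> real) \<Rightarrow> bool"
  where "weight w \<longleftrightarrow> w \<in> borel_measurable lebesgue \<and> (\<forall>x. 0 \<le> w x) \<and>
    (\<forall>K. compact K \<longrightarrow> set_integrable lebesgue K w)"

definition cubes :: "(real^'n) set set"
  where "cubes = {cbox a (a + (\<chi> i. s)) | a s. 0 < s}"

definition average :: "(real^'n) set \<Rightarrow> (real^'n \<Rightarrow> ennreal) \<Rightarrow> ennreal"
  where "average Q f = (\<integral>\<^sup>+x\<in>Q. f x \<partial>lebesgue) / emeasure lebesgue Q"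

text \<open>Here \<open>1 - p' = 1 - p / (p - 1)\<close> is negative, so \<open>w\<^bsup>1-p'\<^esup> = \<infinity>\<close> where \<open>w\<close> vanishes.\<close>

definition Ap_constant :: "real \<Rightarrow> (real^'n \<Rightarrow> real) \<Rightarrow> ennreal"
  where "Ap_constant p w =
    (SUP Q\<in>cubes. average Q (\<lambda>x. ennreal (w x)) *
       epowr (average Q (\<lambda>x. epowr (ennreal (w x)) (1 - p / (p - 1)))) (p - 1))"

text \<open>
  The zero weight, which would get constant \<open>0\<close> through \<open>0 \<cdot> \<infinity> = 0\<close>, is excluded; finiteness
  of the constant then forces \<open>w > 0\<close> a.e.
\<close>

definition Ap_class :: "real \<Rightarrow> (real^'n \<Rightarrow> real) set"
  where "Ap_class p =
    {w. weight w \<and> \<not> (AE x in lebesgue. w x = 0) \<and> Ap_constant p w < \<infinity>}"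

definition weighted_ri_norm ::
  "((real \<Rightarrow> ennreal) \<Rightarrow> ennreal) \<Rightarrow> (real^'n \<Rightarrow> real) \<Rightarrow> (real^'n \<Rightarrow> complex) \<Rightarrow> ennreal"
  where "weighted_ri_norm Nb w f =
    Nb (decr_rearrangement (density lebesgue (\<lambda>x. ennreal (w x))) (\<lambda>x. ennreal (norm (f x))))"

definition weighted_ri_space ::
  "((real \<Rightarrow> ennreal) \<Rightarrow> ennreal) \<Rightarrow> (real^'n \<Rightarrow> real) \<Rightarrow> (real^'n \<Rightarrow> complex) set"
  where "weighted_ri_space Nb w =
    {f \<in> borel_measurable lebesgue. weighted_ri_norm Nb w f < \<infinity>}"

end

theory Submission
  imports Defs "HOL-Library.Nat_Bijection"
begin

text \<open>
  The order of the symbol is so low that the kernel is integrable in \<open>y\<close>, uniformly in \<open>x\<close>. With \<open>d = mn\<close>, the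
  \<open>d\<close>-th derivative of \<open>\<sigma>(x, \<cdot>)\<close> in one frequency coordinate is integrable, with room to spare, and
  its integral vanishes since it is itself a derivative. Integrating by parts in the oscillatory
  integral turns \<open>|y|\<^sup>d K(x,y)\<close> into an absolutely convergent Fourier integral, which the vanishing
  mean makes \<open>O(|y|\<^sup>\<kappa>)\<close> near \<open>y = 0\<close>; one more integration by parts gives decay at infinity. So
  \<open>|K(x,y)| \<le> C |y|\<^bsup>-d\<^esup> min(|y|\<^sup>\<kappa>, |y|\<^bsup>-\<kappa>\<^esup>)\<close> (\<open>kernel_decay\<close>). This splits evenly over the \<open>m\<close> variables:
  \<open>K(x,y)\<close> is at most a constant times \<open>\<phi>(y\<^sub>1) \<cdots> \<phi>(y\<^sub>m)\<close>, where \<open>\<phi>\<close>, the \<open>dyadic_kernel\<close>, is a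
  superposition of normalised cubes of all dyadic sizes with geometrically decaying weights
  (\<open>kernel_dominated\<close>). Hence the kernel integral \<open>kernel_op K f\<close> converges absolutely, and it is
  dominated by the product of the averages \<open>U|f\<^sub>j|\<close>, where \<open>U\<close>, the \<open>dyadic_op\<close>, is convolution with \<open>\<phi>\<close>.

  Off the diagonal \<open>T\<close> agrees with this integral. The difference is therefore a local multilinear
  operator, bounded on Lebesgue spaces, and such an operator is multiplication: there is a bounded
  function \<open>b\<close> with \<open>T f = b f\<^sub>1 \<cdots> f\<^sub>m + kernel_op K f\<close> (\<open>local_representation\<close>). The right hand
  side is the extension \<open>T'\<close> of \<open>T\<close>, and \<open>|T' f|\<close> is at most a constant times
  \<open>(|f\<^sub>1| + U|f\<^sub>1|) \<cdots> (|f\<^sub>m| + U|f\<^sub>m|)\<close>.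

  It remains to bound \<open>U\<close> in the weighted spaces. The \<open>A\<^sub>p\<close> condition is open: on subsets of cubes it
  holds in the form \<open>(|E|/|Q|)\<^sup>s w(Q) \<le> D w(E)\<close> with some \<open>s < p\<close> (\<open>Ap_open\<close>). This gives a restricted
  weak type \<open>(s,s)\<close> bound for \<open>U\<close> (\<open>weak_type\<close>), and cutting \<open>f\<close> at the levels \<open>f\<^sup>*(t/2\<^sup>k)\<close> turns that bound
  into the pointwise estimate
  \<open>(U f)\<^sup>*(t) \<le> B (f\<^sup>*(t) + (\<Sum>k. 2\<^bsup>-k/s'\<^esup> f\<^sup>*(t/2\<^bsup>k+1\<^esup>)))\<close> for any \<open>s' > s\<close>, with rearrangements taken
  with respect to \<open>w\<close> (\<open>rearrangement_dyadic_op\<close>). The right hand side is a series of dilates of \<open>f\<^sup>*\<close>.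
  For \<open>s'\<close> between \<open>s\<close> and the least lower Boyd index \<open>p\<close> its norm converges, because the dilation
  norm of \<open>2\<^sup>k\<close> grows at most like \<open>2\<^bsup>k\<theta>\<^esup>\<close> with some \<open>\<theta> < 1/s'\<close> (\<open>dilation_series_bound\<close>). Finally the
  rearrangement of a product is at most the product of dilated rearrangements, to which the
  assumption on the product operator applies (\<open>rearrangement_norm_bound\<close>).
\<close>

section \<open>Smooth bump functions\<close>

text \<open>
  The power of \<open>1/t\<close> makes the family closed, up to linear combinations, under differentiation.
\<close>

definition exp_bump :: "nat \<Rightarrow> real \<Rightarrow> real"
  where "exp_bump k t = (if t > 0 then inverse t ^ k * exp (- inverse t) else 0)"

lemma exp_bump_lim: "((\<lambda>t. exp_bump k t) \<longlongrightarrow> 0) (at 0)"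
proof -
  have "((\<lambda>x::real. x ^ k / exp x) \<longlongrightarrow> 0) at_top" by (rule tendsto_power_div_exp_0)
  then have "((\<lambda>t::real. inverse t ^ k / exp (inverse t)) \<longlongrightarrow> 0) (at_right 0)"
    by (rule filterlim_compose[OF _ filterlim_inverse_at_top_right])
  then have "((\<lambda>t. exp_bump k t) \<longlongrightarrow> 0) (at_right 0)"
    by (rule Lim_transform_eventually)
       (auto simp: eventually_at_filter exp_bump_def exp_minus field_simps)
  moreover have "((\<lambda>t. exp_bump k t) \<longlongrightarrow> 0) (at_left 0)"
    by (rule Lim_transform_eventually[OF tendsto_const])
       (auto simp: eventually_at_filter exp_bump_def)
  ultimately show ?thesis using filterlim_split_at by blast
qed

lemma exp_bump_deriv:
  "(exp_bump k has_real_derivative exp_bump (k+2) t - real k * exp_bump (k+1) t) (at t)"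
proof (cases "t = 0")
  case True
  have "((\<lambda>h. exp_bump k h / h) \<longlongrightarrow> 0) (at 0)"
    by (rule Lim_transform_eventually[OF exp_bump_lim[of "Suc k"]])
       (auto simp: eventually_at_filter exp_bump_def field_simps)
  then show ?thesis using True by (simp add: DERIV_def exp_bump_def)
next
  case False
  show ?thesis
  proof (cases "t > 0")
    case True
    have e: "eventually (\<lambda>s. s > 0) (nhds t)" using True
      eventually_nhds_in_open[of "{0<..}" t] by simp
    have "((\<lambda>t. inverse t ^ k * exp (- inverse t)) has_real_derivative
        (real k * inverse t ^ (k - 1) * - (inverse t * inverse t)) * exp (- inverse t)
          + inverse t ^ k * (exp (- inverse t) * (inverse t * inverse t))) (at t)"
      using True by (auto intro!: derivative_eq_intros simp: power2_eq_square)
    moreover have "(real k * inverse t ^ (k - 1) * - (inverse t * inverse t)) * exp (- inverse t)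
          + inverse t ^ k * (exp (- inverse t) * (inverse t * inverse t))
        = exp_bump (k+2) t - real k * exp_bump (k+1) t"
      using True by (cases k) (simp_all add: exp_bump_def algebra_simps)
    ultimately have "((\<lambda>t. inverse t ^ k * exp (- inverse t)) has_real_derivative
        exp_bump (k+2) t - real k * exp_bump (k+1) t) (at t)" by simp
    then show ?thesis
      by (subst DERIV_cong_ev[OF refl eventually_mono[OF e] refl]) (auto simp: exp_bump_def)
  next
    case F: False
    with False have "t < 0" by simp
    then have e: "eventually (\<lambda>s. s < 0) (nhds t)"
      using eventually_nhds_in_open[of "{..<0}" t] by simp
    have "((\<lambda>t. 0) has_real_derivative exp_bump (k+2) t - real k * exp_bump (k+1) t) (at t)"
      using \<open>t < 0\<close> by (simp add: exp_bump_def)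
    then show ?thesis
      by (subst DERIV_cong_ev[OF refl eventually_mono[OF e] refl]) (auto simp: exp_bump_def)
  qed
qed

text \<open>
  An algebra that contains the bumps and is closed under differentiation; its elements are therefore
  smooth, and no derivative of order above one ever has to be computed.
\<close>

inductive_set bump_algebra :: "('a::euclidean_space \<Rightarrow> complex) set" where
  const: "(\<lambda>x. c) \<in> bump_algebra"
| bump: "(\<lambda>x. of_real (exp_bump k (x \<bullet> v + c))) \<in> bump_algebra"
| add: "f \<in> bump_algebra \<Longrightarrow> g \<in> bump_algebra \<Longrightarrow> (\<lambda>x. f x + g x) \<in> bump_algebra"
| mult: "f \<in> bump_algebra \<Longrightarrow> g \<in> bump_algebra \<Longrightarrow> (\<lambda>x. f x * g x) \<in> bump_algebra"

lemma bump_algebra_deriv: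
  assumes "f \<in> bump_algebra"
  shows "\<exists>f'. (\<forall>x. (f has_derivative f' x) (at x)) \<and> (\<forall>u. (\<lambda>x. f' x u) \<in> bump_algebra)"
  using assms
proof induction
  case (const c)
  show ?case by (rule exI[of _ "\<lambda>x u. 0"]) (auto intro: bump_algebra.const)
next
  case (bump k v c)
  let ?d = "\<lambda>x. exp_bump (k+2) (x \<bullet> v + c) - real k * exp_bump (k+1) (x \<bullet> v + c)"
  have "((\<lambda>x. complex_of_real (exp_bump k (x \<bullet> v + c))) has_derivative
     (\<lambda>u. of_real (u \<bullet> v * ?d x))) (at x)" for x
  proof -
    have 1: "((\<lambda>x. x \<bullet> v + c) has_derivative (\<lambda>u. u \<bullet> v)) (at x)"
      by (auto intro!: derivative_eq_intros)
    have "((\<lambda>x. exp_bump k (x \<bullet> v + c)) has_derivative (\<lambda>u. ?d x * (u \<bullet> v))) (at x)"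
      using diff_chain_at[OF 1 exp_bump_deriv[THEN has_field_derivative_imp_has_derivative]]
      by (simp add: o_def)
    from has_derivative_of_real[OF this] show ?thesis by (simp add: mult.commute)
  qed
  moreover have "(\<lambda>x. complex_of_real (u \<bullet> v * ?d x)) \<in> bump_algebra" for u
  proof -
    have "(\<lambda>x. of_real (u \<bullet> v) * (of_real (exp_bump (k+2) (x \<bullet> v + c)) +
       of_real (- real k) * of_real (exp_bump (k+1) (x \<bullet> v + c)))) \<in> bump_algebra"
      by (intro bump_algebra.intros)
    then show ?thesis by simp
  qed
  ultimately show ?case by (intro exI[of _ "\<lambda>x u. of_real (u \<bullet> v * ?d x)"]) blast
next
  case (add f g)
  then obtain f' g' where "\<forall>x. (f has_derivative f' x) (at x)" "\<forall>u. (\<lambda>x. f' x u) \<in> bump_algebra"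
    "\<forall>x. (g has_derivative g' x) (at x)" "\<forall>u. (\<lambda>x. g' x u) \<in> bump_algebra" by blast
  then show ?case
    by (intro exI[of _ "\<lambda>x u. f' x u + g' x u"])
       (auto intro!: has_derivative_add bump_algebra.add)
next
  case (mult f g)
  then obtain f' g' where "\<forall>x. (f has_derivative f' x) (at x)" "\<forall>u. (\<lambda>x. f' x u) \<in> bump_algebra"
    "\<forall>x. (g has_derivative g' x) (at x)" "\<forall>u. (\<lambda>x. g' x u) \<in> bump_algebra" by blast
  then show ?case using mult.hyps
    by (intro exI[of _ "\<lambda>x u. f x * g' x u + f' x u * g x"])
       (auto intro!: has_derivative_mult bump_algebra.add bump_algebra.mult)
qed

lemma bump_algebra_iter: "f \<in> bump_algebra \<Longrightarrow> iter_deriv vs f \<in> bump_algebra"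
proof (induction vs)
  case Nil then show ?case by (simp add: iter_deriv_def)
next
  case (Cons v vs)
  then have "iter_deriv vs f \<in> bump_algebra" by simp
  from bump_algebra_deriv[OF this] obtain f' where
    f': "\<forall>x. (iter_deriv vs f has_derivative f' x) (at x)" "\<forall>u. (\<lambda>x. f' x u) \<in> bump_algebra" by blast
  have "iter_deriv (v # vs) f = (\<lambda>x. f' x v)"
    using f'(1) frechet_derivative_at[of "iter_deriv vs f"]
    by (auto simp: iter_deriv_def dir_deriv_def fun_eq_iff) metis
  then show ?case using f'(2) by simp
qed

lemma bump_algebra_smooth: "f \<in> bump_algebra \<Longrightarrow> smooth f"
  unfolding smooth_def
  using bump_algebra_deriv[OF bump_algebra_iter]
  by (metis differentiable_at_imp_differentiable_on differentiable_def)

lemma bump_algebra_prod: "finite I \<Longrightarrow> (\<And>i. i \<in> I \<Longrightarrow> f i \<in> bump_algebra) \<Longrightarrow>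
   (\<lambda>x. \<Prod>i\<in>I. f i x) \<in> bump_algebra"
  by (induction I rule: finite_induct) (auto intro!: bump_algebra.intros)

lemma bump_algebra_power: "f \<in> bump_algebra \<Longrightarrow> (\<lambda>x. f x ^ k) \<in> bump_algebra"
  by (induction k) (auto intro!: bump_algebra.intros)

definition box_bump :: "'a::euclidean_space \<Rightarrow> 'a \<Rightarrow> 'a \<Rightarrow> real"
  where "box_bump a b x = (\<Prod>i\<in>Basis. exp_bump 0 (x \<bullet> i - a \<bullet> i) * exp_bump 0 (b \<bullet> i - x \<bullet> i))"

lemma box_bump_pos: "x \<in> box a b \<Longrightarrow> box_bump a b x > 0"
  unfolding box_bump_def by (rule prod_pos) (auto simp: exp_bump_def mem_box)

lemma box_bump_zero: "x \<notin> box a b \<Longrightarrow> box_bump a b x = 0"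
  by (fastforce simp: box_bump_def exp_bump_def mem_box)

lemma box_bump_zero_cbox: "x \<notin> cbox a b \<Longrightarrow> box_bump a b x = 0"
  using box_bump_zero box_subset_cbox[of a b] by blast

lemma box_bump_le1: "0 \<le> box_bump a b x" "box_bump a b x \<le> 1"
proof -
  have "0 \<le> exp_bump 0 t \<and> exp_bump 0 t \<le> 1" for t by (auto simp: exp_bump_def)
  then show "0 \<le> box_bump a b x" "box_bump a b x \<le> 1"
    unfolding box_bump_def by (auto intro!: prod_nonneg prod_le_1 mult_le_one)
qed

lemma box_bump_algebra: "(\<lambda>x. of_real (box_bump a b x)) \<in> bump_algebra"
proof -
  have "(\<lambda>x. \<Prod>i\<in>Basis. of_real (exp_bump 0 (x \<bullet> i + - (a \<bullet> i))) *
     of_real (exp_bump 0 (x \<bullet> (- i) + b \<bullet> i))) \<in> bump_algebra"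
    by (intro bump_algebra_prod bump_algebra.intros finite_Basis)
  then show ?thesis by (simp add: box_bump_def)
qed

text \<open>
  Since \<open>0 < box_bump \<le> 1\<close> inside the box and \<open>box_bump = 0\<close> outside, these test functions increase
  to the indicator of the box.
\<close>

definition box_approx :: "'a::euclidean_space \<Rightarrow> 'a \<Rightarrow> nat \<Rightarrow> 'a \<Rightarrow> complex"
  where "box_approx a b k x = of_real (1 - (1 - box_bump a b x) ^ k)"

lemma supp_subset_cbox: "(\<And>x. x \<notin> cbox a b \<Longrightarrow> f x = 0) \<Longrightarrow> supp f \<subseteq> cbox a b"
  unfolding supp_def by (rule closure_minimal) auto

lemma supp_compact: "(\<And>x. x \<notin> cbox a b \<Longrightarrow> f x = 0) \<Longrightarrow> compact (supp f)"
  using supp_subset_cbox[of a b f] bounded_subset[OF bounded_cbox]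
  by (auto simp: supp_def compact_eq_bounded_closed)

lemma box_approx_supp: "supp (box_approx a b k) \<subseteq> cbox a b"
  by (intro supp_subset_cbox) (simp add: box_approx_def box_bump_zero_cbox)

lemma box_approx_test: "test_fun (box_approx a b k)"
proof -
  have "(\<lambda>x. 1 + (-1) * (1 + (-1) * of_real (box_bump a b x)) ^ k) \<in> bump_algebra"
    by (intro bump_algebra.intros bump_algebra_power box_bump_algebra)
  then have "smooth (box_approx a b k)"
    using bump_algebra_smooth by (force simp: box_approx_def[abs_def])
  moreover have "compact (supp (box_approx a b k))"
    by (intro supp_compact[of a b]) (simp add: box_approx_def box_bump_zero_cbox)
  ultimately show ?thesis by (simp add: test_fun_def)
qed

lemma box_approx_le: "norm (box_approx a b k x) \<le> indicator (box a b) x"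
proof (cases "x \<in> box a b")
  case True
  have "0 \<le> (1 - box_bump a b x) ^ k" "(1 - box_bump a b x) ^ k \<le> 1"
    using box_bump_le1[of a b x] by (auto intro: power_le_one)
  then show ?thesis using True unfolding box_approx_def norm_of_real by simp
qed (simp add: box_approx_def box_bump_zero)

lemma box_approx_lim: "(\<lambda>k. box_approx a b k x) \<longlonglongrightarrow> indicator (box a b) x"
proof (cases "x \<in> box a b")
  case True
  have "norm (1 - box_bump a b x) < 1"
    using box_bump_le1[of a b x] box_bump_pos[OF True] by simp
  then have "(\<lambda>k. (1 - box_bump a b x) ^ k) \<longlonglongrightarrow> 0" by (rule LIMSEQ_power_zero)
  then have "(\<lambda>k. complex_of_real (1 - (1 - box_bump a b x) ^ k)) \<longlonglongrightarrow> of_real (1 - 0)"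
    by (intro tendsto_of_real tendsto_diff tendsto_const)
  then show ?thesis using True by (simp add: box_approx_def)
qed (simp add: box_approx_def box_bump_zero)

lemma ex_test_fun_one: "\<exists>\<theta>::'a::euclidean_space \<Rightarrow> complex. test_fun \<theta> \<and> \<theta> 0 = 1"
proof -
  define g :: "'a \<Rightarrow> complex" where "g = (\<lambda>x. of_real (box_bump (-One) One x))"
  have "(0::'a) \<in> box (-One) One" by (auto simp: mem_box)
  then have g0: "g 0 \<noteq> 0" using box_bump_pos[of 0 "-One::'a" One] by (simp add: g_def)
  have "(\<lambda>x. inverse (g 0) * g x) \<in> bump_algebra"
    unfolding g_def by (intro bump_algebra.intros box_bump_algebra)
  then have "smooth (\<lambda>x. inverse (g 0) * g x)" by (rule bump_algebra_smooth)
  moreover have "compact (supp (\<lambda>x. inverse (g 0) * g x))"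
    by (intro supp_compact[of "-One" One]) (simp add: g_def box_bump_zero_cbox)
  ultimately show ?thesis using g0
    by (intro exI[of _ "\<lambda>x. inverse (g 0) * g x"]) (auto simp: test_fun_def)
qed

section \<open>Integrals of derivatives\<close>

lemma integral_lborel_translate:
  fixes F :: "'a::euclidean_space \<Rightarrow> 'b::{banach, second_countable_topology}"
  assumes "F \<in> borel_measurable borel"
  shows "(LINT x|lborel. F (c + x)) = (LINT x|lborel. F x)"
proof -
  have "(LINT x|lborel. F x) = (LINT x|distr lborel borel ((+) c). F x)"
    by (simp add: lborel_distr_plus)
  also have "\<dots> = (LINT x|lborel. F (c + x))"
    using assms by (subst integral_distr) auto
  finally show ?thesis by simp
qed

lemma integrable_compact_support:
  fixes F :: "'a::euclidean_space \<Rightarrow> complex"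
  assumes c: "continuous_on UNIV F" and z: "\<And>x. R < norm x \<Longrightarrow> F x = 0"
  shows "integrable lborel F"
proof -
  have "integrable lborel (\<lambda>x. indicator (cball 0 R) x *\<^sub>R F x)"
    using borel_integrable_compact[of "cball 0 R" F] continuous_on_subset[OF c]
    by (auto simp: indicator_def if_distrib cong: if_cong)
  also have "(\<lambda>x. indicator (cball 0 R) x *\<^sub>R F x) = F"
    using z by (auto simp: fun_eq_iff indicator_def not_le)
  finally show ?thesis .
qed

lemma bounded_compact_support:
  fixes F :: "'a::euclidean_space \<Rightarrow> complex"
  assumes c: "continuous_on UNIV F" and z: "\<And>x. R < norm x \<Longrightarrow> F x = 0"
  shows "\<exists>B\<ge>0. \<forall>x. norm (F x) \<le> B"
proof -
  have "bounded (F ` cball 0 R)"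
    using c by (intro compact_imp_bounded compact_continuous_image) (auto intro: continuous_on_subset)
  then obtain B where "\<And>x. x \<in> cball 0 R \<Longrightarrow> norm (F x) \<le> B" unfolding bounded_iff by blast
  then have "norm (F x) \<le> max B 0" for x
    using z[of x] by (cases "norm x \<le> R") (auto intro: max.coboundedI1 max.coboundedI2)
  then show ?thesis by (intro exI[of _ "max B 0"]) auto
qed

text \<open>
  Difference quotients have integral zero by translation invariance, and they converge dominatedly.
\<close>

lemma integral_dir_deriv_eq_0:
  fixes F :: "'a::euclidean_space \<Rightarrow> complex"
  assumes d: "\<And>x. (F has_derivative F' x) (at x)"
    and c: "continuous_on UNIV (\<lambda>x. F' x e)"
    and z: "\<And>x. R < norm x \<Longrightarrow> F x = 0"
  shows "(LINT x|lborel. F' x e) = 0"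
proof -
  have cF: "continuous_on UNIV F"
    using d by (meson continuous_at_imp_continuous_on has_derivative_continuous)
  have z': "F' x e = 0" if "R < norm x" for x
  proof -
    have "eventually (\<lambda>y. y \<in> - cball 0 R) (nhds x)"
      using that by (intro eventually_nhds_in_open) auto
    then have "(F has_derivative (\<lambda>_. 0)) (at x)"
      using z that by (intro has_derivative_transform_eventually[OF has_derivative_const[of 0]])
         (auto simp: eventually_at_filter elim!: eventually_mono)
    then show ?thesis using has_derivative_unique[OF d] by (metis)
  qed
  obtain B where B: "B \<ge> 0" "\<And>x. norm (F' x e) \<le> B"
    using bounded_compact_support[OF c z'] by blast
  have line: "((\<lambda>t. F (x + t *\<^sub>R e)) has_vector_derivative F' (x + t *\<^sub>R e) e) (at t)" for x t
  proof -
    have "((\<lambda>t. F (x + t *\<^sub>R e)) has_derivative (\<lambda>u. F' (x + t *\<^sub>R e) (u *\<^sub>R e))) (at t)"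
    proof -
      have "((\<lambda>t. x + t *\<^sub>R e) has_derivative (\<lambda>u. u *\<^sub>R e)) (at t)"
        by (auto intro!: derivative_eq_intros)
      from diff_chain_at[OF this d] show ?thesis by (simp add: o_def)
    qed
    moreover have "F' (x + t *\<^sub>R e) (u *\<^sub>R e) = u *\<^sub>R F' (x + t *\<^sub>R e) e" for u
      using d[THEN has_derivative_linear] by (simp add: linear_cmul)
    ultimately show ?thesis by (simp add: has_vector_derivative_def)
  qed
  define h where "h n = inverse (real (Suc n))" for n
  have h: "0 < h n" "h n \<le> 1" for n by (auto simp: h_def field_simps)
  have h0: "h \<longlonglongrightarrow> 0" unfolding h_def by (rule LIMSEQ_inverse_real_of_nat)
  define D where "D n x = (F (h n *\<^sub>R e + x) - F x) /\<^sub>R h n" for n x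
  have lim: "(\<lambda>n. D n x) \<longlonglongrightarrow> F' x e" for x
  proof -
    have "((\<lambda>t. norm (F (x + t *\<^sub>R e) - F x - t *\<^sub>R F' x e) / norm t) \<longlongrightarrow> 0) (at 0)"
      using line[of x 0] by (simp add: has_vector_derivative_def has_derivative_at)
    then have "((\<lambda>t. norm ((F (x + t *\<^sub>R e) - F x) /\<^sub>R t - F' x e)) \<longlongrightarrow> 0) (at 0)"
    proof (rule Lim_transform_eventually, unfold eventually_at_filter, intro always_eventually allI impI)
      fix t :: real assume t: "t \<noteq> 0"
      have "(F (x + t *\<^sub>R e) - F x) /\<^sub>R t - F' x e = (F (x + t *\<^sub>R e) - F x - t *\<^sub>R F' x e) /\<^sub>R t"
        using t by (simp add: scaleR_diff_right)
      then show "norm (F (x + t *\<^sub>R e) - F x - t *\<^sub>R F' x e) / norm t =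
          norm ((F (x + t *\<^sub>R e) - F x) /\<^sub>R t - F' x e)"
        by (simp add: divide_inverse mult.commute)
    qed
    then have "((\<lambda>t. (F (x + t *\<^sub>R e) - F x) /\<^sub>R t) \<longlongrightarrow> F' x e) (at 0)"
      using Lim_null tendsto_norm_zero_iff by blast
    then have "(\<lambda>n. (F (x + h n *\<^sub>R e) - F x) /\<^sub>R h n) \<longlonglongrightarrow> F' x e"
      by (rule filterlim_compose) (use h0 h in \<open>auto simp: filterlim_at less_imp_neq[symmetric]\<close>)
    then show ?thesis by (simp add: D_def add.commute)
  qed
  have bnd: "norm (D n x) \<le> B * indicator (cball 0 (R + norm e)) x" for n x
  proof (cases "norm x \<le> R + norm e")
    case True
    have "norm (F (x + h n *\<^sub>R e) - F (x + 0 *\<^sub>R e)) \<le> B * norm (h n - 0)"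
    proof (rule differentiable_bound[OF convex_UNIV])
      show "((\<lambda>t. F (x + t *\<^sub>R e)) has_derivative (\<lambda>u. u *\<^sub>R F' (x + t *\<^sub>R e) e)) (at t)" for t
        using line by (simp add: has_vector_derivative_def)
      show "onorm (\<lambda>u. u *\<^sub>R F' (x + t *\<^sub>R e) e) \<le> B" for t :: real
        using B(2)[of "x + t *\<^sub>R e"] by (intro onorm_le) (simp add: mult.commute[of B] mult_left_mono)
    qed auto
    then have "norm (F (h n *\<^sub>R e + x) - F x) \<le> B * h n" using h[of n] by (simp add: add.commute)
    then have "norm (F (h n *\<^sub>R e + x) - F x) * inverse (h n) \<le> B"
      using h[of n] by (simp add: field_simps)
    then show ?thesis using h[of n] True by (simp add: D_def mult.commute)
  next
    case False
    have "norm (h n *\<^sub>R e) \<le> norm e" using h[of n] by (simp add: mult_left_le_one_le)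
    then have "R < norm (h n *\<^sub>R e + x)" using False norm_diff_ineq[of x "h n *\<^sub>R e"]
      by (simp add: add.commute)
    moreover have "R < norm x" using False norm_ge_zero[of e] by linarith
    ultimately show ?thesis using z B(1) by (simp add: D_def)
  qed
  have "(\<lambda>n. LINT x|lborel. D n x) \<longlonglongrightarrow> (LINT x|lborel. F' x e)"
  proof (rule integral_dominated_convergence)
    show "(\<lambda>x. F' x e) \<in> borel_measurable lborel" using c by (simp add: borel_measurable_continuous_onI)
    show "D n \<in> borel_measurable lborel" for n
      using borel_measurable_continuous_onI[OF cF] unfolding D_def by measurable
    show "integrable lborel (\<lambda>x::'a. B * indicator (cball 0 (R + norm e)) x)"
      using emeasure_bounded_finite[of "cball (0::'a) (R + norm e)"]
      by (intro integrable_mult_right integrable_real_indicator) (auto)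
  qed (use lim bnd in auto)
  moreover have "(LINT x|lborel. D n x) = 0" for n
  proof -
    have i: "integrable lborel F" using integrable_compact_support[OF cF z] by blast
    have i2: "integrable lborel (\<lambda>x. F (h n *\<^sub>R e + x))"
    proof (rule integrable_compact_support[of _ "R + norm (h n *\<^sub>R e)"])
      show "continuous_on UNIV (\<lambda>x. F (h n *\<^sub>R e + x))"
        by (intro continuous_on_compose2[OF cF] continuous_intros) auto
      show "F (h n *\<^sub>R e + x) = 0" if "R + norm (h n *\<^sub>R e) < norm x" for x
        using that norm_diff_ineq[of x "h n *\<^sub>R e"] by (intro z) (simp add: add.commute)
    qed
    show ?thesis unfolding D_def using i i2
      integral_lborel_translate[OF borel_measurable_continuous_onI[OF cF]] by simp
  qed
  ultimately show ?thesis by (simp add: LIMSEQ_const_iff)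
qed

section \<open>Calculus of oscillatory integrals\<close>

lemma iter_deriv_append: "iter_deriv vs (iter_deriv us f) = iter_deriv (vs @ us) f"
  by (simp add: iter_deriv_def)

lemma iter_deriv_single: "iter_deriv [v] f = dir_deriv v f"
  by (simp add: iter_deriv_def)

lemma smooth_has_derivative:
  assumes "smooth f"
  shows "(f has_derivative frechet_derivative f (at x)) (at x)"
proof -
  have "iter_deriv [] f differentiable_on UNIV" using assms unfolding smooth_def by (metis empty_set empty_subsetI)
  then have "f differentiable (at x)" by (simp add: iter_deriv_def differentiable_on_def)
  then show ?thesis by (simp add: frechet_derivative_works)
qed

lemma smooth_dir_deriv: "smooth f \<Longrightarrow> v \<in> Basis \<Longrightarrow> smooth (dir_deriv v f)"
  unfolding smooth_def iter_deriv_single[symmetric] iter_deriv_append by auto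

lemma smooth_continuous: "smooth f \<Longrightarrow> continuous_on UNIV f"
  by (meson smooth_has_derivative continuous_at_imp_continuous_on has_derivative_continuous)

lemma iter_deriv_add_scaled:
  fixes f g :: "'a::euclidean_space \<Rightarrow> complex"
  assumes "smooth f" "smooth g" "set vs \<subseteq> Basis"
  shows "iter_deriv vs (\<lambda>x. f x + c * g x) = (\<lambda>x. iter_deriv vs f x + c * iter_deriv vs g x)"
  using assms(3)
proof (induction vs)
  case Nil then show ?case by (simp add: iter_deriv_def)
next
  case (Cons v vs)
  have "iter_deriv vs f differentiable (at x)" "iter_deriv vs g differentiable (at x)" for x
    using assms(1,2) Cons.prems by (auto simp: smooth_def differentiable_on_def)
  then have *: "((\<lambda>x. iter_deriv vs f x + c * iter_deriv vs g x) has_derivative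
     (\<lambda>u. frechet_derivative (iter_deriv vs f) (at x) u + c * frechet_derivative (iter_deriv vs g) (at x) u)) (at x)" for x
    by (intro has_derivative_add has_derivative_mult_right) (simp_all add: frechet_derivative_works)
  have "iter_deriv vs (\<lambda>x. f x + c * g x) = (\<lambda>x. iter_deriv vs f x + c * iter_deriv vs g x)"
    using Cons by simp
  then have "iter_deriv (v # vs) (\<lambda>x. f x + c * g x) = dir_deriv v (\<lambda>x. iter_deriv vs f x + c * iter_deriv vs g x)"
    by (simp add: iter_deriv_def)
  then show ?case
    using frechet_derivative_at[OF *, symmetric]
    by (simp add: iter_deriv_def dir_deriv_def fun_eq_iff)
qed

lemma smooth_add_scaled:
  fixes f g :: "'a::euclidean_space \<Rightarrow> complex"
  assumes "smooth f" "smooth g" shows "smooth (\<lambda>x. f x + c * g x)"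
  unfolding smooth_def
proof (intro allI impI)
  fix vs :: "'a list" assume vs: "set vs \<subseteq> Basis"
  have "(\<lambda>x. iter_deriv vs f x + c * iter_deriv vs g x) differentiable_on UNIV"
    using assms vs unfolding smooth_def
    by (intro differentiable_on_add differentiable_on_mult) (auto simp: differentiable_on_def)
  then show "iter_deriv vs (\<lambda>x. f x + c * g x) differentiable_on UNIV"
    by (simp add: iter_deriv_add_scaled[OF assms vs])
qed

lemma test_fun_bounded_supp:
  assumes "test_fun \<theta>" obtains R where "R > 0" "\<And>x. R < norm x \<Longrightarrow> \<theta> x = 0"
proof -
  have "bounded (supp \<theta>)" using assms by (simp add: test_fun_def compact_imp_bounded)
  then obtain R where R: "R > 0" "\<And>x. x \<in> supp \<theta> \<Longrightarrow> norm x \<le> R" unfolding bounded_pos by blast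
  have "\<theta> x = 0" if "R < norm x" for x
    using that R(2)[of x] closure_subset[of "{x. \<theta> x \<noteq> 0}"] by (auto simp: supp_def)
  with R that show ?thesis by blast
qed

lemma test_funI: "smooth \<theta> \<Longrightarrow> (\<And>x. R < norm x \<Longrightarrow> \<theta> x = 0) \<Longrightarrow> test_fun \<theta>"
proof -
  assume s: "smooth \<theta>" and z: "\<And>x. R < norm x \<Longrightarrow> \<theta> x = 0"
  have "supp \<theta> \<subseteq> cball 0 R" unfolding supp_def
  proof (rule closure_minimal)
    show "{x. \<theta> x \<noteq> 0} \<subseteq> cball 0 R"
    proof
      fix x assume "x \<in> {x. \<theta> x \<noteq> 0}"
      then show "x \<in> cball 0 R" using z[of x] by (cases "R < norm x") auto
    qed
  qed simp
  then show "test_fun \<theta>" using s bounded_subset[OF bounded_cball]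
    by (auto simp: test_fun_def supp_def compact_eq_bounded_closed)
qed

lemma test_fun_dir_deriv:
  assumes "test_fun \<theta>" "e \<in> Basis" shows "test_fun (dir_deriv e \<theta>)"
proof -
  obtain R where R: "\<And>x. R < norm x \<Longrightarrow> \<theta> x = 0" using assms test_fun_bounded_supp by blast
  have "dir_deriv e \<theta> x = 0" if "R < norm x" for x
  proof -
    have "eventually (\<lambda>y. y \<in> - cball 0 R) (nhds x)"
      using that by (intro eventually_nhds_in_open) auto
    then have "(\<theta> has_derivative (\<lambda>_. 0)) (at x)"
      using R that by (intro has_derivative_transform_eventually[OF has_derivative_const[of 0]])
         (auto simp: eventually_at_filter elim!: eventually_mono)
    then show ?thesis by (simp add: dir_deriv_def frechet_derivative_at[symmetric])
  qed
  then show ?thesis using assms smooth_dir_deriv by (intro test_funI[of _ R]) (auto simp: test_fun_def)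
qed

lemma test_fun_add_scaled:
  assumes "test_fun f" "test_fun g" shows "test_fun (\<lambda>x. f x + c * g x)"
proof -
  obtain R where "\<And>x. R < norm x \<Longrightarrow> f x = 0" using assms test_fun_bounded_supp by blast
  moreover obtain S where "\<And>x. S < norm x \<Longrightarrow> g x = 0" using assms test_fun_bounded_supp by blast
  ultimately show ?thesis using assms smooth_add_scaled
    by (intro test_funI[of _ "max R S"]) (auto simp: test_fun_def)
qed

abbreviation wave :: "'a::euclidean_space \<Rightarrow> 'a \<Rightarrow> complex"
  where "wave y \<xi> \<equiv> exp (2 * of_real pi * \<i> * of_real (y \<bullet> \<xi>))"

lemma norm_wave [simp]: "norm (wave y \<xi>) = 1"
  by (simp add: norm_exp_eq_Re)

lemma wave_has_derivative:
  "(wave y has_derivative (\<lambda>u. 2 * of_real pi * \<i> * of_real (y \<bullet> u) * wave y \<xi>)) (at \<xi>)"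
proof -
  have "((\<lambda>\<xi>. 2 * of_real pi * \<i> * complex_of_real (y \<bullet> \<xi>)) has_derivative
    (\<lambda>u. 2 * of_real pi * \<i> * of_real (y \<bullet> u))) (at \<xi>)"
    by (intro has_derivative_mult_right has_derivative_of_real has_derivative_inner_right has_derivative_ident)
  from diff_chain_at[OF this DERIV_exp[THEN has_field_derivative_imp_has_derivative]]
  show ?thesis by (simp add: o_def mult.commute)
qed

lemma wave_continuous [continuous_intros]: "continuous_on S (wave y)"
  by (intro continuous_intros)

definition cutoff_fourier :: "('a::euclidean_space \<Rightarrow> complex) \<Rightarrow> ('a \<Rightarrow> complex) \<Rightarrow> 'a \<Rightarrow> real \<Rightarrow> complex"
  where "cutoff_fourier \<theta> a y \<epsilon> = (LINT \<xi>|lborel. \<theta> (\<epsilon> *\<^sub>R \<xi>) * a \<xi> * wave y \<xi>)"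

lemma cutoff_continuous:
  assumes "continuous_on UNIV \<theta>" "continuous_on UNIV a"
  shows "continuous_on UNIV (\<lambda>\<xi>. \<theta> (\<epsilon> *\<^sub>R \<xi>) * a \<xi> * wave y \<xi>)"
  by (intro continuous_intros assms continuous_on_compose2[OF assms(1)]) auto

lemma has_osc_iff:
  assumes "continuous_on UNIV a"
  shows "has_osc_inverse_fourier a y I \<longleftrightarrow>
    (\<forall>\<theta>. test_fun \<theta> \<and> \<theta> 0 = 1 \<longrightarrow> (cutoff_fourier \<theta> a y \<longlongrightarrow> I) (at_right 0))"
proof -
  have *: "(\<lambda>\<epsilon>. LINT \<xi>|lebesgue. \<theta> (\<epsilon> *\<^sub>R \<xi>) * a \<xi> * wave y \<xi>) = cutoff_fourier \<theta> a y" if "test_fun \<theta>" for \<theta>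
    unfolding cutoff_fourier_def
    by (intro ext integral_completion, subst measurable_lborel2, intro borel_measurable_continuous_onI
        cutoff_continuous assms smooth_continuous) (use that in \<open>simp add: test_fun_def\<close>)
  show ?thesis unfolding has_osc_inverse_fourier_def
    by (intro all_cong1 imp_cong refl arg_cong[where f = "\<lambda>h. (h \<longlongrightarrow> I) (at_right 0)"] *) (rule conjunct1)
qed

lemma cutoff_integrable:
  assumes "test_fun \<theta>" "continuous_on UNIV a" "\<epsilon> > 0"
  shows "integrable lborel (\<lambda>\<xi>. \<theta> (\<epsilon> *\<^sub>R \<xi>) * a \<xi> * wave y \<xi>)"
proof -
  obtain R where R: "R > 0" "\<And>x. R < norm x \<Longrightarrow> \<theta> x = 0" using assms test_fun_bounded_supp by blast
  show ?thesis
    by (rule integrable_compact_support[of _ "R / \<epsilon>"], rule cutoff_continuous)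
       (use assms R in \<open>auto simp: test_fun_def smooth_continuous field_simps\<close>)
qed

lemma cutoff_add_scaled:
  assumes "test_fun \<theta>" "test_fun \<theta>'" "continuous_on UNIV a" "\<epsilon> > 0"
  shows "cutoff_fourier (\<lambda>x. \<theta> x + c * \<theta>' x) a y \<epsilon> = cutoff_fourier \<theta> a y \<epsilon> + c * cutoff_fourier \<theta>' a y \<epsilon>"
  unfolding cutoff_fourier_def
  using cutoff_integrable[OF assms(1,3,4), of y] cutoff_integrable[OF assms(2,3,4), of y]
  by (simp add: algebra_simps)

lemma cutoff_by_parts:
  assumes t: "test_fun \<theta>" and d: "\<And>x. (a has_derivative a' x) (at x)"
    and c: "continuous_on UNIV (\<lambda>x. a' x e)" and e: "e \<in> Basis" and eps: "\<epsilon> > 0"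
  shows "cutoff_fourier \<theta> (\<lambda>x. a' x e) y \<epsilon> =
     - (of_real \<epsilon> * cutoff_fourier (dir_deriv e \<theta>) a y \<epsilon>)
     - 2 * of_real pi * \<i> * of_real (y \<bullet> e) * cutoff_fourier \<theta> a y \<epsilon>"
proof -
  obtain R where R: "R > 0" "\<And>x. R < norm x \<Longrightarrow> \<theta> x = 0" using t test_fun_bounded_supp by blast
  have ca: "continuous_on UNIV a" using d by (meson continuous_at_imp_continuous_on has_derivative_continuous)
  have s: "smooth \<theta>" using t by (simp add: test_fun_def)
  note t' = test_fun_dir_deriv[OF t e]
  let ?F' = "\<lambda>x u. \<theta> (\<epsilon> *\<^sub>R x) * a x * (2 * of_real pi * \<i> * of_real (y \<bullet> u) * wave y x) +
       (\<theta> (\<epsilon> *\<^sub>R x) * a' x u + frechet_derivative \<theta> (at (\<epsilon> *\<^sub>R x)) (\<epsilon> *\<^sub>R u) * a x) * wave y x"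
  have d1: "((\<lambda>\<xi>. \<theta> (\<epsilon> *\<^sub>R \<xi>)) has_derivative (\<lambda>u. frechet_derivative \<theta> (at (\<epsilon> *\<^sub>R x)) (\<epsilon> *\<^sub>R u))) (at x)" for x
  proof -
    have "((\<lambda>\<xi>. \<epsilon> *\<^sub>R \<xi>) has_derivative (\<lambda>u. \<epsilon> *\<^sub>R u)) (at x)" by (auto intro!: derivative_eq_intros)
    from diff_chain_at[OF this smooth_has_derivative[OF s]] show ?thesis by (simp add: o_def)
  qed
  have dF: "((\<lambda>\<xi>. \<theta> (\<epsilon> *\<^sub>R \<xi>) * a \<xi> * wave y \<xi>) has_derivative ?F' x) (at x)" for x
    by (intro has_derivative_mult d1 d wave_has_derivative)
  have eq: "?F' x e = of_real (2 * pi) * \<i> * of_real (y \<bullet> e) * (\<theta> (\<epsilon> *\<^sub>R x) * a x * wave y x)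
     + \<theta> (\<epsilon> *\<^sub>R x) * a' x e * wave y x + of_real \<epsilon> * (dir_deriv e \<theta> (\<epsilon> *\<^sub>R x) * a x * wave y x)" for x
  proof -
    have "frechet_derivative \<theta> (at (\<epsilon> *\<^sub>R x)) (\<epsilon> *\<^sub>R e) = \<epsilon> *\<^sub>R dir_deriv e \<theta> (\<epsilon> *\<^sub>R x)"
      using smooth_has_derivative[OF s, THEN has_derivative_linear] by (simp add: linear_cmul dir_deriv_def)
    then show ?thesis by (simp add: algebra_simps scaleR_conv_of_real)
  qed
  have cF: "continuous_on UNIV (\<lambda>x. ?F' x e)"
    unfolding eq using s t' smooth_continuous unfolding test_fun_def
    by (intro continuous_on_add continuous_on_mult[OF continuous_on_const] cutoff_continuous ca c) auto
  have "(LINT x|lborel. ?F' x e) = 0"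
    by (rule integral_dir_deriv_eq_0[OF dF cF, of "R / \<epsilon>"]) (use R eps in \<open>simp add: field_simps\<close>)
  then have "of_real (2 * pi) * \<i> * of_real (y \<bullet> e) * cutoff_fourier \<theta> a y \<epsilon>
     + cutoff_fourier \<theta> (\<lambda>x. a' x e) y \<epsilon> + of_real \<epsilon> * cutoff_fourier (dir_deriv e \<theta>) a y \<epsilon> = 0"
    unfolding eq cutoff_fourier_def
    using cutoff_integrable[OF t ca eps, of y] cutoff_integrable[OF t c eps, of y]
      cutoff_integrable[OF t' ca eps, of y] by simp
  moreover have "x + u + v = 0 \<Longrightarrow> u = - v - x" for x u v :: complex by algebra
  ultimately show ?thesis by simp
qed

text \<open>
  Integration by parts leaves \<open>\<epsilon>\<close> times the transform with the cut-off \<open>\<partial>\<^sub>e \<theta>\<close>, whose value at \<open>0\<close> need not be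
  \<open>1\<close>. Adding a multiple of \<open>\<theta>\<close> to it gives an admissible cut-off, so this transform converges as well
  and the extra term vanishes in the limit.
\<close>

lemma has_osc_deriv:
  assumes osc: "has_osc_inverse_fourier a y I" and d: "\<And>x. (a has_derivative a' x) (at x)"
    and c: "continuous_on UNIV (\<lambda>x. a' x e)" and e: "e \<in> Basis"
  shows "has_osc_inverse_fourier (\<lambda>x. a' x e) y (- (2 * of_real pi * \<i> * of_real (y \<bullet> e)) * I)"
proof -
  have ca: "continuous_on UNIV a" using d by (meson continuous_at_imp_continuous_on has_derivative_continuous)
  show ?thesis unfolding has_osc_iff[OF c]
  proof (intro allI impI)
    fix \<theta> :: "'a \<Rightarrow> complex" assume th: "test_fun \<theta> \<and> \<theta> 0 = 1"
    define s where "s = dir_deriv e \<theta> 0"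
    define \<phi> where "\<phi> = (\<lambda>x. dir_deriv e \<theta> x + (1 - s) * \<theta> x)"
    have td: "test_fun (dir_deriv e \<theta>)" using th e by (intro test_fun_dir_deriv) auto
    then have "test_fun \<phi>" "\<phi> 0 = 1"
      unfolding \<phi>_def using th by (auto intro: test_fun_add_scaled simp: s_def)
    then have l1: "(cutoff_fourier \<phi> a y \<longlongrightarrow> I) (at_right 0)" and l2: "(cutoff_fourier \<theta> a y \<longlongrightarrow> I) (at_right 0)"
      using osc th unfolding has_osc_iff[OF ca] by auto
    have "((\<lambda>\<epsilon>. - (of_real \<epsilon> * (cutoff_fourier \<phi> a y \<epsilon> - (1 - s) * cutoff_fourier \<theta> a y \<epsilon>))
       - 2 * of_real pi * \<i> * of_real (y \<bullet> e) * cutoff_fourier \<theta> a y \<epsilon>) \<longlongrightarrow>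
       - (of_real 0 * (I - (1 - s) * I)) - 2 * of_real pi * \<i> * of_real (y \<bullet> e) * I) (at_right 0)"
      by (intro tendsto_intros l1 l2)
    then have "(cutoff_fourier \<theta> (\<lambda>x. a' x e) y \<longlongrightarrow>
       - (of_real 0 * (I - (1 - s) * I)) - 2 * of_real pi * \<i> * of_real (y \<bullet> e) * I) (at_right 0)"
    proof (rule Lim_transform_eventually)
      show "\<forall>\<^sub>F \<epsilon> in at_right 0. - (of_real \<epsilon> * (cutoff_fourier \<phi> a y \<epsilon> - (1 - s) * cutoff_fourier \<theta> a y \<epsilon>))
         - 2 * of_real pi * \<i> * of_real (y \<bullet> e) * cutoff_fourier \<theta> a y \<epsilon> = cutoff_fourier \<theta> (\<lambda>x. a' x e) y \<epsilon>"
        unfolding eventually_at_filter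
        using cutoff_by_parts[OF _ d c e] cutoff_add_scaled[OF td _ ca] th
        by (intro always_eventually) (auto simp: \<phi>_def)
    qed
    then show "(cutoff_fourier \<theta> (\<lambda>x. a' x e) y \<longlongrightarrow> - (2 * of_real pi * \<i> * of_real (y \<bullet> e)) * I) (at_right 0)"
      by simp
  qed
qed

lemma filterlim_inverse_Suc_at_right: "filterlim (\<lambda>n. inverse (real (Suc n))) (at_right 0) sequentially"
  by (auto simp: filterlim_at intro: LIMSEQ_inverse_real_of_nat simp del: of_nat_Suc)

lemma test_fun_bounded: "test_fun \<theta> \<Longrightarrow> \<exists>B\<ge>0. \<forall>x. norm (\<theta> x) \<le> B"
  by (metis bounded_compact_support smooth_continuous test_fun_bounded_supp test_fun_def)

lemma scaled_tendsto_zero: "(\<lambda>n. inverse (real (Suc n)) *\<^sub>R (\<xi>::'a::euclidean_space)) \<longlonglongrightarrow> 0"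
  using tendsto_scaleR[OF LIMSEQ_inverse_real_of_nat tendsto_const[of \<xi>]] by simp

lemma test_fun_tendsto_1:
  assumes "test_fun \<theta>"
  shows "(\<lambda>n. \<theta> (inverse (real (Suc n)) *\<^sub>R (\<xi>::'a::euclidean_space))) \<longlonglongrightarrow> \<theta> 0"
  using assms smooth_continuous scaled_tendsto_zero
  by (intro isCont_tendsto_compose[of 0 \<theta>]) (auto simp: test_fun_def continuous_on_eq_continuous_at)

lemma has_osc_integrable:
  assumes osc: "has_osc_inverse_fourier a y I" and c: "continuous_on UNIV a" and i: "integrable lborel a"
  shows "I = (LINT \<xi>|lborel. a \<xi> * wave y \<xi>)"
proof -
  obtain \<theta> :: "'a \<Rightarrow> complex" where th: "test_fun \<theta>" "\<theta> 0 = 1" using ex_test_fun_one by blast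
  obtain B where B: "B \<ge> 0" "\<And>x. norm (\<theta> x) \<le> B" using test_fun_bounded[OF th(1)] by blast
  have ct: "continuous_on UNIV \<theta>" using th by (simp add: test_fun_def smooth_continuous)
  have "(cutoff_fourier \<theta> a y \<longlongrightarrow> I) (at_right 0)" using osc th unfolding has_osc_iff[OF c] by auto
  then have "(\<lambda>n. cutoff_fourier \<theta> a y (inverse (real (Suc n)))) \<longlonglongrightarrow> I"
    by (rule filterlim_compose[OF _ filterlim_inverse_Suc_at_right])
  moreover have "(\<lambda>n. cutoff_fourier \<theta> a y (inverse (real (Suc n)))) \<longlonglongrightarrow> (LINT \<xi>|lborel. a \<xi> * wave y \<xi>)"
    unfolding cutoff_fourier_def
  proof (rule integral_dominated_convergence)
    show "(\<lambda>\<xi>. a \<xi> * wave y \<xi>) \<in> borel_measurable lborel"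
      using c by (simp, intro borel_measurable_continuous_onI continuous_intros)
    show "(\<lambda>\<xi>. \<theta> (inverse (real (Suc n)) *\<^sub>R \<xi>) * a \<xi> * wave y \<xi>) \<in> borel_measurable lborel" for n
      using borel_measurable_continuous_onI[OF cutoff_continuous[OF ct c]] by simp
    show "integrable lborel (\<lambda>\<xi>. B * norm (a \<xi>))" using i by simp
    have "(\<lambda>n. \<theta> (inverse (real (Suc n)) *\<^sub>R \<xi>) * a \<xi> * wave y \<xi>) \<longlonglongrightarrow> 1 * a \<xi> * wave y \<xi>" for \<xi>
      using test_fun_tendsto_1[OF th(1)] th(2) by (intro tendsto_mult tendsto_const) auto
    then show "AE \<xi> in lborel. (\<lambda>n. \<theta> (inverse (real (Suc n)) *\<^sub>R \<xi>) * a \<xi> * wave y \<xi>) \<longlonglongrightarrow> a \<xi> * wave y \<xi>"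
      by simp
    show "AE \<xi> in lborel. norm (\<theta> (inverse (real (Suc n)) *\<^sub>R \<xi>) * a \<xi> * wave y \<xi>) \<le> B * norm (a \<xi>)" for n
      by (auto simp: norm_mult intro!: mult_right_mono B)
  qed
  ultimately show ?thesis by (rule LIMSEQ_unique)
qed

text \<open>
  The function may exceed an integrable one by a factor of order \<open>|x|\<close>: the derivative of the cut-off
  \<open>\<theta>(\<epsilon>x)\<close> is of size \<open>\<epsilon>\<close> and supported in \<open>|x| \<le> R/\<epsilon>\<close>, which compensates that factor.
\<close>

lemma integral_deriv_eq_0_decay:
  fixes a :: "'a::euclidean_space \<Rightarrow> complex"
  assumes d: "\<And>x. (a has_derivative a' x) (at x)" and c: "continuous_on UNIV (\<lambda>x. a' x e)"
    and e: "e \<in> Basis" and i: "integrable lborel (\<lambda>x. a' x e)"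
    and g: "integrable lborel g" "\<And>x. norm (a x) \<le> (1 + norm x) * g x"
  shows "(LINT x|lborel. a' x e) = 0"
proof -
  obtain \<theta> :: "'a \<Rightarrow> complex" where th: "test_fun \<theta>" "\<theta> 0 = 1" using ex_test_fun_one by blast
  obtain B where B: "B \<ge> 0" "\<And>x. norm (\<theta> x) \<le> B" using test_fun_bounded[OF th(1)] by blast
  note td = test_fun_dir_deriv[OF th(1) e]
  obtain B' where B': "B' \<ge> 0" "\<And>x. norm (dir_deriv e \<theta> x) \<le> B'" using test_fun_bounded[OF td] by blast
  obtain R where R: "R > 0" "\<And>x. R < norm x \<Longrightarrow> dir_deriv e \<theta> x = 0" using td test_fun_bounded_supp by blast
  have ct: "continuous_on UNIV \<theta>" "continuous_on UNIV (dir_deriv e \<theta>)"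
    using th td by (auto simp: test_fun_def smooth_continuous)
  have ca: "continuous_on UNIV a" using d by (meson continuous_at_imp_continuous_on has_derivative_continuous)
  have gn: "g x \<ge> 0" for x
  proof -
    have "0 \<le> (1 + norm x) * g x" using g(2)[of x] norm_ge_zero order_trans by blast
    then show ?thesis by (simp add: zero_le_mult_iff) (smt (verit) norm_ge_zero)
  qed
  let ?h = "\<lambda>n. inverse (real (Suc n))"
  have p: "cutoff_fourier \<theta> (\<lambda>x. a' x e) 0 (?h n) = - (LINT \<xi>|lborel. of_real (?h n) * (dir_deriv e \<theta> (?h n *\<^sub>R \<xi>) * a \<xi>))" for n
    using cutoff_by_parts[OF th(1) d c e, of "?h n" 0] by (simp add: cutoff_fourier_def)
  have 1: "(\<lambda>n. LINT \<xi>|lborel. of_real (?h n) * (dir_deriv e \<theta> (?h n *\<^sub>R \<xi>) * a \<xi>)) \<longlonglongrightarrow> (LINT (\<xi>::'a)|lborel. 0)"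
  proof (rule integral_dominated_convergence)
    show "(\<lambda>\<xi>. of_real (?h n) * (dir_deriv e \<theta> (?h n *\<^sub>R \<xi>) * a \<xi>)) \<in> borel_measurable lborel" for n
      using ca ct by (simp, intro borel_measurable_continuous_onI continuous_intros continuous_on_compose2[OF ct(2)]) auto
    show "integrable lborel (\<lambda>x. B' * (1 + R) * g x)" using g by simp
    have "norm (of_real (?h n) * (dir_deriv e \<theta> (?h n *\<^sub>R \<xi>) * a \<xi>)) \<le> B' * (1 + R) * g \<xi>" for n \<xi>
    proof (cases "norm (?h n *\<^sub>R \<xi>) \<le> R")
      case True
      then have "norm \<xi> \<le> R * real (Suc n)" by (simp add: field_simps)
      then have "?h n * (1 + norm \<xi>) \<le> ?h n * ((1 + R) * real (Suc n))"
        using R by (intro mult_left_mono) (auto simp: algebra_simps)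
      also have "\<dots> = 1 + R" by (simp add: divide_simps)
      finally have *: "?h n * (1 + norm \<xi>) \<le> 1 + R" .
      have "norm (of_real (?h n) * (dir_deriv e \<theta> (?h n *\<^sub>R \<xi>) * a \<xi>)) =
          ?h n * (norm (dir_deriv e \<theta> (?h n *\<^sub>R \<xi>)) * norm (a \<xi>))" by (simp add: norm_mult norm_inverse del: of_nat_Suc)
      also have "\<dots> \<le> ?h n * (B' * ((1 + norm \<xi>) * g \<xi>))"
        using B' g(2)[of \<xi>] by (intro mult_left_mono mult_mono) auto
      also have "\<dots> = B' * (?h n * (1 + norm \<xi>)) * g \<xi>" by simp
      also have "\<dots> \<le> B' * (1 + R) * g \<xi>"
        using * gn B' by (intro mult_right_mono mult_left_mono) auto
      finally show ?thesis .
    next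
      case False
      then have "dir_deriv e \<theta> (?h n *\<^sub>R \<xi>) = 0" using R by simp
      then show ?thesis using gn B' R by simp
    qed
    then show "AE \<xi> in lborel. norm (of_real (?h n) * (dir_deriv e \<theta> (?h n *\<^sub>R \<xi>) * a \<xi>)) \<le> B' * (1 + R) * g \<xi>" for n
      by simp
    have "(\<lambda>n. of_real (?h n) * (dir_deriv e \<theta> (?h n *\<^sub>R \<xi>) * a \<xi>)) \<longlonglongrightarrow> of_real 0 * (dir_deriv e \<theta> 0 * a \<xi>)" for \<xi>
      by (intro tendsto_mult tendsto_of_real LIMSEQ_inverse_real_of_nat test_fun_tendsto_1 td tendsto_const)
    then show "AE \<xi> in lborel. (\<lambda>n. of_real (?h n) * (dir_deriv e \<theta> (?h n *\<^sub>R \<xi>) * a \<xi>)) \<longlonglongrightarrow> 0" by simp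
  qed auto
  have 2: "(\<lambda>n. cutoff_fourier \<theta> (\<lambda>x. a' x e) 0 (?h n)) \<longlonglongrightarrow> (LINT x|lborel. a' x e)"
    unfolding cutoff_fourier_def
  proof (rule integral_dominated_convergence)
    show "(\<lambda>\<xi>. a' \<xi> e) \<in> borel_measurable lborel"
      using c by (simp add: borel_measurable_continuous_onI)
    show "(\<lambda>\<xi>. \<theta> (?h n *\<^sub>R \<xi>) * a' \<xi> e * wave 0 \<xi>) \<in> borel_measurable lborel" for n
      using borel_measurable_continuous_onI[OF cutoff_continuous[OF ct(1) c, of "?h n" 0]] by simp
    show "integrable lborel (\<lambda>\<xi>. B * norm (a' \<xi> e))" using i by simp
    have "(\<lambda>n. \<theta> (?h n *\<^sub>R \<xi>) * a' \<xi> e) \<longlonglongrightarrow> 1 * a' \<xi> e" for \<xi>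
      using test_fun_tendsto_1[OF th(1)] th(2) by (intro tendsto_mult tendsto_const) auto
    then show "AE \<xi> in lborel. (\<lambda>n. \<theta> (?h n *\<^sub>R \<xi>) * a' \<xi> e * wave 0 \<xi>) \<longlonglongrightarrow> a' \<xi> e" by simp
    show "AE \<xi> in lborel. norm (\<theta> (?h n *\<^sub>R \<xi>) * a' \<xi> e * wave 0 \<xi>) \<le> B * norm (a' \<xi> e)" for n
      by (auto simp: norm_mult intro!: mult_right_mono B)
  qed
  have "(\<lambda>n. cutoff_fourier \<theta> (\<lambda>x. a' x e) 0 (?h n)) \<longlonglongrightarrow> 0"
    unfolding p using tendsto_minus[OF 1] by simp
  from LIMSEQ_unique[OF 2 this] show ?thesis .
qed

section \<open>Cubes and product measures\<close>

definition cube :: "'a::euclidean_space \<Rightarrow> real \<Rightarrow> 'a set"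
  where "cube x R = cbox (x - R *\<^sub>R One) (x + R *\<^sub>R One)"

lemma infnorm_le_iff: "infnorm (x::'a::euclidean_space) \<le> R \<longleftrightarrow> (\<forall>b\<in>Basis. \<bar>x \<bullet> b\<bar> \<le> R)"
  by (auto simp: infnorm_Max)

lemma mem_cube: "y \<in> cube x R \<longleftrightarrow> infnorm (x - y) \<le> R"
  unfolding cube_def mem_box infnorm_le_iff
  by (intro ball_cong refl) (auto simp: algebra_simps abs_le_iff)

lemma mem_cube_sym: "y \<in> cube x R \<longleftrightarrow> x \<in> cube y R"
  by (simp add: mem_cube infnorm_sub)

lemma emeasure_cube: "R \<ge> 0 \<Longrightarrow> emeasure lborel (cube (x::'a::euclidean_space) R) = ennreal ((2 * R) ^ DIM('a))"
  unfolding cube_def by (subst emeasure_lborel_cbox) (auto simp: algebra_simps)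

lemma cube_borel [measurable]: "cube x R \<in> sets borel"
  by (simp add: cube_def)

lemma ennreal_le_suminf: "f k \<le> (\<Sum>k. f k :: ennreal)"
  using sum_le_suminf[of f "{k}"] by simp

text \<open>
  The function \<open>(1 + |x|)\<^bsup>-p\<^esup>\<close> is compared with a geometric series of indicators of dyadic cubes.
\<close>

lemma nn_integral_decay_finite:
  assumes p: "p > real (DIM('a))"
  shows "(\<integral>\<^sup>+ x. ennreal ((1 + infnorm (x::'a::euclidean_space)) powr - p) \<partial>lborel) < \<infinity>"
proof -
  let ?d = "DIM('a)"
  define q where "q = (2::real) powr (real ?d - p)"
  have q: "0 < q" "q < 1" using p powr_less_mono[of "real ?d - p" 0 2] by (auto simp: q_def)
  have pt: "ennreal ((1 + infnorm x) powr - p) \<le> (\<Sum>k. ennreal (2 powr p * (2 powr - p) ^ k) * indicator (cube 0 (2 ^ k)) x)" for x :: 'a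
  proof -
    define k where "k = (LEAST k::nat. infnorm x \<le> 2 ^ k)"
    have ex: "\<exists>k::nat. infnorm x \<le> 2 ^ k" using real_arch_pow[of 2 "infnorm x"] by (auto intro: less_imp_le)
    have k: "infnorm x \<le> 2 ^ k" unfolding k_def by (rule LeastI_ex[OF ex])
    have "2 powr (real k - 1) \<le> 1 + infnorm x"
    proof (cases k)
      case 0 then show ?thesis using infnorm_pos_le[of x] powr_mono[of "-1" 0 "2::real"] by simp
    next
      case (Suc j)
      then have "\<not> infnorm x \<le> 2 ^ j" using not_less_Least[of j "\<lambda>k. infnorm x \<le> 2 ^ k"] by (simp add: k_def)
      then show ?thesis using Suc by (simp add: powr_realpow)
    qed
    then have "(1 + infnorm x) powr - p \<le> (2 powr (real k - 1)) powr - p"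
      using p by (intro powr_mono2') auto
    also have "\<dots> = 2 powr p * (2 powr - p) ^ k"
    proof -
      have "(2 powr - p) ^ k = 2 powr (- p * real k)" by (simp add: powr_realpow[symmetric] powr_powr)
      then show ?thesis by (simp only: powr_powr powr_add[symmetric]) (simp add: algebra_simps)
    qed
    finally have "ennreal ((1 + infnorm x) powr - p) \<le> ennreal (2 powr p * (2 powr - p) ^ k) * indicator (cube 0 (2 ^ k)) x"
      using k by (simp add: mem_cube infnorm_neg ennreal_leI)
    also have "\<dots> \<le> (\<Sum>k. ennreal (2 powr p * (2 powr - p) ^ k) * indicator (cube 0 (2 ^ k)) x)"
      by (rule ennreal_le_suminf)
    finally show ?thesis .
  qed
  have "(\<integral>\<^sup>+ x. ennreal ((1 + infnorm (x::'a)) powr - p) \<partial>lborel) \<le>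
     (\<integral>\<^sup>+ x. (\<Sum>k. ennreal (2 powr p * (2 powr - p) ^ k) * indicator (cube (0::'a) (2 ^ k)) x) \<partial>lborel)"
    by (intro nn_integral_mono pt)
  also have "\<dots> = (\<Sum>k. ennreal (2 powr p * (2 powr - p) ^ k) * ennreal ((2 * 2 ^ k) ^ ?d))"
    by (subst nn_integral_suminf) (auto simp: nn_integral_cmult_indicator emeasure_cube)
  also have "\<dots> = (\<Sum>k. ennreal (2 powr p * 2 ^ ?d * q ^ k))"
  proof (intro arg_cong[where f = suminf] ext)
    fix k
    have "(2 powr - p) ^ k * (2 ^ k) ^ ?d = q ^ k"
    proof -
      have "(2 powr - p) ^ k * (2 ^ k) ^ ?d = ((2 powr - p) * 2 ^ ?d) ^ k"
        by (simp add: power_mult_distrib power_mult[symmetric] mult.commute)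
      also have "(2 powr - p) * 2 ^ ?d = q"
        by (simp add: q_def powr_realpow[symmetric] powr_add[symmetric] add.commute)
      finally show ?thesis .
    qed
    then have e: "2 powr p * (2 powr - p) ^ k * (2 * 2 ^ k) ^ ?d = 2 powr p * 2 ^ ?d * q ^ k"
      by (metis power_mult_distrib mult.assoc mult.left_commute)
    have "ennreal (2 powr p * (2 powr - p) ^ k) * ennreal ((2 * 2 ^ k) ^ ?d) =
        ennreal (2 powr p * (2 powr - p) ^ k * (2 * 2 ^ k) ^ ?d)"
      by (rule ennreal_mult[symmetric]) auto
    then show "ennreal (2 powr p * (2 powr - p) ^ k) * ennreal ((2 * 2 ^ k) ^ ?d) = ennreal (2 powr p * 2 ^ ?d * q ^ k)"
      by (simp only: e)
  qed
  also have "\<dots> < \<infinity>"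
  proof -
    have "summable (\<lambda>k. 2 powr p * 2 ^ ?d * q ^ k)" using q by (intro summable_mult summable_geometric) simp
    then show ?thesis using q by (subst suminf_ennreal2) auto
  qed
  finally show ?thesis .
qed

lemma lborel_vec_eq:
  "(lborel :: (real^'n^'m) measure) = distr (\<Pi>\<^sub>M j\<in>(UNIV::'m set). (lborel :: (real^'n) measure)) borel (\<lambda>f. \<chi> j. f j)"
proof (rule lborel_eqI)
  interpret product_sigma_finite "\<lambda>_::'m. lborel :: (real^'n) measure" ..
  fix l u :: "real^'n^'m"
  assume le: "\<And>b. b \<in> Basis \<Longrightarrow> l \<bullet> b \<le> u \<bullet> b"
  have meas: "(\<lambda>f. \<chi> j. f j) \<in> (\<Pi>\<^sub>M j\<in>(UNIV::'m set). (lborel :: (real^'n) measure)) \<rightarrow>\<^sub>M borel"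
    by (rule borel_measurable_euclidean_space[THEN iffD2])
       (auto simp: Basis_vec_def inner_axis intro!: measurable_compose[OF measurable_component_singleton])
  have le': "l $ j \<bullet> b \<le> u $ j \<bullet> b" if "b \<in> Basis" for j b
    using le[of "axis j b"] that by (auto simp: inner_axis axis_in_Basis_iff)
  have "(\<lambda>f. \<chi> j. f j) -` box l u \<inter> space (\<Pi>\<^sub>M j\<in>(UNIV::'m set). (lborel :: (real^'n) measure)) =
     (\<Pi>\<^sub>E j\<in>UNIV. box (l $ j) (u $ j))"
    by (auto simp: mem_box space_PiM PiE_iff Basis_vec_def inner_axis)
  then have "emeasure (distr (\<Pi>\<^sub>M j\<in>(UNIV::'m set). (lborel :: (real^'n) measure)) borel (\<lambda>f. \<chi> j. f j)) (box l u)
     = (\<Prod>j\<in>UNIV. emeasure lborel (box (l $ j) (u $ j)))"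
    using meas by (subst emeasure_distr) (auto simp: emeasure_PiM)
  also have "\<dots> = (\<Prod>j\<in>UNIV. ennreal (\<Prod>b\<in>Basis. (u $ j - l $ j) \<bullet> b))"
    using le' by (intro prod.cong refl) (auto simp: emeasure_lborel_box)
  also have "\<dots> = ennreal (\<Prod>j\<in>UNIV. \<Prod>b\<in>Basis. (u $ j - l $ j) \<bullet> b)"
    using le' by (intro prod_ennreal prod_nonneg) (auto simp: inner_diff_left)
  also have "(\<Prod>j\<in>UNIV. \<Prod>b\<in>Basis. (u $ j - l $ j) \<bullet> b) = (\<Prod>b\<in>Basis. (u - l) \<bullet> b)"
  proof -
    have B: "(Basis :: (real^'n^'m) set) = (\<lambda>(j, b). axis j b) ` (UNIV \<times> Basis)"
      by (auto simp: Basis_vec_def)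
    have inj: "inj_on (\<lambda>(j, b). axis j b :: real^'n^'m) (UNIV \<times> Basis)"
      by (auto simp: inj_on_def axis_eq_axis)
    show ?thesis unfolding B
      by (subst prod.reindex[OF inj]) (auto simp: prod.cartesian_product inner_axis intro!: prod.cong)
  qed
  finally show "emeasure (distr (\<Pi>\<^sub>M j\<in>(UNIV::'m set). (lborel :: (real^'n) measure)) borel (\<lambda>f. \<chi> j. f j)) (box l u)
     = ennreal (\<Prod>b\<in>Basis. (u - l) \<bullet> b)" .
qed simp

lemma nn_integral_vec_prod:
  fixes f :: "'m::finite \<Rightarrow> real^'n \<Rightarrow> ennreal"
  assumes f: "\<And>j. f j \<in> borel_measurable borel"
  shows "(\<integral>\<^sup>+y. (\<Prod>j\<in>UNIV. f j (y $ j)) \<partial>lborel) = (\<Prod>j\<in>UNIV. \<integral>\<^sup>+z. f j z \<partial>lborel)"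
proof -
  interpret product_sigma_finite "\<lambda>_::'m. lborel :: (real^'n) measure" ..
  have meas: "(\<lambda>f. \<chi> j. f j) \<in> (\<Pi>\<^sub>M j\<in>(UNIV::'m set). (lborel :: (real^'n) measure)) \<rightarrow>\<^sub>M borel"
    by (rule borel_measurable_euclidean_space[THEN iffD2])
       (auto simp: Basis_vec_def inner_axis intro!: measurable_compose[OF measurable_component_singleton])
  have nth: "(\<lambda>y::real^'n^'m. y $ j) \<in> borel_measurable borel" for j
    by (intro borel_measurable_continuous_onI continuous_intros)
  have [measurable]: "(\<lambda>y::real^'n^'m. \<Prod>j\<in>UNIV. f j (y $ j)) \<in> borel_measurable borel"
    using measurable_compose[OF nth f] by (intro borel_measurable_prod_ennreal) auto
  show ?thesis
    unfolding lborel_vec_eq using f meas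
    by (subst nn_integral_distr) (auto simp: product_nn_integral_prod)
qed

section \<open>Decay of the kernel\<close>

text \<open>
  The size of a frequency in which the symbol estimates are stated.
\<close>

definition bracket :: "real^'n^'m \<Rightarrow> real"
  where "bracket \<xi> = 1 + (\<Sum>j\<in>UNIV. norm (\<xi> $ j))"

lemma bracket_ge: "1 + norm \<xi> \<le> bracket \<xi>"
proof -
  have "norm \<xi> \<le> (\<Sum>j\<in>UNIV. norm (\<xi> $ j))" unfolding norm_vec_def by (rule L2_set_le_sum) auto
  then show ?thesis by (simp add: bracket_def)
qed

lemma bracket_ge_1: "1 \<le> bracket \<xi>" using bracket_ge[of \<xi>] norm_ge_zero[of \<xi>] by linarith

lemma bracket_le: "bracket (\<xi>::real^'n^'m) \<le> real CARD('m) * (1 + norm \<xi>)"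
proof -
  have "(\<Sum>j\<in>(UNIV::'m set). norm (\<xi> $ j)) \<le> (\<Sum>j\<in>(UNIV::'m set). norm \<xi>)"
    by (intro sum_mono Finite_Cartesian_Product.norm_nth_le)
  moreover have "1 \<le> real CARD('m)" using zero_less_card_finite[where 'a='m] by (simp add: Suc_leI)
  moreover have "(\<Sum>j\<in>(UNIV::'m set). norm \<xi>) = real CARD('m) * norm \<xi>" by simp
  ultimately show ?thesis unfolding bracket_def distrib_left by linarith
qed

lemma bracket_continuous: "continuous_on UNIV bracket"
  unfolding bracket_def[abs_def] by (intro continuous_intros)

lemma integrable_bracket:
  assumes "s < - real (CARD('m) * CARD('n))"
  shows "integrable lborel (\<lambda>\<xi>::real^'n^'m. bracket \<xi> powr s)"
proof (rule integrableI_bounded)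
  have "continuous_on UNIV (\<lambda>\<xi>::real^'n^'m. bracket \<xi> powr s)"
    by (intro continuous_on_powr bracket_continuous continuous_intros) (metis bracket_ge_1 not_one_le_zero)
  then show "(\<lambda>\<xi>::real^'n^'m. bracket \<xi> powr s) \<in> borel_measurable lborel"
    by (simp add: borel_measurable_continuous_onI)
  have s0: "s < 0" using assms by (rule order_less_le_trans) simp
  have "(\<integral>\<^sup>+ \<xi>. ennreal (norm (bracket (\<xi>::real^'n^'m) powr s)) \<partial>lborel) \<le>
     (\<integral>\<^sup>+ \<xi>. ennreal ((1 + infnorm (\<xi>::real^'n^'m)) powr - (- s)) \<partial>lborel)"
  proof (intro nn_integral_mono ennreal_leI)
    fix \<xi> :: "real^'n^'m"
    have "1 + infnorm \<xi> \<le> bracket \<xi>" using bracket_ge[of \<xi>] infnorm_le_norm[of \<xi>] by linarith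
    then show "norm (bracket \<xi> powr s) \<le> (1 + infnorm \<xi>) powr - (- s)"
      using s0 infnorm_pos_le[of \<xi>] by (simp, intro powr_mono2') auto
  qed
  also have "\<dots> < \<infinity>" using assms by (intro nn_integral_decay_finite) (simp add: DIM_cart)
  finally show "(\<integral>\<^sup>+ \<xi>. ennreal (norm (bracket (\<xi>::real^'n^'m) powr s)) \<partial>lborel) < \<infinity>" .
qed

definition freq_deriv :: "(real^'n \<Rightarrow> real^'n^'m \<Rightarrow> complex) \<Rightarrow> real^'n^'m \<Rightarrow> nat \<Rightarrow> real^'n \<Rightarrow> real^'n^'m \<Rightarrow> complex"
  where "freq_deriv \<sigma> e k x \<xi> = iter_deriv (replicate k (0, e)) (\<lambda>(x, \<xi>). \<sigma> x \<xi>) (x, \<xi>)"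

lemma smooth_slice:
  fixes \<sigma> :: "real^'n \<Rightarrow> real^'n^'m \<Rightarrow> complex"
  assumes s: "smooth (\<lambda>(x, \<xi>). \<sigma> x \<xi>)" and e: "e \<in> Basis"
  obtains D where "\<And>\<xi>. (freq_deriv \<sigma> e k x has_derivative D \<xi>) (at \<xi>)"
    "(\<lambda>\<xi>. D \<xi> e) = freq_deriv \<sigma> e (Suc k) x"
proof -
  let ?f = "iter_deriv (replicate k (0, e)) (\<lambda>(x, \<xi>). \<sigma> x \<xi>)"
  have "set (replicate k (0, e)) \<subseteq> (Basis :: ((real^'n) \<times> (real^'n^'m)) set)"
    using e by (auto simp: Basis_prod_def set_replicate_conv_if)
  then have "?f differentiable_on UNIV" using s unfolding smooth_def by blast
  then have d: "(?f has_derivative frechet_derivative ?f (at z)) (at z)" for z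
    unfolding differentiable_on_def using frechet_derivative_works by blast
  let ?D = "\<lambda>\<xi> u. frechet_derivative ?f (at (x, \<xi>)) (0, u)"
  have 1: "(freq_deriv \<sigma> e k x has_derivative ?D \<xi>) (at \<xi>)" for \<xi>
  proof -
    have "((\<lambda>\<xi>. (x, \<xi>)) has_derivative (\<lambda>u. (0, u))) (at \<xi>)"
      by (auto intro!: derivative_eq_intros)
    from diff_chain_at[OF this d] show ?thesis by (simp add: o_def freq_deriv_def[abs_def])
  qed
  have 2: "(\<lambda>\<xi>. ?D \<xi> e) = freq_deriv \<sigma> e (Suc k) x"
    by (auto simp: freq_deriv_def iter_deriv_def dir_deriv_def)
  show ?thesis by (rule that[OF 1 2])
qed

lemma freq_deriv_continuous:
  assumes "smooth (\<lambda>(x, \<xi>). \<sigma> x \<xi>)" "e \<in> Basis" shows "continuous_on UNIV (freq_deriv \<sigma> e k x)"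
  using smooth_slice[OF assms] by (metis continuous_at_imp_continuous_on has_derivative_continuous)

lemma freq_deriv_bound:
  assumes "\<sigma> \<in> symbol_class r \<rho> \<delta>" "e \<in> Basis"
  shows "\<exists>C\<ge>0. \<forall>x \<xi>. norm (freq_deriv \<sigma> e k x \<xi>) \<le> C * bracket \<xi> powr (r - \<rho> * real k)"
proof -
  obtain j i where e: "e = axis j (axis i 1)" using assms(2) by (auto simp: Basis_vec_def)
  obtain C where C: "\<And>x \<xi>. norm (freq_deriv \<sigma> e k x \<xi>) \<le> C * bracket \<xi> powr (r - \<rho> * real k)"
    using assms(1)[unfolded symbol_class_def, simplified, THEN conjunct2, rule_format, of "[]" "replicate k (j, i)"]
    by (auto simp: freq_deriv_def e bracket_def)
  have "norm (freq_deriv \<sigma> e k x \<xi>) \<le> max C 0 * bracket \<xi> powr (r - \<rho> * real k)" for x \<xi>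
    using C[of x \<xi>] by (rule order_trans) (simp add: mult_right_mono)
  then show ?thesis by (intro exI[of _ "max C 0"]) auto
qed

lemma freq_deriv_osc:
  assumes s: "smooth (\<lambda>(x, \<xi>). \<sigma> x \<xi>)" and e: "e \<in> Basis"
    and osc: "has_osc_inverse_fourier (\<sigma> x) y (K x y)"
  shows "has_osc_inverse_fourier (freq_deriv \<sigma> e k x) y ((- (2 * of_real pi * \<i> * of_real (y \<bullet> e))) ^ k * K x y)"
proof (induction k)
  case 0
  have "freq_deriv \<sigma> e 0 x = \<sigma> x" by (auto simp: freq_deriv_def iter_deriv_def)
  then show ?case using osc by simp
next
  case (Suc k)
  obtain D where D: "\<And>\<xi>. (freq_deriv \<sigma> e k x has_derivative D \<xi>) (at \<xi>)"
    "(\<lambda>\<xi>. D \<xi> e) = freq_deriv \<sigma> e (Suc k) x" using smooth_slice[OF s e] by blast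
  have "continuous_on UNIV (\<lambda>\<xi>. D \<xi> e)" unfolding D(2) by (rule freq_deriv_continuous[OF s e])
  from has_osc_deriv[OF Suc D(1) this e] show ?case by (simp only: D(2) power_Suc mult.assoc)
qed

lemma freq_deriv_integrable:
  assumes "\<sigma> \<in> symbol_class r \<rho> \<delta>" "e \<in> Basis" "r - \<rho> * real k < - real (CARD('m) * CARD('n))"
  shows "integrable lborel (freq_deriv \<sigma> e k (x::real^'n) :: real^'n^'m \<Rightarrow> complex)"
proof -
  obtain C where C: "C \<ge> 0" "\<And>x \<xi>. norm (freq_deriv \<sigma> e k x \<xi>) \<le> C * bracket \<xi> powr (r - \<rho> * real k)"
    using freq_deriv_bound[OF assms(1,2)] by blast
  have s: "smooth (\<lambda>(x, \<xi>). \<sigma> x \<xi>)" using assms by (simp add: symbol_class_def)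
  have i: "integrable lborel (\<lambda>\<xi>::real^'n^'m. C * bracket \<xi> powr (r - \<rho> * real k))"
    using integrable_bracket[OF assms(3)] by (rule integrable_mult_right)
  show ?thesis
    by (rule Bochner_Integration.integrable_bound[OF i])
       (use C freq_deriv_continuous[OF s assms(2)] in \<open>auto simp: borel_measurable_continuous_onI\<close>)
qed

text \<open>
  Interpolates between \<open>|e\<^bsup>it\<^esup> - 1| \<le> |t|\<close> and \<open>|e\<^bsup>it\<^esup> - 1| \<le> 2\<close>.
\<close>

lemma norm_wave_diff:
  assumes "0 \<le> \<kappa>" "\<kappa> \<le> 1"
  shows "norm (wave y \<xi> - 1) \<le> 2 * \<bar>2 * pi * (y \<bullet> \<xi>)\<bar> powr \<kappa>"
proof (cases "y \<bullet> \<xi> = 0")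
  case False
  let ?t = "2 * pi * (y \<bullet> \<xi>)"
  have t: "\<bar>?t\<bar> > 0" using False by simp
  have w: "wave y \<xi> = exp (\<i> * of_real ?t)" by (simp add: ac_simps)
  have n: "norm (wave y \<xi> - 1) = 2 * \<bar>sin (?t / 2)\<bar>" unfolding w by (rule dist_exp_i_1)
  show ?thesis
  proof (cases "\<bar>?t\<bar> \<le> 1")
    case True
    have "2 * \<bar>sin (?t / 2)\<bar> \<le> \<bar>?t\<bar>" using abs_sin_x_le_abs_x[of "?t / 2"] by linarith
    also have "\<dots> = \<bar>?t\<bar> powr 1" using t by simp
    also have "\<dots> \<le> \<bar>?t\<bar> powr \<kappa>" using t True assms by (intro powr_mono') auto
    finally show ?thesis unfolding n using powr_ge_zero[of "\<bar>?t\<bar>" \<kappa>] by linarith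
  next
    case F: False
    have "2 * \<bar>sin (?t / 2)\<bar> \<le> 2" by (simp add: abs_le_iff)
    moreover have "1 \<le> \<bar>?t\<bar> powr \<kappa>" using F assms by (intro ge_one_powr_ge_zero) auto
    ultimately show ?thesis unfolding n by linarith
  qed
qed simp

text \<open>
  Let \<open>d = mn\<close> and let \<open>e\<close> be a coordinate direction in which \<open>|y\<^sub>e|\<close> is maximal. Integration by parts in
  direction \<open>e\<close> expresses \<open>y\<^sub>e\<^sup>d K(x,y)\<close> by the Fourier integral of the \<open>d\<close>-th derivative of the symbol. The
  condition on the order makes this derivative integrable even after multiplication by \<open>|\<xi>|\<^sup>\<kappa>\<close>. Its
  integral is zero, so \<open>e\<^bsup>2\<pi>iy\<cdot>\<xi>\<^esup>\<close> may be replaced by \<open>e\<^bsup>2\<pi>iy\<cdot>\<xi>\<^esup> - 1\<close>, which gives the factor \<open>|y|\<^sup>\<kappa>\<close>. One more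
  derivative gives a gain of \<open>1/|y|\<close>, more than enough for large \<open>|y|\<close>.
\<close>

lemma kernel_decay:
  fixes \<sigma> :: "real^'n \<Rightarrow> real^'n^'m \<Rightarrow> complex"
  assumes sym: "\<sigma> \<in> symbol_class r \<rho> \<delta>" and rho: "0 \<le> \<rho>" "\<rho> \<le> 1"
    and r: "r < real (CARD('m) * CARD('n)) * (\<rho> - 1)"
    and osc: "\<And>x y. y \<noteq> 0 \<Longrightarrow> has_osc_inverse_fourier (\<sigma> x) y (K x y)"
  shows "\<exists>C \<kappa>. 0 < \<kappa> \<and> 0 \<le> C \<and> (\<forall>x y. y \<noteq> 0 \<longrightarrow>
     norm (K x y) * infnorm y ^ (CARD('m) * CARD('n)) \<le> C * infnorm y powr \<kappa> \<and>
     norm (K x y) * infnorm y ^ (CARD('m) * CARD('n)) \<le> C * infnorm y powr - \<kappa>)"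
proof -
  let ?d = "CARD('m) * CARD('n)"
  have d1: "?d \<ge> 1" by (simp add: Suc_leI)
  have s: "smooth (\<lambda>(x, \<xi>). \<sigma> x \<xi>)" using sym by (simp add: symbol_class_def)
  \<comment> \<open>half of the gap in the condition on the order, so that the other half keeps the integrals finite\<close>
  define \<kappa> where "\<kappa> = min 1 ((real ?d * (\<rho> - 1) - r) / 2)"
  have k: "0 < \<kappa>" "\<kappa> \<le> 1" "r - \<rho> * real ?d + \<kappa> < - real ?d"
    using r by (auto simp: \<kappa>_def min_def field_simps)
  have ex1: "r - \<rho> * real ?d < - real ?d" using k by linarith
  have ex2: "r - \<rho> * real (Suc ?d) < - real ?d" using ex1 rho by (simp add: algebra_simps)
  have intk: "integrable lborel (\<lambda>\<xi>::real^'n^'m. bracket \<xi> powr (r - \<rho> * real ?d + \<kappa>))"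
    using k by (intro integrable_bracket)
  have int1: "integrable lborel (\<lambda>\<xi>::real^'n^'m. bracket \<xi> powr (r - \<rho> * real ?d))"
    using ex1 by (intro integrable_bracket)
  have int2: "integrable lborel (\<lambda>\<xi>::real^'n^'m. bracket \<xi> powr (r - \<rho> * real (Suc ?d)))"
    using ex2 by (intro integrable_bracket)
  have step: "\<exists>C\<ge>0. \<forall>x y. y \<noteq> 0 \<longrightarrow> \<bar>y \<bullet> e\<bar> = infnorm y \<longrightarrow>
     norm (K x y) * infnorm y ^ ?d \<le> C * infnorm y powr \<kappa> \<and>
     norm (K x y) * infnorm y ^ Suc ?d \<le> C" if e: "e \<in> Basis" for e
  proof -
    obtain C0 where C0: "C0 \<ge> 0" "\<And>x \<xi>. norm (freq_deriv \<sigma> e (?d - 1) x \<xi>) \<le> C0 * bracket \<xi> powr (r - \<rho> * real (?d - 1))"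
      using freq_deriv_bound[OF sym e] by blast
    obtain C1 where C1: "C1 \<ge> 0" "\<And>x \<xi>. norm (freq_deriv \<sigma> e ?d x \<xi>) \<le> C1 * bracket \<xi> powr (r - \<rho> * real ?d)"
      using freq_deriv_bound[OF sym e] by blast
    obtain C2 where C2: "C2 \<ge> 0" "\<And>x \<xi>. norm (freq_deriv \<sigma> e (Suc ?d) x \<xi>) \<le> C2 * bracket \<xi> powr (r - \<rho> * real (Suc ?d))"
      using freq_deriv_bound[OF sym e] by blast
    define I1 where "I1 = (LINT \<xi>|lborel. bracket (\<xi>::real^'n^'m) powr (r - \<rho> * real ?d + \<kappa>))"
    define I2 where "I2 = (LINT \<xi>|lborel. bracket (\<xi>::real^'n^'m) powr (r - \<rho> * real (Suc ?d)))"
    define A where "A = (2 * pi * sqrt (real ?d)) powr \<kappa>"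
    have I: "I1 \<ge> 0" "I2 \<ge> 0" "A \<ge> 0" unfolding I1_def I2_def A_def by (auto intro!: integral_nonneg_AE)
    have zero: "(LINT \<xi>|lborel. freq_deriv \<sigma> e ?d x \<xi>) = 0" for x
    proof -
      obtain D where D: "\<And>\<xi>. (freq_deriv \<sigma> e (?d - 1) x has_derivative D \<xi>) (at \<xi>)"
        "(\<lambda>\<xi>. D \<xi> e) = freq_deriv \<sigma> e (Suc (?d - 1)) x" using smooth_slice[OF s e] by blast
      have Dd: "(\<lambda>\<xi>. D \<xi> e) = freq_deriv \<sigma> e ?d x" using D(2) d1 by simp
      have "(LINT \<xi>|lborel. D \<xi> e) = 0"
      proof (rule integral_deriv_eq_0_decay[OF D(1) _ e])
        show "continuous_on UNIV (\<lambda>x. D x e)" unfolding Dd by (rule freq_deriv_continuous[OF s e])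
        show "integrable lborel (\<lambda>x. D x e)" unfolding Dd by (rule freq_deriv_integrable[OF sym e ex1])
        show "integrable lborel (\<lambda>\<xi>::real^'n^'m. C0 * real CARD('m) * bracket \<xi> powr (r - \<rho> * real ?d))"
          using int1 by simp
        fix \<xi> :: "real^'n^'m"
        have "bracket \<xi> powr (r - \<rho> * real (?d - 1)) = bracket \<xi> powr (r - \<rho> * real ?d) * bracket \<xi> powr \<rho>"
          using d1 by (simp add: powr_add[symmetric] of_nat_diff algebra_simps)
        also have "\<dots> \<le> bracket \<xi> powr (r - \<rho> * real ?d) * bracket \<xi> powr 1"
          using rho bracket_ge_1[of \<xi>] by (intro mult_left_mono powr_mono) auto
        also have "\<dots> = bracket \<xi> powr (r - \<rho> * real ?d) * bracket \<xi>" using bracket_ge_1[of \<xi>] by simp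
        also have "\<dots> \<le> bracket \<xi> powr (r - \<rho> * real ?d) * (real CARD('m) * (1 + norm \<xi>))"
          by (intro mult_left_mono bracket_le) auto
        finally have "C0 * bracket \<xi> powr (r - \<rho> * real (?d - 1)) \<le> C0 * (bracket \<xi> powr (r - \<rho> * real ?d) * (real CARD('m) * (1 + norm \<xi>)))"
          using C0(1) by (rule mult_left_mono)
        with C0(2)[of x \<xi>] show "norm (freq_deriv \<sigma> e (?d - 1) x \<xi>) \<le> (1 + norm \<xi>) * (C0 * real CARD('m) * bracket \<xi> powr (r - \<rho> * real ?d))"
          by (simp add: algebra_simps)
      qed
      then show ?thesis using Dd by (metis (no_types, lifting) Bochner_Integration.integral_cong)
    qed
    have main: "norm (K x y) * infnorm y ^ ?d \<le> (2 * A * C1 * I1 + C2 * I2) * infnorm y powr \<kappa> \<and>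
     norm (K x y) * infnorm y ^ Suc ?d \<le> 2 * A * C1 * I1 + C2 * I2" if y: "y \<noteq> 0" and ye: "\<bar>y \<bullet> e\<bar> = infnorm y" for x y
    proof -
      have yp: "infnorm y > 0" using y by (simp add: infnorm_pos_lt)
      have est: "norm (K x y) * infnorm y ^ k \<le> norm ((- (2 * of_real pi * \<i> * of_real (y \<bullet> e))) ^ k * K x y)" for k
      proof -
        have "infnorm y ^ k \<le> (2 * pi * infnorm y) ^ k"
          using yp pi_ge_two by (intro power_mono) auto
        then have "norm (K x y) * infnorm y ^ k \<le> norm (K x y) * (2 * pi * infnorm y) ^ k"
          by (intro mult_left_mono) auto
        also have "\<dots> = norm ((- (2 * of_real pi * \<i> * of_real (y \<bullet> e))) ^ k * K x y)"
          by (simp add: norm_mult norm_power ye)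
        finally show ?thesis .
      qed
      have c: "continuous_on UNIV (freq_deriv \<sigma> e k x)" for k by (rule freq_deriv_continuous[OF s e])
      have i1: "integrable lborel (freq_deriv \<sigma> e ?d x)" by (rule freq_deriv_integrable[OF sym e ex1])
      have i2: "integrable lborel (freq_deriv \<sigma> e (Suc ?d) x)" by (rule freq_deriv_integrable[OF sym e ex2])
      have iw: "integrable lborel (\<lambda>\<xi>. freq_deriv \<sigma> e ?d x \<xi> * wave y \<xi>)"
        by (rule Bochner_Integration.integrable_bound[OF i1])
           (use c in \<open>auto simp: norm_mult intro!: borel_measurable_continuous_onI continuous_intros\<close>)
      have "(- (2 * of_real pi * \<i> * of_real (y \<bullet> e))) ^ ?d * K x y = (LINT \<xi>|lborel. freq_deriv \<sigma> e ?d x \<xi> * wave y \<xi>)"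
        by (rule has_osc_integrable[OF freq_deriv_osc[where \<sigma> = \<sigma> and K = K, OF s e osc[OF y]] c i1])
      also have "\<dots> = (LINT \<xi>|lborel. freq_deriv \<sigma> e ?d x \<xi> * (wave y \<xi> - 1))"
        using zero[of x] iw i1 by (simp add: algebra_simps)
      finally have eq1: "(- (2 * of_real pi * \<i> * of_real (y \<bullet> e))) ^ ?d * K x y = (LINT \<xi>|lborel. freq_deriv \<sigma> e ?d x \<xi> * (wave y \<xi> - 1))" .
      have "norm ((- (2 * of_real pi * \<i> * of_real (y \<bullet> e))) ^ ?d * K x y) \<le>
           (LINT \<xi>|lborel. C1 * (2 * (A * infnorm y powr \<kappa>)) * bracket (\<xi>::real^'n^'m) powr (r - \<rho> * real ?d + \<kappa>))"
        unfolding eq1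
      proof (rule Bochner_Integration.integral_norm_bound_integral)
        show "integrable lborel (\<lambda>\<xi>. freq_deriv \<sigma> e ?d x \<xi> * (wave y \<xi> - 1))"
          using iw i1 by (simp add: right_diff_distrib)
        show "integrable lborel (\<lambda>\<xi>::real^'n^'m. C1 * (2 * (A * infnorm y powr \<kappa>)) * bracket \<xi> powr (r - \<rho> * real ?d + \<kappa>))"
          using intk by simp
        fix \<xi> :: "real^'n^'m"
        have "\<bar>y \<bullet> \<xi>\<bar> \<le> norm y * norm \<xi>" by (rule Cauchy_Schwarz_ineq2)
        also have "\<dots> \<le> (sqrt (real ?d) * infnorm y) * bracket \<xi>"
          using norm_le_infnorm[of y] bracket_ge[of \<xi>] by (intro mult_mono) (auto simp: DIM_cart infnorm_pos_le)
        finally have "\<bar>2 * pi * (y \<bullet> \<xi>)\<bar> powr \<kappa> \<le> ((2 * pi * sqrt (real ?d)) * infnorm y * bracket \<xi>) powr \<kappa>"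
          using k by (intro powr_mono2) (auto simp: abs_mult)
        also have "\<dots> = A * infnorm y powr \<kappa> * bracket \<xi> powr \<kappa>"
          using yp bracket_ge_1[of \<xi>] by (simp add: A_def powr_mult)
        finally have "norm (wave y \<xi> - 1) \<le> 2 * (A * infnorm y powr \<kappa> * bracket \<xi> powr \<kappa>)"
          using norm_wave_diff[of \<kappa> y \<xi>] k by linarith
        then have "norm (freq_deriv \<sigma> e ?d x \<xi> * (wave y \<xi> - 1)) \<le>
            (C1 * bracket \<xi> powr (r - \<rho> * real ?d)) * (2 * (A * infnorm y powr \<kappa> * bracket \<xi> powr \<kappa>))"
          unfolding norm_mult using C1 by (intro mult_mono) auto
        then show "norm (freq_deriv \<sigma> e ?d x \<xi> * (wave y \<xi> - 1)) \<le>
            C1 * (2 * (A * infnorm y powr \<kappa>)) * bracket \<xi> powr (r - \<rho> * real ?d + \<kappa>)"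
          by (simp only: powr_add mult.assoc mult.left_commute mult.commute)
      qed
      then have "norm (K x y) * infnorm y ^ ?d \<le> 2 * A * C1 * I1 * infnorm y powr \<kappa>"
        using est[of ?d] by (simp add: I1_def algebra_simps)
      also have "\<dots> \<le> (2 * A * C1 * I1 + C2 * I2) * infnorm y powr \<kappa>"
        using C2 I by (intro mult_right_mono) auto
      finally have R1: "norm (K x y) * infnorm y ^ ?d \<le> (2 * A * C1 * I1 + C2 * I2) * infnorm y powr \<kappa>" .
      have eq2: "(- (2 * of_real pi * \<i> * of_real (y \<bullet> e))) ^ (Suc ?d) * K x y = (LINT \<xi>|lborel. freq_deriv \<sigma> e (Suc ?d) x \<xi> * wave y \<xi>)"
        by (rule has_osc_integrable[OF freq_deriv_osc[where \<sigma> = \<sigma> and K = K, OF s e osc[OF y]] c i2])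
      have "norm ((- (2 * of_real pi * \<i> * of_real (y \<bullet> e))) ^ (Suc ?d) * K x y) \<le>
         (LINT \<xi>|lborel. C2 * bracket (\<xi>::real^'n^'m) powr (r - \<rho> * real (Suc ?d)))"
        unfolding eq2
      proof (rule Bochner_Integration.integral_norm_bound_integral)
        show "integrable lborel (\<lambda>\<xi>. freq_deriv \<sigma> e (Suc ?d) x \<xi> * wave y \<xi>)"
          by (rule Bochner_Integration.integrable_bound[OF i2])
             (use c in \<open>auto simp: norm_mult intro!: borel_measurable_continuous_onI continuous_intros\<close>)
        show "integrable lborel (\<lambda>\<xi>::real^'n^'m. C2 * bracket \<xi> powr (r - \<rho> * real (Suc ?d)))"
          using int2 by (intro integrable_mult_right)
        show "norm (freq_deriv \<sigma> e (Suc ?d) x \<xi> * wave y \<xi>) \<le> C2 * bracket \<xi> powr (r - \<rho> * real (Suc ?d))" for \<xi>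
          unfolding norm_mult norm_wave using C2(2)[of x \<xi>] by simp
      qed
      then have "norm (K x y) * infnorm y ^ Suc ?d \<le> C2 * I2"
        using est[of "Suc ?d"] unfolding I2_def by (simp only: integral_mult_right_zero)
      also have "\<dots> \<le> 2 * A * C1 * I1 + C2 * I2" using C1 I by auto
      finally have R2: "norm (K x y) * infnorm y ^ Suc ?d \<le> 2 * A * C1 * I1 + C2 * I2" .
      show ?thesis using R1 R2 by blast
    qed
    have "2 * A * C1 * I1 + C2 * I2 \<ge> 0" using C1 C2 I by auto
    then show ?thesis using main by blast
  qed
  then obtain c where c: "\<And>e. e \<in> Basis \<Longrightarrow> c e \<ge> 0" "\<And>e x y. e \<in> Basis \<Longrightarrow> y \<noteq> 0 \<Longrightarrow> \<bar>y \<bullet> e\<bar> = infnorm y \<Longrightarrow>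
     norm (K x y) * infnorm y ^ ?d \<le> c e * infnorm y powr \<kappa> \<and> norm (K x y) * infnorm y ^ Suc ?d \<le> c e"
    by metis
  define C where "C = (\<Sum>e\<in>(Basis::(real^'n^'m) set). c e)"
  have C0: "C \<ge> 0" unfolding C_def by (intro sum_nonneg c)
  have Ce: "c e \<le> C" if "e \<in> Basis" for e
    unfolding C_def using that c(1) by (intro member_le_sum) auto
  have "norm (K x y) * infnorm y ^ ?d \<le> C * infnorm y powr \<kappa> \<and>
     norm (K x y) * infnorm y ^ ?d \<le> C * infnorm y powr - \<kappa>" if y: "y \<noteq> 0" for x y
  proof -
    have yp: "infnorm y > 0" using y by (simp add: infnorm_pos_lt)
    have "infnorm y \<in> (\<lambda>i. \<bar>y \<bullet> i\<bar>) ` Basis" unfolding infnorm_Max by (intro Max_in) auto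
    then obtain e where e: "e \<in> Basis" "\<bar>y \<bullet> e\<bar> = infnorm y" by auto
    have R1: "norm (K x y) * infnorm y ^ ?d \<le> C * infnorm y powr \<kappa>"
      using c(2)[OF e(1) y e(2), of x] Ce[OF e(1)] by (meson mult_right_mono order_trans powr_ge_zero)
    have R2: "norm (K x y) * infnorm y ^ Suc ?d \<le> C"
      using c(2)[OF e(1) y e(2), of x] Ce[OF e(1)] by linarith
    have "norm (K x y) * infnorm y ^ ?d \<le> C * infnorm y powr - \<kappa>"
    proof (cases "infnorm y \<le> 1")
      case True
      have "infnorm y powr \<kappa> \<le> infnorm y powr - \<kappa>" using True yp k by (intro powr_mono') auto
      then show ?thesis using R1 C0 by (meson mult_left_mono order_trans)
    next
      case False
      have "norm (K x y) * infnorm y ^ ?d = (norm (K x y) * infnorm y ^ Suc ?d) * infnorm y powr - 1"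
        using yp by (simp add: powr_minus field_simps)
      also have "\<dots> \<le> C * infnorm y powr - \<kappa>"
        using R2 False k C0 by (intro mult_mono powr_mono) auto
      finally show ?thesis .
    qed
    with R1 show ?thesis by blast
  qed
  then show ?thesis using k C0 by blast
qed

section \<open>Domination by dyadic averages\<close>

lemma prod_mono_ennreal: "(\<And>i. i \<in> I \<Longrightarrow> f i \<le> g i) \<Longrightarrow> (\<Prod>i\<in>I. f i) \<le> (\<Prod>i\<in>I. g i :: ennreal)"
  by (induction I rule: infinite_finite_induct) (auto intro!: mult_mono)

text \<open>
  All radii \<open>2\<^sup>l\<close> with integer \<open>l\<close>, enumerated by natural numbers so that the series below are ordinary
  ones. As \<open>j \<le> 2|l|\<close> when \<open>j\<close> encodes \<open>l\<close>, a weight \<open>\<beta>\<^sup>j\<close> is at least \<open>\<beta>\<^bsup>2|l|\<^esup>\<close>.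
\<close>

definition rad :: "nat \<Rightarrow> real" where "rad j = 2 powr (of_int (int_decode j))"

lemma rad_pos [simp]: "0 < rad j" "0 \<le> rad j" by (simp_all add: rad_def)

lemma le_int_decode: "real j \<le> 2 * \<bar>of_int (int_decode j)\<bar>"
proof -
  obtain i where j: "j = int_encode i" by (metis int_decode_inverse)
  have "real (int_encode i) \<le> 2 * \<bar>of_int i\<bar>"
    by (auto simp: int_encode_def sum_encode_def)
  then show ?thesis by (simp add: j)
qed

text \<open>
  For suitable \<open>\<beta>\<close>, up to a constant, an integrable majorant of \<open>|z|\<^bsup>-n\<^esup> min(|z|\<^sup>\<kappa>, |z|\<^bsup>-\<kappa>\<^esup>)\<close>. It is a superposition of
  cubes so that convolution with it is a superposition of averages over cubes.
\<close>

definition dyadic_kernel :: "real \<Rightarrow> 'a::euclidean_space \<Rightarrow> ennreal"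
  where "dyadic_kernel \<beta> z = (\<Sum>j. ennreal (\<beta> ^ j / rad j ^ DIM('a)) * indicator (cube 0 (rad j)) z)"

definition dyadic_op :: "real \<Rightarrow> ('a::euclidean_space \<Rightarrow> ennreal) \<Rightarrow> 'a \<Rightarrow> ennreal"
  where "dyadic_op \<beta> f x = (\<integral>\<^sup>+y. dyadic_kernel \<beta> (x - y) * f y \<partial>lborel)"

lemma dyadic_kernel_measurable [measurable]: "dyadic_kernel \<beta> \<in> borel_measurable borel"
  unfolding dyadic_kernel_def[abs_def] by measurable

lemma indicator_cube_diff: "indicator (cube 0 R) (x - y) = (indicator (cube x R) y :: ennreal)"
  by (simp add: indicator_def mem_cube infnorm_sub)

lemma dyadic_op_sum:
  assumes [measurable]: "f \<in> borel_measurable borel"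
  shows "dyadic_op \<beta> f x = (\<Sum>j. ennreal (\<beta> ^ j / rad j ^ DIM('a)) * (\<integral>\<^sup>+y. f y * indicator (cube (x::'a::euclidean_space) (rad j)) y \<partial>lborel))"
proof -
  have "dyadic_op \<beta> f x = (\<integral>\<^sup>+y. (\<Sum>j. ennreal (\<beta> ^ j / rad j ^ DIM('a)) * (f y * indicator (cube x (rad j)) y)) \<partial>lborel)"
    unfolding dyadic_op_def dyadic_kernel_def indicator_cube_diff
    by (simp add: ennreal_suminf_multc[symmetric] ac_simps)
  also have "\<dots> = (\<Sum>j. \<integral>\<^sup>+y. ennreal (\<beta> ^ j / rad j ^ DIM('a)) * (f y * indicator (cube x (rad j)) y) \<partial>lborel)"
    by (rule nn_integral_suminf) measurable
  also have "\<dots> = (\<Sum>j. ennreal (\<beta> ^ j / rad j ^ DIM('a)) * (\<integral>\<^sup>+y. f y * indicator (cube x (rad j)) y \<partial>lborel))"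
    by (intro arg_cong[where f = suminf] ext nn_integral_cmult) measurable
  finally show ?thesis .
qed

lemma dyadic_op_mono_AE:
  assumes "AE y in lborel. f y \<le> g y" shows "dyadic_op \<beta> f x \<le> dyadic_op \<beta> g x"
  unfolding dyadic_op_def using assms by (intro nn_integral_mono_AE) (auto elim!: eventually_mono intro: mult_left_mono)

lemma dyadic_op_measurable [measurable]:
  assumes [measurable]: "f \<in> borel_measurable borel"
  shows "dyadic_op \<beta> f \<in> borel_measurable borel"
proof -
  have [measurable]: "(\<lambda>p::'a \<times> 'a. fst p - snd p) \<in> borel_measurable (borel \<Otimes>\<^sub>M lborel)" by simp
  show ?thesis unfolding dyadic_op_def[abs_def] by measurable
qed

lemma dyadic_op_add:
  assumes [measurable]: "f \<in> borel_measurable borel" "g \<in> borel_measurable borel"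
  shows "dyadic_op \<beta> (\<lambda>y. f y + g y) x = dyadic_op \<beta> f x + dyadic_op \<beta> g x"
  unfolding dyadic_op_def distrib_left by (rule nn_integral_add) measurable

lemma dyadic_op_cmult:
  assumes [measurable]: "f \<in> borel_measurable borel"
  shows "dyadic_op \<beta> (\<lambda>y. c * f y) x = c * dyadic_op \<beta> f x"
  unfolding dyadic_op_def mult.left_commute[of _ c] by (rule nn_integral_cmult) measurable

lemma dyadic_op_suminf:
  assumes [measurable]: "\<And>k. F k \<in> borel_measurable borel"
  shows "dyadic_op \<beta> (\<lambda>y. \<Sum>k. F k y) x = (\<Sum>k. dyadic_op \<beta> (F k) x)"
  unfolding dyadic_op_def ennreal_suminf_cmult[symmetric] by (rule nn_integral_suminf) measurable

text \<open>
  The integral of \<open>dyadic_kernel \<beta>\<close>: each normalised cube contributes \<open>2\<^sup>n \<beta>\<^sup>j\<close>.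
\<close>

definition dyadic_mass :: "real \<Rightarrow> 'a::euclidean_space itself \<Rightarrow> real"
  where "dyadic_mass \<beta> _ = 2 ^ DIM('a) / (1 - \<beta>)"

lemma nn_integral_dyadic_kernel:
  assumes "0 < \<beta>" "\<beta> < 1"
  shows "(\<integral>\<^sup>+z. dyadic_kernel \<beta> (z::'a::euclidean_space) \<partial>lborel) = ennreal (dyadic_mass \<beta> TYPE('a))"
proof -
  have "(\<integral>\<^sup>+z. dyadic_kernel \<beta> (z::'a) \<partial>lborel) = (\<Sum>j. ennreal (\<beta> ^ j / rad j ^ DIM('a)) * ennreal ((2 * rad j) ^ DIM('a)))"
    unfolding dyadic_kernel_def by (subst nn_integral_suminf) (auto simp: nn_integral_cmult_indicator emeasure_cube)
  also have "\<dots> = (\<Sum>j. ennreal (2 ^ DIM('a) * \<beta> ^ j))"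
  proof (intro arg_cong[where f = suminf] ext)
    fix j
    have "ennreal (\<beta> ^ j / rad j ^ DIM('a)) * ennreal ((2 * rad j) ^ DIM('a)) =
       ennreal (\<beta> ^ j / rad j ^ DIM('a) * (2 * rad j) ^ DIM('a))"
      using assms rad_pos(1)[of j] by (intro ennreal_mult[symmetric]) (auto intro: less_imp_le)
    then show "ennreal (\<beta> ^ j / rad j ^ DIM('a)) * ennreal ((2 * rad j) ^ DIM('a)) = ennreal (2 ^ DIM('a) * \<beta> ^ j)"
      using rad_pos(1)[of j] by (simp add: power_mult_distrib mult.commute)
  qed
  also have "\<dots> = ennreal (\<Sum>j. 2 ^ DIM('a) * \<beta> ^ j)"
    using assms by (intro suminf_ennreal2 summable_mult summable_geometric) auto
  also have "(\<Sum>j. 2 ^ DIM('a) * \<beta> ^ j) = dyadic_mass \<beta> TYPE('a)"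
    using assms by (subst suminf_mult) (auto simp: suminf_geometric dyadic_mass_def)
  finally show ?thesis .
qed

lemma nn_integral_lborel_reflect:
  assumes [measurable]: "(f::'a::euclidean_space \<Rightarrow> ennreal) \<in> borel_measurable borel"
  shows "(\<integral>\<^sup>+y. f (x - y) \<partial>lborel) = (\<integral>\<^sup>+y. f y \<partial>lborel)"
proof -
  have "(\<integral>\<^sup>+y. f y \<partial>lborel) = (\<integral>\<^sup>+y. f y \<partial>density (distr lborel borel (\<lambda>y. x + (-1) *\<^sub>R y)) (\<lambda>_. ennreal (\<bar>-1\<bar> ^ DIM('a))))"
    by (subst lborel_affine[of "-1" x, symmetric]) auto
  also have "\<dots> = (\<integral>\<^sup>+y. f (x - y) \<partial>lborel)"
    by (simp add: density_1 nn_integral_distr)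
  finally show ?thesis by simp
qed

lemma dyadic_op_const:
  assumes "0 < \<beta>" "\<beta> < 1"
  shows "dyadic_op \<beta> (\<lambda>_. c) (x::'a::euclidean_space) = ennreal (dyadic_mass \<beta> TYPE('a)) * c"
proof -
  have "dyadic_op \<beta> (\<lambda>_. c) x = (\<integral>\<^sup>+y. dyadic_kernel \<beta> (x - y) \<partial>lborel) * c"
    unfolding dyadic_op_def by (rule nn_integral_multc) measurable
  then show ?thesis using assms by (simp add: nn_integral_lborel_reflect nn_integral_dyadic_kernel)
qed

lemma nn_integral_dyadic_op:
  assumes "0 < \<beta>" "\<beta> < 1" and [measurable]: "f \<in> borel_measurable borel"
  shows "(\<integral>\<^sup>+x. dyadic_op \<beta> f (x::'a::euclidean_space) \<partial>lborel) = ennreal (dyadic_mass \<beta> TYPE('a)) * (\<integral>\<^sup>+x. f x \<partial>lborel)"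
proof -
  interpret pair_sigma_finite "lborel :: 'a measure" "lborel :: 'a measure" ..
  have [measurable]: "(\<lambda>p::'a \<times> 'a. fst p - snd p) \<in> borel_measurable (lborel \<Otimes>\<^sub>M lborel)" by simp
  have sym: "dyadic_kernel \<beta> (x - y) = dyadic_kernel \<beta> (y - x)" for x y :: 'a
    unfolding dyadic_kernel_def indicator_cube_diff by (simp add: indicator_def mem_cube_sym)
  have "(\<integral>\<^sup>+x. dyadic_op \<beta> f x \<partial>lborel) = (\<integral>\<^sup>+y. \<integral>\<^sup>+x. dyadic_kernel \<beta> (x - y) * f y \<partial>lborel \<partial>lborel)"
    unfolding dyadic_op_def by (rule lborel_pair.Fubini'[symmetric]) measurable
  also have "\<dots> = (\<integral>\<^sup>+y. ennreal (dyadic_mass \<beta> TYPE('a)) * f y \<partial>lborel)"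
    using assms by (intro nn_integral_cong, subst nn_integral_multc)
      (simp_all add: sym[of _ "_::'a"] nn_integral_lborel_reflect nn_integral_dyadic_kernel)
  finally show ?thesis by (simp add: nn_integral_cmult)
qed

lemma infnorm_nth_le: "infnorm ((y::real^'n^'m) $ j) \<le> infnorm y"
  unfolding infnorm_le_iff
proof
  fix b :: "real^'n" assume b: "b \<in> Basis"
  have "\<bar>y \<bullet> axis j b\<bar> \<le> infnorm y"
    using infnorm_le_iff[of y "infnorm y"] b by (auto simp: axis_in_Basis_iff)
  then show "\<bar>y $ j \<bullet> b\<bar> \<le> infnorm y" by (simp add: inner_axis)
qed

text \<open>
  Where \<open>|y|\<close> is about \<open>2\<^sup>l\<close>, the kernel is of size \<open>2\<^bsup>-lmn\<^esup> 2\<^bsup>-\<kappa>|l|\<^esup>\<close>. Split evenly into \<open>m\<close> factors, each of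
  them is one term of the series for \<open>dyadic_kernel \<beta> y\<^sub>j\<close>, because \<open>|y\<^sub>j| \<le> |y|\<close>.
\<close>

lemma kernel_dominated:
  fixes \<sigma> :: "real^'n \<Rightarrow> real^'n^'m \<Rightarrow> complex"
  assumes sym: "\<sigma> \<in> symbol_class r \<rho> \<delta>" and rho: "0 \<le> \<rho>" "\<rho> \<le> 1"
    and r: "r < real (CARD('m) * CARD('n)) * (\<rho> - 1)"
    and osc: "\<And>x y. y \<noteq> 0 \<Longrightarrow> has_osc_inverse_fourier (\<sigma> x) y (K x y)"
  shows "\<exists>C \<beta>. 0 \<le> C \<and> 0 < \<beta> \<and> \<beta> < 1 \<and> (\<forall>x y. y \<noteq> 0 \<longrightarrow>
     ennreal (norm (K x y)) \<le> ennreal C * (\<Prod>j\<in>UNIV. dyadic_kernel \<beta> (y $ j)))"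
proof -
  let ?d = "CARD('m) * CARD('n)"
  obtain C \<kappa> where k: "0 < \<kappa>" "0 \<le> C" and K1: "\<And>x y. y \<noteq> 0 \<Longrightarrow> norm (K x y) * infnorm y ^ ?d \<le> C * infnorm y powr \<kappa>"
     and K2: "\<And>x y. y \<noteq> 0 \<Longrightarrow> norm (K x y) * infnorm y ^ ?d \<le> C * infnorm y powr - \<kappa>"
    using kernel_decay[OF sym rho r osc] by blast
  \<comment> \<open>the factor 2 in the denominator pays for the enumeration of the scales by natural numbers\<close>
  define \<beta> where "\<beta> = 2 powr (- \<kappa> / (2 * real CARD('m)))"
  have m: "0 < real CARD('m)" by simp
  have b: "0 < \<beta>" "\<beta> < 1" using k m powr_less_mono[of "- \<kappa> / (2 * real CARD('m))" 0 2]
    by (auto simp: \<beta>_def)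
  have "ennreal (norm (K x y)) \<le> ennreal (C * 2 ^ ?d * 2 powr \<kappa>) * (\<Prod>j\<in>UNIV. dyadic_kernel \<beta> (y $ j))" if y: "y \<noteq> 0" for x y
  proof -
    have yp: "infnorm y > 0" using y by (simp add: infnorm_pos_lt)
    define l where "l = \<lceil>log 2 (infnorm y)\<rceil>"
    define j where "j = int_encode l"
    have rj: "rad j = 2 powr of_int l" by (simp add: rad_def j_def)
    have up: "infnorm y \<le> rad j"
    proof -
      have "infnorm y = 2 powr log 2 (infnorm y)" using yp by simp
      also have "\<dots> \<le> 2 powr of_int l" by (intro powr_mono) (auto simp: l_def)
      finally show ?thesis by (simp add: rj)
    qed
    have low: "rad j / 2 \<le> infnorm y"
    proof -
      have "2 powr (of_int l - 1) \<le> 2 powr log 2 (infnorm y)"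
        unfolding l_def by (intro powr_mono) linarith+
      then show ?thesis using yp by (simp add: rj powr_diff)
    qed
    have decay: "norm (K x y) * infnorm y ^ ?d \<le> C * (2 powr \<kappa> * 2 powr (- \<kappa> * \<bar>of_int l\<bar>))"
    proof (cases "l \<le> 0")
      case True
      have "infnorm y powr \<kappa> \<le> rad j powr \<kappa>" using up yp k by (intro powr_mono2) auto
      also have "\<dots> = 2 powr (- \<kappa> * \<bar>of_int l\<bar>)" using True by (simp add: rj powr_powr mult.commute)
      also have "\<dots> \<le> 2 powr \<kappa> * 2 powr (- \<kappa> * \<bar>of_int l\<bar>)"
        using k ge_one_powr_ge_zero[of 2 \<kappa>] by (simp add: mult_le_cancel_right1)
      finally show ?thesis using K1[OF y, of x] k by (meson mult_left_mono order_trans)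
    next
      case False
      have "infnorm y powr - \<kappa> \<le> (rad j / 2) powr - \<kappa>" using low yp k by (intro powr_mono2') auto
      also have "rad j / 2 = 2 powr (of_int l - 1)" by (simp add: rj powr_diff)
      also have "(2 powr (of_int l - 1)) powr - \<kappa> = 2 powr \<kappa> * 2 powr (- \<kappa> * \<bar>of_int l\<bar>)"
        using False by (simp add: powr_powr powr_add[symmetric] algebra_simps)
      finally show ?thesis using K2[OF y, of x] k by (meson mult_left_mono order_trans)
    qed
    have "2 powr (- \<kappa> * \<bar>of_int l\<bar>) \<le> 2 powr (- \<kappa> / 2 * real j)"
      using le_int_decode[of j] k by (intro powr_mono) (auto simp: j_def)
    also have "\<dots> = (\<beta> ^ j) ^ CARD('m)"
      by (simp add: \<beta>_def powr_realpow[symmetric] powr_powr)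
    finally have g: "2 powr (- \<kappa> * \<bar>of_int l\<bar>) \<le> (\<beta> ^ j) ^ CARD('m)" .
    have "norm (K x y) * (rad j / 2) ^ ?d \<le> norm (K x y) * infnorm y ^ ?d"
      using low rad_pos(2)[of j] by (intro mult_left_mono power_mono) simp_all
    also note decay
    also have "C * (2 powr \<kappa> * 2 powr (- \<kappa> * \<bar>of_int l\<bar>)) \<le> C * (2 powr \<kappa> * (\<beta> ^ j) ^ CARD('m))"
      using g k by (intro mult_left_mono) auto
    finally have "norm (K x y) \<le> C * 2 ^ ?d * 2 powr \<kappa> * ((\<beta> ^ j) ^ CARD('m) / rad j ^ ?d)"
      using rad_pos(1)[of j] by (simp add: power_divide field_simps)
    also have "(\<beta> ^ j) ^ CARD('m) / rad j ^ ?d = (\<Prod>i\<in>(UNIV::'m set). \<beta> ^ j / rad j ^ CARD('n))"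
      by (simp add: power_divide power_mult[symmetric] mult.commute)
    finally have "ennreal (norm (K x y)) \<le> ennreal (C * 2 ^ ?d * 2 powr \<kappa>) * ennreal (\<Prod>i\<in>(UNIV::'m set). \<beta> ^ j / rad j ^ CARD('n))"
      using k by (subst ennreal_mult'[symmetric]) (auto intro: ennreal_leI)
    also have "ennreal (\<Prod>i\<in>(UNIV::'m set). \<beta> ^ j / rad j ^ CARD('n)) = (\<Prod>i\<in>(UNIV::'m set). ennreal (\<beta> ^ j / rad j ^ CARD('n)))"
      using b rad_pos(1)[of j] by (intro prod_ennreal[symmetric]) (auto intro: less_imp_le)
    also have "\<dots> \<le> (\<Prod>i\<in>UNIV. dyadic_kernel \<beta> (y $ i))"
    proof (intro prod_mono_ennreal)
      fix i :: 'm
      have "y $ i \<in> cube 0 (rad j)"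
        using up infnorm_nth_le[of y i] by (simp add: mem_cube infnorm_neg)
      then have "ennreal (\<beta> ^ j / rad j ^ CARD('n)) = ennreal (\<beta> ^ j / rad j ^ DIM(real^'n)) * indicator (cube 0 (rad j)) (y $ i)"
        by simp
      also have "\<dots> \<le> dyadic_kernel \<beta> (y $ i)"
        unfolding dyadic_kernel_def by (rule ennreal_le_suminf)
      finally show "ennreal (\<beta> ^ j / rad j ^ CARD('n)) \<le> dyadic_kernel \<beta> (y $ i)" .
    qed
    finally show ?thesis by (simp add: mult_left_mono)
  qed
  moreover have "0 \<le> C * 2 ^ ?d * 2 powr \<kappa>" using k by simp
  ultimately show ?thesis using b by blast
qed

text \<open>
  The kernel is a pointwise limit of integrals of jointly continuous functions over one variable. At \<open>y = 0\<close>, where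
  the oscillatory integral may diverge, it is replaced by \<open>0\<close>.
\<close>

lemma kernel_measurable:
  fixes \<sigma> :: "real^'n \<Rightarrow> real^'n^'m \<Rightarrow> complex"
  assumes s: "smooth (\<lambda>(x, \<xi>). \<sigma> x \<xi>)"
    and osc: "\<And>x y. y \<noteq> 0 \<Longrightarrow> has_osc_inverse_fourier (\<sigma> x) y (K x y)"
  shows "(\<lambda>p. if snd p = 0 then 0 else K (fst p) (snd p)) \<in> borel_measurable (borel \<Otimes>\<^sub>M borel)"
proof -
  obtain \<theta> :: "real^'n^'m \<Rightarrow> complex" where th: "test_fun \<theta>" "\<theta> 0 = 1" using ex_test_fun_one by blast
  have ct: "continuous_on UNIV \<theta>" using th by (simp add: test_fun_def smooth_continuous)
  have cs: "continuous_on UNIV (\<lambda>p. \<sigma> (fst p) (snd p))" using smooth_continuous[OF s] by (simp add: case_prod_unfold)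
  have cx: "continuous_on UNIV (\<sigma> x)" for x
    using continuous_on_compose2[OF cs continuous_on_Pair[OF continuous_on_const continuous_on_id, of UNIV x]] by simp
  have S: "sets (((borel :: (real^'n) measure) \<Otimes>\<^sub>M (borel :: (real^'n^'m) measure)) \<Otimes>\<^sub>M (lborel :: (real^'n^'m) measure)) = sets borel"
    unfolding borel_prod using sets_pair_measure_cong[OF refl sets_lborel]
    by (metis borel_prod)
  define G where "G n p = (LINT \<xi>|lborel. \<theta> (inverse (real (Suc n)) *\<^sub>R \<xi>) * \<sigma> (fst p) \<xi> * wave (snd p) \<xi>)" for n and p :: "(real^'n) \<times> (real^'n^'m)"
  have "continuous_on UNIV (\<lambda>q::((real^'n) \<times> (real^'n^'m)) \<times> (real^'n^'m). \<theta> (inverse (real (Suc n)) *\<^sub>R snd q) * \<sigma> (fst (fst q)) (snd q) * wave (snd (fst q)) (snd q))" for n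
    by (intro continuous_intros continuous_on_compose2[OF ct] continuous_on_compose2[OF cs, of _ "\<lambda>q. (fst (fst q), snd q)", simplified]) auto
  then have "(\<lambda>q::((real^'n) \<times> (real^'n^'m)) \<times> (real^'n^'m). \<theta> (inverse (real (Suc n)) *\<^sub>R snd q) * \<sigma> (fst (fst q)) (snd q) * wave (snd (fst q)) (snd q)) \<in> borel_measurable ((borel \<Otimes>\<^sub>M borel) \<Otimes>\<^sub>M lborel)" for n
    unfolding measurable_cong_sets[OF S refl] by (rule borel_measurable_continuous_onI)
  then have G: "G n \<in> borel_measurable (borel \<Otimes>\<^sub>M borel)" for n
    unfolding G_def using lborel.borel_measurable_lebesgue_integral[of "\<lambda>p \<xi>. \<theta> (inverse (real (Suc n)) *\<^sub>R \<xi>) * \<sigma> (fst p) \<xi> * wave (snd p) \<xi>" "borel \<Otimes>\<^sub>M borel"]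
    by (simp add: case_prod_unfold)
  show ?thesis
  proof (rule borel_measurable_LIMSEQ_metric)
    show "(\<lambda>p. if snd p = 0 then 0 else G n p) \<in> borel_measurable (borel \<Otimes>\<^sub>M borel)" for n
      using G by measurable
    fix p :: "(real^'n) \<times> (real^'n^'m)"
    show "(\<lambda>n. if snd p = 0 then 0 else G n p) \<longlonglongrightarrow> (if snd p = 0 then 0 else K (fst p) (snd p))"
    proof (cases "snd p = 0")
      case False
      have "(cutoff_fourier \<theta> (\<sigma> (fst p)) (snd p) \<longlongrightarrow> K (fst p) (snd p)) (at_right 0)"
        using osc[OF False, of "fst p"] th unfolding has_osc_iff[OF cx] by blast
      from filterlim_compose[OF this filterlim_inverse_Suc_at_right] show ?thesis
        using False by (simp add: G_def cutoff_fourier_def)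
    qed simp
  qed
qed

section \<open>The absolutely convergent multilinear kernel operator\<close>

definition kernel_op :: "(real^'n \<Rightarrow> real^'n^'m \<Rightarrow> complex) \<Rightarrow> ('m::finite \<Rightarrow> real^'n \<Rightarrow> complex) \<Rightarrow> real^'n \<Rightarrow> complex"
  where "kernel_op K f x = (LINT y|lebesgue. K x (\<chi> j. x - y $ j) * (\<Prod>j\<in>UNIV. f j (y $ j)))"

lemma measurable_completion_AE_eq:
  fixes f g :: "'a \<Rightarrow> 'b::topological_space"
  assumes "g \<in> borel_measurable M" "AE x in M. f x = g x"
  shows "f \<in> borel_measurable (completion M)"
proof (rule measurableI)
  fix A :: "'b set" assume "A \<in> sets borel"
  have g: "g -` A \<inter> space M \<in> sets (completion M)"
    using measurable_sets[OF assms(1) \<open>A \<in> sets borel\<close>] by auto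
  have "AE x in completion M. (x \<in> g -` A \<inter> space M) = (x \<in> f -` A \<inter> space (completion M))"
    using assms(2) unfolding AE_completion_iff by eventually_elim auto
  then show "f -` A \<inter> space (completion M) \<in> sets (completion M)"
    by (rule completion.in_sets_AE[OF _ g]) auto
qed auto

lemma complex_ex_borel:
  fixes f :: "'a \<Rightarrow> complex"
  assumes "f \<in> borel_measurable (completion M)"
  shows "\<exists>g\<in>borel_measurable M. AE x in M. f x = g x"
proof -
  obtain u where u: "u \<in> borel_measurable M" "AE x in M. Re (f x) = u x"
    using completion_ex_borel_measurable_real[of "\<lambda>x. Re (f x)" M] assms by auto
  obtain v where v: "v \<in> borel_measurable M" "AE x in M. Im (f x) = v x"
    using completion_ex_borel_measurable_real[of "\<lambda>x. Im (f x)" M] assms by auto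
  have "AE x in M. f x = Complex (u x) (v x)" using u(2) v(2) by eventually_elim (simp add: complex_eq_iff)
  moreover have "(\<lambda>x. Complex (u x) (v x)) \<in> borel_measurable M"
    using u v unfolding Complex_eq by measurable
  ultimately show ?thesis by (intro bexI[of _ "\<lambda>x. Complex (u x) (v x)"])
qed

lemma AE_lborel_nth:
  assumes "AE z in (lborel :: (real^'n) measure). P z"
  shows "AE y in (lborel :: (real^'n^'m) measure). P (y $ (j::'m))"
proof -
  obtain N where N': "\<And>z. z \<in> space lborel - N \<Longrightarrow> P z" and N: "N \<in> null_sets (lborel :: (real^'n) measure)"
    using AE_E3[OF assms] by blast
  have nth: "(\<lambda>y::real^'n^'m. y $ j) \<in> borel_measurable borel"
    by (intro borel_measurable_continuous_onI continuous_intros)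
  let ?f = "\<lambda>i. if i = j then indicator N else (\<lambda>_. 1) :: real^'n \<Rightarrow> ennreal"
  have "(\<integral>\<^sup>+y. (\<Prod>i\<in>UNIV. ?f i (y $ i)) \<partial>(lborel :: (real^'n^'m) measure)) = (\<Prod>i\<in>UNIV. \<integral>\<^sup>+z. ?f i z \<partial>lborel)"
    using N by (intro nn_integral_vec_prod) (auto simp: null_sets_def)
  also have "\<dots> = 0" using N by (intro prod_zero bexI[of _ j]) (auto simp: null_sets_def)
  also have "(\<lambda>y::real^'n^'m. \<Prod>i\<in>UNIV. ?f i (y $ i)) = indicator ((\<lambda>y. y $ j) -` N)"
  proof
    fix y :: "real^'n^'m"
    have "(\<Prod>i\<in>UNIV. ?f i (y $ i)) = (\<Prod>i\<in>UNIV. if i = j then indicator N (y $ j) else (1::ennreal))"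
      by (intro prod.cong) auto
    then show "(\<Prod>i\<in>UNIV. ?f i (y $ i)) = indicator ((\<lambda>y. y $ j) -` N) y" by (simp add: indicator_def)
  qed
  finally have "(\<lambda>y. y $ j) -` N \<in> null_sets (lborel :: (real^'n^'m) measure)"
    using measurable_sets[OF nth, of N] N by (auto simp: null_sets_def)
  then show ?thesis by (rule AE_I') (use N' in auto)
qed

lemma prod_less_top: "(\<And>i. i \<in> I \<Longrightarrow> f i < \<infinity>) \<Longrightarrow> (\<Prod>i\<in>I. f i :: ennreal) < \<infinity>"
  by (induction I rule: infinite_finite_induct) (auto simp: ennreal_mult_less_top)

text \<open>
  The value \<open>K x 0\<close> is arbitrary, so measurability is required after it has been replaced by \<open>0\<close>.
\<close>

locale dominated_kernel =
  fixes K :: "real^'n \<Rightarrow> real^'n^'m::finite \<Rightarrow> complex" and C \<beta> :: real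
  assumes C: "0 \<le> C" and beta: "0 < \<beta>" "\<beta> < 1"
    and dom: "\<And>x y. y \<noteq> 0 \<Longrightarrow> ennreal (norm (K x y)) \<le> ennreal C * (\<Prod>j\<in>UNIV. dyadic_kernel \<beta> (y $ j))"
    and meas: "(\<lambda>p. if snd p = 0 then 0 else K (fst p) (snd p)) \<in> borel_measurable (borel \<Otimes>\<^sub>M borel)"
begin

definition integrand :: "('m \<Rightarrow> real^'n \<Rightarrow> complex) \<Rightarrow> real^'n \<Rightarrow> real^'n^'m \<Rightarrow> complex"
  where "integrand f x y = K x (\<chi> j. x - y $ j) * (\<Prod>j\<in>UNIV. f j (y $ j))"

text \<open>
  A Borel measurable version of the integrand; it differs at the single point \<open>y = (x, \<dots>, x)\<close>.
\<close>

definition integrand0 :: "('m \<Rightarrow> real^'n \<Rightarrow> complex) \<Rightarrow> real^'n \<Rightarrow> real^'n^'m \<Rightarrow> complex"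
  where "integrand0 f x y = (if (\<chi> j. x - y $ j) = 0 then 0 else K x (\<chi> j. x - y $ j)) * (\<Prod>j\<in>UNIV. f j (y $ j))"

lemma diff_vec_eq_0: "(\<chi> j. x - y $ j) = (0::real^'n^'m) \<longleftrightarrow> y = (\<chi> j. x)"
  by (auto simp: vec_eq_iff)

lemma integrand_AE: "AE y in lborel. integrand f x y = integrand0 f x y"
  using AE_lborel_singleton[of "\<chi> j. x"] by eventually_elim (simp add: integrand_def integrand0_def diff_vec_eq_0)

lemma vec_diff_measurable: "(\<lambda>p::(real^'n) \<times> (real^'n^'m). (\<chi> j. fst p - snd p $ j) :: real^'n^'m) \<in> borel_measurable (borel \<Otimes>\<^sub>M borel)"
  unfolding borel_prod
  by (intro borel_measurable_continuous_onI continuous_intros)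

lemma nth_measurable: "(\<lambda>y::real^'n^'m. y $ j) \<in> borel_measurable borel"
  by (intro borel_measurable_continuous_onI continuous_intros)

lemma integrand0_measurable:
  assumes "\<And>j. f j \<in> borel_measurable borel"
  shows "(\<lambda>p. integrand0 f (fst p) (snd p)) \<in> borel_measurable (borel \<Otimes>\<^sub>M borel)"
proof -
  have "(\<lambda>p::(real^'n) \<times> (real^'n^'m). (fst p, (\<chi> j. fst p - snd p $ j) :: real^'n^'m)) \<in> borel \<Otimes>\<^sub>M borel \<rightarrow>\<^sub>M borel \<Otimes>\<^sub>M borel"
    using vec_diff_measurable by measurable
  from measurable_compose[OF this meas, unfolded fst_conv snd_conv]
  have 1: "(\<lambda>p. if (\<chi> j. fst p - snd p $ j) = 0 then 0 else K (fst p) (\<chi> j. fst p - snd p $ j)) \<in> borel_measurable (borel \<Otimes>\<^sub>M borel)" .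
  have 2: "(\<lambda>p::(real^'n) \<times> (real^'n^'m). \<Prod>j\<in>UNIV. f j (snd p $ j)) \<in> borel_measurable (borel \<Otimes>\<^sub>M borel)"
    using measurable_compose[OF measurable_snd measurable_compose[OF nth_measurable assms]]
    by (intro borel_measurable_prod) auto
  show ?thesis unfolding integrand0_def using 1 2 by (rule borel_measurable_times)
qed

lemma integrand0_measurable1:
  assumes "\<And>j. f j \<in> borel_measurable borel"
  shows "integrand0 f x \<in> borel_measurable borel"
  using measurable_compose[OF _ integrand0_measurable[of f, OF assms], of "Pair x" borel] by simp

lemma integrand_measurable1:
  assumes "\<And>j. f j \<in> borel_measurable borel"
  shows "integrand f x \<in> borel_measurable lebesgue"
  using integrand_AE[of f x] integrand0_measurable1[of f, OF assms] by (intro measurable_completion_AE_eq) auto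

lemma kernel_op_integrand: "kernel_op K f x = (LINT y|lebesgue. integrand f x y)"
  by (simp add: kernel_op_def integrand_def)

lemma kernel_op_integrand0:
  assumes "\<And>j. f j \<in> borel_measurable borel"
  shows "kernel_op K f x = (LINT y|lborel. integrand0 f x y)"
proof -
  have "kernel_op K f x = (LINT y|lebesgue. integrand0 f x y)"
    unfolding kernel_op_integrand
    using integrand_AE[of f x] integrand0_measurable1[of f, OF assms] integrand_measurable1[of f, OF assms]
    by (intro integral_cong_AE) (auto simp: AE_completion_iff measurable_completion)
  then show ?thesis using integrand0_measurable1[of f, OF assms] by (simp add: integral_completion)
qed

lemma integrand_cong_AE:
  assumes "\<And>j. AE z in lborel. f j z = g j z"
  shows "AE y in lborel. integrand f x y = integrand g x y"
proof -
  have "AE y in (lborel :: (real^'n^'m) measure). \<forall>j\<in>UNIV. f j (y $ j) = g j (y $ j)"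
    using AE_lborel_nth[OF assms] by (intro AE_finite_allI) auto
  then show ?thesis by eventually_elim (simp add: integrand_def)
qed

lemma kernel_op_cong_AE:
  assumes "\<And>j. AE z in lborel. f j z = g j z" and "\<And>j. g j \<in> borel_measurable borel"
  shows "kernel_op K f = kernel_op K g"
proof
  fix x
  have ae: "AE y in lborel. integrand f x y = integrand g x y" by (rule integrand_cong_AE[OF assms(1)])
  have "AE y in lborel. integrand f x y = integrand0 g x y"
    using ae integrand_AE[of g x] by eventually_elim simp
  then have "integrand f x \<in> borel_measurable lebesgue"
    using integrand0_measurable1[of g, OF assms(2)] by (intro measurable_completion_AE_eq) auto
  then show "kernel_op K f x = kernel_op K g x"
    unfolding kernel_op_integrand using ae integrand_measurable1[of g, OF assms(2)]
    by (intro integral_cong_AE) (auto simp: AE_completion_iff)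
qed

lemma kernel_op_measurable:
  assumes "\<And>j. f j \<in> borel_measurable borel"
  shows "kernel_op K f \<in> borel_measurable borel"
proof -
  have "(\<lambda>(x, y). integrand0 f x y) \<in> borel_measurable (borel \<Otimes>\<^sub>M lborel)"
    using integrand0_measurable[of f, OF assms] by (simp add: case_prod_unfold measurable_cong_sets[OF sets_pair_measure_cong[OF refl sets_lborel] refl])
  then have "(\<lambda>x. LINT y|lborel. integrand0 f x y) \<in> borel_measurable borel"
    by (rule lborel.borel_measurable_lebesgue_integral)
  moreover have "kernel_op K f = (\<lambda>x. LINT y|lborel. integrand0 f x y)"
    by (intro ext kernel_op_integrand0 assms)
  ultimately show ?thesis by simp
qed

lemma nn_integrand_le:
  assumes f: "\<And>j. f j \<in> borel_measurable borel"
    and h: "\<And>j. h j \<in> borel_measurable borel" "\<And>j z. ennreal (norm (f j z)) \<le> h j z"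
  shows "(\<integral>\<^sup>+y. ennreal (norm (integrand0 f x y)) \<partial>lborel) \<le> ennreal C * (\<Prod>j\<in>UNIV. dyadic_op \<beta> (h j) x)"
proof -
  have "ennreal (norm (integrand0 f x y)) \<le> ennreal C * (\<Prod>j\<in>UNIV. dyadic_kernel \<beta> (x - y $ j) * h j (y $ j))" for y
  proof (cases "(\<chi> j. x - y $ j) = (0::real^'n^'m)")
    case False
    have "ennreal (norm (integrand0 f x y)) = ennreal (norm (K x (\<chi> j. x - y $ j))) * (\<Prod>j\<in>UNIV. ennreal (norm (f j (y $ j))))"
      using False by (simp add: integrand0_def norm_mult ennreal_mult' prod_norm[symmetric] prod_ennreal)
    also have "\<dots> \<le> (ennreal C * (\<Prod>j\<in>UNIV. dyadic_kernel \<beta> ((\<chi> j. x - y $ j) $ j))) * (\<Prod>j\<in>UNIV. h j (y $ j))"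
      using dom[OF False] h(2) by (intro mult_mono prod_mono_ennreal) auto
    finally show ?thesis by (simp add: prod.distrib mult.assoc)
  qed (simp add: integrand0_def)
  then have "(\<integral>\<^sup>+y. ennreal (norm (integrand0 f x y)) \<partial>lborel) \<le>
      (\<integral>\<^sup>+y. ennreal C * (\<Prod>j\<in>UNIV. dyadic_kernel \<beta> (x - y $ j) * h j (y $ j)) \<partial>(lborel :: (real^'n^'m) measure))"
    by (intro nn_integral_mono)
  also have "\<dots> = ennreal C * (\<integral>\<^sup>+y. (\<Prod>j\<in>UNIV. dyadic_kernel \<beta> (x - y $ j) * h j (y $ j)) \<partial>(lborel :: (real^'n^'m) measure))"
  proof (rule nn_integral_cmult)
    have "(\<lambda>z. dyadic_kernel \<beta> (x - z) * h j z) \<in> borel_measurable borel" for j using h by measurable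
    from measurable_compose[OF nth_measurable this]
    show "(\<lambda>y::real^'n^'m. \<Prod>j\<in>UNIV. dyadic_kernel \<beta> (x - y $ j) * h j (y $ j)) \<in> borel_measurable lborel"
      by (intro borel_measurable_prod_ennreal) auto
  qed
  also have "(\<integral>\<^sup>+y. (\<Prod>j\<in>UNIV. dyadic_kernel \<beta> (x - y $ j) * h j (y $ j)) \<partial>(lborel :: (real^'n^'m) measure)) = (\<Prod>j\<in>UNIV. dyadic_op \<beta> (h j) x)"
    unfolding dyadic_op_def using h by (intro nn_integral_vec_prod) measurable
  finally show ?thesis .
qed

text \<open>
  Ensures that the integral defining \<open>kernel_op K f x\<close> converges absolutely.
\<close>

definition abs_convergent :: "('m \<Rightarrow> real^'n \<Rightarrow> complex) \<Rightarrow> real^'n \<Rightarrow> bool"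
  where "abs_convergent f x \<longleftrightarrow> (\<forall>j. dyadic_op \<beta> (\<lambda>z. ennreal (norm (f j z))) x < \<infinity>)"

lemma integrand0_integrable:
  assumes f: "\<And>j. f j \<in> borel_measurable borel" and g: "abs_convergent f x"
  shows "integrable lborel (integrand0 f x)"
proof (rule integrableI_bounded)
  show "integrand0 f x \<in> borel_measurable lborel" using integrand0_measurable1[of f, OF f] by simp
  have "(\<integral>\<^sup>+y. ennreal (norm (integrand0 f x y)) \<partial>lborel) \<le> ennreal C * (\<Prod>j\<in>UNIV. dyadic_op \<beta> (\<lambda>z. ennreal (norm (f j z))) x)"
    using f by (intro nn_integrand_le) auto
  also have "\<dots> < \<infinity>"
  proof -
    have "(\<Prod>j\<in>UNIV. dyadic_op \<beta> (\<lambda>z. ennreal (norm (f j z))) x) < \<infinity>"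
      using g by (intro prod_less_top) (simp add: abs_convergent_def)
    then show ?thesis by (simp add: ennreal_mult_less_top)
  qed
  finally show "(\<integral>\<^sup>+y. ennreal (norm (integrand0 f x y)) \<partial>lborel) < \<infinity>" .
qed

lemma kernel_op_bound:
  assumes f: "\<And>j. f j \<in> borel_measurable borel"
  shows "ennreal (norm (kernel_op K f x)) \<le> ennreal C * (\<Prod>j\<in>UNIV. dyadic_op \<beta> (\<lambda>z. ennreal (norm (f j z))) x)"
proof (cases "integrable lborel (integrand0 f x)")
  case True
  have "ennreal (norm (kernel_op K f x)) \<le> (\<integral>\<^sup>+y. ennreal (norm (integrand0 f x y)) \<partial>lborel)"
    unfolding kernel_op_integrand0[of f, OF f] by (rule integral_norm_bound_ennreal[OF True])
  also have "\<dots> \<le> ennreal C * (\<Prod>j\<in>UNIV. dyadic_op \<beta> (\<lambda>z. ennreal (norm (f j z))) x)"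
    using f by (intro nn_integrand_le) auto
  finally show ?thesis .
qed (simp add: kernel_op_integrand0[of f, OF f] not_integrable_integral_eq)

lemma integrand0_upd:
  "integrand0 (f(j := g)) x y = g (y $ j) * ((if (\<chi> j. x - y $ j) = 0 then 0 else K x (\<chi> j. x - y $ j)) * (\<Prod>i\<in>UNIV - {j}. f i (y $ i)))"
proof -
  have "(\<Prod>i\<in>UNIV. (f(j := g)) i (y $ i)) = g (y $ j) * (\<Prod>i\<in>UNIV - {j}. f i (y $ i))"
    by (subst prod.remove[of _ j]) auto
  then show ?thesis by (simp add: integrand0_def)
qed

lemma kernel_op_linear:
  assumes f: "\<And>j. f j \<in> borel_measurable borel" and g: "g \<in> borel_measurable borel"
    and x: "abs_convergent f x" "abs_convergent (f(j := g)) x"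
  shows "kernel_op K (f(j := (\<lambda>y. a * f j y + g y))) x = a * kernel_op K f x + kernel_op K (f(j := g)) x"
proof -
  have fg: "(f(j := g)) i \<in> borel_measurable borel" for i using f g by auto
  have h: "(\<lambda>y. a * f j y + g y) \<in> borel_measurable borel" using f g by measurable
  have fh: "(f(j := (\<lambda>y. a * f j y + g y))) i \<in> borel_measurable borel" for i using f h by auto
  have "integrand0 (f(j := (\<lambda>y. a * f j y + g y))) x = (\<lambda>y. a * integrand0 f x y + integrand0 (f(j := g)) x y)"
  proof
    fix y
    have "integrand0 f x y = integrand0 (f(j := f j)) x y" by simp
    then show "integrand0 (f(j := (\<lambda>y. a * f j y + g y))) x y = a * integrand0 f x y + integrand0 (f(j := g)) x y"
      unfolding integrand0_upd by (simp add: algebra_simps)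
  qed
  then show ?thesis
    unfolding kernel_op_integrand0[of f, OF f] kernel_op_integrand0[of "f(j := g)", OF fg]
      kernel_op_integrand0[of "f(j := (\<lambda>y. a * f j y + g y))", OF fh]
    using integrand0_integrable[of f, OF f x(1)] integrand0_integrable[of "f(j := g)", OF fg x(2)]
    by (simp del: fun_upd_apply)
qed

lemma kernel_op_dominated:
  assumes f: "\<And>i. f i \<in> borel_measurable borel" and G: "\<And>k. G k \<in> borel_measurable borel"
    and g: "g \<in> borel_measurable borel" and lim: "\<And>z. (\<lambda>k. G k z) \<longlonglongrightarrow> g z"
    and h: "h \<in> borel_measurable borel" "\<And>k z. norm (G k z) \<le> norm (h z)"
    and x: "abs_convergent (f(j := h)) x"
  shows "(\<lambda>k. kernel_op K (f(j := G k)) x) \<longlonglongrightarrow> kernel_op K (f(j := g)) x"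
proof -
  have fG: "(f(j := G k)) i \<in> borel_measurable borel" for k i using f G by simp
  have fg: "(f(j := g)) i \<in> borel_measurable borel" for i using f g by simp
  have fh: "(f(j := h)) i \<in> borel_measurable borel" for i using f h by simp
  have eG: "kernel_op K (f(j := G k)) x = (LINT y|lborel. integrand0 (f(j := G k)) x y)" for k
    by (rule kernel_op_integrand0) (rule fG)
  have eg: "kernel_op K (f(j := g)) x = (LINT y|lborel. integrand0 (f(j := g)) x y)"
    by (rule kernel_op_integrand0) (rule fg)
  show ?thesis
    unfolding eG eg
  proof (rule integral_dominated_convergence)
    show "integrand0 (f(j := g)) x \<in> borel_measurable lborel"
      unfolding measurable_lborel2 by (rule integrand0_measurable1) (rule fg)
    show "integrand0 (f(j := G k)) x \<in> borel_measurable lborel" for k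
      unfolding measurable_lborel2 by (rule integrand0_measurable1) (rule fG)
    show "integrable lborel (\<lambda>y. norm (integrand0 (f(j := h)) x y))"
      by (rule integrable_norm, rule integrand0_integrable) (rule fh, rule x)
    show "AE y in lborel. (\<lambda>k. integrand0 (f(j := G k)) x y) \<longlonglongrightarrow> integrand0 (f(j := g)) x y"
      unfolding integrand0_upd by (intro AE_I2 tendsto_mult lim tendsto_const)
    show "AE y in lborel. norm (integrand0 (f(j := G k)) x y) \<le> norm (integrand0 (f(j := h)) x y)" for k
      unfolding integrand0_upd norm_mult using h(2) by (intro AE_I2 mult_right_mono) auto
  qed
qed

end

section \<open>Dyadic cells and stopping times\<close>

definition cell_index :: "'a::euclidean_space \<Rightarrow> real \<Rightarrow> nat \<Rightarrow> 'a \<Rightarrow> 'a \<Rightarrow> int"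
  where "cell_index a s k x i = \<lfloor>2 ^ k * ((x - a) \<bullet> i) / s\<rfloor>"

text \<open>
  The half-open dyadic cell of generation \<open>k\<close> that contains \<open>x\<close>, in the grid with corner \<open>a\<close> whose cells of
  generation \<open>0\<close> have side \<open>s\<close>.
\<close>

definition cell :: "'a::euclidean_space \<Rightarrow> real \<Rightarrow> nat \<Rightarrow> 'a \<Rightarrow> 'a set"
  where "cell a s k x = {y. \<forall>i\<in>Basis. cell_index a s k y i = cell_index a s k x i}"

definition cell_low :: "'a::euclidean_space \<Rightarrow> real \<Rightarrow> nat \<Rightarrow> 'a \<Rightarrow> 'a"
  where "cell_low a s k x = (\<Sum>i\<in>Basis. (a \<bullet> i + s * of_int (cell_index a s k x i) / 2 ^ k) *\<^sub>R i)"

lemma cell_self [simp]: "x \<in> cell a s k x" by (simp add: cell_def)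

lemma cell_eq: "y \<in> cell a s k x \<Longrightarrow> cell a s k y = cell a s k x"
  by (auto simp: cell_def)

lemma mem_cell:
  assumes "s > 0"
  shows "y \<in> cell a s k x \<longleftrightarrow> (\<forall>i\<in>Basis. cell_low a s k x \<bullet> i \<le> y \<bullet> i \<and> y \<bullet> i < cell_low a s k x \<bullet> i + s / 2 ^ k)"
proof -
  have "cell_index a s k y i = n \<longleftrightarrow>
     a \<bullet> i + s * of_int n / 2 ^ k \<le> y \<bullet> i \<and> y \<bullet> i < a \<bullet> i + s * of_int n / 2 ^ k + s / 2 ^ k" for n i
  proof -
    have "cell_index a s k y i = n \<longleftrightarrow> of_int n \<le> 2 ^ k * ((y - a) \<bullet> i) / s \<and> 2 ^ k * ((y - a) \<bullet> i) / s < of_int n + 1"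
      unfolding cell_index_def by (rule floor_eq_iff)
    also have "\<dots> \<longleftrightarrow> a \<bullet> i + s * of_int n / 2 ^ k \<le> y \<bullet> i \<and> y \<bullet> i < a \<bullet> i + s * of_int n / 2 ^ k + s / 2 ^ k"
      using assms by (auto simp: field_simps inner_diff_left)
    finally show ?thesis .
  qed
  then show ?thesis unfolding cell_def cell_low_def by simp
qed

lemma cell_boxes:
  fixes a :: "'a::euclidean_space"
  assumes "s > 0"
  shows "box (cell_low a s k x) (cell_low a s k x + (s / 2 ^ k) *\<^sub>R One) \<subseteq> cell a s k x"
    "cell a s k x \<subseteq> cbox (cell_low a s k x) (cell_low a s k x + (s / 2 ^ k) *\<^sub>R One)"
  by (auto simp: mem_cell[OF assms] mem_box inner_add_left less_imp_le)

lemma cell_borel [measurable]: "cell (a::'a::euclidean_space) s k x \<in> sets borel"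
proof -
  have "(\<lambda>y. cell_index a s k y i) \<in> borel \<rightarrow>\<^sub>M count_space UNIV" for i
    unfolding cell_index_def by measurable
  then have "{y \<in> space borel. \<forall>i\<in>Basis. cell_index a s k y i = cell_index a s k x i} \<in> sets borel"
    by measurable
  then show ?thesis by (simp add: cell_def)
qed

lemma emeasure_cell:
  assumes "s > 0" shows "emeasure lborel (cell (a::'a::euclidean_space) s k x) = ennreal ((s / 2 ^ k) ^ DIM('a))"
proof (rule antisym)
  let ?l = "cell_low a s k x" and ?u = "cell_low a s k x + (s / 2 ^ k) *\<^sub>R One"
  have e: "emeasure lborel (cbox ?l ?u) = ennreal ((s / 2 ^ k) ^ DIM('a))"
    "emeasure lborel (box ?l ?u) = ennreal ((s / 2 ^ k) ^ DIM('a))"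
    using assms by (simp_all add: inner_add_left)
  show "emeasure lborel (cell a s k x) \<le> ennreal ((s / 2 ^ k) ^ DIM('a))"
    using emeasure_mono[OF cell_boxes(2)[OF assms, of a k x], of lborel] e by simp
  show "ennreal ((s / 2 ^ k) ^ DIM('a)) \<le> emeasure lborel (cell a s k x)"
    using emeasure_mono[OF cell_boxes(1)[OF assms, of a k x], of lborel] e by simp
qed

lemma cell_antimono: "j \<le> k \<Longrightarrow> cell (a::'a::euclidean_space) s k x \<subseteq> cell a s j x"
proof (rule lift_Suc_antimono_le[of "\<lambda>k. cell a s k x"])
  fix k
  have "cell_index a s k y i = cell_index a s (Suc k) y i div 2" for y i
  proof -
    have "\<lfloor>(2 ^ Suc k * ((y - a) \<bullet> i) / s) / of_int 2\<rfloor> = \<lfloor>2 ^ Suc k * ((y - a) \<bullet> i) / s\<rfloor> div 2"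
      by (rule floor_divide_real_eq_div) simp
    then show ?thesis by (simp add: cell_index_def)
  qed
  then show "cell a s (Suc k) x \<subseteq> cell a s k x" by (auto simp: cell_def)
qed

lemma countable_cells: "countable (range (cell (a::'a::euclidean_space) s k))"
proof -
  have "range (cell a s k) \<subseteq> (\<lambda>f. {y. \<forall>i\<in>Basis. cell_index a s k y i = f i}) ` (Basis \<rightarrow>\<^sub>E UNIV)"
  proof
    fix c assume "c \<in> range (cell a s k)"
    then obtain x where c: "c = cell a s k x" by auto
    have "c = (\<lambda>f. {y. \<forall>i\<in>Basis. cell_index a s k y i = f i}) (restrict (cell_index a s k x) Basis)"
      by (auto simp: c cell_def)
    then show "c \<in> (\<lambda>f. {y. \<forall>i\<in>Basis. cell_index a s k y i = f i}) ` (Basis \<rightarrow>\<^sub>E UNIV)"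
      by (intro image_eqI[where x = "restrict (cell_index a s k x) Basis"]) simp_all
  qed
  moreover have "countable ((\<lambda>f. {y. \<forall>i\<in>Basis. cell_index a s k y i = f i}) ` (Basis \<rightarrow>\<^sub>E (UNIV :: int set)))"
    by (intro countable_image countable_PiE) auto
  ultimately show ?thesis by (rule countable_subset)
qed

lemma cell_small:
  assumes s: "s > 0" and G: "open G" and x: "(x::'a::euclidean_space) \<in> G"
  shows "\<exists>k. cell a s k x \<subseteq> G"
proof -
  obtain e where e: "e > 0" "ball x e \<subseteq> G" using G x openE by blast
  obtain k where k: "real DIM('a) * s / e < 2 ^ k" using real_arch_pow[of 2] by auto
  have "cell a s k x \<subseteq> ball x e"
  proof
    fix y assume y: "y \<in> cell a s k x"
    have "\<bar>(x - y) \<bullet> i\<bar> \<le> s / 2 ^ k" if "i \<in> Basis" for i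
      using y cell_self[of x a s k] that unfolding mem_cell[OF s] by (fastforce simp: inner_diff_left)
    then have "norm (x - y) \<le> (\<Sum>i\<in>(Basis::'a set). s / 2 ^ k)"
      by (intro order_trans[OF norm_le_l1] sum_mono) auto
    also have "\<dots> = real DIM('a) * s / 2 ^ k" by simp
    also have "\<dots> < e" using k e by (simp add: field_simps)
    finally show "y \<in> ball x e" by (simp add: dist_norm)
  qed
  then show ?thesis using e by blast
qed

text \<open>
  The maximal cells with the property \<open>P\<close>, as in the Calderon-Zygmund decomposition. They are disjoint
  and cover the points that lie in some cell with this property.
\<close>

definition stopping_cells :: "'a::euclidean_space \<Rightarrow> real \<Rightarrow> ('a set \<Rightarrow> bool) \<Rightarrow> 'a set set"
  where "stopping_cells a s P = {cell a s k x | k x. P (cell a s k x) \<and> (\<forall>j<k. \<not> P (cell a s j x))}"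

lemma countable_stopping: "countable (stopping_cells a s P)"
  by (rule countable_subset[of _ "\<Union>k. range (cell a s k)"])
     (auto simp: stopping_cells_def intro: countable_cells)

lemma Union_stopping: "\<Union>(stopping_cells a s P) = {x. \<exists>k. P (cell a s k x)}"
proof (intro equalityI subsetI)
  fix y assume "y \<in> \<Union>(stopping_cells a s P)"
  then obtain k x where "P (cell a s k x)" "y \<in> cell a s k x" by (auto simp: stopping_cells_def)
  then have "P (cell a s k y)" using cell_eq[of y a s k x] by simp
  then show "y \<in> {x. \<exists>k. P (cell a s k x)}" by blast
next
  fix x assume "x \<in> {x. \<exists>k. P (cell a s k x)}"
  then have ex: "\<exists>k. P (cell a s k x)" by simp
  let ?k = "LEAST k. P (cell a s k x)"
  have "P (cell a s ?k x)" "\<forall>j<?k. \<not> P (cell a s j x)" using LeastI_ex[OF ex] not_less_Least by auto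
  then have "cell a s ?k x \<in> stopping_cells a s P" unfolding stopping_cells_def by blast
  then show "x \<in> \<Union>(stopping_cells a s P)" using cell_self by blast
qed

lemma disjoint_stopping: "disjoint (stopping_cells a s P)"
proof (rule disjointI)
  fix c d assume "c \<in> stopping_cells a s P" "d \<in> stopping_cells a s P" "c \<noteq> d"
  then obtain k x l y where c: "c = cell a s k x" "P c" "\<forall>j<k. \<not> P (cell a s j x)"
    and d: "d = cell a s l y" "P d" "\<forall>j<l. \<not> P (cell a s j y)" by (auto simp: stopping_cells_def)
  show "c \<inter> d = {}"
  proof (rule ccontr)
    assume "c \<inter> d \<noteq> {}"
    then obtain z where z: "z \<in> c" "z \<in> d" by blast
    have 1: "c = cell a s k z" "d = cell a s l z" using z cell_eq c d by metis+
    have zx: "z \<in> cell a s j x" if "j \<le> k" for j using cell_antimono[OF that] z c by blast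
    have zy: "z \<in> cell a s j y" if "j \<le> l" for j using cell_antimono[OF that] z d by blast
    have "\<not> k < l"
    proof
      assume "k < l" then have "\<not> P (cell a s k y)" using d by blast
      moreover have "cell a s k y = cell a s k z" using cell_eq[OF zy[of k]] \<open>k < l\<close> by simp
      ultimately show False using 1 c by simp
    qed
    moreover have "\<not> l < k"
    proof
      assume "l < k" then have "\<not> P (cell a s l x)" using c by blast
      moreover have "cell a s l x = cell a s l z" using cell_eq[OF zx[of l]] \<open>l < k\<close> by simp
      ultimately show False using 1 d by simp
    qed
    ultimately have "k = l" by simp
    then show False using 1 \<open>c \<noteq> d\<close> by simp
  qed
qed

lemma stopping_borel: "c \<in> stopping_cells (a::'a::euclidean_space) s P \<Longrightarrow> c \<in> sets borel"
  by (auto simp: stopping_cells_def)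

lemma emeasure_Union_stopping:
  assumes "sets M = sets borel" and that: "E \<in> sets borel"
  shows "emeasure M (E \<inter> \<Union>(stopping_cells a s P)) = (\<integral>\<^sup>+c. emeasure M (E \<inter> c) \<partial>count_space (stopping_cells (a::'a::euclidean_space) s P))"
proof -
  have "E \<inter> \<Union>(stopping_cells a s P) = (\<Union>c\<in>stopping_cells a s P. E \<inter> c)" by auto
  moreover have "emeasure M (\<Union>c\<in>stopping_cells a s P. E \<inter> c) = (\<integral>\<^sup>+c. emeasure M (E \<inter> c) \<partial>count_space (stopping_cells a s P))"
    using that disjoint_stopping[of a s P]
    by (intro emeasure_UN_countable) (auto simp: assms stopping_borel countable_stopping disjoint_def disjoint_family_on_def)
  ultimately show ?thesis by simp
qed

text \<open>
  Replaces the Lebesgue density theorem. The maximal cells inside an open set \<open>G\<close> that contains \<open>E\<close> and is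
  only slightly larger partition \<open>G\<close>; summing the density bound gives \<open>|E| \<le> \<tau>|G|\<close>, which is less than
  \<open>|E|\<close> unless \<open>|E| = 0\<close>.
\<close>

lemma sparse_density_null:
  fixes E :: "'a::euclidean_space set"
  assumes s: "s > 0" and E: "E \<in> sets borel" "emeasure lborel E < \<infinity>" and t: "0 \<le> \<tau>" "\<tau> < 1"
    and dens: "\<And>x k. x \<in> E \<Longrightarrow> emeasure lborel (E \<inter> cell a s k x) \<le> ennreal \<tau> * emeasure lborel (cell a s k x)"
  shows "emeasure lborel E = 0"
proof (rule ccontr)
  assume nz: "emeasure lborel E \<noteq> 0"
  define m where "m = enn2real (emeasure lborel E)"
  have m: "emeasure lborel E = ennreal m" "m > 0"
    using nz E(2) by (auto simp: m_def enn2real_positive_iff less_top zero_less_iff_neq_zero)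
  obtain \<epsilon> where eps: "\<epsilon> > 0" "\<tau> * (m + \<epsilon>) < m"
  proof (cases "\<tau> = 0")
    case True then show ?thesis using that[of 1] m by simp
  next
    case False
    then have "\<tau> * (m + (1 - \<tau>) * m / 2 / \<tau>) = m * (1 + \<tau>) / 2" by (simp add: field_simps)
    also have "\<dots> < m" using m t by (simp add: field_simps)
    finally show ?thesis using that[of "(1 - \<tau>) * m / 2 / \<tau>"] m t False by simp
  qed
  obtain G where G: "open G" "E \<subseteq> G" "emeasure lborel (G - E) < ennreal \<epsilon>"
    using outer_regular_lborel[OF E(1) eps(1)] by blast
  let ?D = "stopping_cells a s (\<lambda>c. c \<subseteq> G)"
  have U: "\<Union>?D = G" unfolding Union_stopping using cell_small[OF s G(1)] cell_self by blast
  have le: "emeasure lborel (E \<inter> c) \<le> ennreal \<tau> * emeasure lborel c" if "c \<in> ?D" for c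
  proof (cases "E \<inter> c = {}")
    case False
    then obtain x where x: "x \<in> E" "x \<in> c" by blast
    from that obtain k z where "c = cell a s k z" by (auto simp: stopping_cells_def)
    then have "c = cell a s k x" using x cell_eq by metis
    then show ?thesis using dens[OF x(1)] by simp
  qed simp
  have "emeasure lborel E = emeasure lborel (E \<inter> \<Union>?D)" unfolding U using G by (simp add: Int_absorb2)
  also have "\<dots> = (\<integral>\<^sup>+c. emeasure lborel (E \<inter> c) \<partial>count_space ?D)"
    by (rule emeasure_Union_stopping) (use E in auto)
  also have "\<dots> \<le> (\<integral>\<^sup>+c. ennreal \<tau> * emeasure lborel (UNIV \<inter> c) \<partial>count_space ?D)"
    by (intro nn_integral_mono) (simp add: le)
  also have "\<dots> = ennreal \<tau> * (\<integral>\<^sup>+c. emeasure lborel (UNIV \<inter> c) \<partial>count_space ?D)"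
    by (rule nn_integral_cmult) simp
  also have "(\<integral>\<^sup>+c. emeasure lborel (UNIV \<inter> c) \<partial>count_space ?D) = emeasure lborel (UNIV \<inter> \<Union>?D)"
    by (rule emeasure_Union_stopping[symmetric]) auto
  also have "\<dots> = emeasure lborel G" by (simp only: U Int_UNIV_left)
  also have "\<dots> \<le> emeasure lborel E + emeasure lborel (G - E)"
    using emeasure_subadditive[of E lborel "G - E"] E G by (auto simp: Un_absorb1)
  also have "\<dots> \<le> ennreal (m + \<epsilon>)"
    using G(3) m eps by (subst ennreal_plus) (auto intro: add_left_mono less_imp_le)
  finally have "ennreal m \<le> ennreal (\<tau> * (m + \<epsilon>))"
    using t m eps by (simp add: ennreal_mult' mult_left_mono m(1))
  then show False using eps m t by (simp add: ennreal_le_iff)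
qed

section \<open>Openness of the Muckenhoupt condition\<close>

text \<open>
  The \<open>A\<^sub>p\<close> condition, cleared of denominators, for a Borel weight that is positive everywhere. Below, \<open>W\<close> is
  the measure with density \<open>w\<close>, and \<open>S\<close> is the one with the dual density \<open>w\<^bsup>1-p'\<^esup>\<close>, since \<open>1 - p' = -1/(p - 1)\<close>.
\<close>

locale Ap_core =
  fixes w :: "'a::euclidean_space \<Rightarrow> real" and p A :: real
  assumes p: "p > 1" and w_borel [measurable]: "w \<in> borel_measurable borel" and w_pos: "\<And>x. w x > 0"
    and A_pos: "A > 0"
    and W_fin: "\<And>x R. R > 0 \<Longrightarrow> emeasure (density lborel (\<lambda>x. ennreal (w x))) (cube x R) < \<infinity>"
    and S_fin: "\<And>x R. R > 0 \<Longrightarrow> emeasure (density lborel (\<lambda>x. ennreal (w x powr (- 1 / (p - 1))))) (cube x R) < \<infinity>"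
    and Ap: "\<And>x R. R > 0 \<Longrightarrow> measure (density lborel (\<lambda>x. ennreal (w x))) (cube x R) *
       measure (density lborel (\<lambda>x. ennreal (w x powr (- 1 / (p - 1))))) (cube x R) powr (p - 1)
         \<le> A * measure lborel (cube x R) powr p"
begin

definition W where "W = density lborel (\<lambda>x. ennreal (w x))"
definition S where "S = density lborel (\<lambda>x. ennreal (w x powr (- 1 / (p - 1))))"

lemma sets_WS [simp]: "sets W = sets borel" "sets S = sets borel" "space W = UNIV" "space S = UNIV"
  by (simp_all add: W_def S_def)

lemma null_WS:
  assumes "E \<in> sets borel"
  shows "emeasure W E = 0 \<longleftrightarrow> emeasure lborel E = 0" "emeasure S E = 0 \<longleftrightarrow> emeasure lborel E = 0"
proof -
  have *: "emeasure (density lborel (\<lambda>x. ennreal (f x))) E = 0 \<longleftrightarrow> emeasure lborel E = 0"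
    if "f \<in> borel_measurable borel" "\<And>x. f x > 0" for f
  proof -
    have "emeasure (density lborel (\<lambda>x. ennreal (f x))) E = 0 \<longleftrightarrow> (AE x in lborel. ennreal (f x) * indicator E x = 0)"
      using assms that by (subst emeasure_density) (auto simp: nn_integral_0_iff_AE)
    also have "\<dots> \<longleftrightarrow> (AE x in lborel. x \<notin> E)"
    proof (intro AE_cong)
      fix x show "(ennreal (f x) * indicator E x = 0) = (x \<notin> E)"
        using that(2)[of x] by (simp add: indicator_def ennreal_eq_0_iff not_le)
    qed
    also have "\<dots> \<longleftrightarrow> emeasure lborel E = 0"
      using assms by (subst AE_iff_measurable[of E]) auto
    finally show ?thesis .
  qed
  show "emeasure W E = 0 \<longleftrightarrow> emeasure lborel E = 0" unfolding W_def by (rule *) (use w_pos in auto)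
  show "emeasure S E = 0 \<longleftrightarrow> emeasure lborel E = 0" unfolding S_def using w_pos
    by (intro *) (auto simp: less_imp_neq[OF w_pos, symmetric])
qed

text \<open>
  Hoelder's inequality for the factorisation \<open>1 = w\<^bsup>1/p\<^esup> w\<^bsup>-1/p\<^esup>\<close> on \<open>E\<close>. With both factors normalised it is
  the integral of the weighted inequality between arithmetic and geometric means.
\<close>

lemma holder_sets:
  assumes E [measurable]: "E \<in> sets borel" and f: "emeasure W E < \<infinity>" "emeasure S E < \<infinity>" "emeasure lborel E < \<infinity>"
  shows "measure lborel E powr p \<le> measure W E * measure S E powr (p - 1)"
proof (cases "emeasure lborel E = 0")
  case True
  then show ?thesis using null_WS[OF E] p by (simp add: measure_def)
next
  case False
  define a b where "a = measure W E" and "b = measure S E"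
  have ab: "a > 0" "b > 0" "emeasure W E = ennreal a" "emeasure S E = ennreal b"
    using False null_WS[OF E] f
    by (auto simp: a_def b_def measure_def enn2real_positive_iff less_top zero_less_iff_neq_zero)
  define t where "t = a powr (1 / p) * b powr ((p - 1) / p)"
  have t: "t > 0" using ab by (simp add: t_def)
  have sum1: "1 / p + (p - 1) / p = 1" using p by (simp add: field_simps)
  have pt: "1 / t \<le> (1 / p) * (w x / a) + ((p - 1) / p) * (w x powr (- 1 / (p - 1)) / b)" for x
  proof -
    have "(w x / a) powr (1 / p) * (w x powr (- 1 / (p - 1)) / b) powr ((p - 1) / p)
       = (w x powr (1 / p) * w x powr (- 1 / (p - 1) * ((p - 1) / p))) / t"
      using ab w_pos[of x] by (simp add: powr_divide powr_powr t_def)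
    also have "- 1 / (p - 1) * ((p - 1) / p) = - (1 / p)" using p by (simp add: field_simps)
    also have "w x powr (1 / p) * w x powr (- (1 / p)) = 1" using w_pos[of x] by (simp add: powr_add[symmetric])
    finally have "1 / t = (w x / a) powr (1 / p) * (w x powr (- 1 / (p - 1)) / b) powr ((p - 1) / p)" by simp
    also have "\<dots> \<le> (1 / p) * (w x / a) + ((p - 1) / p) * (w x powr (- 1 / (p - 1)) / b)"
      using p ab w_pos[of x] sum1 by (intro Youngs_inequality_0) (auto intro: divide_pos_pos simp: less_imp_neq[OF w_pos, symmetric])
    finally show ?thesis .
  qed
  have "ennreal (1 / t) * emeasure lborel E = (\<integral>\<^sup>+x. ennreal (1 / t) * indicator E x \<partial>lborel)"
    by (simp add: nn_integral_cmult_indicator)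
  also have "\<dots> \<le> (\<integral>\<^sup>+x. (ennreal (1 / p / a) * (ennreal (w x) * indicator E x) +
      ennreal ((p - 1) / p / b) * (ennreal (w x powr (- 1 / (p - 1))) * indicator E x)) \<partial>lborel)"
  proof (intro nn_integral_mono)
    fix x
    have "ennreal (1 / t) \<le> ennreal (1 / p / a) * ennreal (w x) + ennreal ((p - 1) / p / b) * ennreal (w x powr (- 1 / (p - 1)))"
      using pt[of x] p ab w_pos[of x] by (simp add: ennreal_mult[symmetric] ennreal_plus[symmetric] less_imp_le ennreal_leI del: ennreal_plus)
    then show "ennreal (1 / t) * indicator E x \<le> ennreal (1 / p / a) * (ennreal (w x) * indicator E x) +
      ennreal ((p - 1) / p / b) * (ennreal (w x powr (- 1 / (p - 1))) * indicator E x)"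
      by (auto simp: indicator_def)
  qed
  also have "\<dots> = ennreal (1 / p / a) * emeasure W E + ennreal ((p - 1) / p / b) * emeasure S E"
    unfolding W_def S_def by (subst nn_integral_add) (auto simp: nn_integral_cmult emeasure_density)
  also have "\<dots> = ennreal 1"
    using ab p sum1 by (simp add: ennreal_mult[symmetric] ennreal_plus[symmetric] del: ennreal_plus)
  finally have "ennreal (1 / t) * emeasure lborel E \<le> ennreal 1" .
  moreover have "emeasure lborel E = ennreal (measure lborel E)"
    using f(3) by (simp add: emeasure_eq_ennreal_measure less_top)
  ultimately have "1 / t * measure lborel E \<le> 1"
    using t by (simp add: ennreal_mult[symmetric])
  then have "measure lborel E \<le> t" using t by (simp add: field_simps)
  then have "measure lborel E powr p \<le> t powr p" using p by (intro powr_mono2) auto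
  also have "t powr p = a * b powr (p - 1)"
    using ab p by (simp add: t_def powr_mult powr_powr)
  finally show ?thesis by (simp add: a_def b_def)
qed

lemma cell_cube:
  assumes s: "s > 0"
  shows "\<exists>z R. R > 0 \<and> cell a s k x \<subseteq> cube z R \<and> measure lborel (cube z R) = measure lborel (cell a s k x)"
proof -
  let ?h = "s / 2 ^ k"
  let ?z = "cell_low a s k x + (?h / 2) *\<^sub>R One"
  have "cube ?z (?h / 2) = cbox (cell_low a s k x) (cell_low a s k x + ?h *\<^sub>R One)"
    by (simp add: cube_def scaleR_add_left[symmetric] add.assoc)
  then have "cell a s k x \<subseteq> cube ?z (?h / 2)" using cell_boxes(2)[OF s] by simp
  moreover have "measure lborel (cube ?z (?h / 2)) = measure lborel (cell a s k x)"
    using s by (simp add: measure_def emeasure_cube emeasure_cell)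
  ultimately show ?thesis using s by (intro exI[of _ ?z] exI[of _ "?h / 2"]) auto
qed

lemma cell_fin:
  assumes s: "s > 0"
  shows "emeasure W (cell a s k x) < \<infinity>" "emeasure S (cell a s k x) < \<infinity>" "emeasure lborel (cell a s k x) < \<infinity>"
proof -
  obtain z R where R: "R > 0" "cell a s k x \<subseteq> cube z R" using cell_cube[OF s] by blast
  show "emeasure W (cell a s k x) < \<infinity>"
    using emeasure_mono[OF R(2), of W] W_fin[OF R(1), of z] by (simp add: W_def)
  show "emeasure S (cell a s k x) < \<infinity>"
    using emeasure_mono[OF R(2), of S] S_fin[OF R(1), of z] by (simp add: S_def)
  show "emeasure lborel (cell a s k x) < \<infinity>" using s by (simp add: emeasure_cell)
qed

lemma sub_fin:
  assumes "s > 0" "E \<in> sets borel" "E \<subseteq> cell a s k x"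
  shows "emeasure W E < \<infinity>" "emeasure S E < \<infinity>" "emeasure lborel E < \<infinity>"
    and "measure W E \<le> measure W (cell a s k x)" "measure S E \<le> measure S (cell a s k x)" "measure lborel E \<le> measure lborel (cell a s k x)"
proof -
  note f = cell_fin[OF assms(1), of a k x]
  have m: "emeasure M E < \<infinity> \<and> measure M E \<le> measure M (cell a s k x)" if "sets M = sets borel" "emeasure M (cell a s k x) < \<infinity>" for M
    using emeasure_mono[OF assms(3), of M] that assms(2)
    by (auto simp: measure_def intro: enn2real_mono)
  show "emeasure W E < \<infinity>" "emeasure S E < \<infinity>" "emeasure lborel E < \<infinity>"
    "measure W E \<le> measure W (cell a s k x)" "measure S E \<le> measure S (cell a s k x)" "measure lborel E \<le> measure lborel (cell a s k x)"
    using m[of W] m[of S] m[of lborel] f by auto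
qed

lemma Ap_cell:
  assumes s: "s > 0"
  shows "measure W (cell a s k x) * measure S (cell a s k x) powr (p - 1) \<le> A * measure lborel (cell a s k x) powr p"
proof -
  obtain z R where R: "R > 0" "cell a s k x \<subseteq> cube z R" "measure lborel (cube z R) = measure lborel (cell a s k x)"
    using cell_cube[OF s] by blast
  have 1: "measure W (cell a s k x) \<le> measure W (cube z R)"
    using emeasure_mono[OF R(2), of W] W_fin[OF R(1), of z] by (auto simp: measure_def W_def intro: enn2real_mono)
  have 2: "measure S (cell a s k x) \<le> measure S (cube z R)"
    using emeasure_mono[OF R(2), of S] S_fin[OF R(1), of z] by (auto simp: measure_def S_def intro: enn2real_mono)
  have "measure W (cell a s k x) * measure S (cell a s k x) powr (p - 1) \<le> measure W (cube z R) * measure S (cube z R) powr (p - 1)"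
    using 1 2 p by (intro mult_mono powr_mono2) auto
  also have "\<dots> \<le> A * measure lborel (cell a s k x) powr p"
    using Ap[OF R(1), of z] by (simp add: W_def S_def R(3))
  finally show ?thesis .
qed

definition \<delta> where "\<delta> = min (((1 / 2) powr p / A) powr (1 / (p - 1))) (1 / 2)"

lemma delta: "0 < \<delta>" "\<delta> \<le> 1 / 2" using A_pos by (auto simp: \<delta>_def)

text \<open>
  Hoelder's inequality on \<open>c - E\<close>, which makes up at least half of the cell \<open>c\<close>, combined with the \<open>A\<^sub>p\<close> condition
  on \<open>c\<close>, shows that \<open>c - E\<close> carries at least the fraction \<open>\<delta>\<close> of the dual measure of \<open>c\<close>.
\<close>

lemma half_gain:
  assumes s: "s > 0" and E: "E \<in> sets borel" "E \<subseteq> cell a s k x"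
    and half: "measure lborel E \<le> measure lborel (cell a s k x) / 2"
  shows "measure S E \<le> (1 - \<delta>) * measure S (cell a s k x)"
proof -
  let ?c = "cell a s k x"
  have D: "?c - E \<in> sets borel" "?c - E \<subseteq> ?c" using E by auto
  note fE = sub_fin[OF s E] and fD = sub_fin[OF s D] and fc = cell_fin[OF s, of a k x]
  have diff: "measure M (?c - E) = measure M ?c - measure M E" if "sets M = sets borel" "emeasure M ?c < \<infinity>" for M
    using that E by (intro measure_Diff) auto
  have cpos: "measure lborel ?c > 0" using s by (simp add: measure_def emeasure_cell)
  have "(1/2) powr p * measure lborel ?c powr p = (measure lborel ?c / 2) powr p"
    by (simp add: powr_mult[symmetric] powr_divide)
  also have "\<dots> \<le> measure lborel (?c - E) powr p"
    using half diff[of lborel] fc p by (intro powr_mono2) auto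
  also have "\<dots> \<le> measure W (?c - E) * measure S (?c - E) powr (p - 1)"
    by (rule holder_sets[OF D(1) fD(1-3)])
  also have "\<dots> \<le> measure W ?c * measure S (?c - E) powr (p - 1)"
    using fD(4) by (intro mult_right_mono) auto
  finally have "(1/2) powr p * measure lborel ?c powr p * measure S ?c powr (p - 1) \<le>
     measure W ?c * measure S (?c - E) powr (p - 1) * measure S ?c powr (p - 1)"
    by (rule mult_right_mono) simp
  also have "\<dots> = (measure W ?c * measure S ?c powr (p - 1)) * measure S (?c - E) powr (p - 1)" by simp
  also have "\<dots> \<le> (A * measure lborel ?c powr p) * measure S (?c - E) powr (p - 1)"
    by (intro mult_right_mono Ap_cell[OF s]) auto
  finally have "measure lborel ?c powr p * ((1/2) powr p / A * measure S ?c powr (p - 1)) \<le> measure lborel ?c powr p * measure S (?c - E) powr (p - 1)"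
    using A_pos by (simp add: field_simps)
  then have "(1/2) powr p / A * measure S ?c powr (p - 1) \<le> measure S (?c - E) powr (p - 1)"
    by (rule mult_left_le_imp_le) (use cpos in simp)
  then have "((1/2) powr p / A * measure S ?c powr (p - 1)) powr (1 / (p - 1)) \<le> (measure S (?c - E) powr (p - 1)) powr (1 / (p - 1))"
    using A_pos p by (intro powr_mono2) auto
  moreover have "((1/2) powr p / A * measure S ?c powr (p - 1)) powr (1 / (p - 1)) = ((1/2) powr p / A) powr (1 / (p - 1)) * measure S ?c"
    using A_pos p by (subst powr_mult) (simp_all add: powr_powr)
  moreover have "(measure S (?c - E) powr (p - 1)) powr (1 / (p - 1)) = measure S (?c - E)"
    using p by (simp add: powr_powr)
  ultimately have "((1/2) powr p / A) powr (1 / (p - 1)) * measure S ?c \<le> measure S (?c - E)"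
    by linarith
  moreover have "\<delta> * measure S ?c \<le> ((1/2) powr p / A) powr (1 / (p - 1)) * measure S ?c"
    by (intro mult_right_mono) (auto simp: \<delta>_def)
  ultimately have "\<delta> * measure S ?c \<le> measure S ?c - measure S E"
    using diff[of S] fc by simp
  then show ?thesis by (simp add: algebra_simps)
qed

text \<open>
  Chosen so that density at most \<open>\<tau>\<close> in a cell forces density at most one half in each of its children.
\<close>

definition \<tau> :: real where "\<tau> = 1 / 2 ^ Suc (DIM('a))"

lemma tau: "0 < \<tau>" "\<tau> < 1" "\<tau> * 2 ^ DIM('a) = 1 / 2"
proof -
  have "(1::real) < 2 ^ Suc (DIM('a))" by (rule one_less_power) auto
  then show "0 < \<tau>" "\<tau> < 1" "\<tau> * 2 ^ DIM('a) = 1 / 2" by (simp_all add: \<tau>_def)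
qed

text \<open>
  \<open>F\<close> is the union of the maximal cells in which \<open>E\<close> has density above \<open>\<tau>\<close>. In the parent of such a cell
  the density is at most \<open>\<tau>\<close>, hence in the cell itself at most one half, and \<open>half_gain\<close> applies. Almost all
  of \<open>E\<close> lies in \<open>F\<close> because the rest has low density in every cell.
\<close>

lemma enlarge_sparse_set:
  assumes s: "s > 0" and E: "E \<in> sets borel" "E \<subseteq> cell a s 0 x0"
    and small: "measure lborel E \<le> \<tau> * measure lborel (cell a s 0 x0)"
  shows "\<exists>F \<in> sets borel. F \<subseteq> cell a s 0 x0 \<and> measure lborel F \<le> measure lborel E / \<tau> \<and>
     measure S E \<le> (1 - \<delta>) * measure S F"
proof -
  let ?c0 = "cell a s 0 x0"
  define P where "P c \<longleftrightarrow> c \<subseteq> ?c0 \<and> ennreal \<tau> * emeasure lborel c < emeasure lborel (E \<inter> c)" for c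
  define D where "D = stopping_cells a s P"
  define F where "F = \<Union>D"
  note fE = sub_fin[OF s E]
  have Db: "c \<in> sets borel" if "c \<in> D" for c using that stopping_borel unfolding D_def by blast
  have FB: "F \<in> sets borel" unfolding F_def using Db countable_stopping[of a s P] by (intro sets.countable_Union) (auto simp: D_def)
  have Fsub: "F \<subseteq> ?c0" by (auto simp: F_def D_def stopping_cells_def P_def)
  note fF = sub_fin[OF s FB Fsub]
  have Pc: "P c" if "c \<in> D" for c using that by (auto simp: D_def stopping_cells_def)
  have em: "emeasure M X = ennreal (measure M X)" if "emeasure M X < \<infinity>" for M :: "'a measure" and X
    using that by (simp add: emeasure_eq_ennreal_measure less_top)
  have nP0: "\<not> P (cell a s 0 x)" for x
  proof
    assume Px: "P (cell a s 0 x)"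
    then have "x \<in> ?c0" using cell_self by (auto simp: P_def)
    then have "cell a s 0 x = ?c0" by (rule cell_eq)
    then have "ennreal \<tau> * emeasure lborel ?c0 < emeasure lborel E" using Px E(2) by (simp add: P_def Int_absorb2)
    moreover have "emeasure lborel E \<le> ennreal \<tau> * emeasure lborel ?c0"
      using small tau by (simp add: em[OF fE(3)] em[OF cell_fin(3)[OF s]] ennreal_mult[symmetric] ennreal_leI)
    ultimately show False by simp
  qed
  have gain: "emeasure S (E \<inter> c) \<le> ennreal (1 - \<delta>) * emeasure S c" if cD: "c \<in> D" for c
  proof -
    obtain k x where c0: "c = cell a s k x" "P (cell a s k x)" "\<forall>j<k. \<not> P (cell a s j x)"
      using cD unfolding D_def stopping_cells_def by blast
    have c: "c = cell a s k x" "P c" "\<forall>j<k. \<not> P (cell a s j x)" using c0 by auto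
    have "k \<noteq> 0" using nP0 c by metis
    then obtain j where k: "k = Suc j" by (cases k) auto
    have xc0: "x \<in> ?c0" using c cell_self by (auto simp: P_def)
    have "cell a s j x \<subseteq> ?c0"
      using cell_antimono[of 0 j a s x] cell_eq[OF xc0] by simp
    then have "emeasure lborel (E \<inter> cell a s j x) \<le> ennreal \<tau> * emeasure lborel (cell a s j x)"
      using c(3) k by (auto simp: P_def not_less)
    moreover have "emeasure lborel (E \<inter> c) \<le> emeasure lborel (E \<inter> cell a s j x)"
      using cell_antimono[of j k a s x] c k E by (intro emeasure_mono) auto
    ultimately have "emeasure lborel (E \<inter> c) \<le> ennreal \<tau> * ennreal ((s / 2 ^ j) ^ DIM('a))"
      using s by (simp add: emeasure_cell)
    also have "\<dots> = ennreal (\<tau> * (2 ^ DIM('a) * (s / 2 ^ k) ^ DIM('a)))"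
      using tau s by (simp add: ennreal_mult'[symmetric] k power_mult_distrib[symmetric] less_imp_le)
    also have "\<tau> * (2 ^ DIM('a) * (s / 2 ^ k) ^ DIM('a)) = (s / 2 ^ k) ^ DIM('a) / 2"
      using tau(3) by (simp add: mult.assoc[symmetric])
    finally have "measure lborel (E \<inter> c) \<le> measure lborel (cell a s k x) / 2"
      using s enn2real_mono[of "emeasure lborel (E \<inter> c)" "ennreal ((s / 2 ^ k) ^ DIM('a) / 2)"]
      by (simp add: measure_def emeasure_cell)
    then have "measure S (E \<inter> c) \<le> (1 - \<delta>) * measure S (cell a s k x)"
      using E c by (intro half_gain[OF s]) auto
    moreover have "emeasure S (E \<inter> c) < \<infinity>" using sub_fin(2)[OF s, of "E \<inter> c" a k x] E c by auto
    then have "emeasure S (E \<inter> c) = ennreal (measure S (E \<inter> c))" by (rule em)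
    moreover have "emeasure S c = ennreal (measure S c)" unfolding c(1) by (rule em[OF cell_fin(2)[OF s]])
    ultimately show ?thesis using delta unfolding c(1)
      by (simp only: ennreal_mult'[symmetric] ennreal_leI)
  qed
  have null: "emeasure lborel (E - F) = 0"
  proof (rule sparse_density_null[OF s _ _ less_imp_le[OF tau(1)] tau(2)])
    show "E - F \<in> sets borel" using E FB by simp
    show "emeasure lborel (E - F) < \<infinity>"
      using sub_fin(3)[OF s, of "E - F" a 0 x0] E FB by auto
    fix x k assume x: "x \<in> E - F"
    then have "\<not> P (cell a s k x)" unfolding F_def D_def Union_stopping by blast
    moreover have "cell a s k x \<subseteq> ?c0"
      using cell_antimono[of 0 k a s x] cell_eq[of x a s 0 x0] x E by auto
    ultimately have "emeasure lborel (E \<inter> cell a s k x) \<le> ennreal \<tau> * emeasure lborel (cell a s k x)"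
      by (auto simp: P_def not_less)
    moreover have "emeasure lborel ((E - F) \<inter> cell a s k x) \<le> emeasure lborel (E \<inter> cell a s k x)"
      by (rule emeasure_mono) (use E in auto)
    ultimately show "emeasure lborel ((E - F) \<inter> cell a s k x) \<le> ennreal \<tau> * emeasure lborel (cell a s k x)"
      by (rule order_trans[rotated])
  qed
  have "emeasure S E \<le> emeasure S (E \<inter> F) + emeasure S (E - F)"
    using emeasure_subadditive[of "E \<inter> F" S "E - F"] E FB by (simp add: Int_Diff_Un)
  also have "emeasure S (E - F) = 0" using null null_WS(2)[of "E - F"] E FB by auto
  finally have "emeasure S E \<le> emeasure S (E \<inter> F)" by simp
  also have "\<dots> = (\<integral>\<^sup>+c. emeasure S (E \<inter> c) \<partial>count_space D)"
    unfolding F_def D_def by (rule emeasure_Union_stopping) (use E in auto)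
  also have "\<dots> \<le> (\<integral>\<^sup>+c. ennreal (1 - \<delta>) * emeasure S (UNIV \<inter> c) \<partial>count_space D)"
    by (intro nn_integral_mono) (simp add: gain)
  also have "\<dots> = ennreal (1 - \<delta>) * (\<integral>\<^sup>+c. emeasure S (UNIV \<inter> c) \<partial>count_space D)"
    by (rule nn_integral_cmult) simp
  also have "(\<integral>\<^sup>+c. emeasure S (UNIV \<inter> c) \<partial>count_space D) = emeasure S (UNIV \<inter> F)"
    unfolding F_def D_def by (rule emeasure_Union_stopping[symmetric]) auto
  finally have r1: "measure S E \<le> (1 - \<delta>) * measure S F"
    using delta by (simp add: em[OF fE(2)] em[OF fF(2)] ennreal_mult[symmetric] ennreal_le_iff)
  have "ennreal \<tau> * emeasure lborel F = ennreal \<tau> * (\<integral>\<^sup>+c. emeasure lborel (UNIV \<inter> c) \<partial>count_space D)"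
    using emeasure_Union_stopping[of lborel UNIV a s P] by (simp add: F_def D_def)
  also have "\<dots> = (\<integral>\<^sup>+c. ennreal \<tau> * emeasure lborel (UNIV \<inter> c) \<partial>count_space D)"
    by (rule nn_integral_cmult[symmetric]) simp
  also have "\<dots> \<le> (\<integral>\<^sup>+c. emeasure lborel (E \<inter> c) \<partial>count_space D)"
    by (intro nn_integral_mono) (use Pc in \<open>auto simp: P_def less_imp_le\<close>)
  also have "\<dots> = emeasure lborel (E \<inter> F)"
    unfolding F_def D_def by (rule emeasure_Union_stopping[symmetric]) (use E in auto)
  also have "\<dots> \<le> emeasure lborel E" using E by (intro emeasure_mono) auto
  finally have "\<tau> * measure lborel F \<le> measure lborel E"
    using tau by (simp add: em[OF fE(3)] em[OF fF(3)] ennreal_mult[symmetric] ennreal_le_iff)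
  then have "measure lborel F \<le> measure lborel E / \<tau>" using tau by (simp add: field_simps)
  with r1 FB Fsub show ?thesis by blast
qed

text \<open>
  Each enlargement costs a factor \<open>1/\<tau>\<close> in Lebesgue measure and gains a factor \<open>1 - \<delta>\<close> in the dual measure.
\<close>

lemma iterated_gain:
  assumes s: "s > 0" and E: "E \<in> sets borel" "E \<subseteq> cell a s 0 x0"
    and small: "measure lborel E \<le> \<tau> ^ k * measure lborel (cell a s 0 x0)"
  shows "measure S E \<le> (1 - \<delta>) ^ k * measure S (cell a s 0 x0)"
  using E small
proof (induction k arbitrary: E)
  case 0
  then show ?case using sub_fin(5)[OF s 0(1,2)] by simp
next
  case (Suc k)
  have "\<tau> ^ Suc k \<le> \<tau>" using tau by (simp add: mult_left_le power_le_one)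
  then have "measure lborel E \<le> \<tau> * measure lborel (cell a s 0 x0)"
    using Suc.prems(3) by (meson mult_right_mono measure_nonneg order_trans)
  then obtain F where F: "F \<in> sets borel" "F \<subseteq> cell a s 0 x0" "measure lborel F \<le> measure lborel E / \<tau>"
     "measure S E \<le> (1 - \<delta>) * measure S F"
    using enlarge_sparse_set[OF s Suc.prems(1,2)] by blast
  have "measure lborel E / \<tau> \<le> \<tau> ^ k * measure lborel (cell a s 0 x0)"
    using Suc.prems(3) tau by (simp add: field_simps)
  then have "measure S F \<le> (1 - \<delta>) ^ k * measure S (cell a s 0 x0)"
    using F by (intro Suc.IH) auto
  then have "(1 - \<delta>) * measure S F \<le> (1 - \<delta>) * ((1 - \<delta>) ^ k * measure S (cell a s 0 x0))"
    using delta by (intro mult_left_mono) auto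
  then show ?case using F(4) by simp
qed

text \<open>
  The \<open>A\<^sub>\<infinity>\<close> property of the dual weight: \<open>iterated_gain\<close> with \<open>\<tau>\<^sup>k\<close> comparable to \<open>|E|/|c|\<close>.
\<close>

lemma dual_measure_decay:
  "\<exists>\<theta> D. 0 < \<theta> \<and> \<theta> \<le> 1 \<and> 0 < D \<and> (\<forall>a s x0 E. s > 0 \<longrightarrow> E \<in> sets borel \<longrightarrow> E \<subseteq> cell a s 0 x0 \<longrightarrow>
     measure S E \<le> D * (measure lborel E / measure lborel (cell a s 0 x0)) powr \<theta> * measure S (cell a s 0 x0))"
proof -
  \<comment> \<open>the largest exponent up to 1 with \<open>1 - \<delta> \<le> \<tau>\<^sup>\<theta>\<close>\<close>
  define \<theta> where "\<theta> = min 1 (ln (1 - \<delta>) / ln \<tau>)"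
  have lt: "ln \<tau> < 0" "ln (1 - \<delta>) < 0" using tau delta by auto
  have th: "0 < \<theta>" "\<theta> \<le> 1" using lt by (auto simp: \<theta>_def divide_neg_neg)
  have pw: "1 - \<delta> \<le> \<tau> powr \<theta>"
  proof -
    have "1 - \<delta> = \<tau> powr (ln (1 - \<delta>) / ln \<tau>)" using delta tau lt by (simp add: powr_def)
    also have "\<dots> \<le> \<tau> powr \<theta>" using tau by (intro powr_mono') (auto simp: \<theta>_def)
    finally show ?thesis .
  qed
  have "measure S E \<le> \<tau> powr - \<theta> * (measure lborel E / measure lborel (cell a s 0 x0)) powr \<theta> * measure S (cell a s 0 x0)"
    if s: "s > 0" and E: "E \<in> sets borel" "E \<subseteq> cell a s 0 x0" for a s x0 E
  proof (cases "measure lborel E = 0")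
    case True
    then have "emeasure lborel E = 0" using sub_fin(3)[OF s E] by (auto simp: measure_def enn2real_eq_0_iff)
    then show ?thesis using null_WS(2)[OF E(1)] by (simp add: measure_def)
  next
    case False
    define c where "c = measure lborel (cell a s 0 x0)"
    have c: "c > 0" using s by (simp add: c_def measure_def emeasure_cell)
    define u where "u = measure lborel E / c"
    have u: "0 < u" "u \<le> 1" using False c sub_fin(6)[OF s E] by (auto simp: u_def c_def zero_less_measure_iff)
    have ex: "\<exists>k. \<tau> ^ Suc k < u"
    proof -
      obtain k where "\<tau> ^ k < u" using real_arch_pow_inv[OF u(1) tau(2)] by blast
      moreover have "\<tau> ^ Suc k \<le> \<tau> ^ k" using tau by (intro power_decreasing) auto
      ultimately show ?thesis by (intro exI[of _ k]) linarith
    qed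
    define k where "k = (LEAST k. \<tau> ^ Suc k < u)"
    have k1: "\<tau> ^ Suc k < u" unfolding k_def by (rule LeastI_ex[OF ex])
    have k2: "u \<le> \<tau> ^ k"
    proof (cases k)
      case (Suc j)
      then have "\<not> \<tau> ^ Suc j < u" using not_less_Least[of j "\<lambda>k. \<tau> ^ Suc k < u"] by (simp add: k_def)
      then show ?thesis using Suc by simp
    qed (use u in simp)
    have "measure S E \<le> (1 - \<delta>) ^ k * measure S (cell a s 0 x0)"
      using k2 c by (intro iterated_gain[OF s E]) (simp add: u_def c_def field_simps)
    also have "(1 - \<delta>) ^ k \<le> \<tau> powr - \<theta> * u powr \<theta>"
    proof -
      have "(1 - \<delta>) ^ k \<le> (\<tau> powr \<theta>) ^ k" using pw delta by (intro power_mono) auto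
      also have "\<dots> = \<tau> powr - \<theta> * (\<tau> ^ Suc k) powr \<theta>"
        using tau by (simp add: powr_realpow[symmetric] powr_powr powr_add[symmetric] powr_mult algebra_simps)
      also have "\<dots> \<le> \<tau> powr - \<theta> * u powr \<theta>"
        using k1 th tau by (intro mult_left_mono powr_mono2) auto
      finally show ?thesis .
    qed
    finally show ?thesis by (simp add: u_def c_def mult_right_mono)
  qed
  then show ?thesis using th tau by (intro exI[of _ \<theta>] exI[of _ "\<tau> powr - \<theta>"]) auto
qed

text \<open>
  Hoelder's inequality on \<open>E\<close> bounds \<open>|E|\<^sup>p\<close> by \<open>W(E) S(E)\<^bsup>p-1\<^esup>\<close>. The decay of \<open>S(E)\<close> saves a power
  \<open>(|E|/|Q|)\<^bsup>\<theta>(p-1)\<^esup>\<close> over the trivial \<open>S(E) \<le> S(Q)\<close>, which lowers the exponent to \<open>p - \<theta>(p - 1)\<close>. In this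
  form, tested on subsets of cubes, openness is all that restricted weak type estimates require.
\<close>

theorem Ap_open:
  "\<exists>s D. 1 \<le> s \<and> s < p \<and> 0 < D \<and> (\<forall>x R E. R > 0 \<longrightarrow> E \<in> sets borel \<longrightarrow> E \<subseteq> cube x R \<longrightarrow>
     (measure lborel E / measure lborel (cube x R)) powr s * measure W (cube x R) \<le> D * measure W E)"
proof -
  obtain \<theta> D where th: "0 < \<theta>" "\<theta> \<le> 1" "0 < D" and dec: "\<And>a s x0 E. s > 0 \<Longrightarrow> E \<in> sets borel \<Longrightarrow> E \<subseteq> cell a s 0 x0 \<Longrightarrow>
     measure S E \<le> D * (measure lborel E / measure lborel (cell a s 0 x0)) powr \<theta> * measure S (cell a s 0 x0)"
    using dual_measure_decay by blast
  define q where "q = p - \<theta> * (p - 1)"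
  have q: "1 \<le> q" "q < p"
  proof -
    have "\<theta> * (p - 1) \<le> 1 * (p - 1)" using th p by (intro mult_right_mono) auto
    then show "1 \<le> q" by (simp add: q_def)
    show "q < p" using th p by (simp add: q_def)
  qed
  define D' where "D' = D powr (p - 1) * A"
  have "(measure lborel E / measure lborel (cube x R)) powr q * measure W (cube x R) \<le> D' * measure W E"
    if R: "R > 0" and E: "E \<in> sets borel" "E \<subseteq> cube x R" for x R E
  proof -
    define a where "a = x - R *\<^sub>R One"
    define s where "s = 2 * R"
    have s: "s > 0" using R by (simp add: s_def)
    define c where "c = cell a s 0 a"
    have low: "cell_low a s 0 a = a"
      unfolding cell_low_def cell_index_def by (simp add: euclidean_representation)
    have cube: "cube x R = cbox a (a + s *\<^sub>R One)"
    proof -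
      have e: "a + s *\<^sub>R One = x + R *\<^sub>R One" by (auto simp: a_def s_def euclidean_eq_iff[where 'a='a] inner_add_left inner_diff_left)
      show ?thesis by (simp only: cube_def a_def[symmetric] e)
    qed
    have cb: "c \<in> sets borel" by (simp add: c_def)
    have csub: "c \<subseteq> cube x R" using cell_boxes(2)[OF s, of a 0 a] by (simp add: c_def low cube)
    have box: "box a (a + s *\<^sub>R One) \<subseteq> c" using cell_boxes(1)[OF s, of a 0 a] by (simp add: c_def low)
    \<comment> \<open>the cube is closed and the cell half-open; they differ by a null set for both measures\<close>
    have N: "emeasure lborel (cube x R - c) = 0"
    proof -
      have "cube x R - c \<subseteq> cbox a (a + s *\<^sub>R One) - box a (a + s *\<^sub>R One)" using box by (auto simp: cube)
      then have "cube x R - c \<in> null_sets lborel"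
        using null_sets_subset[OF null_sets_cbox_Diff_box] cb cube_borel[of x R] by (metis sets.Diff sets_lborel)
      then show ?thesis by auto
    qed
    have eqM: "measure M (X \<inter> c) = measure M X" if "X \<in> sets borel" "X \<subseteq> cube x R" "M \<in> {lborel, W}" for X M
    proof -
      have sM: "sets M = sets borel" using that by auto
      have "emeasure lborel (X - c) \<le> emeasure lborel (cube x R - c)" using that cb by (intro emeasure_mono) auto
      then have "emeasure lborel (X - c) = 0" using N by simp
      then have "X - c \<in> null_sets M" using that cb null_WS(1)[of "X - c"] by (auto simp: null_sets_def)
      then have "emeasure M (X - (X - c)) = emeasure M X" using that sM by (intro emeasure_Diff_null_set) auto
      then show ?thesis by (simp add: measure_def Diff_Diff_Int)
    qed
    have cubeeq: "measure lborel c = measure lborel (cube x R)" "measure W c = measure W (cube x R)"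
      using eqM[of "cube x R" lborel] eqM[of "cube x R" W] csub by (auto simp: Int_absorb1)
    let ?E = "E \<inter> c"
    have E': "?E \<in> sets borel" "?E \<subseteq> cell a s 0 a" using E cb by (auto simp: c_def)
    note fE = sub_fin[OF s E']
    define u where "u = measure lborel ?E / measure lborel c"
    have cpos: "measure lborel c > 0" using s by (simp add: c_def measure_def emeasure_cell)
    have u0: "0 \<le> u" by (simp add: u_def)
    have "measure lborel ?E powr p \<le> measure W ?E * measure S ?E powr (p - 1)"
      by (rule holder_sets[OF E'(1) fE(1-3)])
    also have "\<dots> \<le> measure W ?E * (D * u powr \<theta> * measure S c) powr (p - 1)"
      using dec[OF s E'] p by (intro mult_left_mono powr_mono2) (auto simp: u_def c_def)
    finally have "measure lborel ?E powr p * measure W c \<le> measure W ?E * (D * u powr \<theta> * measure S c) powr (p - 1) * measure W c"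
      by (rule mult_right_mono) simp
    also have "\<dots> = measure W ?E * D powr (p - 1) * u powr (\<theta> * (p - 1)) * (measure W c * measure S c powr (p - 1))"
      using th u0 by (simp add: powr_mult powr_powr)
    also have "\<dots> \<le> measure W ?E * D powr (p - 1) * u powr (\<theta> * (p - 1)) * (A * measure lborel c powr p)"
      using Ap_cell[OF s, of a 0 a] unfolding c_def[symmetric] by (intro mult_left_mono) auto
    finally have main: "measure lborel ?E powr p * measure W c \<le> D' * measure W ?E * u powr (\<theta> * (p - 1)) * measure lborel c powr p"
      by (simp add: D'_def algebra_simps)
    have "u powr q * measure W c \<le> D' * measure W ?E"
    proof (cases "u = 0")
      case True then show ?thesis using A_pos th by (simp add: D'_def)
    next
      case False
      then have up: "u > 0" using u0 by simp
      have "measure lborel ?E = u * measure lborel c" using cpos by (simp add: u_def)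
      then have "measure lborel c powr p * (u powr p * measure W c) \<le> measure lborel c powr p * (D' * measure W ?E * u powr (\<theta> * (p - 1)))"
        using main u0 by (simp add: powr_mult algebra_simps)
      then have "u powr p * measure W c \<le> D' * measure W ?E * u powr (\<theta> * (p - 1))"
        by (rule mult_left_le_imp_le) (use cpos in simp)
      moreover have "u powr p = u powr q * u powr (\<theta> * (p - 1))" by (simp add: q_def powr_add[symmetric])
      ultimately have "(u powr q * measure W c) * u powr (\<theta> * (p - 1)) \<le> (D' * measure W ?E) * u powr (\<theta> * (p - 1))"
        by (simp add: algebra_simps)
      then show ?thesis by (rule mult_right_le_imp_le) (use up in simp)
    qed
    then show ?thesis using eqM[OF E, of lborel] eqM[OF E, of W] by (simp add: u_def cubeeq)
  qed
  moreover have "0 < D'" using th A_pos by (simp add: D'_def)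
  ultimately show ?thesis using q by blast
qed

end

section \<open>Weighted estimates for dyadic averages\<close>

lemma infnorm_diff_measurable [measurable]:
  "(\<lambda>p. infnorm (fst p - snd p :: 'a::euclidean_space)) \<in> borel_measurable (borel \<Otimes>\<^sub>M borel)"
proof -
  have "continuous_on UNIV (\<lambda>p::'a \<times> 'a. infnorm (fst p - snd p))" by (intro continuous_intros)
  then show ?thesis unfolding borel_prod by (rule borel_measurable_continuous_onI)
qed

lemma infnorm_diff_measurable1 [measurable]:
  "(\<lambda>x. infnorm (x - y :: 'a::euclidean_space)) \<in> borel_measurable borel"
  "(\<lambda>x. infnorm (y - x :: 'a::euclidean_space)) \<in> borel_measurable borel"
  by (intro borel_measurable_continuous_onI continuous_intros)+

lemma ennreal_mult_div_cancel:
  assumes "0 < v" "v < \<infinity>" shows "v * (a / v) = (a::ennreal)" "(a / v) * v = a"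
proof -
  have "v * (a / v) = a * v / v" by (simp add: ennreal_times_divide mult.commute)
  also have "\<dots> = a" by (rule mult_divide_eq_ennreal) (use assms in auto)
  finally show "v * (a / v) = a" .
  then show "(a / v) * v = a" by (simp only: mult.commute)
qed

text \<open>
  The \<open>A\<^sub>s\<close> condition tested only on indicators of subsets of cubes.
\<close>

locale restricted_Ap =
  fixes w :: "'a::euclidean_space \<Rightarrow> real" and s D :: real
  assumes w_borel [measurable]: "w \<in> borel_measurable borel" and w_pos: "\<And>x. w x > 0"
    and s: "1 \<le> s" and D: "0 < D"
    and W_fin0: "\<And>x R. R > 0 \<Longrightarrow> emeasure (density lborel (\<lambda>x. ennreal (w x))) (cube x R) < \<infinity>"
    and restricted0: "\<And>x R E. R > 0 \<Longrightarrow> E \<in> sets borel \<Longrightarrow> E \<subseteq> cube x R \<Longrightarrow>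
     (measure lborel E / measure lborel (cube x R)) powr s * measure (density lborel (\<lambda>x. ennreal (w x))) (cube x R)
       \<le> D * measure (density lborel (\<lambda>x. ennreal (w x))) E"
begin

definition W where "W = density lborel (\<lambda>x. ennreal (w x))"

lemma sets_W [simp, measurable_cong]: "sets W = sets borel" and space_W [simp]: "space W = UNIV"
  by (simp_all add: W_def)

lemmas W_fin = W_fin0[folded W_def] and restricted = restricted0[folded W_def]

lemma AE_W: "(AE x in W. P x) \<longleftrightarrow> (AE x in lborel. P x)"
  unfolding W_def by (subst AE_density) (auto simp: w_pos)

lemma W_cube_pos: "R > 0 \<Longrightarrow> measure W (cube x R) > 0"
proof -
  assume R: "R > 0"
  have "emeasure W (cube x R) \<noteq> 0"
  proof
    assume "emeasure W (cube x R) = 0"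
    then have "AE y in W. y \<notin> cube x R" by (subst AE_iff_measurable[of "cube x R"]) auto
    then have "AE y in lborel. y \<notin> cube x R" by (simp add: AE_W)
    then have "emeasure lborel (cube x R) = 0" by (subst (asm) AE_iff_measurable[of "cube x R"]) auto
    then show False using R by (simp add: emeasure_cube)
  qed
  then show ?thesis using W_fin[OF R, of x] by (simp add: measure_def enn2real_positive_iff less_top zero_less_iff_neq_zero)
qed

lemma W_cube_measurable [measurable]: "(\<lambda>y. emeasure W (cube y R)) \<in> borel_measurable borel"
proof -
  have "(\<lambda>y. emeasure W (cube y R)) = (\<lambda>y. \<integral>\<^sup>+z. ennreal (w z) * (if infnorm (y - z) \<le> R then 1 else 0) \<partial>lborel)"
    unfolding W_def by (auto simp: emeasure_density indicator_def mem_cube intro!: nn_integral_cong)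
  moreover have "(\<lambda>y. \<integral>\<^sup>+z. ennreal (w z) * (if infnorm (y - z) \<le> R then 1 else 0) \<partial>lborel) \<in> borel_measurable borel"
    by measurable
  ultimately show ?thesis by simp
qed

lemma lborel_cube_measurable [measurable]:
  assumes [measurable]: "E \<in> sets borel"
  shows "(\<lambda>x. emeasure lborel (E \<inter> cube x R)) \<in> borel_measurable borel"
proof -
  have "(\<lambda>x. emeasure lborel (E \<inter> cube x R)) = (\<lambda>x. \<integral>\<^sup>+z. indicator E z * (if infnorm (x - z) \<le> R then 1 else 0) \<partial>lborel)"
  proof
    fix x
    have "emeasure lborel (E \<inter> cube x R) = (\<integral>\<^sup>+z. indicator (E \<inter> cube x R) z \<partial>lborel)" by simp
    also have "\<dots> = (\<integral>\<^sup>+z. indicator E z * (if infnorm (x - z) \<le> R then 1 else 0) \<partial>lborel)"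
      by (intro nn_integral_cong) (auto simp: indicator_def mem_cube)
    finally show "emeasure lborel (E \<inter> cube x R) = (\<integral>\<^sup>+z. indicator E z * (if infnorm (x - z) \<le> R then 1 else 0) \<partial>lborel)" .
  qed
  moreover have "(\<lambda>x. \<integral>\<^sup>+z. indicator E z * (if infnorm (x - z) \<le> R then 1 else 0) \<partial>lborel) \<in> borel_measurable borel"
    by measurable
  ultimately show ?thesis by simp
qed

text \<open>
  Where \<open>E\<close> fills a large part of \<open>Q(x,R)\<close>, the hypothesis gives \<open>c W(Q(x,2R)) \<le> W(E \<inter> Q(x,R))\<close>. For \<open>y\<close> in
  \<open>Q(x,R)\<close> the cube \<open>Q(y,R)\<close> lies in \<open>Q(x,2R)\<close>, so the function \<open>H(x)\<close>, the integral of \<open>w(y)/W(Q(y,R))\<close> over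
  \<open>E \<inter> Q(x,R)\<close>, is at least \<open>c\<close> there. By Tonelli's theorem the integral of \<open>H\<close> with respect to \<open>W\<close> is exactly
  \<open>W(E)\<close>, and Markov's inequality concludes; no covering lemma enters.
\<close>

lemma weak_type_average:
  assumes R: "R > 0" and l: "l > 0" and E [measurable]: "E \<in> sets borel"
  shows "emeasure W {x. ennreal (l * R ^ DIM('a)) < emeasure lborel (E \<inter> cube x R)} \<le>
     ennreal (D * 4 powr (real DIM('a) * s) * l powr - s) * emeasure W E"
proof -
  define n where "n = DIM('a)"
  define V where "V y = emeasure W (cube y R)" for y
  have V: "0 < V y" "V y < \<infinity>" for y
    using W_cube_pos[OF R, of y] W_fin[OF R, of y] by (auto simp: V_def measure_def enn2real_positive_iff)
  have [measurable]: "V \<in> borel_measurable borel" unfolding V_def[abs_def] by measurable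
  define H where "H x = (\<integral>\<^sup>+y. indicator E y * (if infnorm (x - y) \<le> R then 1 else 0) * (ennreal (w y) / V y) \<partial>lborel)" for x
  have [measurable]: "H \<in> borel_measurable borel" unfolding H_def[abs_def] by measurable
  define c where "c = l powr s * 4 powr - (real n * s) / D"
  have c: "c > 0" using l D by (simp add: c_def)
  have sub: "{x. ennreal (l * R ^ n) < emeasure lborel (E \<inter> cube x R)} \<subseteq> {x \<in> space W. ennreal c \<le> H x}"
  proof safe
    fix x assume x: "ennreal (l * R ^ n) < emeasure lborel (E \<inter> cube x R)"
    let ?Q = "cube x (2 * R)" and ?F = "E \<inter> cube x R"
    have F: "?F \<in> sets borel" "?F \<subseteq> ?Q" using R by (auto simp: mem_cube)
    have finQ: "emeasure lborel ?Q < \<infinity>" using R by (simp add: emeasure_cube)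
    have finF: "emeasure lborel ?F < \<infinity>" using emeasure_mono[OF F(2), of lborel] finQ by (auto simp: le_less_trans)
    have finWQ: "emeasure W ?Q < \<infinity>" using W_fin R by simp
    have finWF: "emeasure W ?F < \<infinity>" using emeasure_mono[OF F(2), of W] finWQ by (auto simp: le_less_trans)
    have mQ: "measure lborel ?Q = (4 * R) ^ n" using R by (simp add: measure_def emeasure_cube n_def)
    have "l * R ^ n \<le> measure lborel ?F"
      using x finF by (simp add: emeasure_eq_ennreal_measure less_top ennreal_less_iff l R less_imp_le)
    then have "l / 4 ^ n \<le> measure lborel ?F / measure lborel ?Q"
      unfolding mQ using R by (simp add: power_mult_distrib field_simps)
    then have "(l / 4 ^ n) powr s \<le> (measure lborel ?F / measure lborel ?Q) powr s"
      using l s by (intro powr_mono2) auto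
    then have "(l / 4 ^ n) powr s * measure W ?Q \<le> D * measure W ?F"
      using restricted[OF _ F] R by (meson mult_right_mono measure_nonneg order_trans mult_pos_pos zero_less_numeral)
    moreover have "(l / 4 ^ n) powr s = c * D"
      using l D by (simp add: c_def powr_divide powr_realpow[symmetric] powr_powr powr_minus field_simps)
    ultimately have "c * measure W ?Q \<le> measure W ?F" using D by (simp add: mult.commute mult.left_commute)
    then have 1: "ennreal c * emeasure W ?Q \<le> emeasure W ?F"
      using finWQ finWF c by (simp add: emeasure_eq_ennreal_measure less_top ennreal_mult'[symmetric] ennreal_leI less_imp_le)
    have "ennreal c * emeasure W ?Q \<le> (\<integral>\<^sup>+y. ennreal (w y) * indicator ?F y \<partial>lborel)"
      using 1 F by (simp add: W_def emeasure_density)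
    also have "\<dots> \<le> (\<integral>\<^sup>+y. emeasure W ?Q * (indicator E y * (if infnorm (x - y) \<le> R then 1 else 0) * (ennreal (w y) / V y)) \<partial>lborel)"
    proof (intro nn_integral_mono)
      fix y
      show "ennreal (w y) * indicator ?F y \<le> emeasure W ?Q * (indicator E y * (if infnorm (x - y) \<le> R then 1 else 0) * (ennreal (w y) / V y))"
      proof (cases "y \<in> ?F")
        case True
        then have yR: "infnorm (x - y) \<le> R" by (simp add: mem_cube)
        have "cube y R \<subseteq> ?Q"
        proof
          fix z assume "z \<in> cube y R"
          then have "infnorm (y - z) \<le> R" by (simp add: mem_cube)
          then have "infnorm ((x - y) + (y - z)) \<le> R + R" using yR infnorm_triangle[of "x - y" "y - z"] by linarith
          then show "z \<in> ?Q" by (simp add: mem_cube)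
        qed
        then have "V y \<le> emeasure W ?Q" unfolding V_def by (intro emeasure_mono) auto
        then have "V y * (ennreal (w y) / V y) \<le> emeasure W ?Q * (ennreal (w y) / V y)" by (rule mult_right_mono) simp
        moreover have "V y * (ennreal (w y) / V y) = ennreal (w y)"
          by (rule ennreal_mult_div_cancel[OF V])
        ultimately show ?thesis using True yR by simp
      qed simp
    qed
    also have "\<dots> = emeasure W ?Q * H x" unfolding H_def by (rule nn_integral_cmult) measurable
    finally have "emeasure W ?Q * ennreal c \<le> emeasure W ?Q * H x" by (simp add: mult.commute)
    moreover have "0 < emeasure W ?Q" using W_cube_pos[of "2 * R" x] R by (simp add: measure_def enn2real_positive_iff)
    ultimately show "ennreal c \<le> H x" using finWQ by (simp add: ennreal_mult_le_mult_iff)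
  qed simp
  have "(\<integral>\<^sup>+x. H x \<partial>W) = (\<integral>\<^sup>+x. (\<integral>\<^sup>+y. ennreal (w x) * (indicator E y * (if infnorm (x - y) \<le> R then 1 else 0) * (ennreal (w y) / V y)) \<partial>lborel) \<partial>lborel)"
    unfolding W_def by (subst nn_integral_density) (auto simp: H_def nn_integral_cmult)
  also have "\<dots> = (\<integral>\<^sup>+y. (\<integral>\<^sup>+x. ennreal (w x) * (indicator E y * (if infnorm (x - y) \<le> R then 1 else 0) * (ennreal (w y) / V y)) \<partial>lborel) \<partial>lborel)"
    by (rule lborel_pair.Fubini'[symmetric]) measurable
  also have "\<dots> = (\<integral>\<^sup>+y. ennreal (w y) * indicator E y \<partial>lborel)"
  proof (intro nn_integral_cong)
    fix y
    have "(\<integral>\<^sup>+x. ennreal (w x) * (indicator E y * (if infnorm (x - y) \<le> R then 1 else 0) * (ennreal (w y) / V y)) \<partial>lborel)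
       = (\<integral>\<^sup>+x. (indicator E y * (ennreal (w y) / V y)) * (ennreal (w x) * indicator (cube y R) x) \<partial>lborel)"
      by (intro nn_integral_cong) (auto simp: indicator_def mem_cube infnorm_sub mult.commute)
    also have "\<dots> = (indicator E y * (ennreal (w y) / V y)) * V y"
      by (subst nn_integral_cmult) (auto simp: V_def W_def emeasure_density)
    also have "\<dots> = ennreal (w y) * indicator E y"
      unfolding mult.assoc ennreal_mult_div_cancel(2)[OF V] by (rule mult.commute)
    finally show "(\<integral>\<^sup>+x. ennreal (w x) * (indicator E y * (if infnorm (x - y) \<le> R then 1 else 0) * (ennreal (w y) / V y)) \<partial>lborel)
       = ennreal (w y) * indicator E y" .
  qed
  also have "\<dots> = emeasure W E" by (simp add: W_def emeasure_density)
  finally have int: "(\<integral>\<^sup>+x. H x \<partial>W) = emeasure W E" .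
  have "emeasure W {x. ennreal (l * R ^ n) < emeasure lborel (E \<inter> cube x R)} \<le> emeasure W {x \<in> space W. ennreal c \<le> H x}"
    by (rule emeasure_mono[OF sub]) measurable
  also have "{x \<in> space W. ennreal c \<le> H x} = {x \<in> space W. 1 \<le> ennreal (1 / c) * H x}"
  proof -
    have "ennreal c \<le> H x \<longleftrightarrow> 1 \<le> ennreal (1 / c) * H x" for x
    proof -
      have "ennreal c \<le> H x \<longleftrightarrow> ennreal (1 / c) * ennreal c \<le> ennreal (1 / c) * H x"
        using c by (subst ennreal_mult_le_mult_iff) auto
      then show ?thesis using c by (simp add: ennreal_mult'[symmetric])
    qed
    then show ?thesis by simp
  qed
  also have "emeasure W \<dots> \<le> ennreal (1 / c) * (\<integral>\<^sup>+x. H x * indicator UNIV x \<partial>W)"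
    using nn_integral_Markov_inequality[of H UNIV W "ennreal (1 / c)"] by simp
  also have "\<dots> = ennreal (1 / c) * emeasure W E" by (simp add: int)
  also have "1 / c = D * 4 powr (real n * s) * l powr - s"
    by (simp add: c_def powr_minus field_simps)
  finally show ?thesis by (simp add: n_def)
qed

text \<open>
  The level \<open>l\<close> is distributed over the scales in proportion to \<open>\<beta>\<^bsup>j/2\<^esup>\<close>; the other half of the weight \<open>\<beta>\<^sup>j\<close> makes
  the measures of the exceptional sets summable.
\<close>

lemma weak_type:
  assumes b: "0 < \<beta>" "\<beta> < 1"
  shows "\<exists>C>0. \<forall>E\<in>sets borel. \<forall>l>0. emeasure W {x. ennreal l < dyadic_op \<beta> (indicator E) x} \<le> ennreal (C * l powr - s) * emeasure W E"
proof -
  define g where "g = sqrt \<beta>"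
  have g: "0 < g" "g < 1" "g * g = \<beta>" using b by (auto simp: g_def real_sqrt_lt_1_iff)
  define C0 where "C0 = D * 4 powr (real DIM('a) * s)"
  have C0: "C0 > 0" using D by (simp add: C0_def)
  define C where "C = C0 * (1 - g) powr - s / (1 - g powr s)"
  have gs: "0 < g powr s" "g powr s < 1"
    using g s powr_less_mono2[of s g 1] by auto
  have "C > 0" using C0 g gs by (simp add: C_def)
  moreover have "emeasure W {x. ennreal l < dyadic_op \<beta> (indicator E) x} \<le> ennreal (C * l powr - s) * emeasure W E"
    if E [measurable]: "E \<in> sets borel" and l: "l > 0" for E l
  proof -
    define lj where "lj j = (1 - g) * l / g ^ j" for j
    have lj: "lj j > 0" for j using l g by (simp add: lj_def)
    define G where "G j = {x. ennreal (lj j * rad j ^ DIM('a)) < emeasure lborel (E \<inter> cube x (rad j))}" for j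
    have Gm: "G j \<in> sets borel" for j
    proof -
      have "{x \<in> space borel. ennreal (lj j * rad j ^ DIM('a)) < emeasure lborel (E \<inter> cube x (rad j))} \<in> sets borel"
        by measurable
      then show ?thesis by (simp add: G_def)
    qed
    have sub: "{x. ennreal l < dyadic_op \<beta> (indicator E) x} \<subseteq> (\<Union>j. G j)"
    proof (rule ccontr)
      assume "\<not> ?thesis"
      then obtain x where x: "ennreal l < dyadic_op \<beta> (indicator E) x" "\<And>j. x \<notin> G j" by auto
      have "dyadic_op \<beta> (indicator E) x = (\<Sum>j. ennreal (\<beta> ^ j / rad j ^ DIM('a)) * (\<integral>\<^sup>+y. indicator E y * indicator (cube x (rad j)) y \<partial>lborel))"
        by (rule dyadic_op_sum) measurable
      also have "\<dots> = (\<Sum>j. ennreal (\<beta> ^ j / rad j ^ DIM('a)) * emeasure lborel (E \<inter> cube x (rad j)))"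
        by (simp add: indicator_inter_arith[symmetric])
      also have "\<dots> \<le> (\<Sum>j. ennreal ((1 - g) * l * g ^ j))"
      proof (intro suminf_le summableI)
        fix j
        have "emeasure lborel (E \<inter> cube x (rad j)) \<le> ennreal (lj j * rad j ^ DIM('a))"
          using x(2)[of j] by (simp add: G_def not_less)
        then have "ennreal (\<beta> ^ j / rad j ^ DIM('a)) * emeasure lborel (E \<inter> cube x (rad j)) \<le>
           ennreal (\<beta> ^ j / rad j ^ DIM('a)) * ennreal (lj j * rad j ^ DIM('a))"
          by (rule mult_left_mono) simp
        also have "\<dots> = ennreal (\<beta> ^ j / rad j ^ DIM('a) * (lj j * rad j ^ DIM('a)))"
          using b lj[of j] rad_pos(1)[of j] by (intro ennreal_mult[symmetric]) (auto intro: less_imp_le)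
        also have "\<beta> ^ j / rad j ^ DIM('a) * (lj j * rad j ^ DIM('a)) = (1 - g) * l * g ^ j"
        proof -
          have "rad j \<noteq> 0" by (metis rad_pos(1) less_irrefl)
          then show ?thesis using g(1) by (simp add: lj_def g(3)[symmetric] power_mult_distrib)
        qed
        finally show "ennreal (\<beta> ^ j / rad j ^ DIM('a)) * emeasure lborel (E \<inter> cube x (rad j)) \<le> ennreal ((1 - g) * l * g ^ j)" .
      qed
      also have "\<dots> = ennreal (\<Sum>j. (1 - g) * l * g ^ j)"
        using g l by (intro suminf_ennreal2 summable_mult summable_geometric) auto
      also have "(\<Sum>j. (1 - g) * l * g ^ j) = l"
        using g by (subst suminf_mult) (auto simp: suminf_geometric)
      finally show False using x(1) by simp
    qed
    have "emeasure W {x. ennreal l < dyadic_op \<beta> (indicator E) x} \<le> emeasure W (\<Union>j. G j)"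
      using Gm by (intro emeasure_mono[OF sub]) auto
    also have "\<dots> \<le> (\<Sum>j. emeasure W (G j))"
      using Gm by (intro emeasure_subadditive_countably) auto
    also have "\<dots> \<le> (\<Sum>j. ennreal (C0 * (1 - g) powr - s * l powr - s * (g powr s) ^ j) * emeasure W E)"
    proof (intro suminf_le summableI)
      fix j
      have "emeasure W (G j) \<le> ennreal (C0 * lj j powr - s) * emeasure W E"
        unfolding G_def C0_def by (rule weak_type_average[OF rad_pos(1) lj E])
      also have "lj j powr - s = (1 - g) powr - s * l powr - s * (g powr s) ^ j"
      proof -
        have "(g ^ j) powr - s = inverse ((g powr s) ^ j)"
          using g by (simp add: powr_minus powr_realpow[symmetric] powr_powr mult.commute)
        moreover have "lj j powr - s = (1 - g) powr - s * l powr - s / (g ^ j) powr - s"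
          unfolding lj_def using g l by (subst powr_divide, simp, simp, subst powr_mult) simp_all
        ultimately show ?thesis by (simp add: divide_inverse)
      qed
      finally show "emeasure W (G j) \<le> ennreal (C0 * (1 - g) powr - s * l powr - s * (g powr s) ^ j) * emeasure W E"
        by (simp add: mult.assoc)
    qed
    also have "\<dots> = (\<Sum>j. ennreal (C0 * (1 - g) powr - s * l powr - s * (g powr s) ^ j)) * emeasure W E"
      by (rule ennreal_suminf_multc)
    also have "(\<Sum>j. ennreal (C0 * (1 - g) powr - s * l powr - s * (g powr s) ^ j)) = ennreal (\<Sum>j. C0 * (1 - g) powr - s * l powr - s * (g powr s) ^ j)"
      using gs C0 by (intro suminf_ennreal2 summable_mult summable_geometric) auto
    also have "(\<Sum>j. C0 * (1 - g) powr - s * l powr - s * (g powr s) ^ j) = C * l powr - s"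
      using gs by (subst suminf_mult) (auto simp: suminf_geometric C_def)
    finally show ?thesis .
  qed
  ultimately show ?thesis by blast
qed

end

lemma decr_rearrangement_le:
  "emeasure M {x \<in> space M. f x > l} \<le> ennreal t \<Longrightarrow> decr_rearrangement M f t \<le> l"
  unfolding decr_rearrangement_def by (rule Inf_lower) simp

text \<open>
  The infimum that defines the rearrangement is attained, by continuity of the measure from below.
\<close>

lemma emeasure_above_rearrangement:
  assumes [measurable]: "f \<in> borel_measurable M"
  shows "emeasure M {x \<in> space M. f x > decr_rearrangement M f t} \<le> ennreal t"
proof -
  let ?A = "{l. emeasure M {x \<in> space M. f x > l} \<le> ennreal t}"
  have "\<infinity> \<in> ?A" by simp
  then have "?A \<noteq> {}" by blast
  from ennreal_Inf_countable_INF[OF this]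
  obtain u :: "nat \<Rightarrow> ennreal" where u: "decseq u" "range u \<subseteq> ?A" "Inf ?A = (INF i. u i)"
    by (elim exE conjE)
  have "{x \<in> space M. f x > decr_rearrangement M f t} = (\<Union>i. {x \<in> space M. f x > u i})"
    unfolding decr_rearrangement_def u(3) by (auto simp: INF_less_iff)
  also have "emeasure M \<dots> = (SUP i. emeasure M {x \<in> space M. f x > u i})"
    using u(1) by (intro SUP_emeasure_incseq[symmetric]) (auto simp: incseq_def decseq_def intro: le_less_trans)
  also have "\<dots> \<le> ennreal t" using u(2) by (intro SUP_least) auto
  finally show ?thesis .
qed

context restricted_Ap begin

text \<open>
  Almost everywhere \<open>f \<le> f\<^sup>*(t) + (\<Sum>k. f\<^sup>*(t/2\<^bsup>k+1\<^esup>) 1\<^bsub>E k\<^esub>)\<close>, where \<open>E k\<close> is the set of all \<open>x\<close> with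
  \<open>f x > f\<^sup>*(t/2\<^sup>k)\<close>, of measure at most \<open>t/2\<^sup>k\<close>. The operator maps constants to constants, and by
  the weak type bound its value at \<open>1\<^bsub>E k\<^esub>\<close> exceeds \<open>c 2\<^bsup>-k/s'\<^esup>\<close> only on a set of measure at most \<open>t(1 - q)q\<^sup>k\<close>, with
  \<open>q < 1\<close> thanks to \<open>s < s'\<close>. Outside exceptional sets of total measure at most \<open>t\<close> the claimed bound holds pointwise.
\<close>

lemma rearrangement_dyadic_op:
  assumes b: "0 < \<beta>" "\<beta> < 1" and s': "s < s'"
  shows "\<exists>B>0. \<forall>f\<in>borel_measurable borel. \<forall>t>0. decr_rearrangement W (dyadic_op \<beta> f) t \<le>
     ennreal B * (decr_rearrangement W f t + (\<Sum>k. ennreal ((1/2) powr (real k / s')) * decr_rearrangement W f (t / 2 ^ Suc k)))"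
proof -
  obtain C where C: "C > 0" and weak: "\<And>E l. E \<in> sets borel \<Longrightarrow> l > 0 \<Longrightarrow>
     emeasure W {x. ennreal l < dyadic_op \<beta> (indicator E) x} \<le> ennreal (C * l powr - s) * emeasure W E"
    using weak_type[OF b] by blast
  define q where "q = (1/2::real) powr (1 - s / s')"
  have q: "0 < q" "q < 1" using s s' powr_less_mono'[of "1/2::real" 0 "1 - s / s'"] by (auto simp: q_def)
  \<comment> \<open>makes the bounds for the measures of the exceptional sets below add up to \<open>t\<close>\<close>
  define c where "c = (C / (1 - q)) powr (1 / s)"
  have c: "c > 0" using C q by (simp add: c_def)
  have cs: "C * c powr - s = 1 - q"
    using C q s by (simp add: c_def powr_powr powr_minus)
  define m where "m = dyadic_mass \<beta> TYPE('a)"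
  have m: "m > 0" using b by (simp add: m_def dyadic_mass_def)
  define B where "B = m + c"
  have "decr_rearrangement W (dyadic_op \<beta> f) t \<le>
     ennreal B * (decr_rearrangement W f t + (\<Sum>k. ennreal ((1/2) powr (real k / s')) * decr_rearrangement W f (t / 2 ^ Suc k)))"
    if f [measurable]: "f \<in> borel_measurable borel" and t: "t > 0" for f t
  proof -
    define L where "L k = decr_rearrangement W f (t / 2 ^ k)" for k
    define E where "E k = {x. f x > L k}" for k
    have Eb [measurable]: "E k \<in> sets borel" for k
    proof -
      have "{x \<in> space borel. f x > L k} \<in> sets borel" by measurable
      then show ?thesis by (simp add: E_def)
    qed
    have WE: "emeasure W (E k) \<le> ennreal (t / 2 ^ k)" for k
      using emeasure_above_rearrangement[of f W "t / 2 ^ k"] by (simp add: E_def L_def)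
    have ninf: "AE x in lborel. \<exists>k. x \<notin> E k"
    proof -
      have "emeasure W (\<Inter>k. E k) \<le> ennreal e" if e: "e > 0" for e
      proof -
        obtain k where "t / e < 2 ^ k" using real_arch_pow[of 2] by auto
        then have "t / 2 ^ k \<le> e" using e by (simp add: field_simps)
        have "emeasure W (\<Inter>k. E k) \<le> emeasure W (E k)" by (intro emeasure_mono) auto
        also have "\<dots> \<le> ennreal e" using WE[of k] \<open>t / 2 ^ k \<le> e\<close> by (meson ennreal_leI order_trans)
        finally show ?thesis .
      qed
      then have "emeasure W (\<Inter>k. E k) \<le> 0 + ennreal e" if "e > 0" for e using that by simp
      then have "emeasure W (\<Inter>k. E k) \<le> 0" by (rule ennreal_le_epsilon)
      then have "AE x in W. x \<notin> (\<Inter>k. E k)"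
        by (subst AE_iff_measurable[of "\<Inter>k. E k"]) auto
      then show ?thesis by (simp add: AE_W)
    qed
    have split: "f x \<le> L 0 + (\<Sum>k. L (Suc k) * indicator (E k) x)" if "\<exists>k. x \<notin> E k" for x
    proof -
      define k where "k = (LEAST k. x \<notin> E k)"
      have k: "x \<notin> E k" unfolding k_def by (rule LeastI_ex[OF that])
      show ?thesis
      proof (cases k)
        case 0
        then have "f x \<le> L 0" using k by (simp add: E_def not_less)
        then show ?thesis by (simp add: add_increasing2)
      next
        case (Suc j)
        then have "x \<in> E j" using not_less_Least[of j "\<lambda>k. x \<notin> E k"] by (simp add: k_def)
        have "f x \<le> L (Suc j) * indicator (E j) x" using k Suc \<open>x \<in> E j\<close> by (simp add: E_def not_less)
        also have "\<dots> \<le> (\<Sum>k. L (Suc k) * indicator (E k) x)" by (rule ennreal_le_suminf)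
        finally show ?thesis by (simp add: add_increasing)
      qed
    qed
    have U: "dyadic_op \<beta> f x \<le> ennreal m * L 0 + (\<Sum>k. L (Suc k) * dyadic_op \<beta> (indicator (E k)) x)" for x
    proof -
      have "dyadic_op \<beta> f x \<le> dyadic_op \<beta> (\<lambda>x. L 0 + (\<Sum>k. L (Suc k) * indicator (E k) x)) x"
        using ninf by (intro dyadic_op_mono_AE) (auto elim!: eventually_mono intro: split)
      also have "\<dots> = dyadic_op \<beta> (\<lambda>_. L 0) x + dyadic_op \<beta> (\<lambda>x. \<Sum>k. L (Suc k) * indicator (E k) x) x"
        by (rule dyadic_op_add) measurable
      also have "dyadic_op \<beta> (\<lambda>x. \<Sum>k. L (Suc k) * indicator (E k) x) x = (\<Sum>k. dyadic_op \<beta> (\<lambda>x. L (Suc k) * indicator (E k) x) x)"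
        by (rule dyadic_op_suminf) measurable
      also have "\<dots> = (\<Sum>k. L (Suc k) * dyadic_op \<beta> (indicator (E k)) x)"
        by (intro arg_cong[where f = suminf] ext dyadic_op_cmult) measurable
      finally show ?thesis using b by (simp add: dyadic_op_const m_def)
    qed
    define l where "l k = c * (1/2) powr (real k / s')" for k
    have l: "l k > 0" for k using c by (simp add: l_def)
    define F where "F k = {x. ennreal (l k) < dyadic_op \<beta> (indicator (E k)) x}" for k
    have Fb: "F k \<in> sets borel" for k
    proof -
      have "{x \<in> space borel. ennreal (l k) < dyadic_op \<beta> (indicator (E k)) x} \<in> sets borel" by measurable
      then show ?thesis by (simp add: F_def)
    qed
    have WF: "emeasure W (\<Union>k. F k) \<le> ennreal t"
    proof -
      have "emeasure W (\<Union>k. F k) \<le> (\<Sum>k. emeasure W (F k))"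
        using Fb by (intro emeasure_subadditive_countably) auto
      also have "\<dots> \<le> (\<Sum>k. ennreal (t * (1 - q) * q ^ k))"
      proof (intro suminf_le summableI)
        fix k
        have "emeasure W (F k) \<le> ennreal (C * l k powr - s) * emeasure W (E k)"
          unfolding F_def by (rule weak[OF Eb l])
        also have "\<dots> \<le> ennreal (C * l k powr - s) * ennreal (t / 2 ^ k)" by (intro mult_left_mono WE) simp
        also have "\<dots> = ennreal (C * l k powr - s * (t / 2 ^ k))" using C t by (intro ennreal_mult[symmetric]) auto
        also have "C * l k powr - s * (t / 2 ^ k) = t * (C * c powr - s) * (((1/2) powr (real k / s')) powr - s * (1/2) ^ k)"
          using c by (simp add: l_def powr_mult power_divide)
        also have "((1/2::real) powr (real k / s')) powr - s * (1/2) ^ k = q ^ k"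
        proof -
          have h: "(1/2::real) ^ k = (1/2) powr real k" by (simp add: powr_realpow)
          have "((1/2::real) powr (real k / s')) powr - s * (1/2) ^ k = (1/2) powr (real k / s' * - s + real k)"
            by (simp only: h powr_powr powr_add)
          also have "\<dots> = q ^ k" by (simp add: q_def powr_realpow[symmetric] powr_powr algebra_simps)
          finally show ?thesis .
        qed
        finally show "emeasure W (F k) \<le> ennreal (t * (1 - q) * q ^ k)" by (simp add: cs)
      qed
      also have "\<dots> = ennreal (\<Sum>k. t * (1 - q) * q ^ k)"
        using q t by (intro suminf_ennreal2 summable_mult summable_geometric) auto
      also have "(\<Sum>k. t * (1 - q) * q ^ k) = t" using q by (subst suminf_mult) (auto simp: suminf_geometric)
      finally show ?thesis .
    qed
    define Z where "Z = ennreal B * (L 0 + (\<Sum>k. ennreal ((1/2) powr (real k / s')) * L (Suc k)))"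
    have "dyadic_op \<beta> f x \<le> Z" if "x \<notin> (\<Union>k. F k)" for x
    proof -
      have "dyadic_op \<beta> f x \<le> ennreal m * L 0 + (\<Sum>k. L (Suc k) * dyadic_op \<beta> (indicator (E k)) x)" by (rule U)
      also have "\<dots> \<le> ennreal B * L 0 + (\<Sum>k. ennreal B * (ennreal ((1/2) powr (real k / s')) * L (Suc k)))"
      proof (intro add_mono suminf_le summableI)
        show "ennreal m * L 0 \<le> ennreal B * L 0" using m c by (intro mult_right_mono ennreal_leI) (auto simp: B_def)
        fix k
        have "dyadic_op \<beta> (indicator (E k)) x \<le> ennreal (l k)" using that by (auto simp: F_def not_less)
        also have "\<dots> \<le> ennreal (B * (1/2) powr (real k / s'))" using m by (intro ennreal_leI) (simp add: l_def B_def)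
        also have "\<dots> = ennreal B * ennreal ((1/2) powr (real k / s'))" using m c by (intro ennreal_mult) (auto simp: B_def)
        finally have "L (Suc k) * dyadic_op \<beta> (indicator (E k)) x \<le> L (Suc k) * (ennreal B * ennreal ((1/2) powr (real k / s')))"
          by (rule mult_left_mono) simp
        then show "L (Suc k) * dyadic_op \<beta> (indicator (E k)) x \<le> ennreal B * (ennreal ((1/2) powr (real k / s')) * L (Suc k))"
          by (simp add: ac_simps)
      qed
      also have "\<dots> = Z" by (simp add: Z_def distrib_left ennreal_suminf_cmult)
      finally show ?thesis .
    qed
    then have "{x \<in> space W. dyadic_op \<beta> f x > Z} \<subseteq> (\<Union>k. F k)" by (auto simp: not_less[symmetric])
    then have "emeasure W {x \<in> space W. dyadic_op \<beta> f x > Z} \<le> emeasure W (\<Union>k. F k)"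
      using Fb by (intro emeasure_mono) auto
    then have "emeasure W {x \<in> space W. dyadic_op \<beta> f x > Z} \<le> ennreal t"
      using WF by (rule order_trans)
    then have "decr_rearrangement W (dyadic_op \<beta> f) t \<le> Z" by (rule decr_rearrangement_le)
    then show ?thesis by (simp add: Z_def L_def)
  qed
  moreover have "B > 0" using m c by (simp add: B_def)
  ultimately show ?thesis by blast
qed

end

section \<open>Dilations and Boyd indices on the half line\<close>

lemma space_half_line [simp]: "space half_line = {0<..}"
  by (simp add: space_restrict_space)

lemma sets_half_line: "A \<in> sets half_line \<longleftrightarrow> A \<in> sets lebesgue \<and> A \<subseteq> {0<..}"
  by (auto simp: sets_restrict_space_iff)

lemma emeasure_half_line: "A \<subseteq> {0<..} \<Longrightarrow> emeasure half_line A = emeasure lebesgue A"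
  by (rule emeasure_restrict_space) simp_all

lemma antimono_half_line_measurable:
  fixes g :: "real \<Rightarrow> ennreal"
  assumes "\<And>s t. 0 < s \<Longrightarrow> s \<le> t \<Longrightarrow> g t \<le> g s"
  shows "g \<in> borel_measurable half_line"
proof (rule borel_measurableI_greater)
  fix l
  have "is_interval {s \<in> {0<..}. l < g s}"
    unfolding is_interval_1 by (auto intro: less_le_trans assms)
  then have "{s \<in> {0<..}. l < g s} \<in> sets borel" by (rule real_interval_borel_measurable)
  then show "{s \<in> space half_line. l < g s} \<in> sets half_line"
    unfolding sets_half_line by (auto simp: greaterThan_def)
qed

lemma decr_rearrangement_antimono: "s \<le> t \<Longrightarrow> decr_rearrangement M f t \<le> decr_rearrangement M f s"
  unfolding decr_rearrangement_def
  by (intro Inf_superset_mono) (auto intro: order_trans ennreal_leI)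

lemma decr_rearrangement_measurable [measurable]: "decr_rearrangement M f \<in> borel_measurable half_line"
  by (intro antimono_half_line_measurable decr_rearrangement_antimono)

lemma less_decr_rearrangement_iff:
  assumes [measurable]: "f \<in> borel_measurable M"
  shows "l < decr_rearrangement M f t \<longleftrightarrow> ennreal t < emeasure M {x \<in> space M. f x > l}"
proof
  assume "l < decr_rearrangement M f t"
  then show "ennreal t < emeasure M {x \<in> space M. f x > l}"
    using decr_rearrangement_le[where M = M and f = f and l = l and t = t] by (meson not_le)
next
  assume t: "ennreal t < emeasure M {x \<in> space M. f x > l}"
  show "l < decr_rearrangement M f t"
  proof (rule ccontr)
    assume "\<not> l < decr_rearrangement M f t"
    then have "{x \<in> space M. f x > l} \<subseteq> {x \<in> space M. f x > decr_rearrangement M f t}" by auto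
    then have "emeasure M {x \<in> space M. f x > l} \<le> emeasure M {x \<in> space M. f x > decr_rearrangement M f t}"
      by (rule emeasure_mono) measurable
    also have "\<dots> \<le> ennreal t" by (rule emeasure_above_rearrangement[OF assms])
    finally have "emeasure M {x \<in> space M. f x > l} \<le> ennreal t" .
    then show False using t by simp
  qed
qed

lemma emeasure_lebesgue_initial: "emeasure lebesgue {s::real. 0 < s \<and> ennreal s < m} = m"
proof (cases m rule: ennreal_cases)
  case (real r)
  then have "{s::real. 0 < s \<and> ennreal s < m} = {0<..<r}" by (auto simp: ennreal_less_iff)
  then show ?thesis using real by simp
next
  case top
  have "emeasure lebesgue {s::real. 0 < s \<and> ennreal s < m} = emeasure lebesgue {0::real<..}"
    using top by (intro arg_cong[where f = "emeasure lebesgue"]) auto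
  moreover have "emeasure lebesgue {0::real<..} = \<infinity>"
  proof -
    have "of_nat n \<le> emeasure lborel {0::real<..}" for n :: nat
    proof -
      have "of_nat n = emeasure lborel {0<..<real n}" by (simp add: ennreal_of_nat_eq_real_of_nat)
      also have "\<dots> \<le> emeasure lborel {0::real<..}" by (intro emeasure_mono) auto
      finally show ?thesis .
    qed
    then have "emeasure lborel {0::real<..} = top"
    proof (cases "emeasure lborel {0::real<..}" rule: ennreal_cases)
      case (real r)
      obtain n :: nat where n: "r < real n" using reals_Archimedean2 by blast
      have "ennreal (real n) \<le> ennreal r"
        using \<open>\<And>n. of_nat n \<le> emeasure lborel {0::real<..}\<close>[of n] real by (simp add: ennreal_of_nat_eq_real_of_nat)
      then show ?thesis using n real by (simp add: ennreal_le_iff)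
    qed
    then show ?thesis by simp
  qed
  ultimately show ?thesis using top by simp
qed

lemma emeasure_decr_rearrangement:
  assumes "f \<in> borel_measurable M"
  shows "emeasure half_line {s \<in> space half_line. decr_rearrangement M f s > l} = emeasure M {x \<in> space M. f x > l}"
proof -
  have "{s \<in> space half_line. decr_rearrangement M f s > l} = {s. 0 < s \<and> ennreal s < emeasure M {x \<in> space M. f x > l}}"
    using less_decr_rearrangement_iff[OF assms] by auto
  then show ?thesis by (subst emeasure_half_line) (auto simp: emeasure_lebesgue_initial)
qed

lemma dilation_level:
  fixes f :: "real \<Rightarrow> 'b::topological_space"
  assumes f: "f \<in> borel_measurable half_line" and c: "c > 0"
  shows "(\<lambda>s. f (s / c)) \<in> borel_measurable half_line"
    and "B \<in> sets borel \<Longrightarrow> emeasure half_line {s \<in> space half_line. f (s / c) \<in> B} = ennreal c * emeasure half_line {s \<in> space half_line. f s \<in> B}"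
proof -
  have key: "{s \<in> {0<..}. f (s / c) \<in> B} \<in> sets lebesgue \<and>
     emeasure lebesgue {s \<in> {0<..}. f (s / c) \<in> B} = ennreal c * emeasure lebesgue {s \<in> {0<..}. f s \<in> B}"
    if B: "B \<in> sets borel" for B
  proof -
    let ?A = "{s \<in> {0<..}. f s \<in> B}"
    have "f -` B \<inter> space half_line \<in> sets half_line" by (rule measurable_sets[OF f B])
    moreover have "f -` B \<inter> space half_line = ?A" by auto
    ultimately have A: "?A \<in> sets lebesgue" by (simp add: sets_half_line)
    have eq: "{s \<in> {0<..}. f (s / c) \<in> B} = (*\<^sub>R) (1 / c) -` ?A \<inter> space lebesgue"
      using c by (auto simp: divide_simps)
    have m: "{s \<in> {0<..}. f (s / c) \<in> B} \<in> sets lebesgue"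
      unfolding eq by (rule measurable_sets[OF lebesgue_measurable_scaling A])
    have "emeasure lebesgue {s \<in> {0<..}. f (s / c) \<in> B} = (\<integral>\<^sup>+x. indicator {s \<in> {0<..}. f (s / c) \<in> B} x \<partial>lebesgue)"
      using m by simp
    also have "\<dots> = ennreal \<bar>c\<bar> * (\<integral>\<^sup>+x. indicator {s \<in> {0<..}. f (s / c) \<in> B} (0 + c * x) \<partial>lebesgue)"
      using m c by (intro nn_integral_real_affine_lebesgue) auto
    also have "(\<lambda>x. indicator {s \<in> {0<..}. f (s / c) \<in> B} (0 + c * x) :: ennreal) = indicator ?A"
      using c by (auto simp: indicator_def fun_eq_iff zero_less_mult_iff)
    finally show ?thesis using m A c by simp
  qed
  show "(\<lambda>s. f (s / c)) \<in> borel_measurable half_line"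
  proof (rule measurableI)
    fix B :: "'b set" assume "B \<in> sets borel"
    moreover have "(\<lambda>s. f (s / c)) -` B \<inter> space half_line = {s \<in> {0<..}. f (s / c) \<in> B}" by auto
    ultimately show "(\<lambda>s. f (s / c)) -` B \<inter> space half_line \<in> sets half_line"
      using key[of B] by (auto simp: sets_half_line)
  qed simp
  show "emeasure half_line {s \<in> space half_line. f (s / c) \<in> B} = ennreal c * emeasure half_line {s \<in> space half_line. f s \<in> B}"
    if "B \<in> sets borel"
    using key[OF that] by (simp add: emeasure_half_line[of "{s. 0 < s \<and> f s \<in> B}"] emeasure_half_line[of "{s. 0 < s \<and> f (s / c) \<in> B}"] subset_eq)
qed

lemma dilation_distribution:
  fixes f :: "real \<Rightarrow> ennreal"
  assumes "f \<in> borel_measurable half_line" "c > 0"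
  shows "emeasure half_line {s \<in> space half_line. f (s / c) > l} = ennreal c * emeasure half_line {s \<in> space half_line. f s > l}"
  using dilation_level(2)[OF assms, of "{l<..}"] by simp

locale ri_half_line =
  fixes N :: "(real \<Rightarrow> ennreal) \<Rightarrow> ennreal"
  assumes ri: "ri_banach_norm half_line N"
begin

abbreviation "HM \<equiv> borel_measurable half_line :: (real \<Rightarrow> ennreal) set"

lemma N_zero: "f \<in> HM \<Longrightarrow> N f = 0 \<longleftrightarrow> (AE x in half_line. f x = 0)"
  and N_add: "f \<in> HM \<Longrightarrow> g \<in> HM \<Longrightarrow> N (\<lambda>x. f x + g x) \<le> N f + N g"
  and N_cmult: "f \<in> HM \<Longrightarrow> a \<ge> 0 \<Longrightarrow> N (\<lambda>x. ennreal a * f x) = ennreal a * N f"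
  and N_mono: "f \<in> HM \<Longrightarrow> g \<in> HM \<Longrightarrow> (AE x in half_line. f x \<le> g x) \<Longrightarrow> N f \<le> N g"
  and N_lim: "(\<And>k::nat. F k \<in> HM) \<Longrightarrow> f \<in> HM \<Longrightarrow> (AE x in half_line. incseq (\<lambda>k. F k x) \<and> (\<lambda>k. F k x) \<longlonglongrightarrow> f x) \<Longrightarrow> (\<lambda>k. N (F k)) \<longlonglongrightarrow> N f"
  and N_indicator: "E \<in> sets half_line \<Longrightarrow> emeasure half_line E < \<infinity> \<Longrightarrow> N (indicator E) < \<infinity>"
  and N_equi: "f \<in> HM \<Longrightarrow> g \<in> HM \<Longrightarrow> equimeasurable half_line f g \<Longrightarrow> N f = N g"
  using ri unfolding ri_banach_norm_def by blast+

lemma N_mono': "f \<in> HM \<Longrightarrow> g \<in> HM \<Longrightarrow> (\<And>x. x > 0 \<Longrightarrow> f x \<le> g x) \<Longrightarrow> N f \<le> N g"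
  by (rule N_mono) (auto intro!: AE_I2)

lemma N_rearr: "f \<in> HM \<Longrightarrow> N (decr_rearrangement half_line f) = N f"
  by (rule N_equi) (auto simp: equimeasurable_def emeasure_decr_rearrangement[of f, simplified])

lemma N_distribution:
  assumes "f \<in> HM" "g \<in> HM"
    and "\<And>l. emeasure half_line {s \<in> space half_line. f s > l} \<le> emeasure half_line {s \<in> space half_line. g s > l}"
  shows "N f \<le> N g"
proof -
  have "decr_rearrangement half_line f t \<le> decr_rearrangement half_line g t" for t
    unfolding decr_rearrangement_def using assms(3) by (intro Inf_superset_mono) (auto intro: order_trans)
  then have "N (decr_rearrangement half_line f) \<le> N (decr_rearrangement half_line g)"
    by (intro N_mono') auto
  then show ?thesis using assms by (simp add: N_rearr)
qed

lemma N_suminf: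
  assumes [measurable]: "\<And>k. F k \<in> HM"
  shows "N (\<lambda>x. \<Sum>k. F k x) \<le> (\<Sum>k. N (F k))"
proof -
  have z: "N (\<lambda>_. 0) = 0" by (subst N_zero) auto
  have fin: "N (\<lambda>x. \<Sum>k<n. F k x) \<le> (\<Sum>k<n. N (F k))" for n
  proof (induction n)
    case (Suc n)
    have "N (\<lambda>x. (\<Sum>k<n. F k x) + F n x) \<le> N (\<lambda>x. \<Sum>k<n. F k x) + N (F n)" by (rule N_add) measurable
    also have "\<dots> \<le> (\<Sum>k<n. N (F k)) + N (F n)" using Suc by (rule add_right_mono)
    finally show ?case by simp
  qed (simp add: z)
  have "(\<lambda>n. N (\<lambda>x. \<Sum>k<n. F k x)) \<longlonglongrightarrow> N (\<lambda>x. \<Sum>k. F k x)"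
    by (rule N_lim) (auto simp: incseq_def intro!: sum_mono2 summable_LIMSEQ)
  then show ?thesis
    by (rule LIMSEQ_le_const2) (auto intro!: exI[of _ 0] order_trans[OF fin] sum_le_suminf)
qed

lemma N_finite_AE:
  assumes [measurable]: "f \<in> HM" and "N f < \<infinity>"
  shows "AE x in half_line. f x < \<infinity>"
proof -
  define E where "E = {x \<in> space half_line. f x = \<infinity>}"
  have E [measurable]: "E \<in> sets half_line" unfolding E_def by measurable
  have i: "(indicator E :: real \<Rightarrow> ennreal) \<in> HM" by measurable
  have "of_nat n * N (indicator E) \<le> N f" for n :: nat
  proof -
    have "of_nat n * N (indicator E) = N (\<lambda>x. ennreal (real n) * indicator E x)"
      by (subst N_cmult[OF i]) (auto simp: ennreal_of_nat_eq_real_of_nat)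
    also have "\<dots> \<le> N f"
    proof (rule N_mono')
      show "(\<lambda>x. ennreal (real n) * indicator E x) \<in> HM" by measurable
    qed (auto simp: E_def indicator_def)
    finally show ?thesis .
  qed
  then have "N (indicator E) = 0"
  proof (intro ccontr[of "N (indicator E) = 0"])
    assume le: "\<And>n::nat. of_nat n * N (indicator E) \<le> N f" and nz: "N (indicator E) \<noteq> 0"
    obtain r where r: "N f = ennreal r" "r \<ge> 0" using assms(2) by (cases "N f") auto
    show False
    proof (cases "N (indicator E)" rule: ennreal_cases)
      case (real e)
      then have e: "e > 0" using nz by (cases "e = 0") auto
      obtain n :: nat where "r / e < real n" using reals_Archimedean2 by blast
      then have "r < real n * e" using e by (simp add: field_simps)
      moreover have "ennreal (real n * e) \<le> ennreal r"
        using le[of n] real r by (simp add: ennreal_of_nat_eq_real_of_nat ennreal_mult)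
      ultimately show False using r by (simp add: ennreal_le_iff)
    next
      case top
      then show False using le[of 1] assms(2) by simp
    qed
  qed
  then have "AE x in half_line. indicator E x = (0::ennreal)" using N_zero[OF i] by simp
  then show ?thesis using AE_space by eventually_elim (auto simp: E_def indicator_def less_top split: if_splits)
qed

lemma dilation_mono:
  assumes f: "f \<in> HM" and st: "0 < s" "s \<le> t"
  shows "N (\<lambda>x. f (x / s)) \<le> N (\<lambda>x. f (x / t))"
proof (rule N_distribution)
  show "(\<lambda>x. f (x / s)) \<in> HM" "(\<lambda>x. f (x / t)) \<in> HM" using f st by (auto intro: dilation_level)
  show "emeasure half_line {x \<in> space half_line. l < f (x / s)} \<le> emeasure half_line {x \<in> space half_line. l < f (x / t)}" for l
    using st dilation_distribution[OF f, of s l] dilation_distribution[OF f, of t l]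
    by (auto intro!: mult_right_mono ennreal_leI)
qed

text \<open>
  Only a finite bound matters, and it makes all dilation norms finite. Replace \<open>f\<close> by its decreasing rearrangement
  \<open>g\<close>. On \<open>(2\<^bsup>k+1\<^esup>, 2\<^bsup>k+2\<^esup>]\<close> the dilate of \<open>g\<close> is at most \<open>g(2\<^sup>k)\<close>. The quarters \<open>I i k\<close> of this interval are as
  long as \<open>J k = (2\<^bsup>k-1\<^esup>, 2\<^sup>k]\<close>, on which \<open>g \<ge> g(2\<^sup>k)\<close>. So the part of the majorant that lives on the \<open>i\<close>-th
  quarters has a distribution function no larger than that of \<open>g\<close>, and there are four such parts.
\<close>

lemma dilation_2:
  assumes f: "f \<in> HM"
  shows "N (\<lambda>x. f (x / 2)) \<le> 4 * N f"
proof -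
  define g where "g = decr_rearrangement half_line f"
  have g [measurable]: "g \<in> HM" by (simp add: g_def)
  have anti: "s \<le> t \<Longrightarrow> g t \<le> g s" for s t unfolding g_def by (rule decr_rearrangement_antimono)
  have "N (\<lambda>x. f (x / 2)) = N (\<lambda>x. g (x / 2))"
  proof (rule N_equi)
    show "(\<lambda>x. f (x / 2)) \<in> HM" "(\<lambda>x. g (x / 2)) \<in> HM" using f g by (auto intro!: dilation_level)
    show "equimeasurable half_line (\<lambda>x. f (x / 2)) (\<lambda>x. g (x / 2))"
      unfolding equimeasurable_def
      using dilation_distribution[OF f, of 2] dilation_distribution[OF g, of 2] emeasure_decr_rearrangement[OF f]
      by (simp add: g_def)
  qed
  define I :: "nat \<Rightarrow> int \<Rightarrow> real set" where
    "I i k = {2 powr (of_int k + 1) + real i * 2 powr (of_int k - 1) <.. 2 powr (of_int k + 1) + (real i + 1) * 2 powr (of_int k - 1)}" for i k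
  define G where "G i s = (SUP k. g (2 powr (of_int k)) * indicator (I i k) s)" for i s
  have Ib [measurable]: "I i k \<in> sets half_line" for i k
  proof -
    have "0 < 2 powr (real_of_int k + 1) + real i * 2 powr (real_of_int k - 1)" by (intro add_pos_nonneg) auto
    then show ?thesis unfolding sets_half_line by (auto simp: I_def)
  qed
  have G [measurable]: "G i \<in> HM" for i
    unfolding G_def[abs_def] by (intro borel_measurable_SUP) (auto intro!: measurable_const borel_measurable_times_ennreal borel_measurable_indicator Ib)
  have cover: "g (x / 2) \<le> G 0 x + (G 1 x + (G 2 x + G 3 x))" if x: "x > 0" for x
  proof -
    define k where "k = \<lceil>log 2 x\<rceil> - 2"
    have c: "of_int k + 1 < log 2 x" "log 2 x \<le> of_int k + 2" unfolding k_def by linarith+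
    have lo: "2 powr (of_int k + 1) < x"
      using powr_less_mono[OF c(1), of 2] x by simp
    have hi: "x \<le> 2 powr (of_int k + 2)"
      using powr_mono[OF c(2), of 2] x by simp
    have p: "2 powr (real_of_int k + 1) = 4 * 2 powr (of_int k - 1)" "2 powr (real_of_int k + 2) = 8 * 2 powr (of_int k - 1)"
      "2 powr (real_of_int k) = 2 * 2 powr (of_int k - 1)"
      by (simp_all add: powr_add powr_diff)
    have "x \<in> I 0 k \<or> x \<in> I 1 k \<or> x \<in> I 2 k \<or> x \<in> I 3 k"
      using lo hi unfolding I_def p by (auto simp: algebra_simps)
    then obtain i where i: "i \<in> {0,1,2,3}" "x \<in> I i k" by blast
    have "g (x / 2) \<le> g (2 powr (of_int k))" using lo p by (intro anti) simp
    also have "\<dots> = g (2 powr (of_int k)) * indicator (I i k) x" using i by simp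
    also have "\<dots> \<le> G i x" unfolding G_def by (rule SUP_upper) simp
    also have "\<dots> \<le> G 0 x + (G 1 x + (G 2 x + G 3 x))"
      using i(1) by (auto intro: add_increasing add_increasing2)
    finally show ?thesis .
  qed
  define J where "J k = {2 powr (real_of_int k - 1) <.. 2 powr (of_int k)}" for k
  have J_disj: "J j \<inter> J k = {}" if jk: "j \<noteq> k" for j k
  proof -
    consider "j \<le> k - 1" | "k \<le> j - 1" using jk by linarith
    then show ?thesis
    proof cases
      case 1
      then have "2 powr real_of_int j \<le> 2 powr (real_of_int k - 1)" by (intro powr_mono) auto
      then show ?thesis by (auto simp: J_def)
    next
      case 2
      then have "2 powr real_of_int k \<le> 2 powr (real_of_int j - 1)" by (intro powr_mono) auto
      then show ?thesis by (auto simp: J_def)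
    qed
  qed
  have J_pos: "J k \<subseteq> {0<..}" for k
  proof
    fix x assume "x \<in> J k"
    then have "2 powr (real_of_int k - 1) < x" by (simp add: J_def)
    moreover have "0 < 2 powr (real_of_int k - 1)" by simp
    ultimately have "0 < x" by linarith
    then show "x \<in> {0<..}" by simp
  qed
  have J_sets: "J k \<in> sets half_line" for k
    unfolding sets_half_line using J_pos by (auto simp: J_def)
  have IJ: "I i k \<subseteq> J (k + 2)" if "i < 4" for i k
  proof -
    define z where "z = 2 powr (real_of_int k - 1)"
    have e: "2 powr (real_of_int (k + 2) - 1) = 4 * z" "2 powr (real_of_int (k + 2)) = 8 * z"
      "2 powr (real_of_int k + 1) = 4 * z"
      by (simp_all add: powr_add powr_diff z_def)
    have b: "(real i + 1) * z \<le> 4 * z" "0 \<le> real i * z"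
      using that by (auto intro!: mult_right_mono simp: z_def)
    show ?thesis
    proof
      fix x assume "x \<in> I i k"
      then have "4 * z + real i * z < x" "x \<le> 4 * z + (real i + 1) * z" unfolding I_def z_def[symmetric] e by auto
      then show "x \<in> J (k + 2)" unfolding J_def e using b by auto
    qed
  qed
  have NG: "N (G i) \<le> N g" if i4: "i < 4" for i
  proof (rule N_distribution[OF G g])
    fix l
    define A where "A = {k::int. l < g (2 powr (of_int k))}"
    have A: "countable A" by simp
    have "{s \<in> space half_line. l < G i s} \<subseteq> (\<Union>k\<in>A. I i k)"
      by (auto simp: G_def less_SUP_iff A_def indicator_def split: if_splits)
    then have "emeasure half_line {s \<in> space half_line. l < G i s} \<le> emeasure half_line (\<Union>k\<in>A. I i k)"
      using A by (intro emeasure_mono sets.countable_UN') auto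
    also have "\<dots> = (\<integral>\<^sup>+k. emeasure half_line (I i k) \<partial>count_space A)"
    proof (rule emeasure_UN_countable)
      show "disjoint_family_on (I i) A"
      proof (unfold disjoint_family_on_def, intro ballI impI)
        fix j k :: int assume "j \<noteq> k"
        then have "J (j + 2) \<inter> J (k + 2) = {}" by (intro J_disj) simp
        then show "I i j \<inter> I i k = {}" using IJ[OF i4, of j] IJ[OF i4, of k] by blast
      qed
    qed (use A in auto)
    also have "\<dots> = (\<integral>\<^sup>+k. emeasure half_line (J k) \<partial>count_space A)"
    proof (intro nn_integral_cong)
      fix k
      have "emeasure half_line (I i k) = emeasure lebesgue (I i k)"
        using Ib[of i k] by (intro emeasure_half_line) (simp add: sets_half_line)
      also have "\<dots> = ennreal (2 powr (of_int k - 1))" unfolding I_def by (simp add: algebra_simps)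
      also have "\<dots> = emeasure lebesgue (J k)" by (simp add: J_def powr_diff)
      also have "\<dots> = emeasure half_line (J k)" by (intro emeasure_half_line[symmetric] J_pos)
      finally show "emeasure half_line (I i k) = emeasure half_line (J k)" .
    qed
    also have "\<dots> = emeasure half_line (\<Union>k\<in>A. J k)"
      using J_disj by (intro emeasure_UN_countable[symmetric] J_sets A) (auto simp: disjoint_family_on_def)
    also have "\<dots> \<le> emeasure half_line {s \<in> space half_line. l < g s}"
    proof (rule emeasure_mono)
      show "(\<Union>k\<in>A. J k) \<subseteq> {s \<in> space half_line. l < g s}"
      proof safe
        fix k s assume "k \<in> A" "s \<in> J k"
        then show "l < g s" using anti[of s "2 powr (of_int k)"] by (auto simp: A_def J_def intro: less_le_trans)
        show "s \<in> space half_line" using J_pos[of k] \<open>s \<in> J k\<close> by auto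
      qed
    qed measurable
    finally show "emeasure half_line {s \<in> space half_line. l < G i s} \<le> emeasure half_line {s \<in> space half_line. l < g s}" .
  qed
  have "N (\<lambda>x. g (x / 2)) \<le> N (\<lambda>x. G 0 x + (G 1 x + (G 2 x + G 3 x)))"
    using cover dilation_level(1)[OF g, of 2] by (intro N_mono') auto
  also have "\<dots> \<le> N (G 0) + N (\<lambda>x. G 1 x + (G 2 x + G 3 x))" by (rule N_add) measurable
  also have "\<dots> \<le> N (G 0) + (N (G 1) + N (\<lambda>x. G 2 x + G 3 x))" by (intro add_left_mono N_add) measurable
  also have "\<dots> \<le> N (G 0) + (N (G 1) + (N (G 2) + N (G 3)))" by (intro add_left_mono N_add) measurable
  also have "\<dots> \<le> N g + (N g + (N g + N g))" by (intro add_mono NG) auto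
  also have "\<dots> = 4 * N g"
  proof -
    have "(4::ennreal) = 1 + (1 + (1 + 1))" by simp
    then show ?thesis by (simp only: distrib_right mult_1)
  qed
  finally show ?thesis using \<open>N (\<lambda>x. f (x / 2)) = N (\<lambda>x. g (x / 2))\<close> N_rearr[OF f] by (simp add: g_def)
qed

abbreviation h where "h \<equiv> dilation_norm N"

lemma h_least:
  assumes "\<And>f. f \<in> HM \<Longrightarrow> N (\<lambda>s. f (s / t)) \<le> c * N f"
  shows "h t \<le> c"
  unfolding dilation_norm_def
proof (rule SUP_least)
  fix f assume f: "f \<in> {f \<in> ri_space half_line N. ri_norm N f \<le> 1}"
  then have m: "(\<lambda>x. ennreal (norm (f x))) \<in> HM" by (auto simp: ri_space_def)
  have "ri_norm N (\<lambda>s. f (s / t)) \<le> c * ri_norm N f" using assms[OF m] by (simp add: ri_norm_def)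
  also have "\<dots> \<le> c * 1" using f by (intro mult_left_mono) auto
  finally show "ri_norm N (\<lambda>s. f (s / t)) \<le> c" by simp
qed

text \<open>
  The dilation norm is a supremum over complex functions in the unit ball. A function of finite nonzero norm is
  finite almost everywhere, so after normalisation it is equimeasurable with the modulus of such a function.
\<close>

lemma h_bound:
  assumes f [measurable]: "f \<in> HM" and fin: "N f < \<infinity>" and t: "t > 0"
  shows "N (\<lambda>s. f (s / t)) \<le> h t * N f"
proof (cases "N f = 0")
  case True
  have ms: "{s \<in> space half_line. 0 < f s} \<in> sets half_line" by measurable
  have mt [measurable]: "(\<lambda>s. f (s / t)) \<in> HM" by (rule dilation_level(1)[OF f t])
  have mst: "{s \<in> space half_line. 0 < f (s / t)} \<in> sets half_line" by measurable
  have "AE s in half_line. \<not> 0 < f s" using True N_zero[OF f] by simp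
  then have "emeasure half_line {s \<in> space half_line. f s > 0} = 0"
    using AE_iff_measurable[OF ms, of "\<lambda>s. \<not> 0 < f s"] by (simp add: zero_less_iff_neq_zero)
  then have "emeasure half_line {s \<in> space half_line. f (s / t) > 0} = 0"
    using dilation_distribution[OF f t, of 0] by simp
  then have "AE s in half_line. \<not> (f (s / t) > 0)"
    using AE_iff_measurable[OF mst, of "\<lambda>s. \<not> 0 < f (s / t)"] by (simp add: zero_less_iff_neq_zero)
  then have "N (\<lambda>s. f (s / t)) = 0" using N_zero[OF dilation_level(1)[OF f t]] by simp
  then show ?thesis by simp
next
  case False
  obtain a where a: "N f = ennreal a" "a > 0"
    using fin False by (cases "N f" rule: ennreal_cases) (auto simp: less_le)
  define F where "F s = complex_of_real (enn2real (f s) / a)" for s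
  have F: "F \<in> borel_measurable half_line" unfolding F_def by measurable
  have nF: "ennreal (norm (F s)) = ennreal (1 / a) * f s" if "f s < \<infinity>" for s
    using a that by (cases "f s" rule: ennreal_cases) (auto simp: F_def ennreal_mult[symmetric] norm_divide)
  have m [measurable]: "(\<lambda>s. ennreal (norm (F s))) \<in> HM" using F by measurable
  have m2 [measurable]: "(\<lambda>s. ennreal (1 / a) * f s) \<in> HM" by measurable
  have ae: "AE s in half_line. ennreal (norm (F s)) = ennreal (1 / a) * f s"
    using N_finite_AE[OF f fin] by eventually_elim (rule nF)
  have eqd: "equimeasurable half_line (\<lambda>s. ennreal (norm (F s))) (\<lambda>s. ennreal (1 / a) * f s)"
    unfolding equimeasurable_def
  proof
    fix l
    show "emeasure half_line {x \<in> space half_line. l < ennreal (norm (F x))} = emeasure half_line {x \<in> space half_line. l < ennreal (1 / a) * f x}"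
    proof (rule emeasure_eq_AE)
      show "AE x in half_line. (x \<in> {x \<in> space half_line. l < ennreal (norm (F x))}) = (x \<in> {x \<in> space half_line. l < ennreal (1 / a) * f x})"
        using ae by eventually_elim simp
    qed measurable
  qed
  have eqd2: "equimeasurable half_line (\<lambda>s. ennreal (norm (F (s / t)))) (\<lambda>s. ennreal (1 / a) * f (s / t))"
    using eqd dilation_distribution[OF m t] dilation_distribution[OF m2 t] by (simp add: equimeasurable_def)
  have 1: "ri_norm N F = 1"
    using N_equi[OF m m2 eqd] N_cmult[OF f, of "1 / a"] a by (simp add: ri_norm_def ennreal_mult[symmetric])
  have "ri_norm N (\<lambda>s. F (s / t)) \<le> h t"
    unfolding dilation_norm_def by (rule SUP_upper) (use 1 F in \<open>auto simp: ri_space_def\<close>)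
  moreover have "ri_norm N (\<lambda>s. F (s / t)) = ennreal (1 / a) * N (\<lambda>s. f (s / t))"
    using N_equi[OF dilation_level(1)[OF m t] dilation_level(1)[OF m2 t] eqd2]
      N_cmult[OF dilation_level(1)[OF f t], of "1 / a"] a by (simp add: ri_norm_def)
  ultimately have "ennreal a * (ennreal (1 / a) * N (\<lambda>s. f (s / t))) \<le> ennreal a * h t"
    by (simp add: mult_left_mono)
  moreover have "ennreal a * (ennreal (1 / a) * N (\<lambda>s. f (s / t))) = N (\<lambda>s. f (s / t))"
    using a by (simp add: mult.assoc[symmetric] ennreal_mult[symmetric])
  ultimately show ?thesis by (simp add: a mult.commute)
qed

lemma dilation_measurable: "f \<in> HM \<Longrightarrow> t > 0 \<Longrightarrow> (\<lambda>s. f (s / t)) \<in> HM"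
  by (rule dilation_level(1))

lemma h_pow2: "h (2 ^ k) \<le> 4 ^ k"
proof (rule h_least)
  fix f assume f: "f \<in> HM"
  show "N (\<lambda>s. f (s / 2 ^ k)) \<le> 4 ^ k * N f"
  proof (induction k)
    case (Suc k)
    have m: "(\<lambda>s. f (s / 2 ^ k)) \<in> HM" using f by (rule dilation_measurable) simp
    have "N (\<lambda>s. f (s / 2 ^ Suc k)) = N (\<lambda>s. (\<lambda>s. f (s / 2 ^ k)) (s / 2))" by simp
    also have "\<dots> \<le> 4 * N (\<lambda>s. f (s / 2 ^ k))" by (rule dilation_2[OF m])
    also have "\<dots> \<le> 4 * (4 ^ k * N f)" using Suc by (rule mult_left_mono) simp
    finally show ?case by (simp add: mult.assoc)
  qed simp
qed

lemma h_mono: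
  assumes "0 < s" "s \<le> t" shows "h s \<le> h t"
  unfolding dilation_norm_def
proof (rule SUP_mono)
  fix F assume F: "F \<in> {f \<in> ri_space half_line N. ri_norm N f \<le> 1}"
  then have m: "(\<lambda>x. ennreal (norm (F x))) \<in> HM" by (auto simp: ri_space_def)
  show "\<exists>G\<in>{f \<in> ri_space half_line N. ri_norm N f \<le> 1}. ri_norm N (\<lambda>x. F (x / s)) \<le> ri_norm N (\<lambda>x. G (x / t))"
    using F dilation_mono[OF m assms] by (intro bexI[of _ F]) (auto simp: ri_norm_def)
qed

lemma h_finite: "t > 0 \<Longrightarrow> h t < \<infinity>"
proof -
  assume t: "t > 0"
  obtain k where "t < 2 ^ k" using real_arch_pow[of 2 t] by auto
  then have "h t \<le> h (2 ^ k)" using t by (intro h_mono) auto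
  also have "\<dots> \<le> 4 ^ k" by (rule h_pow2)
  also have "(4::ennreal) ^ k = ennreal (4 ^ k)" by (simp flip: ennreal_power)
  also have "\<dots> < \<infinity>" by simp
  finally show ?thesis .
qed

lemma h_ge_1: "1 \<le> t \<Longrightarrow> 1 \<le> h t"
proof -
  assume t: "1 \<le> t"
  let ?E = "indicator {0<..1::real} :: real \<Rightarrow> ennreal"
  have E: "{0<..1::real} \<in> sets half_line" by (auto simp: sets_half_line)
  then have m: "?E \<in> HM" by measurable
  have e1: "emeasure half_line {0<..1::real} = 1"
    by (subst emeasure_half_line) auto
  have fin: "N ?E < \<infinity>" using N_indicator[OF E] e1 by simp
  have nz: "N ?E \<noteq> 0"
  proof
    assume "N ?E = 0"
    then have ae: "AE x in half_line. x \<notin> {0<..1::real}" using N_zero[OF m] by (auto simp: indicator_eq_0_iff elim!: eventually_mono)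
    have sp: "{x \<in> space half_line. \<not> x \<notin> {0<..1::real}} = {0<..1}" by auto
    have "emeasure half_line {0<..1::real} = 0" by (rule iffD1[OF AE_iff_measurable[OF E sp] ae])
    then show False using e1 by simp
  qed
  have "N ?E = N (\<lambda>s. ?E (s / 1))" by simp
  also have "\<dots> \<le> N (\<lambda>s. ?E (s / t))" using t by (intro dilation_mono m) auto
  also have "\<dots> \<le> h t * N ?E" using t by (intro h_bound m fin) auto
  finally have "N ?E * 1 \<le> N ?E * h t" by (simp add: mult.commute)
  then show ?thesis using fin nz by (subst (asm) ennreal_mult_le_mult_iff) (auto simp: less_top)
qed

lemma h_submult:
  assumes "0 < s" "0 < t" shows "h (s * t) \<le> h s * h t"
  unfolding dilation_norm_def[of N "s * t"]
proof (rule SUP_least)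
  fix F assume F: "F \<in> {f \<in> ri_space half_line N. ri_norm N f \<le> 1}"
  define f where "f x = ennreal (norm (F x))" for x
  have m: "f \<in> HM" using F by (auto simp: ri_space_def f_def[abs_def])
  have le1: "N f \<le> 1" using F by (simp add: ri_norm_def f_def[abs_def])
  then have fin: "N f < \<infinity>" by (auto simp: le_less_trans)
  have 1: "N (\<lambda>x. f (x / t)) \<le> h t * N f" by (rule h_bound[OF m fin assms(2)])
  then have 2: "N (\<lambda>x. f (x / t)) < \<infinity>"
    using h_finite[OF assms(2)] fin by (auto intro: le_less_trans simp: ennreal_mult_less_top)
  have "ri_norm N (\<lambda>x. F (x / (s * t))) = N (\<lambda>x. (\<lambda>x. f (x / t)) (x / s))"
    by (simp add: ri_norm_def f_def)
  also have "\<dots> \<le> h s * N (\<lambda>x. f (x / t))" by (rule h_bound[OF dilation_measurable[OF m assms(2)] 2 assms(1)])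
  also have "\<dots> \<le> h s * (h t * N f)" using 1 by (rule mult_left_mono) simp
  also have "\<dots> \<le> h s * (h t * 1)" using le1 by (intro mult_left_mono) auto
  finally show "ri_norm N (\<lambda>x. F (x / (s * t))) \<le> h s * h t" by simp
qed

definition h_real where "h_real t = enn2real (h t)"

lemma h_eq_h_real: "t > 0 \<Longrightarrow> h t = ennreal (h_real t)"
  using h_finite[of t] by (simp add: h_real_def less_top)

lemma h_real_ge_1: "1 \<le> t \<Longrightarrow> 1 \<le> h_real t"
  using h_ge_1[of t] h_eq_h_real[of t] by (simp add: ennreal_1[symmetric] del: ennreal_1) (metis ennreal_1 ennreal_le_iff enn2real_nonneg h_real_def)

lemma h_real_mono: "0 < s \<Longrightarrow> s \<le> t \<Longrightarrow> h_real s \<le> h_real t"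
  unfolding h_real_def using h_mono h_finite[of t] by (intro enn2real_mono) auto

lemma h_real_submult: "0 < s \<Longrightarrow> 0 < t \<Longrightarrow> h_real (s * t) \<le> h_real s * h_real t"
  unfolding h_real_def enn2real_mult[symmetric] using h_submult[of s t] h_finite[of s] h_finite[of t]
  by (intro enn2real_mono) (auto simp: ennreal_mult_less_top)

lemma h_real_power: "1 \<le> t \<Longrightarrow> h_real (t ^ k * u) \<le> h_real t ^ k * h_real u" if "u > 0"
proof (induction k)
  case (Suc k)
  have "h_real (t ^ Suc k * u) = h_real (t * (t ^ k * u))" by (simp add: mult.assoc)
  also have "\<dots> \<le> h_real t * h_real (t ^ k * u)" using Suc.prems that by (intro h_real_submult) auto
  also have "\<dots> \<le> h_real t * (h_real t ^ k * h_real u)" using Suc h_real_ge_1[of t] by (intro mult_left_mono) auto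
  finally show ?case by (simp add: mult.assoc)
qed simp

text \<open>
  The exponent of growth of the dilation norm, that is, the reciprocal of the lower Boyd index.
\<close>

definition growth where "growth = Inf ((\<lambda>t. ln (h_real t) / ln t) ` {1<..})"

lemma growth_bdd: "bdd_below ((\<lambda>t. ln (h_real t) / ln t) ` {1<..})"
  by (rule bdd_belowI[of _ 0]) (use h_real_ge_1 in \<open>auto intro!: divide_nonneg_nonneg ln_ge_zero\<close>)

lemma growth_nonneg: "0 \<le> growth"
  unfolding growth_def by (rule cInf_greatest) (use h_real_ge_1 in \<open>auto intro!: divide_nonneg_nonneg ln_ge_zero\<close>)

text \<open>
  Fekete's lemma for the submultiplicative function \<open>h\<close>; monotonicity passes from the powers of \<open>t\<^sub>0\<close> to all \<open>t\<close>.
\<close>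

lemma growth_tendsto: "((\<lambda>t. ln (h_real t) / ln t) \<longlongrightarrow> growth) at_top"
proof (rule tendstoI)
  fix e :: real assume e: "e > 0"
  have "\<exists>z\<in>(\<lambda>t. ln (h_real t) / ln t) ` {1<..}. z < growth + e / 2"
    by (rule cInf_lessD) (use e in \<open>auto simp: growth_def[symmetric]\<close>)
  then obtain t0 where t0: "t0 > 1" "ln (h_real t0) / ln t0 < growth + e / 2" by auto
  let ?q = "ln (h_real t0) / ln t0"
  have q0: "0 \<le> ?q" using t0 h_real_ge_1[of t0] by simp
  have upper: "ln (h_real t) / ln t \<le> ?q + ln (h_real t0) / ln t" if t: "t > 1" for t
  proof -
    define j where "j = nat \<lfloor>ln t / ln t0\<rfloor>"
    have lt: "0 < ln t" "0 < ln t0" using t t0 by auto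
    have j: "real j \<le> ln t / ln t0" "ln t / ln t0 < real j + 1"
      using lt by (auto simp: j_def of_nat_nat divide_nonneg_pos)
    have "t \<le> t0 ^ j * t0"
    proof -
      have "ln t \<le> (real j + 1) * ln t0" using j(2) lt by (simp add: field_simps)
      also have "\<dots> = ln (t0 ^ j * t0)" using t0 by (simp add: ln_mult ln_realpow algebra_simps)
      finally show ?thesis using t t0 by (subst (asm) ln_le_cancel_iff) auto
    qed
    then have "h_real t \<le> h_real (t0 ^ j * t0)" using t by (intro h_real_mono) auto
    also have "\<dots> \<le> h_real t0 ^ j * h_real t0" using t0 by (intro h_real_power) auto
    finally have "ln (h_real t) \<le> ln (h_real t0 ^ j * h_real t0)"
      using h_real_ge_1[of t] t by (intro ln_mono) auto
    also have "\<dots> = real j * ln (h_real t0) + ln (h_real t0)"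
      using h_real_ge_1[of t0] t0 by (simp add: ln_mult ln_realpow)
    also have "\<dots> \<le> ln t / ln t0 * ln (h_real t0) + ln (h_real t0)"
      using j(1) h_real_ge_1[of t0] t0 by (intro add_right_mono mult_right_mono) auto
    finally have "ln (h_real t) / ln t \<le> (ln t / ln t0 * ln (h_real t0) + ln (h_real t0)) / ln t"
      using lt by (intro divide_right_mono) auto
    also have "\<dots> = ?q + ln (h_real t0) / ln t" using lt by (simp add: field_simps)
    finally show ?thesis .
  qed
  have "((\<lambda>t::real. ln (h_real t0) / ln t) \<longlongrightarrow> 0) at_top"
    by (intro tendsto_divide_0[OF tendsto_const] filterlim_at_top_imp_at_infinity ln_at_top)
  then have "eventually (\<lambda>t. ln (h_real t0) / ln t < e / 2) at_top"
    by (rule order_tendstoD) (use e in simp)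
  then show "eventually (\<lambda>t. dist (ln (h_real t) / ln t) growth < e) at_top"
    using eventually_gt_at_top[of 1]
  proof eventually_elim
    case (elim t)
    have "growth \<le> ln (h_real t) / ln t"
      unfolding growth_def by (rule cInf_lower[OF _ growth_bdd]) (use elim in auto)
    moreover have "ln (h_real t) / ln t < growth + e" using upper[of t] elim t0(2) by linarith
    ultimately show ?case unfolding dist_real_def by linarith
  qed
qed

text \<open>
  If the growth is positive, the Boyd index is its reciprocal; if it is zero, the claim is trivial.
\<close>

lemma growth_less:
  assumes s: "0 < s" "ereal s < boyd_p N"
  shows "growth < 1 / s"
proof (cases "growth = 0")
  case False
  then have g: "growth > 0" using growth_nonneg by simp
  have "((\<lambda>t. ereal (inverse (ln (h_real t) / ln t))) \<longlongrightarrow> ereal (inverse growth)) at_top"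
    using g by (intro tendsto_intros growth_tendsto) auto
  moreover have "eventually (\<lambda>t. ereal (inverse (ln (h_real t) / ln t)) = boyd_quotient N t) at_top"
    using order_tendstoD(1)[OF growth_tendsto g]
  proof eventually_elim
    case (elim t)
    then have "ln (h_real t) / ln t \<noteq> 0" by (rule less_imp_neq[symmetric])
    then show ?case unfolding boyd_quotient_def h_real_def[symmetric] by (metis inverse_ereal.simps(1))
  qed
  ultimately have "(boyd_quotient N \<longlongrightarrow> ereal (inverse growth)) at_top"
    by (rule Lim_transform_eventually)
  then have "boyd_p N = ereal (inverse growth)"
    unfolding boyd_p_def by (intro tendsto_Lim) auto
  then have "s < inverse growth" using s by simp
  then show ?thesis using g s by (simp add: field_simps)
qed (use s in simp)

text \<open>
  The dilation norm of \<open>2\<^sup>k\<close> is eventually at most \<open>2\<^bsup>k(growth + e)\<^esup>\<close> with \<open>growth + e < 1/s\<close>, so the series is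
  dominated by a geometric one.
\<close>

lemma dilation_series_finite:
  assumes s: "0 < s" "ereal s < boyd_p N"
  shows "(\<Sum>k. ennreal ((1/2) powr (real k / s)) * h (2 ^ Suc k)) < \<infinity>"
proof -
  define e where "e = (1 / s - growth) / 2"
  have e: "e > 0" "growth + e < 1 / s" using growth_less[OF s] by (auto simp: e_def field_simps)
  have "eventually (\<lambda>t. ln (h_real t) / ln t < growth + e) at_top"
    using order_tendstoD(2)[OF growth_tendsto, of "growth + e"] e by simp
  then have ev: "eventually (\<lambda>t. h_real t \<le> t powr (growth + e)) at_top"
    using eventually_gt_at_top[of 1]
  proof eventually_elim
    case (elim t)
    then have "ln (h_real t) \<le> (growth + e) * ln t" by (simp add: field_simps)
    then have "exp (ln (h_real t)) \<le> exp ((growth + e) * ln t)" by (simp only: exp_le_cancel_iff)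
    moreover have "exp (ln (h_real t)) = h_real t" using h_real_ge_1[of t] elim by (intro exp_ln) linarith
    ultimately show ?case using elim by (simp add: powr_def)
  qed
  have fl: "filterlim (\<lambda>k::nat. (2::real) ^ Suc k) at_top sequentially"
  proof (rule filterlim_at_top_mono[OF filterlim_real_sequentially], rule always_eventually, rule allI)
    fix k :: nat
    have "k < 2 ^ k" by (rule less_exp)
    also have "(2::nat) ^ k \<le> 2 ^ Suc k" by simp
    finally have "k \<le> 2 ^ Suc k" by (rule less_imp_le)
    then have "real k \<le> real (2 ^ Suc k)" by (simp only: of_nat_le_iff)
    then show "real k \<le> 2 ^ Suc k" by simp
  qed
  have ev2: "eventually (\<lambda>k. h_real (2 ^ Suc k) \<le> (2 ^ Suc k) powr (growth + e)) sequentially"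
    by (rule eventually_compose_filterlim[OF ev fl])
  define q where "q = (2::real) powr (growth + e - 1 / s)"
  have q: "0 < q" "q < 1" using e powr_less_mono[of "growth + e - 1 / s" 0 2] by (auto simp: q_def)
  have "summable (\<lambda>k. (1/2) powr (real k / s) * h_real (2 ^ Suc k))"
  proof (rule summable_comparison_test_ev)
    show "summable (\<lambda>k. 2 powr (growth + e) * q ^ k)"
      using q by (intro summable_mult summable_geometric) simp
    show "eventually (\<lambda>k. norm ((1/2) powr (real k / s) * h_real (2 ^ Suc k)) \<le> 2 powr (growth + e) * q ^ k) sequentially"
      using ev2
    proof eventually_elim
      case (elim k)
      have "norm ((1/2) powr (real k / s) * h_real (2 ^ Suc k)) = (1/2) powr (real k / s) * h_real (2 ^ Suc k)"
        by (simp add: h_real_def)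
      also have "\<dots> \<le> (1/2) powr (real k / s) * (2 ^ Suc k) powr (growth + e)"
        using elim by (intro mult_left_mono) auto
      also have "\<dots> = 2 powr (growth + e) * q ^ k"
      proof -
        have "(1/2::real) powr (real k / s) = 2 powr (- (real k / s))" by (simp add: powr_minus powr_divide field_simps)
        moreover have "(2 ^ Suc k :: real) powr (growth + e) = 2 powr (real (Suc k) * (growth + e))"
          by (simp only: powr_realpow[symmetric] powr_powr zero_less_numeral)
        moreover have "q ^ k = 2 powr (real k * (growth + e - 1 / s))"
          by (simp add: q_def powr_realpow[symmetric] powr_powr mult.commute)
        moreover have "- (real k / s) + real (Suc k) * (growth + e) = (growth + e) + real k * (growth + e - 1 / s)"
          by (simp add: algebra_simps)
        ultimately show ?thesis by (simp only: powr_add[symmetric])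
      qed
      finally show ?case .
    qed
  qed
  moreover have "ennreal ((1/2) powr (real k / s)) * h (2 ^ Suc k) = ennreal ((1/2) powr (real k / s) * h_real (2 ^ Suc k))" for k
    by (subst h_eq_h_real) (auto simp: ennreal_mult' h_real_def)
  ultimately show ?thesis by (simp add: suminf_ennreal2 h_real_def)
qed

lemma dilation_series_bound:
  assumes s: "0 < s" "ereal s < boyd_p N"
  shows "\<exists>C\<ge>0. \<forall>g\<in>HM. N g < \<infinity> \<longrightarrow>
     N (\<lambda>t. g t + (\<Sum>k. ennreal ((1/2) powr (real k / s)) * g (t / 2 ^ Suc k))) \<le> ennreal C * N g"
proof -
  let ?S = "\<Sum>k. ennreal ((1/2) powr (real k / s)) * h (2 ^ Suc k)"
  obtain C where C: "1 + ?S = ennreal C" "C \<ge> 0"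
    using dilation_series_finite[OF s] by (cases "1 + ?S" rule: ennreal_cases) auto
  have "N (\<lambda>t. g t + (\<Sum>k. ennreal ((1/2) powr (real k / s)) * g (t / 2 ^ Suc k))) \<le> ennreal C * N g"
    if g [measurable]: "g \<in> HM" and fin: "N g < \<infinity>" for g
  proof -
    have gm: "(\<lambda>t. g (t / 2 ^ Suc k)) \<in> HM" for k by (rule dilation_measurable[OF g]) simp
    have gm': "(\<lambda>t. ennreal ((1/2) powr (real k / s)) * g (t / 2 ^ Suc k)) \<in> HM" for k
      by (intro borel_measurable_times_ennreal gm) simp
    have "N (\<lambda>t. g t + (\<Sum>k. ennreal ((1/2) powr (real k / s)) * g (t / 2 ^ Suc k)))
       \<le> N g + N (\<lambda>t. \<Sum>k. ennreal ((1/2) powr (real k / s)) * g (t / 2 ^ Suc k))"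
      using gm' by (intro N_add g borel_measurable_suminf_order)
    also have "\<dots> \<le> N g + (\<Sum>k. N (\<lambda>t. ennreal ((1/2) powr (real k / s)) * g (t / 2 ^ Suc k)))"
      using gm' by (intro add_left_mono N_suminf)
    also have "\<dots> \<le> N g + (\<Sum>k. ennreal ((1/2) powr (real k / s)) * h (2 ^ Suc k) * N g)"
    proof (intro add_left_mono suminf_le summableI)
      fix k
      have "N (\<lambda>t. ennreal ((1/2) powr (real k / s)) * g (t / 2 ^ Suc k)) = ennreal ((1/2) powr (real k / s)) * N (\<lambda>t. g (t / 2 ^ Suc k))"
        by (rule N_cmult[OF gm]) simp
      also have "\<dots> \<le> ennreal ((1/2) powr (real k / s)) * (h (2 ^ Suc k) * N g)"
        by (intro mult_left_mono h_bound[OF g fin]) auto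
      finally show "N (\<lambda>t. ennreal ((1/2) powr (real k / s)) * g (t / 2 ^ Suc k)) \<le> ennreal ((1/2) powr (real k / s)) * h (2 ^ Suc k) * N g"
        by (simp only: mult.assoc)
    qed
    also have "\<dots> = (1 + ?S) * N g" by (simp only: ennreal_suminf_multc distrib_right mult_1)
    finally show ?thesis by (simp only: C)
  qed
  then show ?thesis using C(2) by blast
qed

end

section \<open>Multilinear operators on Lebesgue spaces\<close>

lemma AE_lebesgue [simp]: "(AE x in lebesgue. P x) \<longleftrightarrow> (AE x in lborel. P x)"
  by (rule AE_completion_iff)

lemma epowr_ennreal: "a > 0 \<Longrightarrow> x \<ge> 0 \<Longrightarrow> epowr (ennreal x) a = ennreal (x powr a)"
  by (auto simp: epowr_def)

lemma epowr_less_top_iff: "a > 0 \<Longrightarrow> epowr x a < \<infinity> \<longleftrightarrow> x < \<infinity>"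
  by (cases x rule: ennreal_cases) (auto simp: epowr_ennreal epowr_def)

text \<open>
  The power of the norm is easier to handle than the norm, since the exponent of the target space of the
  operator may be less than \<open>1\<close>.
\<close>

definition pow_int :: "real \<Rightarrow> (real^'n \<Rightarrow> complex) \<Rightarrow> ennreal"
  where "pow_int p f = (\<integral>\<^sup>+x. ennreal (norm (f x) powr p) \<partial>lborel)"

lemma Lp_norm_pow_int: "Lp_norm p f = epowr (pow_int p f) (1 / p)"
  by (simp add: Lp_norm_def pow_int_def nn_integral_completion)

lemma Lp_space_iff: "p > 0 \<Longrightarrow> f \<in> Lp_space p \<longleftrightarrow> f \<in> borel_measurable lebesgue \<and> pow_int p f < \<infinity>"
  by (simp add: Lp_space_def Lp_norm_pow_int epowr_less_top_iff[of "1/p", simplified])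

lemma Lp_norm_real: "p > 0 \<Longrightarrow> pow_int p f < \<infinity> \<Longrightarrow> Lp_norm p f = ennreal (enn2real (pow_int p f) powr (1 / p))"
  unfolding Lp_norm_pow_int by (cases "pow_int p f" rule: ennreal_cases) (auto simp: epowr_ennreal)

lemma powr_add_le: "a \<ge> 0 \<Longrightarrow> b \<ge> 0 \<Longrightarrow> p > 0 \<Longrightarrow> (a + b) powr p \<le> 2 powr p * (a powr p + b powr p)" for a b p :: real
proof -
  assume ab: "a \<ge> 0" "b \<ge> 0" and p: "p > 0"
  have "(a + b) powr p \<le> (2 * max a b) powr p" using ab p by (intro powr_mono2) auto
  also have "\<dots> = 2 powr p * max a b powr p" using ab by (simp add: powr_mult)
  also have "max a b powr p \<le> a powr p + b powr p" by (simp add: max_def)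
  finally show ?thesis by (simp add: mult_left_mono)
qed

lemma pow_int_mono:
  assumes "p > 0" "AE x in lborel. norm (f x) \<le> norm (g x)" shows "pow_int p f \<le> pow_int p g"
  unfolding pow_int_def
proof (rule nn_integral_mono_AE)
  show "AE x in lborel. ennreal (norm (f x) powr p) \<le> ennreal (norm (g x) powr p)"
    using assms(2) by eventually_elim (intro ennreal_leI powr_mono2, use assms(1) in auto)
qed

lemma norm_powr_measurable:
  fixes f :: "'a \<Rightarrow> complex"
  assumes [measurable]: "f \<in> borel_measurable M"
  shows "(\<lambda>x. norm (f x) powr p) \<in> borel_measurable M" "(\<lambda>x. ennreal (norm (f x) powr p)) \<in> borel_measurable M"
    "(\<lambda>x. c * ennreal (norm (f x) powr p)) \<in> borel_measurable M"
  by measurable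

lemma pow_int_lin:
  assumes p: "p > 0" and m: "f \<in> borel_measurable lebesgue" "g \<in> borel_measurable lebesgue"
    and fin: "pow_int p f < \<infinity>" "pow_int p g < \<infinity>"
  shows "pow_int p (\<lambda>x. a * f x + g x) < \<infinity>"
proof -
  have le: "ennreal (norm (a * f x + g x) powr p) \<le> ennreal (2 powr p * norm a powr p) * ennreal (norm (f x) powr p) + ennreal (2 powr p) * ennreal (norm (g x) powr p)" for x
  proof -
    have "norm (a * f x + g x) powr p \<le> (norm a * norm (f x) + norm (g x)) powr p"
      using p norm_triangle_ineq[of "a * f x" "g x"] by (intro powr_mono2) (auto simp: norm_mult)
    also have "\<dots> \<le> 2 powr p * ((norm a * norm (f x)) powr p + norm (g x) powr p)"
      using p by (intro powr_add_le) auto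
    also have "\<dots> = 2 powr p * norm a powr p * norm (f x) powr p + 2 powr p * norm (g x) powr p"
      by (simp add: powr_mult algebra_simps)
    finally show ?thesis by (simp add: ennreal_mult[symmetric] ennreal_plus[symmetric] ennreal_leI del: ennreal_plus)
  qed
  have "pow_int p (\<lambda>x. a * f x + g x) = (\<integral>\<^sup>+x. ennreal (norm (a * f x + g x) powr p) \<partial>lebesgue)"
    by (simp add: pow_int_def nn_integral_completion)
  also have "\<dots> \<le> (\<integral>\<^sup>+x. ennreal (2 powr p * norm a powr p) * ennreal (norm (f x) powr p) + ennreal (2 powr p) * ennreal (norm (g x) powr p) \<partial>lebesgue)"
    by (intro nn_integral_mono le)
  also have "\<dots> = (\<integral>\<^sup>+x. ennreal (2 powr p * norm a powr p) * ennreal (norm (f x) powr p) \<partial>lebesgue) + (\<integral>\<^sup>+x. ennreal (2 powr p) * ennreal (norm (g x) powr p) \<partial>lebesgue)"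
    by (intro nn_integral_add norm_powr_measurable m)
  also have "(\<integral>\<^sup>+x. ennreal (2 powr p * norm a powr p) * ennreal (norm (f x) powr p) \<partial>lebesgue) = ennreal (2 powr p * norm a powr p) * (\<integral>\<^sup>+x. ennreal (norm (f x) powr p) \<partial>lebesgue)"
    by (intro nn_integral_cmult norm_powr_measurable m)
  also have "(\<integral>\<^sup>+x. ennreal (2 powr p) * ennreal (norm (g x) powr p) \<partial>lebesgue) = ennreal (2 powr p) * (\<integral>\<^sup>+x. ennreal (norm (g x) powr p) \<partial>lebesgue)"
    by (intro nn_integral_cmult norm_powr_measurable m)
  also have "ennreal (2 powr p * norm a powr p) * (\<integral>\<^sup>+x. ennreal (norm (f x) powr p) \<partial>lebesgue) + ennreal (2 powr p) * (\<integral>\<^sup>+x. ennreal (norm (g x) powr p) \<partial>lebesgue)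
      = ennreal (2 powr p * norm a powr p) * pow_int p f + ennreal (2 powr p) * pow_int p g"
    by (simp only: pow_int_def nn_integral_completion)
  also have "\<dots> < \<infinity>" using fin by (simp add: ennreal_mult_less_top)
  finally show ?thesis .
qed

lemma Lp_lin: "p > 0 \<Longrightarrow> f \<in> Lp_space p \<Longrightarrow> g \<in> Lp_space p \<Longrightarrow> (\<lambda>x. a * f x + g x) \<in> Lp_space p"
  using pow_int_lin[of p f g a] by (auto simp: Lp_space_iff)

lemma Lp_dom: "p > 0 \<Longrightarrow> h \<in> Lp_space p \<Longrightarrow> f \<in> borel_measurable lebesgue \<Longrightarrow> (AE x in lborel. norm (f x) \<le> norm (h x)) \<Longrightarrow> f \<in> Lp_space p"
  using pow_int_mono[of p f h] by (auto simp: Lp_space_iff intro: le_less_trans)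

lemma Lp_indicator:
  fixes A :: "(real^'n) set"
  assumes "p > 0" "A \<in> sets borel" "emeasure lborel A < \<infinity>"
  shows "indicator A \<in> Lp_space p" "pow_int p (indicator A) = emeasure lborel A"
proof -
  have "pow_int p (indicator A) = (\<integral>\<^sup>+x. indicator A x \<partial>lborel)"
    unfolding pow_int_def using assms(1) by (intro nn_integral_cong) (auto simp: indicator_def)
  then show e: "pow_int p (indicator A) = emeasure lborel A" using assms by simp
  show "indicator A \<in> Lp_space p"
    using assms e by (auto simp: Lp_space_iff intro!: measurable_completion)
qed

lemma emeasure_box_finite: "emeasure lborel (box a (b::'a::euclidean_space)) < \<infinity>"
  by (rule emeasure_lborel_box_finite)

locale local_op = dominated_kernel K C \<beta>
  for K :: "real^'n \<Rightarrow> real^'n^'m::finite \<Rightarrow> complex" and C \<beta> :: real +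
  fixes T :: "('m \<Rightarrow> real^'n \<Rightarrow> complex) \<Rightarrow> real^'n \<Rightarrow> complex" and q :: "'m \<Rightarrow> real" and CT :: real
  assumes q: "\<And>j. 1 \<le> q j"
    and ml: "multilinear_on (\<lambda>j. Lp_space (q j)) T"
    and bd: "\<And>f. (\<And>j. f j \<in> Lp_space (q j)) \<Longrightarrow> T f \<in> Lp_space (1 / (\<Sum>j\<in>UNIV. 1 / q j)) \<and>
       Lp_norm (1 / (\<Sum>j\<in>UNIV. 1 / q j)) (T f) \<le> ennreal CT * (\<Prod>j\<in>UNIV. Lp_norm (q j) (f j))"
    and hk: "has_kernel T (\<lambda>u. K (u None) (\<chi> j. u None - u (Some j)))"
begin

abbreviation L where "L j \<equiv> Lp_space (q j)"
definition q0 where "q0 = 1 / (\<Sum>j\<in>UNIV. 1 / q j)"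

lemma qpos: "0 < q j" using q[of j] by linarith

lemma q0_pos: "0 < q0"
  unfolding q0_def using qpos by (intro divide_pos_pos sum_pos) auto

lemmas bd' = bd[folded q0_def]

lemma T_meas: "(\<And>j. f j \<in> L j) \<Longrightarrow> T f \<in> borel_measurable lebesgue"
  using bd'[of f] q0_pos by (auto simp: Lp_space_iff)

lemma T_lin:
  assumes "\<And>i. f i \<in> L i" "g \<in> L j"
  shows "AE x in lborel. T (f(j := (\<lambda>y. a * f j y + g y))) x = a * T f x + T (f(j := g)) x"
  using ml assms unfolding multilinear_on_def by simp

text \<open>
  Convergence to zero in one slot yields convergence in the target space, hence almost everywhere along a
  subsequence.
\<close>

lemma T_small:
  assumes f: "\<And>i. f i \<in> L i" and G: "\<And>k. G k \<in> L j" and lim: "(\<lambda>k. enn2real (pow_int (q j) (G k))) \<longlonglongrightarrow> 0"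
  shows "\<exists>r::nat \<Rightarrow> nat. strict_mono r \<and> (AE x in lborel. (\<lambda>k. T (f(j := G (r k))) x) \<longlonglongrightarrow> 0)"
proof -
  have fG: "(f(j := G k)) i \<in> L i" for i k using f G by auto
  define J where "J k = pow_int q0 (T (f(j := G k)))" for k
  have Jfin: "J k < \<infinity>" for k using bd'[of "f(j := G k)", OF fG] q0_pos by (simp add: J_def Lp_space_iff)
  have Gfin: "pow_int (q j) (G k) < \<infinity>" for k using G[of k] qpos by (simp add: Lp_space_iff)
  define c where "c = enn2real (ennreal CT * (\<Prod>i\<in>UNIV - {j}. Lp_norm (q i) (f i)))"
  have cfin: "ennreal CT * (\<Prod>i\<in>UNIV - {j}. Lp_norm (q i) (f i)) < \<infinity>"
  proof -
    have "(\<Prod>i\<in>UNIV - {j}. Lp_norm (q i) (f i)) < \<infinity>" using f by (intro prod_less_top) (simp add: Lp_space_def)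
    then show ?thesis by (simp add: ennreal_mult_less_top)
  qed
  have le: "enn2real (J k) powr (1 / q0) \<le> c * enn2real (pow_int (q j) (G k)) powr (1 / q j)" for k
  proof -
    have pr: "(\<Prod>i\<in>UNIV. Lp_norm (q i) ((f(j := G k)) i)) = Lp_norm (q j) (G k) * (\<Prod>i\<in>UNIV - {j}. Lp_norm (q i) (f i))"
      by (subst prod.remove[of _ j]) auto
    have "Lp_norm q0 (T (f(j := G k))) \<le> (ennreal CT * (\<Prod>i\<in>UNIV - {j}. Lp_norm (q i) (f i))) * Lp_norm (q j) (G k)"
      using bd'[of "f(j := G k)", OF fG] unfolding pr by (simp only: ac_simps)
    also have "ennreal CT * (\<Prod>i\<in>UNIV - {j}. Lp_norm (q i) (f i)) = ennreal c" using cfin by (simp add: c_def less_top)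
    finally have "ennreal (enn2real (J k) powr (1 / q0)) \<le> ennreal c * ennreal (enn2real (pow_int (q j) (G k)) powr (1 / q j))"
      using Lp_norm_real[OF q0_pos Jfin[unfolded J_def], of k] Lp_norm_real[OF qpos Gfin, of k] by (simp add: J_def del: fun_upd_apply)
    then show ?thesis by (simp add: ennreal_mult'[symmetric] c_def)
  qed
  have "(\<lambda>k. c * enn2real (pow_int (q j) (G k)) powr (1 / q j)) \<longlonglongrightarrow> c * 0 powr (1 / q j)"
    using qpos[of j] by (intro tendsto_mult tendsto_const tendsto_powr2 lim) auto
  then have up0: "(\<lambda>k. c * enn2real (pow_int (q j) (G k)) powr (1 / q j)) \<longlonglongrightarrow> 0"
    by simp
  have l0: "(\<lambda>k. enn2real (J k) powr (1 / q0)) \<longlonglongrightarrow> 0"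
    by (rule tendsto_sandwich[OF _ _ tendsto_const up0]) (simp_all add: le)
  have "(\<lambda>k. (enn2real (J k) powr (1 / q0)) powr q0) \<longlonglongrightarrow> 0 powr q0"
    using q0_pos by (intro tendsto_powr2 l0 tendsto_const) auto
  then have JJ: "(\<lambda>k. enn2real (J k)) \<longlonglongrightarrow> 0" using q0_pos by (simp add: powr_powr)
  define u where "u k x = norm (T (f(j := G k)) x) powr q0" for k x
  have um: "u k \<in> borel_measurable lebesgue" for k
    unfolding u_def[abs_def] by (intro norm_powr_measurable T_meas fG)
  have unn: "(\<integral>\<^sup>+x. ennreal (norm (u k x)) \<partial>lebesgue) = J k" for k
    by (simp add: u_def J_def pow_int_def nn_integral_completion)
  have ui: "integrable lebesgue (u k)" for k
    by (rule integrableI_bounded) (use um unn Jfin in auto)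
  have ul: "(LINT x|lebesgue. norm (u k x)) = enn2real (J k)" for k
    using um by (subst integral_eq_nn_integral) (auto simp: unn[simplified])
  obtain r :: "nat \<Rightarrow> nat" where r: "strict_mono r" "AE x in lebesgue. (\<lambda>k. u (r k) x) \<longlonglongrightarrow> 0"
    using tendsto_L1_AE_subseq[of lebesgue u, OF ui] JJ ul by auto
  have "(\<lambda>k. T (f(j := G (r k))) x) \<longlonglongrightarrow> 0" if "(\<lambda>k. u (r k) x) \<longlonglongrightarrow> 0" for x
  proof -
    have "(\<lambda>k. u (r k) x powr (1 / q0)) \<longlonglongrightarrow> 0 powr (1 / q0)"
      using q0_pos by (intro tendsto_powr2 that tendsto_const) (auto simp: u_def)
    then have "(\<lambda>k. norm (T (f(j := G (r k))) x)) \<longlonglongrightarrow> 0" using q0_pos by (simp add: u_def powr_powr)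
    then show ?thesis by (rule tendsto_norm_zero_cancel)
  qed
  then show ?thesis using r by (intro exI[of _ r]) (auto elim!: eventually_mono)
qed

lemma T_dom:
  assumes f: "\<And>i. f i \<in> L i" and G: "\<And>k. G k \<in> L j" and g: "g \<in> L j" and h: "h \<in> L j"
    and lim: "\<And>x. (\<lambda>k. G k x) \<longlonglongrightarrow> g x" and le: "\<And>k x. norm (G k x) \<le> norm (h x)"
  shows "\<exists>r::nat \<Rightarrow> nat. strict_mono r \<and> (AE x in lborel. (\<lambda>k. T (f(j := G (r k))) x) \<longlonglongrightarrow> T (f(j := g)) x)"
proof -
  define D where "D k x = G k x - g x" for k x
  have D: "D k \<in> L j" for k
    using Lp_lin[OF qpos g G[of k], of "-1"] by (simp add: D_def[abs_def])
  have gh: "norm (g x) \<le> norm (h x)" for x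
    using le by (intro LIMSEQ_le_const2[OF tendsto_norm[OF lim]]) auto
  have "(\<lambda>k. \<integral>\<^sup>+x. ennreal (norm (D k x) powr q j) \<partial>lebesgue) \<longlonglongrightarrow> (\<integral>\<^sup>+x. 0 \<partial>(lebesgue :: (real^'n) measure))"
  proof (rule nn_integral_dominated_convergence)
    have hm: "h \<in> borel_measurable lebesgue" using h qpos by (simp add: Lp_space_iff)
    show "(\<lambda>x. ennreal (2 powr q j) * ennreal (norm (h x) powr q j)) \<in> borel_measurable lebesgue" by (intro norm_powr_measurable hm)
    show "(\<lambda>x. ennreal (norm (D k x) powr q j)) \<in> borel_measurable lebesgue" for k
    proof -
      have "D k \<in> borel_measurable lebesgue" using D[of k] qpos by (simp add: Lp_space_iff)
      then show ?thesis by (rule norm_powr_measurable)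
    qed
    have "(\<integral>\<^sup>+x. ennreal (2 powr q j) * ennreal (norm (h x) powr q j) \<partial>lebesgue) = ennreal (2 powr q j) * pow_int (q j) h"
      unfolding pow_int_def by (subst nn_integral_cmult) (intro norm_powr_measurable hm, simp only: nn_integral_completion)
    also have "\<dots> < \<infinity>" using h qpos by (simp add: Lp_space_iff ennreal_mult_less_top)
    finally show "(\<integral>\<^sup>+x. ennreal (2 powr q j) * ennreal (norm (h x) powr q j) \<partial>lebesgue) < \<infinity>" .
    show "AE x in lebesgue. ennreal (norm (D k x) powr q j) \<le> ennreal (2 powr q j) * ennreal (norm (h x) powr q j)" for k
    proof (rule AE_I2)
      fix x
      have "norm (D k x) \<le> 2 * norm (h x)" using le[of k x] gh[of x] norm_triangle_ineq4[of "G k x" "g x"] by (simp add: D_def)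
      then have "norm (D k x) powr q j \<le> (2 * norm (h x)) powr q j" using qpos[of j] by (intro powr_mono2) auto
      then show "ennreal (norm (D k x) powr q j) \<le> ennreal (2 powr q j) * ennreal (norm (h x) powr q j)"
        by (simp add: ennreal_mult[symmetric] powr_mult ennreal_leI)
    qed
    show "AE x in lebesgue. (\<lambda>k. ennreal (norm (D k x) powr q j)) \<longlonglongrightarrow> 0"
    proof (rule AE_I2)
      fix x
      have "(\<lambda>k. norm (D k x)) \<longlonglongrightarrow> norm (g x - g x)"
        unfolding D_def by (intro tendsto_norm tendsto_diff lim tendsto_const)
      then have "(\<lambda>k. norm (D k x) powr q j) \<longlonglongrightarrow> 0 powr q j"
        using qpos[of j] by (intro tendsto_powr2 tendsto_const) auto
      then have "(\<lambda>k. ennreal (norm (D k x) powr q j)) \<longlonglongrightarrow> ennreal 0" using qpos[of j] by (intro tendsto_ennrealI) simp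
      then show "(\<lambda>k. ennreal (norm (D k x) powr q j)) \<longlonglongrightarrow> 0" by simp
    qed
  qed simp
  then have "(\<lambda>k. pow_int (q j) (D k)) \<longlonglongrightarrow> 0" by (simp add: pow_int_def nn_integral_completion)
  then have "(\<lambda>k. enn2real (pow_int (q j) (D k))) \<longlonglongrightarrow> enn2real 0"
    by (intro tendsto_enn2real) auto
  then have "(\<lambda>k. enn2real (pow_int (q j) (D k))) \<longlonglongrightarrow> 0" by simp
  from T_small[OF f D this] obtain r :: "nat \<Rightarrow> nat" where r: "strict_mono r" "AE x in lborel. (\<lambda>k. T (f(j := D (r k))) x) \<longlonglongrightarrow> 0"
    by blast
  have fg: "(f(j := g)) i \<in> L i" for i using f g by auto
  have "AE x in lborel. T (f(j := G k)) x = T (f(j := g)) x + T (f(j := D k)) x" for k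
    using T_lin[of "f(j := g)" "D k" j 1, OF fg D] by (simp add: D_def[abs_def])
  then have "AE x in lborel. \<forall>k. T (f(j := G k)) x = T (f(j := g)) x + T (f(j := D k)) x"
    by (simp add: AE_all_countable)
  then have "AE x in lborel. (\<lambda>k. T (f(j := G (r k))) x) \<longlonglongrightarrow> T (f(j := g)) x"
    using r(2)
  proof eventually_elim
    case (elim x)
    have "(\<lambda>k. T (f(j := g)) x + T (f(j := D (r k))) x) \<longlonglongrightarrow> T (f(j := g)) x + 0"
      by (intro tendsto_add tendsto_const elim(2))
    then show ?case using elim(1) by simp
  qed
  then show ?thesis using r(1) by blast
qed

lemma T_cong1:
  assumes f: "\<And>i. f i \<in> L i" and g: "g \<in> L j" and eq: "AE x in lborel. f j x = g x"
  shows "AE x in lborel. T (f(j := g)) x = T f x"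
proof -
  define D where "D x = g x - f j x" for x
  have D: "D \<in> L j"
    using Lp_lin[OF qpos f[of j] g, of "-1"] by (simp add: D_def[abs_def])
  have "pow_int (q j) D = (\<integral>\<^sup>+x. 0 \<partial>(lborel :: (real^'n) measure))"
    unfolding pow_int_def using eq by (intro nn_integral_cong_AE) (auto simp: D_def elim!: eventually_mono)
  then have "(\<lambda>k. enn2real (pow_int (q j) ((\<lambda>_. D) k))) \<longlonglongrightarrow> 0" by simp
  from T_small[OF f D this] have "AE x in lborel. T (f(j := D)) x = 0"
    by (auto elim!: eventually_mono simp: LIMSEQ_const_iff)
  moreover have "AE x in lborel. T (f(j := g)) x = T f x + T (f(j := D)) x"
    using T_lin[of f D j 1, OF f D] by (simp add: D_def[abs_def])
  ultimately show ?thesis by eventually_elim simp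
qed

lemma T_cong:
  assumes f: "\<And>i. f i \<in> L i" and g: "\<And>i. g i \<in> L i" and eq: "\<And>i. AE x in lborel. f i x = g i x"
  shows "AE x in lborel. T f x = T g x"
proof -
  have "AE x in lborel. T (\<lambda>i. if i \<in> J then g i else f i) x = T f x" if "finite J" for J
    using that
  proof induction
    case (insert j J)
    let ?F = "\<lambda>i. if i \<in> J then g i else f i"
    have F: "?F i \<in> L i" for i using f g by auto
    have "(\<lambda>i. if i \<in> insert j J then g i else f i) = ?F(j := g j)" by auto
    moreover have "AE x in lborel. T (?F(j := g j)) x = T ?F x"
      by (rule T_cong1[of ?F, OF F g]) (use eq[of j] insert.hyps in auto)
    ultimately have "AE x in lborel. T (\<lambda>i. if i \<in> insert j J then g i else f i) x = T ?F x" by simp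
    then show ?case using insert.IH by eventually_elim simp
  qed simp
  from this[of UNIV] show ?thesis by (auto elim!: eventually_mono)
qed

text \<open>
  With \<open>U\<close> the \<open>dyadic_op\<close>, \<open>|f| \<le> 1 + |f|\<^sup>q\<close> gives \<open>U|f| \<le> U 1 + U(|f|\<^sup>q)\<close>, where \<open>U 1\<close> is constant and \<open>U(|f|\<^sup>q)\<close>
  is integrable.
\<close>

lemma AE_abs_convergent:
  assumes f: "\<And>i. f i \<in> borel_measurable borel" "\<And>i. f i \<in> L i"
  shows "AE x in lborel. abs_convergent f x"
proof -
  have "AE x in lborel. dyadic_op \<beta> (\<lambda>z. ennreal (norm (f i z))) x < \<infinity>" for i
  proof -
    define F where "F z = ennreal (norm (f i z) powr q i)" for z
    have [measurable]: "F \<in> borel_measurable borel" using f(1)[of i] unfolding F_def[abs_def] by measurable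
    have "(\<integral>\<^sup>+x. dyadic_op \<beta> F x \<partial>lborel) = ennreal (dyadic_mass \<beta> TYPE(real^'n)) * (\<integral>\<^sup>+x. F x \<partial>lborel)"
      by (rule nn_integral_dyadic_op[OF beta]) measurable
    also have "(\<integral>\<^sup>+x. F x \<partial>lborel) = pow_int (q i) (f i)" by (simp add: pow_int_def F_def)
    also have "ennreal (dyadic_mass \<beta> TYPE(real^'n)) * pow_int (q i) (f i) < \<infinity>"
      using f(2)[of i] qpos by (simp add: Lp_space_iff ennreal_mult_less_top)
    finally have fi: "(\<integral>\<^sup>+x. dyadic_op \<beta> F x \<partial>lborel) < \<infinity>" .
    have ne: "AE x in lborel. dyadic_op \<beta> F x \<noteq> \<infinity>"
      by (rule nn_integral_noteq_infinite) (measurable, use fi in simp)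
    have bound: "dyadic_op \<beta> (\<lambda>z. ennreal (norm (f i z))) x \<le> ennreal (dyadic_mass \<beta> TYPE(real^'n)) * 1 + dyadic_op \<beta> F x" for x
    proof -
      have pt: "ennreal (norm (f i z)) \<le> 1 + F z" for z
      proof -
        have "norm (f i z) \<le> 1 + norm (f i z) powr q i"
        proof (cases "norm (f i z) \<le> 1")
          case False
          then have "norm (f i z) powr 1 \<le> norm (f i z) powr q i" using q[of i] by (intro powr_mono) auto
          then show ?thesis using False by simp
        qed (simp add: add_increasing2)
        then have "ennreal (norm (f i z)) \<le> ennreal (1 + norm (f i z) powr q i)" by (rule ennreal_leI)
        then show ?thesis by (simp add: F_def)
      qed
      have "dyadic_op \<beta> (\<lambda>z. ennreal (norm (f i z))) x \<le> dyadic_op \<beta> (\<lambda>z. 1 + F z) x"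
        by (intro dyadic_op_mono_AE AE_I2 pt)
      also have "\<dots> = dyadic_op \<beta> (\<lambda>z. 1) x + dyadic_op \<beta> F x" by (rule dyadic_op_add) measurable
      finally show ?thesis using beta by (simp add: dyadic_op_const)
    qed
    from ne show ?thesis
    proof eventually_elim
      case (elim x)
      have "ennreal (dyadic_mass \<beta> TYPE(real^'n)) * 1 + dyadic_op \<beta> F x < \<infinity>"
        using elim by (simp add: less_top)
      then show ?case using bound by (rule le_less_trans[rotated])
    qed
  qed
  then have "AE x in lborel. \<forall>i\<in>UNIV. dyadic_op \<beta> (\<lambda>z. ennreal (norm (f i z))) x < \<infinity>"
    by (intro AE_finite_allI) auto
  then show ?thesis by (simp add: abs_convergent_def)
qed

section \<open>The operator minus its kernel integral is multiplication by a bounded function\<close>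

abbreviation BM where "BM \<equiv> borel_measurable (borel :: (real^'n) measure) :: (real^'n \<Rightarrow> complex) set"

lemma kernel_op_lin_AE:
  assumes f: "\<And>i. f i \<in> BM" "\<And>i. f i \<in> L i" and g: "g \<in> BM" "g \<in> L j"
  shows "AE x in lborel. kernel_op K (f(j := (\<lambda>y. a * f j y + g y))) x = a * kernel_op K f x + kernel_op K (f(j := g)) x"
proof -
  have "(f(j := g)) i \<in> BM" "(f(j := g)) i \<in> L i" for i using f g by auto
  then have "AE x in lborel. abs_convergent (f(j := g)) x" by (intro AE_abs_convergent)
  moreover have "AE x in lborel. abs_convergent f x" using f by (intro AE_abs_convergent)
  ultimately show ?thesis
  proof eventually_elim
    case (elim x)
    show ?case by (rule kernel_op_linear[OF f(1) g(1) elim(2,1)])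
  qed
qed

text \<open>
  In slot \<open>j\<close>, and at the points with property \<open>R\<close>, the operator minus its kernel integral acts on \<open>g\<close> as
  multiplication by \<open>c\<close>. The class of these \<open>g\<close> is closed under linear combinations and dominated limits, so
  it suffices to find indicators of boxes in it.
\<close>

definition mult_at where
  "mult_at f j R c g \<longleftrightarrow> (AE x in lborel. R x \<longrightarrow> T (f(j := g)) x = c x * g x + kernel_op K (f(j := g)) x)"

lemma mult_at_lin:
  assumes f: "\<And>i. f i \<in> BM" "\<And>i. f i \<in> L i" and g: "g1 \<in> BM" "g1 \<in> L j" "g2 \<in> BM" "g2 \<in> L j"
    and Q: "mult_at f j R c g1" "mult_at f j R c g2"
  shows "mult_at f j R c (\<lambda>y. a * g1 y + g2 y)"
proof -
  have F: "(f(j := g1)) i \<in> BM" "(f(j := g1)) i \<in> L i" for i using f g by auto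
  have 1: "AE x in lborel. T (f(j := (\<lambda>y. a * g1 y + g2 y))) x = a * T (f(j := g1)) x + T (f(j := g2)) x"
    using T_lin[of "f(j := g1)" g2 j a, OF F(2) g(4)] by simp
  have 2: "AE x in lborel. kernel_op K (f(j := (\<lambda>y. a * g1 y + g2 y))) x = a * kernel_op K (f(j := g1)) x + kernel_op K (f(j := g2)) x"
    using kernel_op_lin_AE[of "f(j := g1)" g2 j a, OF F g(3,4)] by simp
  show ?thesis using 1 2 Q unfolding mult_at_def
    by eventually_elim (simp add: algebra_simps)
qed

lemma mult_at_lim:
  assumes f: "\<And>i. f i \<in> BM" "\<And>i. f i \<in> L i" and G: "\<And>k. G k \<in> BM" "\<And>k. mult_at f j R c (G k)"
    and g: "g \<in> BM" and h: "h \<in> BM" "h \<in> L j"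
    and lim: "\<And>x. (\<lambda>k. G k x) \<longlonglongrightarrow> g x" and le: "\<And>k x. norm (G k x) \<le> norm (h x)"
  shows "mult_at f j R c g"
proof -
  have leb: "u \<in> borel_measurable lebesgue" if "u \<in> BM" for u using that by (simp add: measurable_completion)
  have GL: "G k \<in> L j" for k using Lp_dom[OF qpos h(2) leb[OF G(1)], of k] le by simp
  have gh: "norm (g x) \<le> norm (h x)" for x
    using le by (intro LIMSEQ_le_const2[OF tendsto_norm[OF lim]]) auto
  have gL: "g \<in> L j" using Lp_dom[OF qpos h(2) leb[OF g]] gh by simp
  obtain r :: "nat \<Rightarrow> nat" where r: "strict_mono r" "AE x in lborel. (\<lambda>k. T (f(j := G (r k))) x) \<longlonglongrightarrow> T (f(j := g)) x"
    using T_dom[OF f(2) GL gL h(2) lim le] by blast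
  have fh: "(f(j := h)) i \<in> BM" "(f(j := h)) i \<in> L i" for i using f h by auto
  have abs_convergent: "AE x in lborel. abs_convergent (f(j := h)) x" by (rule AE_abs_convergent) (rule fh)+
  have all: "AE x in lborel. \<forall>k. R x \<longrightarrow> T (f(j := G k)) x = c x * G k x + kernel_op K (f(j := G k)) x"
    unfolding AE_all_countable using G(2) by (simp add: mult_at_def)
  show ?thesis unfolding mult_at_def using r(2) abs_convergent all
  proof eventually_elim
    case (elim x)
    show ?case
    proof
      assume "R x"
      have k: "(\<lambda>k. kernel_op K (f(j := G k)) x) \<longlonglongrightarrow> kernel_op K (f(j := g)) x"
        by (rule kernel_op_dominated[OF f(1) G(1) g lim h(1) le elim(2)])
      have "(\<lambda>k. c x * G (r k) x + kernel_op K (f(j := G (r k))) x) \<longlonglongrightarrow> c x * g x + kernel_op K (f(j := g)) x"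
        using LIMSEQ_subseq_LIMSEQ[OF k r(1)] LIMSEQ_subseq_LIMSEQ[OF lim r(1), of x]
        by (intro tendsto_add tendsto_mult tendsto_const) (auto simp: o_def)
      then have "(\<lambda>k. T (f(j := G (r k))) x) \<longlonglongrightarrow> c x * g x + kernel_op K (f(j := g)) x"
        using elim(3) \<open>R x\<close> by simp
      with elim(1) show "T (f(j := g)) x = c x * g x + kernel_op K (f(j := g)) x"
        by (rule LIMSEQ_unique)
    qed
  qed
qed

definition box_ind :: "real^'n \<Rightarrow> real^'n \<Rightarrow> real^'n \<Rightarrow> complex" where "box_ind a b = indicator (box a b)"

lemma box_ind: "box_ind a b \<in> BM" "box_ind a b \<in> L j"
proof -
  show "box_ind a b \<in> L j" unfolding box_ind_def
    by (rule Lp_indicator(1)) (use qpos emeasure_box_finite[of a b] in auto)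
qed (simp add: box_ind_def)

lemma norm_box_ind: "norm (box_ind a b x) = indicator (box a b) x"
  by (simp add: box_ind_def indicator_def)

lemma box_approx_BM: "box_approx a b k \<in> BM"
  using box_approx_test[of a b k] by (intro borel_measurable_continuous_onI smooth_continuous) (simp add: test_fun_def)

lemma box_approx_L: "box_approx (a::real^'n) b k \<in> L j"
  by (rule Lp_dom[OF qpos box_ind(2)[of a b]])
     (use box_approx_BM[of a b k] box_approx_le[of a b k] in \<open>simp_all add: measurable_completion norm_box_ind\<close>)

text \<open>
  The kernel representation of the operator concerns test functions. The slots in \<open>J\<close> have already been passed from test
  functions to indicators of boxes; each new slot is a dominated limit with multiplier \<open>0\<close>.
\<close>

lemma T_boxes_off_diagonal_gen:
  assumes "finite J"
  shows "AE x in lborel. (\<exists>i. x \<notin> cbox (l i) (u i)) \<longrightarrow>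
     T (\<lambda>i. if i \<in> J then box_ind (l i) (u i) else box_approx (l i) (u i) (n i)) x =
     kernel_op K (\<lambda>i. if i \<in> J then box_ind (l i) (u i) else box_approx (l i) (u i) (n i)) x"
  using assms
proof (induction J arbitrary: n)
  case empty
  let ?f = "\<lambda>i. box_approx (l i) (u i) (n i)"
  have "\<forall>j. test_fun (?f j)" by (simp add: box_approx_test)
  from hk[unfolded has_kernel_def, THEN spec, of ?f, THEN mp, OF this]
  have ae: "AE x in lborel. x \<notin> (\<Inter>j. supp (?f j)) \<longrightarrow> T ?f x = kernel_op K ?f x"
    unfolding AE_lebesgue by (simp add: kernel_op_def cons_point_def)
  show ?case unfolding empty_iff if_False using ae
  proof eventually_elim
    case (elim x)
    show ?case
    proof
      assume "\<exists>i. x \<notin> cbox (l i) (u i)"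
      then obtain i where "x \<notin> cbox (l i) (u i)" by blast
      then have "x \<notin> supp (?f i)" using box_approx_supp[of "l i" "u i" "n i"] by blast
      then show "T ?f x = kernel_op K ?f x" using elim by blast
    qed
  qed
next
  case (insert j J)
  let ?F = "\<lambda>i. if i \<in> J then box_ind (l i) (u i) else box_approx (l i) (u i) (n i)"
  let ?R = "\<lambda>x. \<exists>i. x \<notin> cbox (l i) (u i)"
  have F: "?F i \<in> BM" "?F i \<in> L i" for i using box_ind box_approx_BM box_approx_L by auto
  have "mult_at ?F j ?R (\<lambda>_. 0) (box_ind (l j) (u j))"
  proof (rule mult_at_lim[OF F, where G = "\<lambda>k. box_approx (l j) (u j) k" and h = "box_ind (l j) (u j)"])
    show "mult_at ?F j ?R (\<lambda>_. 0) (box_approx (l j) (u j) k)" for k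
    proof -
      have eq: "(\<lambda>i. if i \<in> J then box_ind (l i) (u i) else box_approx (l i) (u i) ((n(j := k)) i)) = ?F(j := box_approx (l j) (u j) k)"
        using insert.hyps by (auto simp: fun_eq_iff)
      show ?thesis using insert.IH[of "n(j := k)"] unfolding mult_at_def eq by simp
    qed
    show "(\<lambda>k. box_approx (l j) (u j) k x) \<longlonglongrightarrow> box_ind (l j) (u j) x" for x
      unfolding box_ind_def by (rule box_approx_lim)
    show "norm (box_approx (l j) (u j) k x) \<le> norm (box_ind (l j) (u j) x)" for k x
      using box_approx_le[of "l j" "u j" k x] by (simp add: norm_box_ind)
  qed (use box_ind box_approx_BM in auto)
  moreover have "?F(j := box_ind (l j) (u j)) = (\<lambda>i. if i \<in> insert j J then box_ind (l i) (u i) else box_approx (l i) (u i) (n i))"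
    by (auto simp: fun_eq_iff)
  ultimately show ?case by (simp add: mult_at_def)
qed

lemma T_boxes_off_diagonal:
  "AE x in lborel. (\<exists>i. x \<notin> cbox (l i) (u i)) \<longrightarrow> T (\<lambda>i. box_ind (l i) (u i)) x = kernel_op K (\<lambda>i. box_ind (l i) (u i)) x"
  using T_boxes_off_diagonal_gen[of UNIV l u "\<lambda>_. 0"] by simp

lemma AE_box_cbox: "AE x in lborel. x \<in> cbox a b \<longrightarrow> x \<in> box a (b::real^'n)"
proof -
  have "cbox a b - box a b \<in> null_sets lborel" by (rule null_sets_cbox_Diff_box)
  then show ?thesis by (rule AE_I') auto
qed

definition residual where "residual f x = T f x - kernel_op K f x"

lemma residual_off_box: "AE x in lborel. (\<exists>i. x \<notin> box (l i) (u i)) \<longrightarrow> residual (\<lambda>i. box_ind (l i) (u i)) x = 0"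
proof -
  have "AE x in lborel. \<forall>i\<in>UNIV. x \<in> cbox (l i) (u i) \<longrightarrow> x \<in> box (l i) (u i)"
    using AE_box_cbox by (intro AE_finite_allI) auto
  then show ?thesis using T_boxes_off_diagonal[of l u]
    by eventually_elim (auto simp: residual_def)
qed

lemma residual_lin:
  assumes f: "\<And>i. f i \<in> BM" "\<And>i. f i \<in> L i" and g: "g1 \<in> BM" "g1 \<in> L j" "g2 \<in> BM" "g2 \<in> L j"
  shows "AE x in lborel. residual (f(j := (\<lambda>y. a * g1 y + g2 y))) x = a * residual (f(j := g1)) x + residual (f(j := g2)) x"
proof -
  have F: "(f(j := g1)) i \<in> BM" "(f(j := g1)) i \<in> L i" for i using f g by auto
  have 1: "AE x in lborel. T (f(j := (\<lambda>y. a * g1 y + g2 y))) x = a * T (f(j := g1)) x + T (f(j := g2)) x"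
    using T_lin[of "f(j := g1)" g2 j a, OF F(2) g(4)] by simp
  have 2: "AE x in lborel. kernel_op K (f(j := (\<lambda>y. a * g1 y + g2 y))) x = a * kernel_op K (f(j := g1)) x + kernel_op K (f(j := g2)) x"
    using kernel_op_lin_AE[of "f(j := g1)" g2 j a, OF F g(3,4)] by simp
  show ?thesis using 1 2 unfolding residual_def by eventually_elim (simp add: algebra_simps)
qed

lemma zero_L: "(\<lambda>_::real^'n. 0) \<in> L j"
  using qpos by (auto simp: Lp_space_iff pow_int_def)

lemma residual_zero:
  assumes f: "\<And>i. f i \<in> BM" "\<And>i. f i \<in> L i"
  shows "AE x in lborel. residual (f(j := (\<lambda>_. 0))) x = 0"
  using residual_lin[of f "\<lambda>_. 0" j "\<lambda>_. 0" 1, OF f _ zero_L _ zero_L] by simp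

lemma residual_sum:
  assumes f: "\<And>i. f i \<in> BM" "\<And>i. f i \<in> L i" and I: "finite I" and g: "\<And>k. k \<in> I \<Longrightarrow> g k \<in> BM" "\<And>k. k \<in> I \<Longrightarrow> g k \<in> L j"
  shows "(\<lambda>y. \<Sum>k\<in>I. g k y) \<in> BM \<and> (\<lambda>y. \<Sum>k\<in>I. g k y) \<in> L j \<and>
    (AE x in lborel. residual (f(j := (\<lambda>y. \<Sum>k\<in>I. g k y))) x = (\<Sum>k\<in>I. residual (f(j := g k)) x))"
  using I g
proof (induction I rule: finite_induct)
  case empty
  show ?case using zero_L residual_zero[of f j, OF f] by (simp del: fun_upd_apply)
next
  case (insert k I)
  then have IH: "(\<lambda>y. \<Sum>k\<in>I. g k y) \<in> BM" "(\<lambda>y. \<Sum>k\<in>I. g k y) \<in> L j"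
    "AE x in lborel. residual (f(j := (\<lambda>y. \<Sum>k\<in>I. g k y))) x = (\<Sum>k\<in>I. residual (f(j := g k)) x)" by (simp_all del: fun_upd_apply)
  have k: "g k \<in> BM" "g k \<in> L j" using insert.prems by auto
  have e: "(\<lambda>y. \<Sum>k\<in>insert k I. g k y) = (\<lambda>y. 1 * g k y + (\<Sum>k\<in>I. g k y))"
    using insert.hyps by simp
  have A: "AE x in lborel. residual (f(j := (\<lambda>y. 1 * g k y + (\<Sum>k\<in>I. g k y)))) x = 1 * residual (f(j := g k)) x + residual (f(j := (\<lambda>y. \<Sum>k\<in>I. g k y))) x"
    by (rule residual_lin[OF f k IH(1,2)])
  have "AE x in lborel. residual (f(j := (\<lambda>y. \<Sum>k\<in>insert k I. g k y))) x = (\<Sum>k\<in>insert k I. residual (f(j := g k)) x)"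
    unfolding e using A IH(3) by eventually_elim (simp add: insert.hyps del: fun_upd_apply)
  moreover have "(\<lambda>y. \<Sum>k\<in>insert k I. g k y) \<in> L j"
    using Lp_lin[OF qpos k(2) IH(2), of 1] insert.hyps by simp
  moreover have "(\<lambda>y. \<Sum>k\<in>insert k I. g k y) \<in> BM" using k IH insert.hyps by simp
  ultimately show ?case by blast
qed

lemma residual_cong:
  assumes f: "\<And>i. f i \<in> BM" "\<And>i. f i \<in> L i" and g: "\<And>i. g i \<in> BM" "\<And>i. g i \<in> L i" and eq: "\<And>i. AE x in lborel. f i x = g i x"
  shows "AE x in lborel. residual f x = residual g x"
proof -
  have "kernel_op K f = kernel_op K g" by (rule kernel_op_cong_AE[OF eq g(1)])
  then show ?thesis using T_cong[OF f(2) g(2) eq] by (auto simp: residual_def)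
qed

text \<open>
  The multiplier is first found on the central boxes of half-side \<open>n\<close>, as the residual of the operator on the tuple
  of indicators of such a box.
\<close>

definition central_ind :: "nat \<Rightarrow> real^'n \<Rightarrow> complex" where "central_ind n = box_ind (- (real n *\<^sub>R One)) (real n *\<^sub>R One)"
definition central_box :: "nat \<Rightarrow> (real^'n) set" where "central_box n = box (- (real n *\<^sub>R One)) (real n *\<^sub>R One)"
definition central_multiplier where "central_multiplier n = residual (\<lambda>_. central_ind n)"

text \<open>
  Extend \<open>box a b\<close> to a partition of the central box into boxes. By linearity the residual for the central box is the sum of
  those for the pieces, and each of these vanishes off its piece. Almost every point is interior to one piece only, so at
  points of \<open>box a b\<close> just one summand remains.
\<close>

lemma residual_split:
  assumes f: "\<And>i. f i = box_ind (l i) (u i)" and sub: "box a b \<subseteq> central_box n"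
  shows "AE x in lborel. residual (f(j := box_ind a b)) x = box_ind a b x * residual (f(j := central_ind n)) x"
proof -
  let ?lo = "- (real n *\<^sub>R One) :: real^'n" and ?hi = "real n *\<^sub>R One :: real^'n"
  have fB: "f i \<in> BM" "f i \<in> L i" for i using box_ind f by auto
  have off: "AE x in lborel. x \<notin> box c d \<longrightarrow> residual (f(j := box_ind c d)) x = 0" for c d
  proof -
    have "f(j := box_ind c d) = (\<lambda>i. box_ind ((l(j := c)) i) ((u(j := d)) i))" by (auto simp: f)
    then show ?thesis using residual_off_box[of "l(j := c)" "u(j := d)"]
      by (auto elim!: eventually_mono split: if_splits)
  qed
  show ?thesis
  proof (cases "box a b = {}")
    case True
    then have "box_ind a b = (\<lambda>_. 0)" by (auto simp: box_ind_def)
    then show ?thesis using residual_zero[of f j, OF fB] by simp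
  next
    case False
    then have cne: "cbox a b \<noteq> {}" using box_subset_cbox[of a b] by auto
    have "cbox a b \<subseteq> cbox ?lo ?hi"
    proof -
      have "closure (box a b) \<subseteq> closure (central_box n)" using sub by (rule closure_mono)
      also have "\<dots> \<subseteq> cbox ?lo ?hi" unfolding central_box_def by (rule closure_minimal) (auto simp: box_subset_cbox)
      finally show ?thesis using False by (simp add: closure_box)
    qed
    then obtain p where p: "p division_of cbox ?lo ?hi" "cbox a b \<in> p"
      using partial_division_extend_1[OF _ cne] by metis
    have fin: "finite p" using p(1) by auto
    define cl where "cl k = (SOME c. \<exists>d. k = cbox c d)" for k :: "(real^'n) set"
    define cu where "cu k = (SOME d. k = cbox (cl k) d)" for k :: "(real^'n) set"
    have kbox: "k = cbox (cl k) (cu k)" if kp: "k \<in> p" for k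
    proof -
      obtain c d where "k = cbox c d" using division_ofD(4)[OF p(1) kp] by blast
      then have "\<exists>c. \<exists>d. k = cbox c d" by blast
      then have "\<exists>d. k = cbox (cl k) d" unfolding cl_def by (rule someI_ex)
      then show ?thesis unfolding cu_def by (rule someI_ex)
    qed
    have kint: "interior k = box (cl k) (cu k)" if "k \<in> p" for k
      using kbox[OF that] interior_cbox by metis
    define g where "g k = box_ind (cl k) (cu k)" for k
    have g: "g k \<in> BM" "g k \<in> L j" for k using box_ind by (auto simp: g_def)
    have ab: "interior (cbox a b) = box a b" by (rule interior_cbox)
    have gab: "g (cbox a b) = box_ind a b" using kint[OF p(2)] ab by (simp add: g_def box_ind_def)
    have aeint: "AE x in lborel. \<forall>k\<in>p. x \<in> k \<longrightarrow> x \<in> interior k"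
    proof (rule AE_finite_allI[OF fin])
      fix k assume k: "k \<in> p"
      show "AE x in lborel. x \<in> k \<longrightarrow> x \<in> interior k"
        using AE_box_cbox[of "cl k" "cu k"] kint[OF k] kbox[OF k] by simp
    qed
    have sum1: "AE x in lborel. (\<Sum>k\<in>p. g k x) = central_ind n x"
      using aeint AE_box_cbox[of ?lo ?hi]
    proof eventually_elim
      case (elim x)
      show ?case
      proof (cases "x \<in> cbox ?lo ?hi")
        case True
        then obtain k where k: "k \<in> p" "x \<in> k" using division_ofD(6)[OF p(1)] by blast
        then have xk: "x \<in> interior k" using elim(1) by blast
        have "g k' x = (if k' = k then 1 else 0)" if "k' \<in> p" for k'
        proof (cases "k' = k")
          case False
          then have "interior k' \<inter> interior k = {}" using division_ofD(5)[OF p(1) that k(1)] by blast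
          then show ?thesis using xk kint[OF that] False by (auto simp: g_def box_ind_def)
        qed (use xk kint[OF k(1)] in \<open>simp add: g_def box_ind_def\<close>)
        then have "(\<Sum>k'\<in>p. g k' x) = (\<Sum>k'\<in>p. if k' = k then 1 else 0)" by (intro sum.cong) auto
        also have "\<dots> = 1" using k fin by simp
        finally show ?thesis using True elim(2) by (simp add: central_ind_def box_ind_def)
      next
        case F: False
        have "g k x = 0" if "k \<in> p" for k
        proof -
          have "x \<notin> k" using F division_ofD(2)[OF p(1) that] by blast
          then have "x \<notin> interior k" using interior_subset by blast
          then show ?thesis using kint[OF that] by (simp add: g_def box_ind_def)
        qed
        moreover have "x \<notin> box ?lo ?hi" using F box_subset_cbox by blast
        ultimately show ?thesis by (simp add: central_ind_def box_ind_def)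
      qed
    qed
    have S: "(\<lambda>y. \<Sum>k\<in>p. g k y) \<in> BM" "(\<lambda>y. \<Sum>k\<in>p. g k y) \<in> L j"
      "AE x in lborel. residual (f(j := (\<lambda>y. \<Sum>k\<in>p. g k y))) x = (\<Sum>k\<in>p. residual (f(j := g k)) x)"
      using residual_sum[of f p g j, OF fB fin g] by auto
    have QB: "central_ind n \<in> BM" "central_ind n \<in> L j" using box_ind by (auto simp: central_ind_def)
    have c: "AE x in lborel. residual (f(j := (\<lambda>y. \<Sum>k\<in>p. g k y))) x = residual (f(j := central_ind n)) x"
    proof (rule residual_cong)
      show "(f(j := (\<lambda>y. \<Sum>k\<in>p. g k y))) i \<in> BM" "(f(j := (\<lambda>y. \<Sum>k\<in>p. g k y))) i \<in> L i"
        "(f(j := central_ind n)) i \<in> BM" "(f(j := central_ind n)) i \<in> L i" for i using fB S QB by auto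
      show "AE x in lborel. (f(j := (\<lambda>y. \<Sum>k\<in>p. g k y))) i x = (f(j := central_ind n)) i x" for i
        using sum1 by (cases "i = j") auto
    qed
    have off': "AE x in lborel. \<forall>k\<in>p. x \<notin> interior k \<longrightarrow> residual (f(j := g k)) x = 0"
      using off kint by (intro AE_finite_allI[OF fin]) (simp add: g_def)
    show ?thesis using S(3) c off'
    proof eventually_elim
      case (elim x)
      show ?case
      proof (cases "x \<in> box a b")
        case True
        have "residual (f(j := g k)) x = 0" if "k \<in> p - {cbox a b}" for k
        proof -
          have "interior k \<inter> interior (cbox a b) = {}" using division_ofD(5)[OF p(1) _ p(2)] that by blast
          then have "x \<notin> interior k" using True ab by auto
          then show ?thesis using elim(3) that by auto
        qed
        then have "(\<Sum>k\<in>p. residual (f(j := g k)) x) = residual (f(j := box_ind a b)) x"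
          using fin p(2) by (subst sum.remove[of _ "cbox a b"]) (auto simp: gab)
        then show ?thesis using elim(1,2) True by (simp add: box_ind_def)
      next
        case False
        then have "residual (f(j := g (cbox a b))) x = 0" using elim(3) p(2) ab by auto
        then show ?thesis using False by (simp add: gab box_ind_def)
      qed
    qed
  qed
qed

lemma mem_central_box: "x \<in> central_box n \<longleftrightarrow> infnorm x < real n"
  unfolding central_box_def mem_box infnorm_Max by (subst Max_less_iff) (auto simp: abs_less_iff algebra_simps)

lemma central_ind_eq: "central_ind n = indicator (central_box n)"
  by (simp add: central_ind_def central_box_def box_ind_def)

lemma central_ind_BM: "central_ind n \<in> BM" "central_ind n \<in> L j"
  using box_ind by (auto simp: central_ind_def)

lemma central_box_mono: "n \<le> n' \<Longrightarrow> central_box n \<subseteq> central_box n'"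
  by (auto simp: mem_central_box)

lemma residual_boxes_central:
  assumes sub: "\<And>i. box (l i) (u i) \<subseteq> central_box n"
  shows "AE x in lborel. residual (\<lambda>i. box_ind (l i) (u i)) x = central_multiplier n x * (\<Prod>i\<in>UNIV. box_ind (l i) (u i) x)"
proof -
  have "AE x in lborel. residual (\<lambda>i. if i \<in> J then box_ind (l i) (u i) else central_ind n) x = central_multiplier n x * (\<Prod>i\<in>J. box_ind (l i) (u i) x)" if "finite J" for J
    using that
  proof induction
    case empty
    show ?case by (simp add: central_multiplier_def)
  next
    case (insert j J)
    let ?F = "\<lambda>i. if i \<in> J then box_ind (l i) (u i) else central_ind n"
    have F: "?F i = box_ind (if i \<in> J then l i else - (real n *\<^sub>R One)) (if i \<in> J then u i else real n *\<^sub>R One)" for i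
      by (simp add: central_ind_def)
    have "AE x in lborel. residual (?F(j := box_ind (l j) (u j))) x = box_ind (l j) (u j) x * residual (?F(j := central_ind n)) x"
      by (rule residual_split[OF F sub])
    moreover have "?F(j := central_ind n) = ?F" using insert.hyps by (auto simp: fun_eq_iff)
    moreover have "?F(j := box_ind (l j) (u j)) = (\<lambda>i. if i \<in> insert j J then box_ind (l i) (u i) else central_ind n)" by (auto simp: fun_eq_iff)
    ultimately have "AE x in lborel. residual (\<lambda>i. if i \<in> insert j J then box_ind (l i) (u i) else central_ind n) x = box_ind (l j) (u j) x * residual ?F x"
      by (simp only:)
    then show ?case using insert.IH
      by eventually_elim (simp add: insert.hyps)
  qed
  from this[of UNIV] show ?thesis by simp
qed

text \<open>
  Some \<open>n\<close> such that \<open>x\<close> lies in the \<open>n\<close>-th central box.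
\<close>

definition box_index :: "real^'n \<Rightarrow> nat" where "box_index x = nat \<lceil>infnorm x\<rceil> + 1"
definition multiplier where "multiplier x = central_multiplier (box_index x) x"

lemma mem_box_index: "x \<in> central_box (box_index x)"
  using infnorm_pos_le[of x] by (simp add: mem_central_box box_index_def) linarith

lemma central_multiplier_consistent: "AE x in lborel. \<forall>n. x \<in> central_box n \<longrightarrow> central_multiplier n x = multiplier x"
proof -
  have "AE x in lborel. n \<le> n' \<longrightarrow> x \<in> central_box n \<longrightarrow> central_multiplier n x = central_multiplier n' x" for n n'
  proof (cases "n \<le> n'")
    case True
    have "AE x in lborel. residual (\<lambda>i. central_ind n) x = central_multiplier n' x * (\<Prod>i\<in>(UNIV::'m set). central_ind n x)"
      using residual_boxes_central[of "\<lambda>_. - (real n *\<^sub>R One)" "\<lambda>_. real n *\<^sub>R One" n'] central_box_mono[OF True]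
      by (simp add: central_ind_def central_box_def)
    then show ?thesis by eventually_elim (simp add: central_multiplier_def central_ind_eq)
  qed simp
  then have "AE x in lborel. \<forall>n n'. n \<le> n' \<longrightarrow> x \<in> central_box n \<longrightarrow> central_multiplier n x = central_multiplier n' x"
    by (subst AE_all_countable, intro allI, subst AE_all_countable, intro allI)
  then show ?thesis
  proof eventually_elim
    case (elim x)
    show ?case
    proof (intro allI impI)
      fix n assume x: "x \<in> central_box n"
      show "central_multiplier n x = multiplier x"
      proof (cases "n \<le> box_index x")
        case True
        show ?thesis unfolding multiplier_def by (rule elim[THEN spec, THEN spec, THEN mp, THEN mp, OF True x])
      next
        case False
        then have "box_index x \<le> n" by simp
        from elim[THEN spec, THEN spec, THEN mp, THEN mp, OF this mem_box_index] show ?thesis unfolding multiplier_def by (rule sym)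
      qed
    qed
  qed
qed

lemma residual_boxes: "AE x in lborel. residual (\<lambda>i. box_ind (l i) (u i)) x = multiplier x * (\<Prod>i\<in>UNIV. box_ind (l i) (u i) x)"
proof -
  have "bounded (\<Union>i. box (l i) (u i))" by (intro bounded_UN) auto
  then obtain r where r: "\<And>x i. x \<in> box (l i) (u i) \<Longrightarrow> norm x \<le> r" unfolding bounded_iff by blast
  obtain n :: nat where n: "r < real n" using reals_Archimedean2 by blast
  have sub: "box (l i) (u i) \<subseteq> central_box n" for i
  proof
    fix x assume "x \<in> box (l i) (u i)"
    then have "norm x \<le> r" by (rule r)
    then show "x \<in> central_box n" using n infnorm_le_norm[of x] unfolding mem_central_box by linarith
  qed
  from residual_boxes_central[of l u n, OF sub] central_multiplier_consistent show ?thesis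
  proof eventually_elim
    case (elim x)
    show ?case
    proof (cases "\<exists>i. x \<notin> box (l i) (u i)")
      case True
      then obtain i where "x \<notin> box (l i) (u i)" by blast
      then have "box_ind (l i) (u i) x = 0" by (simp add: box_ind_def)
      then have "(\<Prod>i\<in>UNIV. box_ind (l i) (u i) x) = 0" by (intro prod_zero) auto
      then show ?thesis using elim(1) by simp
    next
      case False
      then have "x \<in> central_box n" using sub by blast
      then show ?thesis using elim by simp
    qed
  qed
qed

lemma multiplier_measurable: "multiplier \<in> borel_measurable lebesgue"
proof -
  have "central_multiplier n \<in> borel_measurable lebesgue" for n
  proof -
    have 1: "T (\<lambda>_. central_ind n) \<in> borel_measurable lebesgue" by (intro T_meas central_ind_BM)
    have "kernel_op K (\<lambda>_. central_ind n) \<in> borel_measurable borel" by (intro kernel_op_measurable central_ind_BM)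
    then have 2: "kernel_op K (\<lambda>_. central_ind n) \<in> borel_measurable lebesgue" by (simp add: measurable_completion)
    show ?thesis unfolding central_multiplier_def residual_def[abs_def] using 1 2 by (rule borel_measurable_diff)
  qed
  moreover have "box_index \<in> lebesgue \<rightarrow>\<^sub>M count_space UNIV"
  proof -
    have "(infnorm :: real^'n \<Rightarrow> real) \<in> borel_measurable borel"
      by (intro borel_measurable_continuous_onI continuous_intros)
    then have "box_index \<in> borel \<rightarrow>\<^sub>M count_space UNIV" unfolding box_index_def[abs_def] by measurable
    then show ?thesis by (simp add: measurable_completion)
  qed
  ultimately show ?thesis unfolding multiplier_def[abs_def] by (rule measurable_compose_countable)
qed

lemma mult_at_zero:
  assumes "mult_at f j R c (box_ind 0 0)" shows "mult_at f j R c (\<lambda>_. 0)"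
proof -
  have "box (0::real^'n) 0 = {}" by (simp add: box_eq_empty)
  then have "box_ind 0 0 = (\<lambda>_. 0)" by (auto simp: box_ind_def)
  then show ?thesis using assms by simp
qed

lemma indicator_central_BM: "A \<in> sets borel \<Longrightarrow> indicator (A \<inter> central_box n) \<in> BM" "A \<in> sets borel \<Longrightarrow> indicator (A \<inter> central_box n) \<in> L j"
proof -
  assume A: "A \<in> sets borel"
  have Q: "central_box n \<in> sets borel" by (simp add: central_box_def)
  show "indicator (A \<inter> central_box n) \<in> BM" using A Q by simp
  have "emeasure lborel (A \<inter> central_box n) \<le> emeasure lborel (central_box n)" using Q by (intro emeasure_mono) auto
  also have "\<dots> < \<infinity>" unfolding central_box_def by (rule emeasure_box_finite)
  finally show "indicator (A \<inter> central_box n) \<in> L j" using A Q qpos by (intro Lp_indicator) auto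
qed

text \<open>
  From boxes to bounded Borel sets by Dynkin's \<open>\<pi>\<close>-\<open>\<lambda>\<close> theorem, then to simple functions by linearity, and to all
  \<open>g\<close> by a dominated limit.
\<close>

lemma mult_at_dense:
  assumes f: "\<And>i. f i \<in> BM" "\<And>i. f i \<in> L i" and Q: "\<And>a b. mult_at f j R c (box_ind a b)"
    and g: "g \<in> BM" "g \<in> L j"
  shows "mult_at f j R c g"
proof -
  have ind: "mult_at f j R c (indicator (A \<inter> central_box n))" if "A \<in> sets borel" for A n
  proof -
    let ?E = "range (\<lambda>(a, b). box a b :: (real^'n) set)"
    have A: "A \<in> sigma_sets UNIV ?E" using that by (simp add: borel_eq_box)
    have St: "Int_stable ?E" by (auto simp: Int_stable_def box_Int_box)
    have inB: "X \<in> sets borel" if "X \<in> sigma_sets UNIV ?E" for X using that by (simp add: borel_eq_box)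
    have "?E \<subseteq> Pow UNIV" by auto
    from St this A show ?thesis
    proof (induction rule: sigma_sets_induct_disjoint)
      case (basic A)
      then obtain a b where "A = box a b" by auto
      then have "\<exists>a b. A \<inter> central_box n = box a b" by (simp only: central_box_def box_Int_box) blast
      then show ?case using Q by (auto simp: box_ind_def[symmetric])
    next
      case empty
      show ?case using mult_at_zero[OF Q] by simp
    next
      case (compl A)
      have "indicator ((UNIV - A) \<inter> central_box n) = (\<lambda>y. - 1 * indicator (A \<inter> central_box n) y + central_ind n y :: complex)"
        by (auto simp: central_ind_eq indicator_def fun_eq_iff)
      moreover have "mult_at f j R c (\<lambda>y. - 1 * indicator (A \<inter> central_box n) y + central_ind n y)"
        by (rule mult_at_lin[OF f indicator_central_BM central_ind_BM]) (use inB compl Q in \<open>auto simp: central_ind_def\<close>)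
      ultimately show ?case by simp
    next
      case (union A)
      define G where "G k = (indicator ((\<Union>i<k. A i) \<inter> central_box n) :: real^'n \<Rightarrow> complex)" for k
      have Ab: "A i \<in> sets borel" for i using union(2) inB by blast
      have Gb: "G k \<in> BM" "G k \<in> L j" for k unfolding G_def using Ab by (auto intro!: indicator_central_BM)
      have GQ: "mult_at f j R c (G k)" for k
      proof (induction k)
        case 0
        show ?case using mult_at_zero[OF Q] by (simp add: G_def)
      next
        case (Suc k)
        have "x \<notin> A k" if "x \<in> A i" "i < k" for x i
          using disjoint_family_onD[OF union(1), of i k] that by auto
        then have "G (Suc k) = (\<lambda>y. 1 * indicator (A k \<inter> central_box n) y + G k y)"
          by (auto simp: G_def indicator_def fun_eq_iff less_Suc_eq)
        then show ?case using mult_at_lin[OF f indicator_central_BM[OF Ab] Gb union(3) Suc, of 1] by simp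
      qed
      show ?case
      proof (rule mult_at_lim[OF f Gb(1) GQ _ central_ind_BM])
        show "indicator ((\<Union>i. A i) \<inter> central_box n) \<in> BM" using Ab by (intro indicator_central_BM) auto
        show "(\<lambda>k. G k x) \<longlonglongrightarrow> indicator ((\<Union>i. A i) \<inter> central_box n) x" for x
        proof (cases "x \<in> (\<Union>i. A i) \<inter> central_box n")
          case True
          then obtain i where i: "x \<in> A i" by blast
          have "G k x = 1" if "k > i" for k
          proof -
            have "x \<in> (\<Union>i<k. A i) \<inter> central_box n" using that True i by blast
            then show ?thesis by (simp add: G_def)
          qed
          then show ?thesis using True
            by (intro tendsto_eventually eventually_sequentiallyI[of "Suc i"]) auto
        next
          case False
          have "G k x = 0" for k
          proof -
            have "x \<notin> (\<Union>i<k. A i) \<inter> central_box n" using False by blast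
            then show ?thesis by (simp add: G_def)
          qed
          then show ?thesis using False by simp
        qed
        show "norm (G k x) \<le> norm (central_ind n x)" for k x by (auto simp: G_def central_ind_eq indicator_def)
      qed
    qed
  qed
  obtain F where F: "\<And>i. simple_function borel (F i)" "\<And>x. (\<lambda>i. F i x) \<longlonglongrightarrow> g x" "\<And>i x. norm (F i x) \<le> 2 * norm (g x)"
    using borel_measurable_implies_sequence_metric[OF g(1), of 0] by (auto simp: dist_norm)
  define G where "G i x = F i x * indicator (central_box i) x" for i x
  have simp_sum: "(\<lambda>x. \<Sum>v\<in>V. v * indicator (F i -` {v} \<inter> central_box i) x) \<in> BM \<and> (\<lambda>x. \<Sum>v\<in>V. v * indicator (F i -` {v} \<inter> central_box i) x) \<in> L j \<and>
     mult_at f j R c (\<lambda>x. \<Sum>v\<in>V. v * indicator (F i -` {v} \<inter> central_box i) x)" if "finite V" "V \<subseteq> range (F i)" for V i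
    using that
  proof (induction V rule: finite_induct)
    case empty
    then show ?case using mult_at_zero[OF Q] zero_L by simp
  next
    case (insert v V)
    let ?S = "\<lambda>x. \<Sum>v\<in>V. v * indicator (F i -` {v} \<inter> central_box i) x"
    have IH: "?S \<in> BM" "?S \<in> L j" "mult_at f j R c ?S" using insert by auto
    have b: "F i -` {v} \<in> sets borel"
    proof -
      have "F i -` {v} \<inter> space borel \<in> sets borel" using F(1)[of i] insert.prems by (intro simple_functionD)
      then show ?thesis by simp
    qed
    have e: "(\<lambda>x. \<Sum>v\<in>insert v V. v * indicator (F i -` {v} \<inter> central_box i) x) = (\<lambda>x. v * indicator (F i -` {v} \<inter> central_box i) x + ?S x)"
      by (intro ext sum.insert insert.hyps)
    show ?case unfolding e
    proof (intro conjI)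
      show "(\<lambda>x. v * indicator (F i -` {v} \<inter> central_box i) x + ?S x) \<in> BM"
        by (intro borel_measurable_add borel_measurable_times borel_measurable_const indicator_central_BM b IH)
      show "(\<lambda>x. v * indicator (F i -` {v} \<inter> central_box i) x + ?S x) \<in> L j"
        by (intro Lp_lin qpos indicator_central_BM b IH)
      show "mult_at f j R c (\<lambda>x. v * indicator (F i -` {v} \<inter> central_box i) x + ?S x)"
        by (rule mult_at_lin[OF f indicator_central_BM(1)[OF b] indicator_central_BM(2)[OF b] IH(1,2) ind[OF b] IH(3)])
    qed
  qed
  have Gs: "G i = (\<lambda>x. \<Sum>v\<in>range (F i). v * indicator (F i -` {v} \<inter> central_box i) x)" for i
  proof
    fix x
    have fin: "finite (range (F i))" using F(1)[of i] by (simp add: simple_function_def)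
    have "(\<Sum>v\<in>range (F i). v * indicator (F i -` {v} \<inter> central_box i) x) = (\<Sum>v\<in>range (F i). if v = F i x then v * indicator (central_box i) x else 0)"
      by (intro sum.cong) (auto simp: indicator_def)
    also have "\<dots> = G i x" using fin by (simp add: G_def)
    finally show "G i x = (\<Sum>v\<in>range (F i). v * indicator (F i -` {v} \<inter> central_box i) x)" by simp
  qed
  have G: "G i \<in> BM" "mult_at f j R c (G i)" for i
    using simp_sum[of "range (F i)" i] F(1)[of i] unfolding Gs by (auto simp: simple_function_def)
  have h: "(\<lambda>x. 2 * g x) \<in> BM" "(\<lambda>x. 2 * g x) \<in> L j"
    using g Lp_lin[OF qpos g(2) zero_L, of 2] by auto
  show ?thesis
  proof (rule mult_at_lim[OF f G g(1) h])
    show "(\<lambda>i. G i x) \<longlonglongrightarrow> g x" for x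
    proof (rule Lim_transform_eventually[OF F(2)])
      show "\<forall>\<^sub>F i in sequentially. F i x = G i x"
      proof (rule eventually_sequentiallyI[of "box_index x"])
        fix i assume "box_index x \<le> i"
        then have "x \<in> central_box i" using mem_box_index[of x] central_box_mono by blast
        then show "F i x = G i x" by (simp add: G_def)
      qed
    qed
    show "norm (G i x) \<le> norm (2 * g x)" for i x
      using F(3)[of i x] by (auto simp: G_def norm_mult indicator_def)
  qed
qed

lemma prod_upd_split: "(\<Prod>i\<in>(UNIV::'m set). (F(j := g)) i x) = (\<Prod>i\<in>UNIV - {j}. F i x) * (g x :: complex)"
  by (subst prod.remove[of _ j]) (auto simp: mult.commute)

text \<open>
  The indicators of boxes are replaced by general functions one slot at a time.
\<close>

lemma representation_borel:
  assumes f: "\<And>i. f i \<in> BM" "\<And>i. f i \<in> L i"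
  shows "AE x in lborel. T f x = multiplier x * (\<Prod>i\<in>UNIV. f i x) + kernel_op K f x"
proof -
  have "\<forall>l u. AE x in lborel. T (\<lambda>i. if i \<in> J then f i else box_ind (l i) (u i)) x =
      multiplier x * (\<Prod>i\<in>UNIV. (if i \<in> J then f i else box_ind (l i) (u i)) x) + kernel_op K (\<lambda>i. if i \<in> J then f i else box_ind (l i) (u i)) x"
    if "finite J" for J
    using that
  proof induction
    case empty
    have "AE x in lborel. T (\<lambda>i. box_ind (l i) (u i)) x = multiplier x * (\<Prod>i\<in>UNIV. box_ind (l i) (u i) x) + kernel_op K (\<lambda>i. box_ind (l i) (u i)) x" for l u
      using residual_boxes[of l u] by eventually_elim (simp add: residual_def algebra_simps)
    then show ?case by simp
  next
    case (insert j J)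
    show ?case
    proof (intro allI)
      fix l u
      let ?F = "\<lambda>i. if i \<in> J then f i else box_ind (l i) (u i)"
      let ?c = "\<lambda>x. multiplier x * (\<Prod>i\<in>UNIV - {j}. ?F i x)"
      have F: "?F i \<in> BM" "?F i \<in> L i" for i using f box_ind by auto
      have "mult_at ?F j (\<lambda>_. True) ?c (f j)"
      proof (rule mult_at_dense[OF F _ f])
        fix a b
        have e: "(\<lambda>i. if i \<in> J then f i else box_ind ((l(j := a)) i) ((u(j := b)) i)) = ?F(j := box_ind a b)"
          using insert.hyps by (auto simp: fun_eq_iff)
        have "AE x in lborel. T (?F(j := box_ind a b)) x =
            multiplier x * (\<Prod>i\<in>UNIV. (?F(j := box_ind a b)) i x) + kernel_op K (?F(j := box_ind a b)) x"
          using insert.IH[THEN spec, THEN spec, of "l(j := a)" "u(j := b)"] unfolding e[symmetric] by simp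
        then show "mult_at ?F j (\<lambda>_. True) ?c (box_ind a b)"
          unfolding mult_at_def prod_upd_split by (simp only: simp_thms mult.assoc)
      qed
      moreover have "?F(j := f j) = (\<lambda>i. if i \<in> insert j J then f i else box_ind (l i) (u i))"
        by (auto simp: fun_eq_iff)
      ultimately have "AE x in lborel. T (\<lambda>i. if i \<in> insert j J then f i else box_ind (l i) (u i)) x =
         multiplier x * (\<Prod>i\<in>UNIV. (?F(j := f j)) i x) + kernel_op K (\<lambda>i. if i \<in> insert j J then f i else box_ind (l i) (u i)) x"
        unfolding mult_at_def prod_upd_split by (simp only: simp_thms mult.assoc)
      then show "AE x in lborel. T (\<lambda>i. if i \<in> insert j J then f i else box_ind (l i) (u i)) x =
         multiplier x * (\<Prod>i\<in>UNIV. (if i \<in> insert j J then f i else box_ind (l i) (u i)) x) + kernel_op K (\<lambda>i. if i \<in> insert j J then f i else box_ind (l i) (u i)) x"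
        unfolding \<open>?F(j := f j) = (\<lambda>i. if i \<in> insert j J then f i else box_ind (l i) (u i))\<close> .
    qed
  qed
  from this[of UNIV] show ?thesis by simp
qed

text \<open>
  On a box \<open>Q\<close> the multiplier is the difference of \<open>T\<close> and the kernel integral at the tuple of indicators of \<open>Q\<close>. The kernel
  integral is bounded, and the norm of the other term is at most a constant times \<open>|Q|\<^bsup>1/q\<^sub>0\<^esup>\<close> by the boundedness of \<open>T\<close>.
\<close>

lemma multiplier_box_integral:
  "\<exists>M>0. \<forall>l u. (\<integral>\<^sup>+x. ennreal (norm (multiplier x) powr q0) * indicator (box l u) x \<partial>lborel) \<le> ennreal M * emeasure lborel (box l u)"
proof -
  define D where "D = C * dyadic_mass \<beta> TYPE(real^'n) ^ CARD('m)"
  have mass: "0 \<le> dyadic_mass \<beta> TYPE(real^'n)" using beta by (simp add: dyadic_mass_def)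
  have D: "D \<ge> 0" using C mass by (simp add: D_def)
  define M where "M = 2 powr q0 * (max CT 0 powr q0 + D powr q0) + 1"
  have M: "M > 0" unfolding M_def by (intro add_nonneg_pos) auto
  have "(\<integral>\<^sup>+x. ennreal (norm (multiplier x) powr q0) * indicator (box l u) x \<partial>lborel) \<le> ennreal M * emeasure lborel (box l u)" for l u
  proof -
    let ?f = "\<lambda>_::'m. box_ind l u"
    define v where "v = enn2real (emeasure lborel (box l u))"
    have v: "emeasure lborel (box l u) = ennreal v" "v \<ge> 0"
      using emeasure_box_finite[of l u] by (auto simp: v_def less_top)
    have kb: "norm (kernel_op K ?f x) \<le> D" for x
    proof -
      have "ennreal (norm (kernel_op K ?f x)) \<le> ennreal C * (\<Prod>j\<in>(UNIV::'m set). dyadic_op \<beta> (\<lambda>z. ennreal (norm (box_ind l u z))) x)"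
        by (rule kernel_op_bound) (rule box_ind)
      also have "\<dots> \<le> ennreal C * (\<Prod>j\<in>(UNIV::'m set). ennreal (dyadic_mass \<beta> TYPE(real^'n)))"
      proof (intro mult_left_mono prod_mono_ennreal)
        have "dyadic_op \<beta> (\<lambda>z. ennreal (norm (box_ind l u z))) x \<le> dyadic_op \<beta> (\<lambda>_. 1) x"
          by (intro dyadic_op_mono_AE AE_I2) (auto simp: norm_box_ind indicator_def)
        then show "dyadic_op \<beta> (\<lambda>z. ennreal (norm (box_ind l u z))) x \<le> ennreal (dyadic_mass \<beta> TYPE(real^'n))"
          using beta by (simp add: dyadic_op_const)
      qed simp
      also have "\<dots> = ennreal D" using C mass by (simp add: D_def ennreal_power ennreal_mult)
      finally show ?thesis using D by simp
    qed
    have pt: "AE x in lborel. ennreal (norm (multiplier x) powr q0) * indicator (box l u) x \<le>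
       ennreal (2 powr q0) * ennreal (norm (T ?f x) powr q0) + ennreal (2 powr q0 * D powr q0) * indicator (box l u) x"
      using representation_borel[of ?f, OF box_ind]
    proof eventually_elim
      case (elim x)
      show ?case
      proof (cases "x \<in> box l u")
        case True
        then have "multiplier x = T ?f x - kernel_op K ?f x" using elim by (simp add: box_ind_def)
        then have "norm (multiplier x) \<le> norm (T ?f x) + D" using kb[of x] norm_triangle_ineq4[of "T ?f x" "kernel_op K ?f x"] by simp
        then have "norm (multiplier x) powr q0 \<le> (norm (T ?f x) + D) powr q0" using q0_pos by (intro powr_mono2) auto
        also have "\<dots> \<le> 2 powr q0 * (norm (T ?f x) powr q0 + D powr q0)" using D q0_pos by (intro powr_add_le) auto
        finally have "norm (multiplier x) powr q0 \<le> 2 powr q0 * norm (T ?f x) powr q0 + 2 powr q0 * D powr q0" by (simp add: algebra_simps)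
        then show ?thesis using True
          by (simp add: ennreal_mult[symmetric] ennreal_plus[symmetric] ennreal_leI del: ennreal_plus)
      qed simp
    qed
    have Tf: "T ?f \<in> Lp_space q0" "Lp_norm q0 (T ?f) \<le> ennreal CT * (\<Prod>j\<in>UNIV. Lp_norm (q j) (box_ind l u))"
      using bd'[of ?f, OF box_ind(2)] by auto
    have TJ: "pow_int q0 (T ?f) < \<infinity>" using Tf(1) q0_pos by (simp add: Lp_space_iff)
    have "Lp_norm (q j) (box_ind l u) = ennreal (v powr (1 / q j))" for j
      using Lp_indicator(2)[OF qpos _ emeasure_box_finite[of l u], of j] qpos[of j] v
      by (simp add: Lp_norm_pow_int box_ind_def epowr_ennreal)
    then have "(\<Prod>j\<in>UNIV. Lp_norm (q j) (box_ind l u)) = ennreal (\<Prod>j\<in>UNIV. v powr (1 / q j))" by (simp add: prod_ennreal)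
    also have "(\<Prod>j\<in>UNIV. v powr (1 / q j)) = v powr (1 / q0)"
    proof (cases "v = 0")
      case False
      then show ?thesis using v by (simp add: q0_def powr_sum)
    qed simp
    finally have "ennreal (enn2real (pow_int q0 (T ?f)) powr (1 / q0)) \<le> ennreal CT * ennreal (v powr (1 / q0))"
      using Tf(2) Lp_norm_real[OF q0_pos TJ] by simp
    also have "\<dots> \<le> ennreal (max CT 0) * ennreal (v powr (1 / q0))" by (intro mult_right_mono ennreal_leI) auto
    finally have "enn2real (pow_int q0 (T ?f)) powr (1 / q0) \<le> max CT 0 * v powr (1 / q0)"
      by (simp add: ennreal_mult[symmetric])
    then have "(enn2real (pow_int q0 (T ?f)) powr (1 / q0)) powr q0 \<le> (max CT 0 * v powr (1 / q0)) powr q0"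
      using q0_pos by (intro powr_mono2) auto
    then have "enn2real (pow_int q0 (T ?f)) \<le> max CT 0 powr q0 * v"
      using q0_pos v by (simp add: powr_mult powr_powr)
    then have J: "pow_int q0 (T ?f) \<le> ennreal (max CT 0 powr q0 * v)"
      using TJ by (metis ennreal_enn2real ennreal_leI infinity_ennreal_def)
    have Tm: "T ?f \<in> borel_measurable lebesgue" using Tf(1) q0_pos by (simp add: Lp_space_iff)
    have "(\<integral>\<^sup>+x. ennreal (norm (multiplier x) powr q0) * indicator (box l u) x \<partial>lborel) \<le>
       (\<integral>\<^sup>+x. ennreal (2 powr q0) * ennreal (norm (T ?f x) powr q0) + ennreal (2 powr q0 * D powr q0) * indicator (box l u) x \<partial>lborel)"
      by (rule nn_integral_mono_AE[OF pt])
    also have "\<dots> = (\<integral>\<^sup>+x. ennreal (2 powr q0) * ennreal (norm (T ?f x) powr q0) + ennreal (2 powr q0 * D powr q0) * indicator (box l u) x \<partial>lebesgue)"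
      by (simp only: nn_integral_completion)
    also have "\<dots> = (\<integral>\<^sup>+x. ennreal (2 powr q0) * ennreal (norm (T ?f x) powr q0) \<partial>lebesgue) + (\<integral>\<^sup>+x. ennreal (2 powr q0 * D powr q0) * indicator (box l u) x \<partial>lebesgue)"
    proof (rule nn_integral_add)
      show "(\<lambda>x. ennreal (2 powr q0) * ennreal (norm (T ?f x) powr q0)) \<in> borel_measurable lebesgue"
        by (rule norm_powr_measurable(3)[OF Tm])
      have "(\<lambda>x. ennreal (2 powr q0 * D powr q0) * indicator (box l u) x) \<in> borel_measurable lborel" by measurable
      then show "(\<lambda>x. ennreal (2 powr q0 * D powr q0) * indicator (box l u) x) \<in> borel_measurable lebesgue"
        by (rule measurable_completion)
    qed
    also have "(\<integral>\<^sup>+x. ennreal (2 powr q0) * ennreal (norm (T ?f x) powr q0) \<partial>lebesgue) = ennreal (2 powr q0) * pow_int q0 (T ?f)"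
      unfolding pow_int_def by (subst nn_integral_cmult, rule norm_powr_measurable(2)[OF Tm]) (simp only: nn_integral_completion)
    also have "(\<integral>\<^sup>+x. ennreal (2 powr q0 * D powr q0) * indicator (box l u) x \<partial>lebesgue) = ennreal (2 powr q0 * D powr q0) * ennreal v"
      unfolding nn_integral_completion by (subst nn_integral_cmult_indicator) (auto simp: v)
    also have "ennreal (2 powr q0) * pow_int q0 (T ?f) + ennreal (2 powr q0 * D powr q0) * ennreal v \<le>
       ennreal (2 powr q0) * ennreal (max CT 0 powr q0 * v) + ennreal (2 powr q0 * D powr q0) * ennreal v"
      by (intro add_right_mono mult_left_mono J) simp
    also have "\<dots> = ennreal (2 powr q0 * (max CT 0 powr q0 * v) + 2 powr q0 * D powr q0 * v)"
      using v by (simp add: ennreal_mult[symmetric] ennreal_plus[symmetric] del: ennreal_plus)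
    also have "\<dots> \<le> ennreal (M * v)"
      using v by (intro ennreal_leI) (simp add: M_def algebra_simps)
    also have "\<dots> = ennreal M * emeasure lborel (box l u)" using M v by (simp add: ennreal_mult)
    finally show ?thesis .
  qed
  then show ?thesis using M by blast
qed

text \<open>
  The multiplier is bounded because its means of order \<open>q\<^sub>0\<close> over cells are bounded, say by \<open>M\<close>: the set where
  \<open>|b|\<^bsup>q\<^sub>0\<^esup> > 2M\<close> has density at most one half in every cell, and so it is a null set.
\<close>

theorem local_representation:
  "\<exists>b B. b \<in> BM \<and> 0 \<le> B \<and> (\<forall>x. norm (b x) \<le> B) \<and>
    (\<forall>f. (\<forall>i. f i \<in> L i) \<longrightarrow> (AE x in lborel. T f x = b x * (\<Prod>i\<in>UNIV. f i x) + kernel_op K f x))"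
proof -
  obtain b' where b': "b' \<in> BM" "AE x in lborel. multiplier x = b' x"
    using complex_ex_borel[OF multiplier_measurable] by auto
  obtain M where M: "M > 0" "\<And>l u. (\<integral>\<^sup>+x. ennreal (norm (multiplier x) powr q0) * indicator (box l u) x \<partial>lborel) \<le> ennreal M * emeasure lborel (box l u)"
    using multiplier_box_integral by blast
  have pm [measurable]: "(\<lambda>x. ennreal (norm (b' x) powr q0)) \<in> borel_measurable borel"
    by (rule norm_powr_measurable(2)[OF b'(1)])
  define E where "E n = {x \<in> central_box n. 2 * M < norm (b' x) powr q0}" for n
  have Eb [measurable]: "E n \<in> sets borel" for n
  proof -
    have "(\<lambda>x. norm (b' x) powr q0) \<in> borel_measurable borel" by (rule norm_powr_measurable(1)[OF b'(1)])
    then have "central_box n \<inter> {x \<in> space borel. 2 * M < norm (b' x) powr q0} \<in> sets borel"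
      unfolding central_box_def by measurable
    moreover have "central_box n \<inter> {x \<in> space borel. 2 * M < norm (b' x) powr q0} = E n" by (auto simp: E_def)
    ultimately show ?thesis by simp
  qed
  have "emeasure lborel (E n) = 0" for n
  proof (rule sparse_density_null[of 1 "E n" "1/2"])
    have "emeasure lborel (E n) \<le> emeasure lborel (central_box n)" unfolding E_def central_box_def by (intro emeasure_mono) auto
    also have "\<dots> < \<infinity>" unfolding central_box_def by (rule emeasure_box_finite)
    finally show "emeasure lborel (E n) < \<infinity>" .
    fix x k
    let ?c = "cell 0 1 k x :: (real^'n) set"
    let ?l = "cell_low 0 1 k x :: real^'n" and ?u = "cell_low 0 1 k x + (1 / 2 ^ k) *\<^sub>R One :: real^'n"
    have cb: "box ?l ?u \<subseteq> ?c" "?c \<subseteq> cbox ?l ?u" by (rule cell_boxes, simp)+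
    have m: "emeasure lborel (box ?l ?u) = emeasure lborel ?c"
      by (simp add: emeasure_cell inner_add_left)
    have ae: "AE y in lborel. y \<in> ?c \<longrightarrow> y \<in> box ?l ?u"
      using AE_box_cbox[of ?l ?u] cb(2) by (auto elim!: eventually_mono)
    have "ennreal (2 * M) * emeasure lborel (E n \<inter> ?c) = (\<integral>\<^sup>+y. ennreal (2 * M) * indicator (E n \<inter> ?c) y \<partial>lborel)"
      by (subst nn_integral_cmult_indicator) auto
    also have "\<dots> \<le> (\<integral>\<^sup>+y. ennreal (norm (multiplier y) powr q0) * indicator (box ?l ?u) y \<partial>lborel)"
    proof (rule nn_integral_mono_AE)
      show "AE y in lborel. ennreal (2 * M) * indicator (E n \<inter> ?c) y \<le> ennreal (norm (multiplier y) powr q0) * indicator (box ?l ?u) y"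
        using ae b'(2) by eventually_elim (auto simp: E_def indicator_def intro!: ennreal_leI)
    qed
    also have "\<dots> \<le> ennreal M * emeasure lborel ?c" using M(2)[of ?l ?u] by (simp only: m)
    finally have "ennreal (1 / (2 * M)) * (ennreal (2 * M) * emeasure lborel (E n \<inter> ?c)) \<le> ennreal (1 / (2 * M)) * (ennreal M * emeasure lborel ?c)"
      by (rule mult_left_mono) simp
    moreover have "ennreal (1 / (2 * M)) * (ennreal (2 * M) * z) = z" for z
      using M(1) by (simp add: mult.assoc[symmetric] ennreal_mult'[symmetric])
    moreover have "ennreal (1 / (2 * M)) * (ennreal M * z) = ennreal (1 / 2) * z" for z
      using M(1) by (simp add: mult.assoc[symmetric] ennreal_mult'[symmetric])
    ultimately show "emeasure lborel (E n \<inter> ?c) \<le> ennreal (1 / 2) * emeasure lborel ?c" by simp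
  qed auto
  then have "AE x in lborel. x \<notin> E n" for n
    by (subst AE_iff_measurable[of "E n"]) auto
  then have "AE x in lborel. \<forall>n. x \<notin> E n" by (simp add: AE_all_countable)
  then have small: "AE x in lborel. norm (b' x) powr q0 \<le> 2 * M"
  proof eventually_elim
    case (elim x)
    then show ?case using mem_box_index[of x] by (auto simp: E_def not_less)
  qed
  define B where "B = (2 * M) powr (1 / q0)"
  define b where "b x = (if norm (b' x) \<le> B then b' x else 0)" for x
  have small': "AE x in lborel. norm (b' x) \<le> B"
    using small
  proof eventually_elim
    case (elim x)
    then have "(norm (b' x) powr q0) powr (1 / q0) \<le> B" unfolding B_def using q0_pos by (intro powr_mono2) auto
    then show ?case using q0_pos by (simp add: powr_powr)
  qed
  have bM: "b \<in> BM" unfolding b_def[abs_def] using b'(1) by measurable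
  have bB: "norm (b x) \<le> B" for x using M by (simp add: b_def B_def)
  have "AE x in lborel. T f x = b x * (\<Prod>i\<in>UNIV. f i x) + kernel_op K f x" if f: "\<forall>i. f i \<in> L i" for f
  proof -
    have "\<exists>g. g \<in> BM \<and> (AE x in lborel. f i x = g x)" for i
      using complex_ex_borel[of "f i" lborel] f qpos by (auto simp: Lp_space_iff)
    then obtain g where g: "\<And>i. g i \<in> BM" "\<And>i. AE x in lborel. f i x = g i x" by metis
    have gL: "g i \<in> L i" for i
    proof (rule Lp_dom[OF qpos f[rule_format, of i]])
      show "g i \<in> borel_measurable lebesgue" using g(1)[of i] by (simp add: measurable_completion)
      show "AE x in lborel. norm (g i x) \<le> norm (f i x)" using g(2)[of i] by eventually_elim simp
    qed
    have all: "AE x in lborel. \<forall>i\<in>UNIV. f i x = g i x" using g(2) by (intro AE_finite_allI) auto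
    have Tfg: "AE x in lborel. T f x = T g x" by (rule T_cong) (use f gL g in auto)
    have kfg: "kernel_op K f = kernel_op K g" by (rule kernel_op_cong_AE[OF g(2) g(1)])
    show ?thesis unfolding kfg using Tfg representation_borel[of g, OF g(1) gL] b'(2) small' all
      by eventually_elim (simp add: b_def)
  qed
  moreover have "0 \<le> B" by (simp add: B_def)
  ultimately show ?thesis using bM bB by blast
qed

end

section \<open>Weights and rearrangements\<close>

lemma One_vec: "(\<chi> i. s) = s *\<^sub>R (One :: real^'n)"
proof -
  have "(One :: real^'n) $ i = 1" for i
  proof -
    have "(axis i 1 :: real^'n) \<in> Basis" by (simp add: axis_in_Basis_iff)
    then have "(One :: real^'n) \<bullet> axis i 1 = 1" by (rule inner_sum_Basis)
    then show ?thesis by (simp only: cart_eq_inner_axis)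
  qed
  then show ?thesis by (simp add: vec_eq_iff)
qed

lemma cube_in_cubes: "R > 0 \<Longrightarrow> cube (x::real^'n) R \<in> cubes"
proof -
  assume R: "R > 0"
  have "x - R *\<^sub>R One + (\<chi> i. 2 * R) = x + R *\<^sub>R One"
    unfolding One_vec by (auto simp: euclidean_eq_iff[where 'a="real^'n"] inner_add_left inner_diff_left)
  then have "cube x R = cbox (x - R *\<^sub>R One) (x - R *\<^sub>R One + (\<chi> i. 2 * R))" by (simp only: cube_def)
  then show ?thesis unfolding cubes_def using R by (intro CollectI exI[of _ "x - R *\<^sub>R One"] exI[of _ "2 * R"]) simp
qed

text \<open>
  If \<open>w\<^bsup>1-p'\<^esup>\<close> had infinite integral over some cube, it would have infinite integral over all larger cubes around the same
  centre, and finiteness of the constant would force \<open>w = 0\<close> almost everywhere on each of them. So the dual weight is locally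
  integrable, hence finite almost everywhere, hence \<open>w > 0\<close> almost everywhere, and \<open>w\<close> can be made Borel and positive
  everywhere by a change on a null set.
\<close>

lemma Ap_class_core:
  assumes w: "w \<in> Ap_class p" and p: "p > 1"
  shows "\<exists>v A. Ap_core (v :: real^'n \<Rightarrow> real) p A \<and> (AE x in lborel. w x = v x)"
proof -
  let ?e = "- 1 / (p - 1)"
  have e: "1 - p / (p - 1) = ?e" using p by (simp add: field_simps)
  have e0: "?e < 0" using p by simp
  have wt: "weight w" and nz: "\<not> (AE x in lborel. w x = 0)" and fin: "Ap_constant p w < \<infinity>"
    using w by (auto simp: Ap_class_def)
  have wm: "w \<in> borel_measurable lebesgue" and w0: "w x \<ge> 0" for x using wt by (auto simp: weight_def)
  define \<sigma> where "\<sigma> x = epowr (ennreal (w x)) ?e" for x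
  have s1: "\<sigma> x = (if w x = 0 then \<infinity> else ennreal (w x powr ?e))" for x
    using w0[of x] e0 p by (auto simp: \<sigma>_def epowr_def)
  define WQ where "WQ Q = (\<integral>\<^sup>+x. ennreal (w x) * indicator Q x \<partial>lborel)" for Q
  define SQ where "SQ Q = (\<integral>\<^sup>+x. \<sigma> x * indicator Q x \<partial>lborel)" for Q
  have Ap: "(WQ (cube x R) / emeasure lborel (cube x R)) * epowr (SQ (cube x R) / emeasure lborel (cube x R)) (p - 1) \<le> Ap_constant p w"
    if R: "R > 0" for x R
  proof -
    have "average (cube x R) (\<lambda>x. ennreal (w x)) * epowr (average (cube x R) (\<lambda>x. epowr (ennreal (w x)) (1 - p / (p - 1)))) (p - 1) \<le> Ap_constant p w"
      unfolding Ap_constant_def by (rule SUP_upper[OF cube_in_cubes[OF R]])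
    then show ?thesis unfolding e average_def WQ_def SQ_def \<sigma>_def nn_integral_completion
      by simp
  qed
  have WQfin: "WQ (cube x R) < \<infinity>" for x R
  proof -
    have "compact (cube x R)" by (simp add: cube_def)
    then have "set_integrable lebesgue (cube x R) w" using wt by (simp add: weight_def)
    then have "(\<integral>\<^sup>+y. ennreal (norm (indicator (cube x R) y *\<^sub>R w y)) \<partial>lebesgue) < \<infinity>"
      unfolding set_integrable_def by (simp add: integrable_iff_bounded)
    also have "(\<integral>\<^sup>+y. ennreal (norm (indicator (cube x R) y *\<^sub>R w y)) \<partial>lebesgue) = WQ (cube x R)"
      unfolding WQ_def nn_integral_completion using w0 by (intro nn_integral_cong) (auto simp: indicator_def)
    finally show ?thesis .
  qed
  have cubepos: "0 < emeasure lborel (cube x R)" "emeasure lborel (cube x R) < \<infinity>" if "R > 0" for x :: "real^'n" and R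
    using that by (auto simp: emeasure_cube)
  have SQfin: "SQ (cube x R) < \<infinity>" if R: "R > 0" for x R
  proof (rule ccontr)
    assume "\<not> SQ (cube x R) < \<infinity>"
    then have inf: "SQ (cube x R) = \<infinity>" by (simp add: less_top[symmetric])
    have "AE y in lborel. y \<in> cube x (R + real n) \<longrightarrow> w y = 0" for n
    proof -
      have R': "R + real n > 0" using R by simp
      have "SQ (cube x R) \<le> SQ (cube x (R + real n))"
        unfolding SQ_def by (intro nn_integral_mono mult_left_mono) (auto simp: indicator_def mem_cube)
      then have inf': "SQ (cube x (R + real n)) = \<infinity>" using inf by (simp add: top_unique)
      have "SQ (cube x (R + real n)) / emeasure lborel (cube x (R + real n)) = \<infinity>"
        unfolding inf' using cubepos[OF R', of x] by (simp add: ennreal_top_divide less_top)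
      then have "epowr (SQ (cube x (R + real n)) / emeasure lborel (cube x (R + real n))) (p - 1) = \<infinity>"
        using p by (simp add: epowr_def)
      then have "(WQ (cube x (R + real n)) / emeasure lborel (cube x (R + real n))) * \<infinity> < \<infinity>"
        using Ap[OF R', of x] fin by (auto intro: le_less_trans)
      then have "WQ (cube x (R + real n)) / emeasure lborel (cube x (R + real n)) = 0"
        by (simp add: ennreal_mult_less_top)
      then have "WQ (cube x (R + real n)) = 0"
        using cubepos[OF R', of x] by (auto simp: ennreal_divide_eq_0_iff)
      then have "(\<integral>\<^sup>+y. ennreal (w y) * indicator (cube x (R + real n)) y \<partial>lebesgue) = 0"
        by (simp only: WQ_def nn_integral_completion)
      then have "AE y in lebesgue. ennreal (w y) * indicator (cube x (R + real n)) y = 0"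
      proof (subst (asm) nn_integral_0_iff_AE)
        have "(indicator (cube x (R + real n)) :: _ \<Rightarrow> ennreal) \<in> borel_measurable lebesgue"
          by (rule borel_measurable_indicator) (simp add: cube_def)
        then show "(\<lambda>y. ennreal (w y) * indicator (cube x (R + real n)) y) \<in> borel_measurable lebesgue"
          using wm by (intro borel_measurable_times_ennreal measurable_compose[OF wm measurable_ennreal])
      qed
      then show ?thesis unfolding AE_lebesgue
        by eventually_elim (use w0 in \<open>auto simp: indicator_def ennreal_eq_0_iff intro: antisym\<close>)
    qed
    then have "AE y in lborel. \<forall>n. y \<in> cube x (R + real n) \<longrightarrow> w y = 0" unfolding AE_all_countable by (rule allI)
    then have "AE y in lborel. w y = 0"
    proof eventually_elim
      case (elim y)
      obtain n :: nat where "infnorm (x - y) < real n" using reals_Archimedean2 by blast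
      then have "y \<in> cube x (R + real n)" using R by (simp add: mem_cube)
      then show ?case using elim by blast
    qed
    then show False using nz by blast
  qed
  have sm: "\<sigma> \<in> borel_measurable lebesgue"
  proof -
    have "(\<lambda>x. if w x = 0 then \<infinity> else ennreal (w x powr ?e)) \<in> borel_measurable lebesgue"
      using wm by measurable
    then show ?thesis by (simp add: s1[abs_def])
  qed
  have pos: "AE x in lborel. w x > 0"
  proof -
    have "AE y in lborel. y \<in> cube 0 (1 + real n) \<longrightarrow> w y \<noteq> 0" for n
    proof -
      have R': "1 + real n > 0" by simp
      have "(\<integral>\<^sup>+y. \<sigma> y * indicator (cube 0 (1 + real n)) y \<partial>lebesgue) \<noteq> \<infinity>"
        using SQfin[OF R', of 0] by (simp add: SQ_def nn_integral_completion less_top)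
      then have "AE y in lebesgue. \<sigma> y * indicator (cube 0 (1 + real n)) y \<noteq> \<infinity>"
        by (rule nn_integral_PInf_AE[rotated]) (intro borel_measurable_times_ennreal sm borel_measurable_indicator, simp add: cube_def)
      then show ?thesis unfolding AE_lebesgue by eventually_elim (auto simp: s1 indicator_def)
    qed
    then have "AE y in lborel. \<forall>n. y \<in> cube 0 (1 + real n) \<longrightarrow> w y \<noteq> 0" unfolding AE_all_countable by (rule allI)
    then show ?thesis
    proof eventually_elim
      case (elim y)
      obtain n :: nat where "infnorm y < real n" using reals_Archimedean2 by blast
      then have "y \<in> cube 0 (1 + real n)" by (simp add: mem_cube infnorm_neg)
      then have "w y \<noteq> 0" using elim by blast
      then show ?case using w0[of y] by simp
    qed
  qed
  obtain w' where w': "w' \<in> borel_measurable lborel" "AE x in lborel. w x = w' x"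
    using completion_ex_borel_measurable_real[OF wm] by blast
  define v where "v x = (if w' x > 0 then w' x else 1)" for x
  have wv: "AE x in lborel. w x = v x" using w'(2) pos by eventually_elim (simp add: v_def)
  have vb: "v \<in> borel_measurable borel" unfolding v_def[abs_def] using w'(1) by measurable
  have vpos: "v x > 0" for x by (simp add: v_def)
  have W: "emeasure (density lborel (\<lambda>x. ennreal (v x))) (cube x R) = WQ (cube x R)" for x R
  proof -
    have "emeasure (density lborel (\<lambda>x. ennreal (v x))) (cube x R) = (\<integral>\<^sup>+y. ennreal (v y) * indicator (cube x R) y \<partial>lborel)"
      using vb by (intro emeasure_density) auto
    also have "\<dots> = WQ (cube x R)" unfolding WQ_def
      by (rule nn_integral_cong_AE) (use wv in eventually_elim, simp)
    finally show ?thesis .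
  qed
  have S: "emeasure (density lborel (\<lambda>x. ennreal (v x powr ?e))) (cube x R) = SQ (cube x R)" for x R
  proof -
    have "emeasure (density lborel (\<lambda>x. ennreal (v x powr ?e))) (cube x R) = (\<integral>\<^sup>+y. ennreal (v y powr ?e) * indicator (cube x R) y \<partial>lborel)"
      using vb by (intro emeasure_density) auto
    also have "\<dots> = SQ (cube x R)" unfolding SQ_def
    proof (rule nn_integral_cong_AE)
      show "AE y in lborel. ennreal (v y powr ?e) * indicator (cube x R) y = \<sigma> y * indicator (cube x R) y"
        using wv by eventually_elim (use vpos in \<open>simp add: s1 less_imp_neq[OF vpos, symmetric]\<close>)
    qed
    finally show ?thesis .
  qed
  define A where "A = enn2real (Ap_constant p w) + 1"
  have A: "A > 0" by (simp add: A_def add_nonneg_pos)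
  have "Ap_core v p A"
  proof
    show "1 < p" "v \<in> borel_measurable borel" "0 < v x" "0 < A" for x by (fact p vb vpos A)+
    show "emeasure (density lborel (\<lambda>x. ennreal (v x))) (cube x R) < \<infinity>" for x R using WQfin by (simp only: W)
    show "emeasure (density lborel (\<lambda>x. ennreal (v x powr ?e))) (cube x R) < \<infinity>" if "0 < R" for x R using SQfin[OF that] by (simp only: S)
    show "measure (density lborel (\<lambda>x. ennreal (v x))) (cube x R) * measure (density lborel (\<lambda>x. ennreal (v x powr ?e))) (cube x R) powr (p - 1)
         \<le> A * measure lborel (cube x R) powr p" if R: "0 < R" for x R
    proof -
      define a b c where "a = enn2real (WQ (cube x R))" and "b = enn2real (SQ (cube x R))" and "c = measure lborel (cube x R)"
      have c: "c > 0" "emeasure lborel (cube x R) = ennreal c"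
        using R by (auto simp: c_def measure_def emeasure_cube)
      have ab: "a \<ge> 0" "b \<ge> 0" "WQ (cube x R) = ennreal a" "SQ (cube x R) = ennreal b"
        using WQfin[of x R] SQfin[OF R, of x] by (auto simp: a_def b_def less_top)
      have "ennreal (a / c) * epowr (ennreal (b / c)) (p - 1) \<le> Ap_constant p w"
        using Ap[OF R, of x] ab c by (simp add: divide_ennreal)
      also have "Ap_constant p w \<le> ennreal A" using fin by (cases "Ap_constant p w" rule: ennreal_cases) (auto simp: A_def intro!: ennreal_leI)
      finally have "ennreal (a / c) * ennreal ((b / c) powr (p - 1)) \<le> ennreal A"
        using p ab c by (simp add: epowr_ennreal)
      then have "a / c * (b / c) powr (p - 1) \<le> A"
        using ab c A by (simp add: ennreal_mult[symmetric] ennreal_le_iff)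
      then have "a / c * (b powr (p - 1) / c powr (p - 1)) \<le> A"
        using ab c by (simp add: powr_divide)
      then have "a * b powr (p - 1) \<le> A * (c * c powr (p - 1))"
        using c by (simp add: field_simps)
      also have "c * c powr (p - 1) = c powr p" using c by (simp add: powr_diff)
      finally show ?thesis unfolding a_def b_def c_def measure_def W S .
    qed
  qed
  then show ?thesis using wv by blast
qed

lemma rearrangement_density:
  assumes w: "w \<in> borel_measurable lebesgue" and f: "f \<in> borel_measurable lebesgue"
    and v: "v \<in> borel_measurable borel" "AE x in lborel. w x = v x" and g: "g \<in> borel_measurable borel" "AE x in lborel. f x = (g x :: ennreal)"
  shows "decr_rearrangement (density lebesgue (\<lambda>x::'a::euclidean_space. ennreal (w x))) f = decr_rearrangement (density lborel (\<lambda>x. ennreal (v x))) g"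
proof -
  have "emeasure (density lebesgue (\<lambda>x. ennreal (w x))) {x \<in> space (density lebesgue (\<lambda>x. ennreal (w x))). l < f x} =
    emeasure (density lborel (\<lambda>x. ennreal (v x))) {x \<in> space (density lborel (\<lambda>x. ennreal (v x))). l < g x}" for l
  proof -
    have f1: "{x. l < f x} \<in> sets lebesgue"
      using measurable_sets[OF f, of "{l<..}"] by (simp add: vimage_def)
    have g1: "{x. l < g x} \<in> sets borel"
      using measurable_sets[OF g(1), of "{l<..}"] by (simp add: vimage_def)
    have "emeasure (density lebesgue (\<lambda>x. ennreal (w x))) {x. l < f x} = (\<integral>\<^sup>+x. ennreal (w x) * indicator {x. l < f x} x \<partial>lebesgue)"
      using w f1 by (intro emeasure_density) auto
    also have "\<dots> = (\<integral>\<^sup>+x. ennreal (w x) * indicator {x. l < f x} x \<partial>lborel)" by (rule nn_integral_completion)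
    also have "\<dots> = (\<integral>\<^sup>+x. ennreal (v x) * indicator {x. l < g x} x \<partial>lborel)"
    proof (rule nn_integral_cong_AE)
      show "AE x in lborel. ennreal (w x) * indicator {x. l < f x} x = ennreal (v x) * indicator {x. l < g x} x"
        using v(2) g(2) by eventually_elim (simp add: indicator_def)
    qed
    also have "\<dots> = emeasure (density lborel (\<lambda>x. ennreal (v x))) {x. l < g x}"
      using v g1 by (intro emeasure_density[symmetric]) auto
    finally show ?thesis by simp
  qed
  then show ?thesis unfolding decr_rearrangement_def by (simp only:)
qed

text \<open>
  Each of the \<open>2m\<close> functions exceeds its rearrangement at \<open>t/(2m)\<close> only on a set of measure at most \<open>t/(2m)\<close>.
\<close>

lemma rearrangement_prod:
  fixes g u :: "'m::finite \<Rightarrow> 'a \<Rightarrow> ennreal"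
  assumes g: "\<And>j. g j \<in> borel_measurable M" and u: "\<And>j. u j \<in> borel_measurable M" and t: "t > 0"
    and F: "\<And>x. x \<in> space M \<Longrightarrow> F x \<le> c * (\<Prod>j\<in>UNIV. g j x + u j x)"
  shows "decr_rearrangement M F t \<le> c * (\<Prod>j\<in>UNIV. decr_rearrangement M (g j) (t / (2 * real CARD('m))) + decr_rearrangement M (u j) (t / (2 * real CARD('m))))"
proof (rule decr_rearrangement_le)
  let ?s = "t / (2 * real CARD('m))"
  let ?A = "\<lambda>f. {x \<in> space M. f x > decr_rearrangement M f ?s}"
  have s: "?s > 0" using t by simp
  have A: "?A f \<in> sets M" if "f \<in> borel_measurable M" for f using that by measurable
  have "{x \<in> space M. c * (\<Prod>j\<in>UNIV. decr_rearrangement M (g j) ?s + decr_rearrangement M (u j) ?s) < F x} \<subseteq> (\<Union>j\<in>UNIV. ?A (g j) \<union> ?A (u j))"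
  proof (rule subsetI, rule ccontr)
    fix x assume x0: "x \<in> {x \<in> space M. c * (\<Prod>j\<in>UNIV. decr_rearrangement M (g j) ?s + decr_rearrangement M (u j) ?s) < F x}"
      and nx: "x \<notin> (\<Union>j\<in>UNIV. ?A (g j) \<union> ?A (u j))"
    from x0 have x: "x \<in> space M" "c * (\<Prod>j\<in>UNIV. decr_rearrangement M (g j) ?s + decr_rearrangement M (u j) ?s) < F x" by simp_all
    have gx: "g j x \<le> decr_rearrangement M (g j) ?s" and ux: "u j x \<le> decr_rearrangement M (u j) ?s" for j
      using nx x(1) by (auto simp: not_less[symmetric])
    have "F x \<le> c * (\<Prod>j\<in>UNIV. g j x + u j x)" by (rule F[OF x(1)])
    also have "\<dots> \<le> c * (\<Prod>j\<in>UNIV. decr_rearrangement M (g j) ?s + decr_rearrangement M (u j) ?s)"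
      by (intro mult_left_mono prod_mono_ennreal add_mono gx ux) simp
    finally show False using x(2) by simp
  qed
  then have "emeasure M {x \<in> space M. c * (\<Prod>j\<in>UNIV. decr_rearrangement M (g j) ?s + decr_rearrangement M (u j) ?s) < F x}
      \<le> emeasure M (\<Union>j\<in>UNIV. ?A (g j) \<union> ?A (u j))"
    using A g u by (intro emeasure_mono sets.finite_UN sets.Un) auto
  also have "\<dots> \<le> (\<Sum>j\<in>UNIV. emeasure M (?A (g j) \<union> ?A (u j)))"
    using A g u by (intro emeasure_subadditive_finite) (auto intro!: sets.Un)
  also have "\<dots> \<le> (\<Sum>j\<in>(UNIV::'m set). ennreal ?s + ennreal ?s)"
  proof (intro sum_mono)
    fix j :: 'm
    have "emeasure M (?A (g j) \<union> ?A (u j)) \<le> emeasure M (?A (g j)) + emeasure M (?A (u j))"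
      using A g u by (intro emeasure_subadditive) auto
    also have "\<dots> \<le> ennreal ?s + ennreal ?s"
      by (intro add_mono emeasure_above_rearrangement g u)
    finally show "emeasure M (?A (g j) \<union> ?A (u j)) \<le> ennreal ?s + ennreal ?s" .
  qed
  also have "\<dots> = ennreal t"
  proof -
    have "(\<Sum>j\<in>(UNIV::'m set). ennreal ?s + ennreal ?s) = (\<Sum>j\<in>(UNIV::'m set). ennreal (?s + ?s))"
      using s by (intro sum.cong refl ennreal_plus[symmetric]) auto
    also have "\<dots> = ennreal (\<Sum>j\<in>(UNIV::'m set). ?s + ?s)" using s by (intro sum_ennreal) auto
    also have "(\<Sum>j\<in>(UNIV::'m set). ?s + ?s) = t" by simp
    finally show ?thesis .
  qed
  finally show "emeasure M {x \<in> space M. c * (\<Prod>j\<in>UNIV. decr_rearrangement M (g j) ?s + decr_rearrangement M (u j) ?s) < F x} \<le> ennreal t" .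
qed

text \<open>
  The assumption concerns products of complex functions. It carries over to functions with values in \<open>[0, \<infinity>]\<close>, since finite
  norm makes these finite almost everywhere.
\<close>

lemma product_norm_bound:
  fixes Xbs :: "'m::finite \<Rightarrow> (real \<Rightarrow> ennreal) \<Rightarrow> ennreal"
  assumes X: "ri_half_line Xb" and Xs: "\<And>i. ri_half_line (Xbs i)"
    and bd: "bounded_on (\<lambda>i. ri_space half_line (Xbs i)) (\<lambda>i. ri_norm (Xbs i)) (ri_space half_line Xb) (ri_norm Xb) product_op"
  shows "\<exists>C::real. C \<ge> 0 \<and> (\<forall>H. (\<forall>i. H i \<in> borel_measurable half_line \<and> Xbs i (H i) < \<infinity>) \<longrightarrow>
     Xb (\<lambda>t. \<Prod>i\<in>UNIV. H i t) \<le> ennreal C * (\<Prod>i\<in>UNIV. Xbs i (H i)))"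
proof -
  obtain C where C: "\<And>f. (\<forall>i. f i \<in> ri_space half_line (Xbs i)) \<Longrightarrow>
     ri_norm Xb (product_op f) \<le> ennreal C * (\<Prod>i\<in>UNIV. ri_norm (Xbs i) (f i))"
    using bd unfolding bounded_on_def by blast
  have "Xb (\<lambda>t. \<Prod>i\<in>UNIV. H i t) \<le> ennreal (max C 0) * (\<Prod>i\<in>UNIV. Xbs i (H i))"
    if H: "\<forall>i. H i \<in> borel_measurable half_line \<and> Xbs i (H i) < \<infinity>" for H
  proof -
    define f where "f i t = complex_of_real (enn2real (H i t))" for i t
    have Hm: "H i \<in> borel_measurable half_line" for i using H by blast
    have fm: "f i \<in> borel_measurable half_line" for i
      unfolding f_def[abs_def] using Hm[of i] by measurable
    have fm': "(\<lambda>t. ennreal (norm (f i t))) \<in> borel_measurable half_line" for i using fm[of i] by measurable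
    have ae: "AE t in half_line. ennreal (norm (f i t)) = H i t" for i
      using ri_half_line.N_finite_AE[OF Xs Hm[of i], of i] H by (auto elim!: eventually_mono simp: f_def less_top)
    have le: "ri_norm (Xbs i) (f i) \<le> Xbs i (H i)" for i
      unfolding ri_norm_def by (rule ri_half_line.N_mono[OF Xs fm' Hm]) (use ae[of i] in eventually_elim, simp)
    have fs: "\<forall>i. f i \<in> ri_space half_line (Xbs i)"
      using fm le H by (auto simp: ri_space_def intro: le_less_trans)
    have all: "AE t in half_line. \<forall>i\<in>UNIV. ennreal (norm (f i t)) = H i t" using ae by (intro AE_finite_allI) auto
    have m1: "(\<lambda>t. \<Prod>i\<in>UNIV. H i t) \<in> borel_measurable half_line" using Hm by (intro borel_measurable_prod_ennreal) auto
    have m2: "(\<lambda>t. ennreal (norm (product_op f t))) \<in> borel_measurable half_line"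
      unfolding product_op_def using fm by measurable
    have "Xb (\<lambda>t. \<Prod>i\<in>UNIV. H i t) \<le> ri_norm Xb (product_op f)"
      unfolding ri_norm_def
    proof (rule ri_half_line.N_mono[OF X m1 m2])
      show "AE t in half_line. (\<Prod>i\<in>UNIV. H i t) \<le> ennreal (norm (product_op f t))"
        using all
      proof eventually_elim
        case (elim t)
        have "(\<Prod>i\<in>UNIV. H i t) = (\<Prod>i\<in>UNIV. ennreal (norm (f i t)))" using elim by (intro prod.cong) auto
        also have "\<dots> = ennreal (norm (product_op f t))" by (simp add: product_op_def prod_norm[symmetric] prod_ennreal)
        finally show ?case by simp
      qed
    qed
    also have "\<dots> \<le> ennreal C * (\<Prod>i\<in>UNIV. ri_norm (Xbs i) (f i))" by (rule C[OF fs])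
    also have "\<dots> \<le> ennreal (max C 0) * (\<Prod>i\<in>UNIV. Xbs i (H i))"
      by (intro mult_mono prod_mono_ennreal le ennreal_leI) auto
    finally show ?thesis .
  qed
  then show ?thesis by (intro exI[of _ "max C 0"]) auto
qed

section \<open>Bounds in rearrangement invariant spaces\<close>

context restricted_Ap begin

text \<open>
  The estimate for the rearrangement of the dyadic average shows that it is finite at arbitrarily small \<open>t > 0\<close>, so the set where
  the average is infinite has measure at most every such \<open>t\<close>.
\<close>

lemma dyadic_op_finite_AE:
  assumes b: "0 < \<beta>" "\<beta> < 1" and s': "s < s'" and N: "ri_half_line N" and p: "ereal s' < boyd_p N"
    and f [measurable]: "f \<in> borel_measurable borel" and fin: "N (decr_rearrangement W f) < \<infinity>"
  shows "AE x in lborel. dyadic_op \<beta> f x < \<infinity>"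
proof -
  interpret N: ri_half_line N by (rule N)
  obtain B where B: "B > 0" and U0: "\<forall>f\<in>borel_measurable borel. \<forall>t>0. decr_rearrangement W (dyadic_op \<beta> f) t \<le>
     ennreal B * (decr_rearrangement W f t + (\<Sum>k. ennreal ((1/2) powr (real k / s')) * decr_rearrangement W f (t / 2 ^ Suc k)))"
    using rearrangement_dyadic_op[OF b s'] by (elim exE conjE)
  note U = U0[rule_format, OF f]
  define g where "g = decr_rearrangement W f"
  define G where "G t = g t + (\<Sum>k. ennreal ((1/2) powr (real k / s')) * g (t / 2 ^ Suc k))" for t
  have gm: "g \<in> borel_measurable half_line" unfolding g_def by (rule decr_rearrangement_measurable)
  have Gm: "G \<in> borel_measurable half_line"
    unfolding G_def[abs_def]
    by (intro borel_measurable_add gm borel_measurable_suminf_order borel_measurable_times_ennreal borel_measurable_const N.dilation_measurable) auto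
  have "0 < s'" using s s' by linarith
  then obtain C where "N G \<le> ennreal C * N g"
    using N.dilation_series_bound[of s'] p gm fin unfolding G_def[abs_def] g_def by blast
  also have "\<dots> < \<infinity>" using fin by (simp add: g_def ennreal_mult_less_top)
  finally have G_fin: "AE t in half_line. G t < \<infinity>" by (rule N.N_finite_AE[OF Gm])
  define Z where "Z = {x \<in> space W. dyadic_op \<beta> f x = \<infinity>}"
  have Z: "Z \<in> sets W" unfolding Z_def by measurable
  have small: "emeasure W Z \<le> ennreal t" if t: "t > 0" for t
  proof -
    have "\<exists>u. 0 < u \<and> u < t \<and> G u < \<infinity>"
    proof (rule ccontr)
      assume none: "\<nexists>u. 0 < u \<and> u < t \<and> G u < \<infinity>"
      have "AE u in half_line. u \<notin> {0<..<t}" using G_fin by eventually_elim (use none in auto)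
      then have "emeasure half_line {0<..<t} = 0"
        by (subst (asm) AE_iff_measurable[of "{0<..<t}"]) (auto simp: sets_half_line)
      moreover have "emeasure half_line {0<..<t} = emeasure lebesgue {0<..<t}" by (rule emeasure_half_line) auto
      ultimately show False using t by simp
    qed
    then obtain u where u: "0 < u" "u < t" "G u < \<infinity>" by blast
    have "decr_rearrangement W (dyadic_op \<beta> f) u \<le> ennreal B * G u"
      using U[OF u(1)] by (simp only: G_def g_def)
    also have "\<dots> < \<infinity>" using u by (simp add: ennreal_mult_less_top)
    finally have fu: "decr_rearrangement W (dyadic_op \<beta> f) u < \<infinity>" .
    have "emeasure W Z \<le> emeasure W {x \<in> space W. dyadic_op \<beta> f x > decr_rearrangement W (dyadic_op \<beta> f) u}"
      by (rule emeasure_mono) (use fu in \<open>auto simp: Z_def\<close>)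
    also have "\<dots> \<le> ennreal u" by (rule emeasure_above_rearrangement) simp
    also have "\<dots> \<le> ennreal t" using u by (simp add: ennreal_leI)
    finally show ?thesis .
  qed
  have "emeasure W Z \<le> 0"
  proof (rule ennreal_le_epsilon)
    fix e :: real assume "0 < e" then show "emeasure W Z \<le> 0 + ennreal e" using small[of e] by simp
  qed
  then have "AE x in W. x \<notin> Z" using Z by (subst AE_iff_measurable[of Z]) (auto simp: Z_def)
  then have "AE x in W. dyadic_op \<beta> f x < \<infinity>"
    by eventually_elim (simp add: Z_def less_top)
  then show ?thesis by (simp only: AE_W)
qed

text \<open>
  The rearrangement of the product at \<open>t\<close> is at most a product of functions \<open>H i t\<close>, each a constant times the series of dilates
  of the rearrangement of \<open>h i\<close> at \<open>t/(2m)\<close>. The extra dilation by \<open>2m\<close> costs the finite factor \<open>dilation_norm (2m)\<close>.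
\<close>

lemma rearrangement_norm_bound:
  fixes Xbs :: "'m::finite \<Rightarrow> (real \<Rightarrow> ennreal) \<Rightarrow> ennreal"
  assumes b: "0 < \<beta>" "\<beta> < 1" and s': "s < s'"
    and X: "ri_half_line Xb" and Xs: "\<And>i. ri_half_line (Xbs i)" and p: "\<And>i. ereal s' < boyd_p (Xbs i)"
    and bd: "bounded_on (\<lambda>i. ri_space half_line (Xbs i)) (\<lambda>i. ri_norm (Xbs i)) (ri_space half_line Xb) (ri_norm Xb) product_op"
    and c: "c \<ge> 0"
  shows "\<exists>A. \<forall>h F. (\<forall>i. h i \<in> borel_measurable borel \<and> Xbs i (decr_rearrangement W (h i)) < \<infinity>) \<longrightarrow>
      (\<forall>x. F x \<le> ennreal c * (\<Prod>j\<in>UNIV. h j x + dyadic_op \<beta> (h j) x)) \<longrightarrow>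
      Xb (decr_rearrangement W F) \<le> ennreal A * (\<Prod>i\<in>UNIV. Xbs i (decr_rearrangement W (h i)))"
proof -
  obtain B where B: "B > 0" and U: "\<And>f t. f \<in> borel_measurable borel \<Longrightarrow> t > 0 \<Longrightarrow> decr_rearrangement W (dyadic_op \<beta> f) t \<le>
     ennreal B * (decr_rearrangement W f t + (\<Sum>k. ennreal ((1/2) powr (real k / s')) * decr_rearrangement W f (t / 2 ^ Suc k)))"
    using rearrangement_dyadic_op[OF b s'] by (elim exE conjE) (simp only: Ball_def)
  obtain C where C: "C \<ge> 0" and prod: "\<And>H. (\<forall>i. H i \<in> borel_measurable half_line \<and> Xbs i (H i) < \<infinity>) \<Longrightarrow>
     Xb (\<lambda>t. \<Prod>i\<in>UNIV. H i t) \<le> ennreal C * (\<Prod>i\<in>UNIV. Xbs i (H i))"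
    using product_norm_bound[of Xb Xbs, OF X Xs bd] by blast
  have s0: "0 < s'" using s s' by linarith
  have "\<forall>i. \<exists>D\<ge>0. \<forall>g\<in>borel_measurable half_line. Xbs i g < \<infinity> \<longrightarrow>
     Xbs i (\<lambda>t. g t + (\<Sum>k. ennreal ((1/2) powr (real k / s')) * g (t / 2 ^ Suc k))) \<le> ennreal D * Xbs i g"
    by (intro allI ri_half_line.dilation_series_bound Xs s0 p)
  from choice[OF this] obtain D where D: "\<And>i. D i \<ge> 0" and ser: "\<And>i g. g \<in> borel_measurable half_line \<Longrightarrow> Xbs i g < \<infinity> \<Longrightarrow>
     Xbs i (\<lambda>t. g t + (\<Sum>k. ennreal ((1/2) powr (real k / s')) * g (t / 2 ^ Suc k))) \<le> ennreal (D i) * Xbs i g"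
    by blast
  define \<tau> where "\<tau> = 2 * real CARD('m)"
  have tau: "\<tau> > 0" by (simp add: \<tau>_def)
  define d where "d i = enn2real (dilation_norm (Xbs i) \<tau>)" for i
  have d: "d i \<ge> 0" "dilation_norm (Xbs i) \<tau> = ennreal (d i)" for i
    using ri_half_line.h_finite[OF Xs tau, of i] by (auto simp: d_def less_top)
  define A where "A = c * (C * (\<Prod>i\<in>UNIV. (1 + B) * (d i * D i)))"
  have "Xb (decr_rearrangement W F) \<le> ennreal A * (\<Prod>i\<in>UNIV. Xbs i (decr_rearrangement W (h i)))"
    if h: "\<forall>i. h i \<in> borel_measurable borel \<and> Xbs i (decr_rearrangement W (h i)) < \<infinity>"
      and F: "\<forall>x. F x \<le> ennreal c * (\<Prod>j\<in>UNIV. h j x + dyadic_op \<beta> (h j) x)" for h F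
  proof -
    define g where "g i = decr_rearrangement W (h i)" for i
    define G where "G i t = g i t + (\<Sum>k. ennreal ((1/2) powr (real k / s')) * g i (t / 2 ^ Suc k))" for i t
    define H where "H i t = ennreal (1 + B) * G i (t / \<tau>)" for i t
    have hm: "h i \<in> borel_measurable borel" for i using h by blast
    have gf: "Xbs i (g i) < \<infinity>" for i using h by (simp add: g_def)
    have gm: "g i \<in> borel_measurable half_line" for i unfolding g_def by (rule decr_rearrangement_measurable)
    have Gm: "G i \<in> borel_measurable half_line" for i
      unfolding G_def[abs_def]
      by (intro borel_measurable_add gm borel_measurable_suminf_order borel_measurable_times_ennreal borel_measurable_const ri_half_line.dilation_measurable[OF Xs[of i]]) auto
    have Gt: "(\<lambda>t. G i (t / \<tau>)) \<in> borel_measurable half_line" for i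
      by (rule ri_half_line.dilation_measurable[OF Xs[of i] Gm tau])
    have Hm: "H i \<in> borel_measurable half_line" for i
      unfolding H_def[abs_def] by (intro borel_measurable_times_ennreal Gt) simp
    have GN: "Xbs i (G i) \<le> ennreal (D i) * Xbs i (g i)" for i
      unfolding G_def[abs_def] by (rule ser[OF gm gf])
    have Gf: "Xbs i (G i) < \<infinity>" for i
      by (rule le_less_trans[OF GN]) (use gf in \<open>simp add: ennreal_mult_less_top\<close>)
    have HN: "Xbs i (H i) \<le> ennreal ((1 + B) * (d i * D i)) * Xbs i (g i)" for i
    proof -
      have "Xbs i (H i) = ennreal (1 + B) * Xbs i (\<lambda>t. G i (t / \<tau>))"
        unfolding H_def[abs_def] by (rule ri_half_line.N_cmult[OF Xs Gt]) (use B in simp)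
      also have "\<dots> \<le> ennreal (1 + B) * (ennreal (d i) * Xbs i (G i))"
        using ri_half_line.h_bound[OF Xs[of i] Gm Gf tau] d(2)[of i] by (intro mult_left_mono) auto
      also have "\<dots> \<le> ennreal (1 + B) * (ennreal (d i) * (ennreal (D i) * Xbs i (g i)))"
        by (intro mult_left_mono GN) auto
      also have "\<dots> = ennreal ((1 + B) * (d i * D i)) * Xbs i (g i)"
        using B D[of i] d(1)[of i] by (simp add: ennreal_mult' mult.assoc)
      finally show ?thesis .
    qed
    have Hf: "Xbs i (H i) < \<infinity>" for i
      by (rule le_less_trans[OF HN]) (use gf in \<open>simp add: ennreal_mult_less_top\<close>)
    have Pm: "(\<lambda>t. \<Prod>i\<in>UNIV. H i t) \<in> borel_measurable half_line"
      using Hm by (intro borel_measurable_prod_ennreal) auto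
    have pt: "decr_rearrangement W F t \<le> ennreal c * (\<Prod>i\<in>UNIV. H i t)" if t: "t > 0" for t
    proof -
      have tt: "t / \<tau> > 0" using t tau by simp
      have "decr_rearrangement W F t \<le> ennreal c * (\<Prod>j\<in>UNIV. decr_rearrangement W (h j) (t / \<tau>) + decr_rearrangement W (dyadic_op \<beta> (h j)) (t / \<tau>))"
        unfolding \<tau>_def
      proof (rule rearrangement_prod)
        show "h j \<in> borel_measurable W" "dyadic_op \<beta> (h j) \<in> borel_measurable W" for j
          using hm[of j] by measurable
        show "F x \<le> ennreal c * (\<Prod>j\<in>UNIV. h j x + dyadic_op \<beta> (h j) x)" for x using F by blast
      qed (rule t)
      also have "\<dots> \<le> ennreal c * (\<Prod>i\<in>UNIV. H i t)"
      proof (intro mult_left_mono prod_mono_ennreal)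
        fix j
        have "g j (t / \<tau>) + decr_rearrangement W (dyadic_op \<beta> (h j)) (t / \<tau>) \<le> G j (t / \<tau>) + ennreal B * G j (t / \<tau>)"
        proof (rule add_mono)
          show "g j (t / \<tau>) \<le> G j (t / \<tau>)" by (simp add: G_def)
          show "decr_rearrangement W (dyadic_op \<beta> (h j)) (t / \<tau>) \<le> ennreal B * G j (t / \<tau>)"
            using U[OF hm[of j] tt] by (simp only: G_def g_def)
        qed
        also have "\<dots> = H j t" using B by (simp add: H_def distrib_right)
        finally show "decr_rearrangement W (h j) (t / \<tau>) + decr_rearrangement W (dyadic_op \<beta> (h j)) (t / \<tau>) \<le> H j t"
          by (simp only: g_def)
      qed simp
      finally show ?thesis .
    qed
    have "Xb (decr_rearrangement W F) \<le> Xb (\<lambda>t. ennreal c * (\<Prod>i\<in>UNIV. H i t))"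
      by (rule ri_half_line.N_mono'[OF X]) (auto intro!: pt borel_measurable_times_ennreal Pm)
    also have "\<dots> = ennreal c * Xb (\<lambda>t. \<Prod>i\<in>UNIV. H i t)" by (rule ri_half_line.N_cmult[OF X Pm c])
    also have "\<dots> \<le> ennreal c * (ennreal C * (\<Prod>i\<in>UNIV. Xbs i (H i)))"
      by (intro mult_left_mono prod) (use Hm Hf in auto)
    also have "\<dots> \<le> ennreal c * (ennreal C * (\<Prod>i\<in>UNIV. ennreal ((1 + B) * (d i * D i)) * Xbs i (g i)))"
      by (intro mult_left_mono prod_mono_ennreal HN) auto
    also have "\<dots> = ennreal A * (\<Prod>i\<in>UNIV. Xbs i (g i))"
    proof -
      have nn: "0 \<le> (1 + B) * (d i * D i)" for i using B D[of i] d(1)[of i] by simp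
      have "(\<Prod>i\<in>UNIV. ennreal ((1 + B) * (d i * D i)) * Xbs i (g i)) = ennreal (\<Prod>i\<in>UNIV. (1 + B) * (d i * D i)) * (\<Prod>i\<in>UNIV. Xbs i (g i))"
        by (subst prod.distrib, subst prod_ennreal) (rule nn, rule refl)
      moreover have "ennreal A = ennreal c * (ennreal C * ennreal (\<Prod>i\<in>UNIV. (1 + B) * (d i * D i)))"
        unfolding A_def using c C nn by (simp add: ennreal_mult prod_nonneg)
      ultimately show ?thesis by (simp only: mult.assoc)
    qed
    finally show ?thesis unfolding g_def .
  qed
  then show ?thesis by blast
qed

end

context local_op begin

text \<open>
  The extension is \<open>T' f = b f\<^sub>1 \<cdots> f\<^sub>m + kernel_op K f\<close>. It agrees with \<open>T\<close> on the common domain by the representation of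
  \<open>T\<close>, is multilinear because the kernel integral converges absolutely almost everywhere, and is bounded by
  \<open>rearrangement_norm_bound\<close>. All estimates are made for Borel representatives and the Borel weight \<open>v\<close>.
\<close>

theorem weighted_extension:
  fixes Xbs :: "'m \<Rightarrow> (real \<Rightarrow> ennreal) \<Rightarrow> ennreal" and w v :: "real^'n \<Rightarrow> real"
  assumes R: "restricted_Ap v s D" and s': "s < s'" and w: "w \<in> borel_measurable lebesgue" and wv: "AE x in lborel. w x = v x"
    and X: "ri_half_line Xb" and Xs: "\<And>i. ri_half_line (Xbs i)" and p: "\<And>i. ereal s' < boyd_p (Xbs i)"
    and prod: "bounded_on (\<lambda>i. ri_space half_line (Xbs i)) (\<lambda>i. ri_norm (Xbs i)) (ri_space half_line Xb) (ri_norm Xb) product_op"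
  shows "\<exists>T'. multilinear_on (\<lambda>i. weighted_ri_space (Xbs i) w) T' \<and>
    (\<forall>f. (\<forall>i. f i \<in> Lp_space (q i) \<inter> weighted_ri_space (Xbs i) w) \<longrightarrow> (AE x in lebesgue. T' f x = T f x)) \<and>
    bounded_on (\<lambda>i. weighted_ri_space (Xbs i) w) (\<lambda>i. weighted_ri_norm (Xbs i) w)
      (weighted_ri_space Xb w) (weighted_ri_norm Xb w) T'"
proof -
  interpret R: restricted_Ap v s D by (rule R)
  obtain b B where b: "b \<in> borel_measurable borel" "0 \<le> B" "\<And>x. norm (b x) \<le> B"
    and rep: "\<And>f. (\<And>i. f i \<in> L i) \<Longrightarrow> AE x in lborel. T f x = b x * (\<Prod>i\<in>UNIV. f i x) + kernel_op K f x"
    using local_representation by blast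
  define T' where "T' f x = b x * (\<Prod>i\<in>UNIV. f i x) + kernel_op K f x" for f x
  let ?n = "\<lambda>g x. ennreal (norm (g x :: complex))"
  have norm_eq: "weighted_ri_norm N w f = N (decr_rearrangement R.W (?n g))"
    if "f \<in> borel_measurable lebesgue" "g \<in> borel_measurable borel" "AE x in lborel. f x = g x" for N f g
  proof -
    have "decr_rearrangement (density lebesgue (\<lambda>x. ennreal (w x))) (?n f) = decr_rearrangement (density lborel (\<lambda>x. ennreal (v x))) (?n g)"
    proof (rule rearrangement_density[OF w])
      show "?n f \<in> borel_measurable lebesgue" "?n g \<in> borel_measurable borel" using that(1,2) by measurable
      show "AE x in lborel. ?n f x = ?n g x" using that(3) by eventually_elim simp
    qed (fact R.w_borel wv)+
    then show ?thesis by (simp only: weighted_ri_norm_def R.W_def)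
  qed
  have borel: "\<exists>g. (\<forall>i. g i \<in> borel_measurable borel \<and> (AE x in lborel. f i x = g i x) \<and> Xbs i (decr_rearrangement R.W (?n (g i))) < \<infinity>
      \<and> weighted_ri_norm (Xbs i) w (f i) = Xbs i (decr_rearrangement R.W (?n (g i))))"
    if f: "\<And>i. f i \<in> weighted_ri_space (Xbs i) w" for f
  proof -
    have fm: "f i \<in> borel_measurable lebesgue" and ff: "weighted_ri_norm (Xbs i) w (f i) < \<infinity>" for i
      using f[of i] by (auto simp: weighted_ri_space_def)
    have "\<forall>i. \<exists>g. g \<in> borel_measurable borel \<and> (AE x in lborel. f i x = g x)"
      using complex_ex_borel[OF fm] by auto
    from choice[OF this] obtain g where g: "\<And>i. g i \<in> borel_measurable borel" "\<And>i. AE x in lborel. f i x = g i x" by blast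
    have "weighted_ri_norm (Xbs i) w (f i) = Xbs i (decr_rearrangement R.W (?n (g i)))" for i
      by (rule norm_eq[OF fm g])
    then show ?thesis using g ff by (intro exI[of _ g]) simp
  qed
  have AE_abs_convergent: "AE x in lborel. abs_convergent g x"
    if "\<And>i. g i \<in> borel_measurable borel" "\<And>i. Xbs i (decr_rearrangement R.W (?n (g i))) < \<infinity>" for g
  proof -
    have "AE x in lborel. dyadic_op \<beta> (?n (g i)) x < \<infinity>" for i
    proof (rule R.dyadic_op_finite_AE[OF beta s' Xs p])
      show "?n (g i) \<in> borel_measurable borel" using that(1)[of i] by measurable
    qed (rule that(2))
    then have "AE x in lborel. \<forall>i\<in>UNIV. dyadic_op \<beta> (?n (g i)) x < \<infinity>" by (intro AE_finite_allI) auto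
    then show ?thesis by (simp add: abs_convergent_def)
  qed
  have "multilinear_on (\<lambda>i. weighted_ri_space (Xbs i) w) T'"
    unfolding multilinear_on_def
  proof (intro allI impI, elim conjE)
    fix f j h a assume f: "\<forall>i. f i \<in> weighted_ri_space (Xbs i) w" and h: "h \<in> weighted_ri_space (Xbs j) w"
    have fh: "(f(j := h)) i \<in> weighted_ri_space (Xbs i) w" for i using f h by simp
    obtain g where g: "\<And>i. g i \<in> borel_measurable borel" "\<And>i. AE x in lborel. f i x = g i x" "\<And>i. Xbs i (decr_rearrangement R.W (?n (g i))) < \<infinity>"
      using borel[of f] f by blast
    obtain g' where g': "\<And>i. g' i \<in> borel_measurable borel" "\<And>i. AE x in lborel. (f(j := h)) i x = g' i x"
       "\<And>i. Xbs i (decr_rearrangement R.W (?n (g' i))) < \<infinity>"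
      using borel[of "f(j := h)", OF fh] by blast
    define k where "k = g' j"
    have k: "k \<in> borel_measurable borel" "AE x in lborel. h x = k x" "Xbs j (decr_rearrangement R.W (?n k)) < \<infinity>"
      using g'(1)[of j] g'(2)[of j] g'(3)[of j] by (simp_all add: k_def)
    have gk: "(g(j := k)) i \<in> borel_measurable borel" "Xbs i (decr_rearrangement R.W (?n ((g(j := k)) i))) < \<infinity>" for i
      using g k by auto
    have gak: "(g(j := (\<lambda>y. a * g j y + k y))) i \<in> borel_measurable borel" for i
      using g(1)[of i] g(1)[of j] k(1) by (cases "i = j") auto
    have e1: "kernel_op K f = kernel_op K g" by (rule kernel_op_cong_AE) (rule g)+
    have fk: "AE z in lborel. (f(j := h)) i z = (g(j := k)) i z" for i
      using g(2)[of i] k(2) by (cases "i = j") auto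
    have e2: "kernel_op K (f(j := h)) = kernel_op K (g(j := k))"
      by (rule kernel_op_cong_AE) (rule fk, rule gk(1))
    have "AE x in lborel. a * f j x + h x = a * g j x + k x"
      using g(2)[of j] k(2) by eventually_elim simp
    then have fak: "AE z in lborel. (f(j := (\<lambda>y. a * f j y + h y))) i z = (g(j := (\<lambda>y. a * g j y + k y))) i z" for i
      using g(2)[of i] by (cases "i = j") auto
    have e3: "kernel_op K (f(j := (\<lambda>y. a * f j y + h y))) = kernel_op K (g(j := (\<lambda>y. a * g j y + k y)))"
      by (rule kernel_op_cong_AE) (rule fak, rule gak)
    have G1: "AE x in lborel. abs_convergent g x" by (rule AE_abs_convergent) (rule g)+
    have G2: "AE x in lborel. abs_convergent (g(j := k)) x" by (rule AE_abs_convergent) (rule gk)+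
    have P: "(\<Prod>i\<in>UNIV. (f(j := u)) i x) = (\<Prod>i\<in>UNIV - {j}. f i x) * u x" for u x
      by (rule prod_upd_split)
    have P0: "(\<Prod>i\<in>UNIV. f i x) = (\<Prod>i\<in>UNIV - {j}. f i x) * f j x" for x
      using P[of "f j" x] by simp
    show "AE x in lebesgue. T' (f(j := (\<lambda>y. a * f j y + h y))) x = a * T' f x + T' (f(j := h)) x"
      unfolding AE_lebesgue using G1 G2
    proof eventually_elim
      case (elim x)
      have "kernel_op K (g(j := (\<lambda>y. a * g j y + k y))) x = a * kernel_op K g x + kernel_op K (g(j := k)) x"
        by (rule kernel_op_linear[of g, OF g(1) k(1) elim])
      then show ?case
        unfolding T'_def e1 e2 e3 P P0 by (simp add: algebra_simps)
    qed
  qed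
  moreover have "AE x in lebesgue. T' f x = T f x" if "\<forall>i. f i \<in> Lp_space (q i) \<inter> weighted_ri_space (Xbs i) w" for f
    unfolding AE_lebesgue T'_def using rep[of f] that by (auto elim!: eventually_mono)
  moreover have "bounded_on (\<lambda>i. weighted_ri_space (Xbs i) w) (\<lambda>i. weighted_ri_norm (Xbs i) w)
      (weighted_ri_space Xb w) (weighted_ri_norm Xb w) T'"
  proof -
    have BC: "B + C \<ge> 0" using b C by simp
    obtain A where A: "\<And>h F. (\<forall>i. h i \<in> borel_measurable borel \<and> Xbs i (decr_rearrangement R.W (h i)) < \<infinity>) \<Longrightarrow>
        (\<forall>x. F x \<le> ennreal (B + C) * (\<Prod>j\<in>UNIV. h j x + dyadic_op \<beta> (h j) x)) \<Longrightarrow>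
        Xb (decr_rearrangement R.W F) \<le> ennreal A * (\<Prod>i\<in>UNIV. Xbs i (decr_rearrangement R.W (h i)))"
      using R.rearrangement_norm_bound[of \<beta> s' Xb Xbs "B + C", OF beta s' X Xs p prod BC] by blast
    have "T' f \<in> weighted_ri_space Xb w \<and> weighted_ri_norm Xb w (T' f) \<le> ennreal A * (\<Prod>i\<in>UNIV. weighted_ri_norm (Xbs i) w (f i))"
      if f: "\<forall>i. f i \<in> weighted_ri_space (Xbs i) w" for f
    proof -
      obtain g where g: "\<And>i. g i \<in> borel_measurable borel" "\<And>i. AE x in lborel. f i x = g i x" "\<And>i. Xbs i (decr_rearrangement R.W (?n (g i))) < \<infinity>"
        and ng: "\<And>i. weighted_ri_norm (Xbs i) w (f i) = Xbs i (decr_rearrangement R.W (?n (g i)))"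
        using borel[of f] f by blast
      have e1: "kernel_op K f = kernel_op K g" by (rule kernel_op_cong_AE) (rule g)+
      have km: "kernel_op K g \<in> borel_measurable borel" by (rule kernel_op_measurable) (rule g)
      have Tg: "T' g \<in> borel_measurable borel"
        unfolding T'_def[abs_def] using b(1) km g(1) by measurable
      have "AE x in lborel. \<forall>i\<in>UNIV. f i x = g i x" using g(2) by (intro AE_finite_allI) auto
      then have ae: "AE x in lborel. T' f x = T' g x" by eventually_elim (simp add: T'_def e1)
      have Tf: "T' f \<in> borel_measurable lebesgue"
        by (rule measurable_completion_AE_eq[OF _ ae]) (use Tg in simp)
      have pt: "\<forall>x. ?n (T' g) x \<le> ennreal (B + C) * (\<Prod>j\<in>UNIV. ?n (g j) x + dyadic_op \<beta> (?n (g j)) x)"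
      proof
        fix x
        let ?P = "\<Prod>j\<in>UNIV. ?n (g j) x + dyadic_op \<beta> (?n (g j)) x"
        have "?n (T' g) x \<le> ennreal (norm (b x * (\<Prod>i\<in>UNIV. g i x)) + norm (kernel_op K g x))"
          unfolding T'_def by (intro ennreal_leI norm_triangle_ineq)
        also have "\<dots> = ennreal (norm (b x * (\<Prod>i\<in>UNIV. g i x))) + ennreal (norm (kernel_op K g x))" by simp
        also have "ennreal (norm (b x * (\<Prod>i\<in>UNIV. g i x))) = ennreal (norm (b x)) * (\<Prod>i\<in>UNIV. ?n (g i) x)"
          by (simp add: norm_mult ennreal_mult' prod_norm[symmetric] prod_ennreal)
        also have "\<dots> + ennreal (norm (kernel_op K g x)) \<le> ennreal B * ?P + ennreal C * ?P"
        proof (rule add_mono)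
          show "ennreal (norm (b x)) * (\<Prod>i\<in>UNIV. ?n (g i) x) \<le> ennreal B * ?P"
            using b(3) by (intro mult_mono prod_mono_ennreal ennreal_leI) auto
          have "ennreal (norm (kernel_op K g x)) \<le> ennreal C * (\<Prod>j\<in>UNIV. dyadic_op \<beta> (?n (g j)) x)"
            by (rule kernel_op_bound) (rule g)
          also have "\<dots> \<le> ennreal C * ?P" by (intro mult_left_mono prod_mono_ennreal) auto
          finally show "ennreal (norm (kernel_op K g x)) \<le> ennreal C * ?P" .
        qed
        also have "\<dots> = ennreal (B + C) * ?P" using b C by (simp add: distrib_right)
        finally show "?n (T' g) x \<le> ennreal (B + C) * ?P" .
      qed
      have "weighted_ri_norm Xb w (T' f) = Xb (decr_rearrangement R.W (?n (T' g)))"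
        by (rule norm_eq[OF Tf Tg ae])
      also have "\<dots> \<le> ennreal A * (\<Prod>i\<in>UNIV. Xbs i (decr_rearrangement R.W (?n (g i))))"
      proof (rule A[OF _ pt], rule allI, rule conjI)
        show "?n (g i) \<in> borel_measurable borel" for i using g(1)[of i] by measurable
      qed (rule g(3))
      finally have le: "weighted_ri_norm Xb w (T' f) \<le> ennreal A * (\<Prod>i\<in>UNIV. Xbs i (decr_rearrangement R.W (?n (g i))))" .
      also have "\<dots> < \<infinity>"
        using prod_less_top[of UNIV "\<lambda>i. Xbs i (decr_rearrangement R.W (?n (g i)))"] g(3) by (simp add: ennreal_mult_less_top)
      finally show ?thesis using le Tf unfolding ng by (simp add: weighted_ri_space_def)
    qed
    then show ?thesis unfolding bounded_on_def by blast
  qed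
  ultimately show ?thesis by blast
qed

end

theorem corollary6p1:
  fixes \<sigma> :: "real^'n \<Rightarrow> real^'n^'m \<Rightarrow> complex"
    and K :: "real^'n \<Rightarrow> real^'n^'m \<Rightarrow> complex"
    and T :: "('m \<Rightarrow> real^'n \<Rightarrow> complex) \<Rightarrow> real^'n \<Rightarrow> complex"
    and r \<rho> \<delta> :: real
    and q :: "'m \<Rightarrow> real"
    and X :: "(real^'n \<Rightarrow> ennreal) \<Rightarrow> ennreal"
    and Xb :: "(real \<Rightarrow> ennreal) \<Rightarrow> ennreal"
    and Xs :: "'m \<Rightarrow> (real^'n \<Rightarrow> ennreal) \<Rightarrow> ennreal"
    and Xbs :: "'m \<Rightarrow> (real \<Rightarrow> ennreal) \<Rightarrow> ennreal"
    and w :: "real^'n \<Rightarrow> real"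
  assumes "0 \<le> \<rho>" "\<rho> \<le> 1" "0 \<le> \<delta>" "\<delta> \<le> 1"
    and "\<sigma> \<in> symbol_class r \<rho> \<delta>"
    and "r + \<delta> < real (CARD('n) * CARD('m)) * (\<rho> - 1)"
    and "\<And>x y. y \<noteq> 0 \<Longrightarrow> has_osc_inverse_fourier (\<sigma> x) y (K x y)"
    and "multilinear_cz_operator q T (\<lambda>u. K (u None) (\<chi> j. u None - u (Some j)))"
    and "ri_banach_norm lebesgue X" "luxemburg_representation X Xb"
    and "\<And>i. ri_banach_norm lebesgue (Xs i)" "\<And>i. luxemburg_representation (Xs i) (Xbs i)"
    and "1 < boyd_p Xb" "boyd_p Xb \<le> boyd_q Xb" "boyd_q Xb < \<infinity>"
    and "\<And>i. 1 < boyd_p (Xbs i)" "\<And>i. boyd_p (Xbs i) \<le> boyd_q (Xbs i)"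
        "\<And>i. boyd_q (Xbs i) < \<infinity>"
    and "bounded_on (\<lambda>i. ri_space half_line (Xbs i)) (\<lambda>i. ri_norm (Xbs i))
           (ri_space half_line Xb) (ri_norm Xb) product_op"
    and "w \<in> Ap_class (real_of_ereal (MIN i. boyd_p (Xbs i)))"
  shows "\<exists>T'. multilinear_on (\<lambda>i. weighted_ri_space (Xbs i) w) T' \<and>
    (\<forall>f. (\<forall>i. f i \<in> Lp_space (q i) \<inter> weighted_ri_space (Xbs i) w) \<longrightarrow>
      (AE x in lebesgue. T' f x = T f x)) \<and>
    bounded_on (\<lambda>i. weighted_ri_space (Xbs i) w) (\<lambda>i. weighted_ri_norm (Xbs i) w)
      (weighted_ri_space Xb w) (weighted_ri_norm Xb w) T'"
proof -
  note rho = assms(1,2) and delta = assms(3) and sym = assms(5) and order = assms(6) and osc = assms(7)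
    and cz = assms(8) and rep = assms(10) and reps = assms(12) and boyd = assms(16-18) and prod = assms(19) and wA = assms(20)
  have r: "r < real (CARD('m) * CARD('n)) * (\<rho> - 1)" using order delta by (simp add: mult.commute)
  have smooth: "smooth (\<lambda>(x, \<xi>). \<sigma> x \<xi>)" using sym by (simp add: symbol_class_def)
  obtain C \<beta> where C: "0 \<le> C" and beta: "0 < \<beta>" "\<beta> < 1" and dom: "\<And>x y. y \<noteq> 0 \<Longrightarrow>
      ennreal (norm (K x y)) \<le> ennreal C * (\<Prod>j\<in>UNIV. dyadic_kernel \<beta> (y $ j))"
    using kernel_dominated[OF sym rho r osc] by blast
  have kernel: "dominated_kernel K C \<beta>"
    by unfold_locales (use C beta dom kernel_measurable[OF smooth osc] in auto)
  let ?q0 = "1 / (\<Sum>j\<in>UNIV. 1 / q j)"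
  have q: "\<And>j. 1 \<le> q j" and ml: "multilinear_on (\<lambda>j. Lp_space (q j)) T"
    and bd: "bounded_on (\<lambda>j. Lp_space (q j)) (\<lambda>j. Lp_norm (q j)) (Lp_space ?q0) (Lp_norm ?q0) T"
    and hk: "has_kernel T (\<lambda>u. K (u None) (\<chi> j. u None - u (Some j)))"
    using cz unfolding multilinear_cz_operator_def Let_def by auto
  obtain CT where CT: "\<And>f. (\<forall>i. f i \<in> Lp_space (q i)) \<Longrightarrow>
      T f \<in> Lp_space ?q0 \<and> Lp_norm ?q0 (T f) \<le> ennreal CT * (\<Prod>i\<in>UNIV. Lp_norm (q i) (f i))"
    using bd unfolding bounded_on_def by blast
  have loc: "local_op K C \<beta> T q CT"
  proof (intro local_op.intro kernel local_op_axioms.intro q ml hk)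
    fix f :: "'m \<Rightarrow> real^'n \<Rightarrow> complex" assume "\<And>j. f j \<in> Lp_space (q j)"
    then show "T f \<in> Lp_space ?q0 \<and> Lp_norm ?q0 (T f) \<le> ennreal CT * (\<Prod>j\<in>UNIV. Lp_norm (q j) (f j))"
      by (intro CT allI)
  qed
  define pe where "pe = (MIN i. boyd_p (Xbs i))"
  have "pe \<in> range (\<lambda>i. boyd_p (Xbs i))" unfolding pe_def by (rule Min_in) auto
  then obtain i0 where i0: "pe = boyd_p (Xbs i0)" by blast
  have pe_le: "pe \<le> boyd_p (Xbs i)" for i unfolding pe_def by (rule Min_le) auto
  have "1 < pe" "pe < \<infinity>" using boyd(1)[of i0] boyd(2)[of i0] boyd(3)[of i0] unfolding i0 by (blast intro: le_less_trans)+
  then obtain p where p: "pe = ereal p" "1 < p" by (cases pe) (auto simp: one_ereal_def)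
  have "w \<in> Ap_class p" using wA by (simp add: pe_def[symmetric] p(1))
  then obtain v A where core: "Ap_core v p A" and wv: "AE x in lborel. w x = v x" and w: "w \<in> borel_measurable lebesgue"
    using Ap_class_core[of w p] p(2) by (auto simp: Ap_class_def weight_def)
  interpret A: Ap_core v p A by (rule core)
  obtain s D where s: "1 \<le> s" "s < p" and D: "0 < D" and rWI: "\<And>x R E. R > 0 \<Longrightarrow> E \<in> sets borel \<Longrightarrow> E \<subseteq> cube x R \<Longrightarrow>
     (measure lborel E / measure lborel (cube x R)) powr s * measure A.W (cube x R) \<le> D * measure A.W E"
    using A.Ap_open by blast
  have R: "restricted_Ap v s D"
    by unfold_locales (use A.w_borel A.w_pos s D A.W_fin rWI[unfolded A.W_def] in auto)
  \<comment> \<open>strictly between the exponent of the restricted condition and the least Boyd index\<close>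
  define s' where "s' = (s + p) / 2"
  have s': "s < s'" "s' < p" using s by (auto simp: s'_def)
  show ?thesis
  proof (rule local_op.weighted_extension[OF loc R s'(1) w wv _ _ _ prod])
    show "ri_half_line Xb" "ri_half_line (Xbs i)" for i
      using rep reps[of i] by (auto simp: ri_half_line_def luxemburg_representation_def)
    have "ereal s' < pe" using s' p by simp
    then show "ereal s' < boyd_p (Xbs i)" for i using pe_le[of i] by (rule less_le_trans)
  qed
qed

end
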